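(* Let $a>0$, $\alpha>0$, and let $V_+,V_-\in L^\infty(\mathbb{R})$ be real-valued with $V_-+V_+\in L^1(\mathbb{R})$ and $\int_{\mathbb{R}}(V_-+V_+)(x)\,dx<0$. Then $\inf\sigma(H_{\alpha,V_+,V_-})<\xi_0$. Consequently, if in addition $\lim_{L\to\infty}\operatorname*{ess\,sup}_{\mathbb{R}\setminus[-L,L]}|V_\pm|=0$, then $H_{\alpha,V_+,V_-}$ possesses at least one isolated eigenvalue of finite multiplicity below $\xi_0$.
   Context: $H_{\alpha,V_+,V_-}$ is the self-adjoint operator in $L^2(\mathbb{R}^2)$ associated with the closed, lower-bounded quadratic form $$\mathcal{E}_{\alpha,V_+,V_-}[\psi]=\int_{\mathbb{R}^2}|\nabla\psi|^2+\int_{\mathbb{R}}(V_+(x_1)-\alpha)|\psi(x_1,a)|^2\,dx_1+\int_{\mathbb{R}}(V_-(x_1)-\alpha)|\psi(x_1,-a)|^2\,dx_1,\qquad \psi\in W^{1,2}(\mathbb{R}^2),$$ where $\psi(\cdot,\pm a)$ are traces on the lines $\mathbb{R}\times\{\pm a\}$. $\xi_0<0$ is the lowest eigenvalue of the self-adjoint operator $-\Delta_\alpha^{\mathbb{R}}$ in $L^2(\mathbb{R})$ associated with the form $\varepsilon_\alpha[\phi]=\int_{\mathbb{R}}|\phi'|^2-\alpha|\phi(a)|^2-\alpha|\phi(-a)|^2$, $\phi\in W^{1,2}(\mathbb{R})$. *)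

theory Defs
  imports "HOL-Analysis.Analysis" "HOL-Probability.Essential_Supremum"
begin

definition sq_int :: "('a::euclidean_space \<Rightarrow> complex) \<Rightarrow> bool" where
  "sq_int f \<longleftrightarrow> f \<in> borel_measurable lborel \<and> integrable lborel (\<lambda>x. (cmod (f x))^2)"

definition L2norm2 :: "('a::euclidean_space \<Rightarrow> complex) \<Rightarrow> real" where
  "L2norm2 f = (\<integral>x. (cmod (f x))^2 \<partial>lborel)"

definition L2inner :: "('a::euclidean_space \<Rightarrow> complex) \<Rightarrow> ('a \<Rightarrow> complex) \<Rightarrow> complex" where
  "L2inner f g = (\<integral>x. f x * cnj (g x) \<partial>lborel)"

fun dderiv :: "'a::euclidean_space list \<Rightarrow> ('a \<Rightarrow> complex) \<Rightarrow> 'a \<Rightarrow> complex" where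
  "dderiv [] f = f"
| "dderiv (v # vs) f = (\<lambda>x. frechet_derivative (dderiv vs f) (at x) v)"

definition smooth_fun :: "('a::euclidean_space \<Rightarrow> complex) \<Rightarrow> bool" where
  "smooth_fun f \<longleftrightarrow> (\<forall>vs x. dderiv vs f differentiable (at x))"

definition test_fun :: "('a::euclidean_space \<Rightarrow> complex) \<Rightarrow> bool" where
  "test_fun f \<longleftrightarrow> smooth_fun f \<and> compact (closure {x. f x \<noteq> 0})"

definition weak_deriv :: "('a::euclidean_space \<Rightarrow> complex) \<Rightarrow> 'a \<Rightarrow> ('a \<Rightarrow> complex) \<Rightarrow> bool" where
  "weak_deriv \<psi> b g \<longleftrightarrow> g \<in> borel_measurable lborel \<and>
     (\<forall>\<phi>. test_fun \<phi> \<longrightarrow>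
        (\<integral>x. \<psi> x * dderiv [b] \<phi> x \<partial>lborel) = - (\<integral>x. g x * \<phi> x \<partial>lborel))"

definition W12 :: "('a::euclidean_space \<Rightarrow> complex) \<Rightarrow> bool" where
  "W12 \<psi> \<longleftrightarrow> sq_int \<psi> \<and> (\<forall>b\<in>Basis. \<exists>g. sq_int g \<and> weak_deriv \<psi> b g)"

definition wd :: "('a::euclidean_space \<Rightarrow> complex) \<Rightarrow> 'a \<Rightarrow> 'a \<Rightarrow> complex" where
  "wd \<psi> b = (SOME g. sq_int g \<and> weak_deriv \<psi> b g)"

definition W12_lim :: "(nat \<Rightarrow> 'a::euclidean_space \<Rightarrow> complex) \<Rightarrow> ('a \<Rightarrow> complex) \<Rightarrow> bool" where
  "W12_lim \<phi>s \<psi> \<longleftrightarrow>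
     ((\<lambda>n. L2norm2 (\<lambda>x. \<phi>s n x - \<psi> x)) \<longlonglongrightarrow> 0) \<and>
     (\<forall>b\<in>Basis. (\<lambda>n. L2norm2 (\<lambda>x. dderiv [b] (\<phi>s n) x - wd \<psi> b x)) \<longlonglongrightarrow> 0)"

definition is_trace_line :: "(real \<times> real \<Rightarrow> complex) \<Rightarrow> real \<Rightarrow> (real \<Rightarrow> complex) \<Rightarrow> bool" where
  "is_trace_line \<psi> c \<tau> \<longleftrightarrow> sq_int \<tau> \<and>
     (\<exists>\<phi>s. (\<forall>n. test_fun (\<phi>s n)) \<and> W12_lim \<phi>s \<psi> \<and>
        (\<lambda>n. L2norm2 (\<lambda>s. \<phi>s n (s, c) - \<tau> s)) \<longlonglongrightarrow> 0)"

definition tr_line :: "(real \<times> real \<Rightarrow> complex) \<Rightarrow> real \<Rightarrow> real \<Rightarrow> complex" where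
  "tr_line \<psi> c = (SOME \<tau>. is_trace_line \<psi> c \<tau>)"

definition is_trace_pt :: "(real \<Rightarrow> complex) \<Rightarrow> real \<Rightarrow> complex \<Rightarrow> bool" where
  "is_trace_pt \<psi> c z \<longleftrightarrow>
     (\<exists>\<phi>s. (\<forall>n. test_fun (\<phi>s n)) \<and> W12_lim \<phi>s \<psi> \<and> (\<lambda>n. \<phi>s n c) \<longlonglongrightarrow> z)"

definition tr_pt :: "(real \<Rightarrow> complex) \<Rightarrow> real \<Rightarrow> complex" where
  "tr_pt \<psi> c = (SOME z. is_trace_pt \<psi> c z)"

text \<open>op_rel D e psi f: psi is in the operator domain and H psi = f (a.e.), where H is
  the operator associated with the sesquilinear form e on the form domain D:
  psi in D and e(psi, phi) = <f, phi> for all phi in D.\<close>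
definition op_rel :: "(('a::euclidean_space \<Rightarrow> complex) \<Rightarrow> bool) \<Rightarrow>
    (('a \<Rightarrow> complex) \<Rightarrow> ('a \<Rightarrow> complex) \<Rightarrow> complex) \<Rightarrow> ('a \<Rightarrow> complex) \<Rightarrow> ('a \<Rightarrow> complex) \<Rightarrow> bool" where
  "op_rel D e \<psi> f \<longleftrightarrow> D \<psi> \<and> sq_int f \<and> (\<forall>\<phi>. D \<phi> \<longrightarrow> e \<psi> \<phi> = L2inner f \<phi>)"

definition resolvent_pt :: "(('a::euclidean_space \<Rightarrow> complex) \<Rightarrow> bool) \<Rightarrow>
    (('a \<Rightarrow> complex) \<Rightarrow> ('a \<Rightarrow> complex) \<Rightarrow> complex) \<Rightarrow> complex \<Rightarrow> bool" where
  "resolvent_pt D e lam \<longleftrightarrow>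
     (\<forall>f. sq_int f \<longrightarrow> (\<exists>\<psi>. op_rel D e \<psi> (\<lambda>x. f x + lam * \<psi> x))) \<and>
     (\<forall>\<psi>. op_rel D e \<psi> (\<lambda>x. lam * \<psi> x) \<longrightarrow> (AE x in lborel. \<psi> x = 0)) \<and>
     (\<exists>C. \<forall>\<psi> f. sq_int f \<longrightarrow> op_rel D e \<psi> (\<lambda>x. f x + lam * \<psi> x) \<longrightarrow> L2norm2 \<psi> \<le> C * L2norm2 f)"

definition op_spectrum :: "(('a::euclidean_space \<Rightarrow> complex) \<Rightarrow> bool) \<Rightarrow>
    (('a \<Rightarrow> complex) \<Rightarrow> ('a \<Rightarrow> complex) \<Rightarrow> complex) \<Rightarrow> complex set" where
  "op_spectrum D e = {lam. \<not> resolvent_pt D e lam}"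

definition is_eigenvalue :: "(('a::euclidean_space \<Rightarrow> complex) \<Rightarrow> bool) \<Rightarrow>
    (('a \<Rightarrow> complex) \<Rightarrow> ('a \<Rightarrow> complex) \<Rightarrow> complex) \<Rightarrow> complex \<Rightarrow> bool" where
  "is_eigenvalue D e lam \<longleftrightarrow>
     (\<exists>\<psi>. op_rel D e \<psi> (\<lambda>x. lam * \<psi> x) \<and> \<not> (AE x in lborel. \<psi> x = 0))"

definition isolated_fin_eigenvalue :: "(('a::euclidean_space \<Rightarrow> complex) \<Rightarrow> bool) \<Rightarrow>
    (('a \<Rightarrow> complex) \<Rightarrow> ('a \<Rightarrow> complex) \<Rightarrow> complex) \<Rightarrow> complex \<Rightarrow> bool" where
  "isolated_fin_eigenvalue D e lam \<longleftrightarrow>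
     is_eigenvalue D e lam \<and>
     (\<exists>\<epsilon>>0. \<forall>\<mu>\<in>op_spectrum D e. cmod (\<mu> - lam) < \<epsilon> \<longrightarrow> \<mu> = lam) \<and>
     (\<exists>n::nat. \<exists>\<psi>s. \<forall>\<psi>. op_rel D e \<psi> (\<lambda>x. lam * \<psi> x) \<longrightarrow>
        (\<exists>c. AE x in lborel. \<psi> x = (\<Sum>i<n. c i * \<psi>s i x)))"

definition E_form :: "real \<Rightarrow> real \<Rightarrow> (real \<Rightarrow> real) \<Rightarrow> (real \<Rightarrow> real) \<Rightarrow>
    (real \<times> real \<Rightarrow> complex) \<Rightarrow> (real \<times> real \<Rightarrow> complex) \<Rightarrow> complex" where
  "E_form a \<alpha> Vp Vm \<psi> \<phi> =
     (\<integral>x. (\<Sum>b\<in>Basis. wd \<psi> b x * cnj (wd \<phi> b x)) \<partial>lborel)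
     + (\<integral>s. of_real (Vp s - \<alpha>) * tr_line \<psi> a s * cnj (tr_line \<phi> a s) \<partial>lborel)
     + (\<integral>s. of_real (Vm s - \<alpha>) * tr_line \<psi> (-a) s * cnj (tr_line \<phi> (-a) s) \<partial>lborel)"

definition eps_form :: "real \<Rightarrow> real \<Rightarrow> (real \<Rightarrow> complex) \<Rightarrow> (real \<Rightarrow> complex) \<Rightarrow> complex" where
  "eps_form a \<alpha> \<psi> \<phi> =
     (\<integral>x. wd \<psi> 1 x * cnj (wd \<phi> 1 x) \<partial>lborel)
     - of_real \<alpha> * tr_pt \<psi> a * cnj (tr_pt \<phi> a)
     - of_real \<alpha> * tr_pt \<psi> (-a) * cnj (tr_pt \<phi> (-a))"

definition xi0 :: "real \<Rightarrow> real \<Rightarrow> real" where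
  "xi0 a \<alpha> = (LEAST lam::real. is_eigenvalue W12 (eps_form a \<alpha>) (of_real lam))"

end

theory Submission
  imports Defs
    "HOL-Library.Function_Algebras"
    "HOL-Probability.Distributions"
    "HOL-Complex_Analysis.Great_Picard"
begin

text \<open>The transverse operator has lowest eigenvalue \<open>\<xi>\<^sub>0 = - k\<^sup>2\<close>, where \<open>k (1 + tanh (k a)) = \<alpha>\<close>, with an
  explicit ground state \<open>\<phi>\<^sub>0\<close> that is \<open>cosh\<close> between the lines and exponentially decaying outside;
  sharpness of \<open>\<xi>\<^sub>0\<close> as a lower bound follows from a Riccati argument with \<open>w = \<phi>\<^sub>0' / \<phi>\<^sub>0\<close>. The trial
  functions \<open>\<chi> (x\<^sub>1 / n) \<phi>\<^sub>0 (x\<^sub>2)\<close> have form value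
  \<open>\<xi>\<^sub>0 \<parallel>\<psi>\<parallel>\<^sup>2 + \<phi>\<^sub>0 (a)\<^sup>2 \<integral> (V\<^sub>+ + V\<^sub>-) + o (1)\<close>, so the infimum of the form lies below \<open>\<xi>\<^sub>0\<close>, and this
  infimum always belongs to the spectrum of the associated operator.

  If \<open>V\<^sub>+\<close> and \<open>V\<^sub>-\<close> decay, then up to an arbitrarily small error only the traces on a bounded segment
  can push the form below \<open>\<xi>\<^sub>0\<close>. The trace on a segment is compact, hence a normalised sequence whose
  form values tend to the infimum has a convergent subsequence. This single compactness property
  gives an eigenfunction, the finite dimension of the eigenspace, and a spectral gap on its orthogonal complement.\<close>

section \<open>Hermitian forms and the operators they define\<close>

text \<open>No spectral theorem is invoked. The spectrum is defined through solvability of a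
  relation between functions, with complex parameters, so the resolvent is built directly from
  completeness of the form domain: Riesz representation at a real base point, then an iteration
  around it. Functions are not identified modulo null sets, and weak derivatives and traces are
  picked by \<open>SOME\<close>, hence linear only almost everywhere. The abstract part therefore
  uses a semidefinite inner product, and uniqueness arguments pin the choices down almost
  everywhere. Inequalities are proved for test functions, whose slices are smooth, and reach
  \<open>W12\<close> by density. The ground state equals 1 on both lines, so V_+ and V_- enter with
  equal weight and only the integral of their sum counts; stretching the longitudinal cutoff makes
  its kinetic energy O(1/n), which a strictly negative integral beats. For compactness the decisive
  quantity is the gap between the infimum of the form and \<open>xi0\<close>: it leaves room for the
  error made where the potentials are small.\<close>

lemma quadratic_nonneg_complex:
  fixes A C :: real and z :: complex
  assumes "\<And>t. 0 \<le> A + 2 * Re (cnj t * z) + (cmod t)\<^sup>2 * C" and "0 \<le> C"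
  shows "(cmod z)\<^sup>2 \<le> A * C"
proof (cases "C = 0")
  case True
  have "z = 0"
  proof (rule ccontr)
    assume z: "z \<noteq> 0"
    \<comment> \<open>With t = - r z the linear term equals - (A + 1), so the hypothesis would give
      0 \<le> - 1.\<close>
    define r where "r = (A + 1) / (2 * (cmod z)\<^sup>2)"
    have "Re (cnj (of_real (- r) * z) * z) = - r * (cmod z)\<^sup>2"
      unfolding cmod_power2 by (simp add: algebra_simps power2_eq_square)
    then show False using assms(1)[of "of_real (- r) * z"] z True
      by (simp add: r_def field_simps)
  qed
  then show ?thesis using True by simp
next
  case False
  then have C: "C > 0" using assms(2) by simp
  \<comment> \<open>The quadratic is smallest at t = - z / C, where its value is A - |z|^2 /
    C.\<close>
  have "Re (cnj (of_real (- 1 / C) * z) * z) = - (cmod z)\<^sup>2 / C"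
    unfolding cmod_power2 by (simp add: power2_eq_square add_divide_distrib diff_divide_distrib)
  moreover have "(cmod (of_real (- 1 / C) * z))\<^sup>2 * C = (cmod z)\<^sup>2 / C"
    using C by (simp add: norm_mult norm_divide power_mult_distrib power_divide power2_eq_square field_simps)
  ultimately show ?thesis using assms(1)[of "of_real (- 1 / C) * z"] C
    by (simp add: field_simps)
qed

lemma tendsto_zero_le:
  fixes f g :: "nat \<Rightarrow> real"
  assumes "\<And>n. 0 \<le> f n" "\<And>n. f n \<le> g n" "g \<longlonglongrightarrow> 0"
  shows "f \<longlonglongrightarrow> 0"
  by (rule real_tendsto_sandwich[OF _ _ tendsto_const assms(3)]) (use assms in auto)

text \<open>The laws are demanded on a subspace only: the Hilbert space and the form domain are two
  different subspaces of the same space of all functions, and the integrals behave well only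
  there.\<close>

locale herm_form = vector_space s
  for s :: "complex \<Rightarrow> 'v::ab_group_add \<Rightarrow> 'v" +
  fixes S :: "'v set" and B :: "'v \<Rightarrow> 'v \<Rightarrow> complex"
  assumes sub: "subspace S"
    and add_left: "\<lbrakk>x \<in> S; y \<in> S; z \<in> S\<rbrakk> \<Longrightarrow> B (x + y) z = B x z + B y z"
    and scale_left: "\<lbrakk>x \<in> S; z \<in> S\<rbrakk> \<Longrightarrow> B (s c x) z = c * B x z"
    and herm: "\<lbrakk>x \<in> S; y \<in> S\<rbrakk> \<Longrightarrow> B y x = cnj (B x y)"
begin

lemma mem [simp]:
  "0 \<in> S"
  "\<lbrakk>x \<in> S; y \<in> S\<rbrakk> \<Longrightarrow> x + y \<in> S"
  "\<lbrakk>x \<in> S; y \<in> S\<rbrakk> \<Longrightarrow> x - y \<in> S"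
  "x \<in> S \<Longrightarrow> s c x \<in> S"
  "(\<And>i. i \<in> A \<Longrightarrow> f i \<in> S) \<Longrightarrow> (\<Sum>i\<in>A. f i) \<in> S"
  using sub by (auto intro: subspace_0 subspace_add subspace_diff subspace_scale subspace_sum)

lemma add_right: "\<lbrakk>x \<in> S; y \<in> S; z \<in> S\<rbrakk> \<Longrightarrow> B z (x + y) = B z x + B z y"
  using herm[of "x + y" z] herm[of x z] herm[of y z] by (simp add: add_left)

lemma scale_right: "\<lbrakk>x \<in> S; z \<in> S\<rbrakk> \<Longrightarrow> B z (s c x) = cnj c * B z x"
  using herm[of "s c x" z] herm[of x z] by (simp add: scale_left)

lemma diff_left: "\<lbrakk>x \<in> S; y \<in> S; z \<in> S\<rbrakk> \<Longrightarrow> B (x - y) z = B x z - B y z"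
  using add_left[of "x - y" y z] by simp

lemma diff_right: "\<lbrakk>x \<in> S; y \<in> S; z \<in> S\<rbrakk> \<Longrightarrow> B z (x - y) = B z x - B z y"
  using add_right[of "x - y" y z] by simp

lemma zero_left: "z \<in> S \<Longrightarrow> B 0 z = 0"
  using diff_left[of z z z] by simp

lemma zero_right: "z \<in> S \<Longrightarrow> B z 0 = 0"
  using diff_right[of z z z] by simp

lemma sum_left:
  "finite A \<Longrightarrow> (\<And>i. i \<in> A \<Longrightarrow> f i \<in> S) \<Longrightarrow> z \<in> S \<Longrightarrow> B (\<Sum>i\<in>A. f i) z = (\<Sum>i\<in>A. B (f i) z)"
  by (induction A rule: finite_induct) (auto simp: zero_left add_left)

lemmas form_simps = add_left add_right scale_left scale_right diff_left diff_right zero_left zero_right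

lemma Im_diag: "x \<in> S \<Longrightarrow> Im (B x x) = 0"
  using arg_cong[OF herm[of x x], where f = Im] by simp

lemma diag_of_real: "x \<in> S \<Longrightarrow> B x x = of_real (Re (B x x))"
  by (simp add: complex_eq_iff Im_diag)

lemma diag_add_scale:
  assumes "x \<in> S" "y \<in> S"
  shows "Re (B (x + s t y) (x + s t y)) =
    Re (B x x) + 2 * Re (cnj t * B x y) + (cmod t)\<^sup>2 * Re (B y y)"
proof -
  have "B (x + s t y) (x + s t y) = B x x + cnj t * B x y + cnj (cnj t * B x y) + t * cnj t * B y y"
    using assms by (simp add: form_simps herm[of x y] algebra_simps)
  then show ?thesis
    by (simp add: complex_norm_square[symmetric] Im_diag assms)
qed

lemma parallelogram:
  assumes "x \<in> S" "y \<in> S"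
  shows "Re (B (x + y) (x + y)) + Re (B (x - y) (x - y)) = 2 * Re (B x x) + 2 * Re (B y y)"
  using assms by (simp add: form_simps)

end

text \<open>Semidefinite rather than definite, since a function that vanishes almost everywhere is a
  nonzero vector of norm 0.\<close>

locale semi_ip = herm_form s S B
  for s :: "complex \<Rightarrow> 'v::ab_group_add \<Rightarrow> 'v" and S B +
  assumes nonneg: "x \<in> S \<Longrightarrow> 0 \<le> Re (B x x)"
begin

lemma cauchy_schwarz:
  assumes "x \<in> S" "y \<in> S"
  shows "(cmod (B x y))\<^sup>2 \<le> Re (B x x) * Re (B y y)"
proof (rule quadratic_nonneg_complex)
  show "0 \<le> Re (B x x) + 2 * Re (cnj t * B x y) + (cmod t)\<^sup>2 * Re (B y y)" for t
    using nonneg[of "x + s t y"] diag_add_scale[OF assms, of t] assms by simp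
qed (use assms nonneg in auto)

lemma cauchy_schwarz_sqrt:
  assumes "x \<in> S" "y \<in> S"
  shows "cmod (B x y) \<le> sqrt (Re (B x x)) * sqrt (Re (B y y))"
  using cauchy_schwarz[OF assms] by (simp add: real_le_rsqrt real_sqrt_mult[symmetric])

lemma diff_diag_le:
  assumes "x \<in> S" "y \<in> S"
  shows "Re (B (x - y) (x - y)) \<le> 2 * Re (B x x) + 2 * Re (B y y)"
  using parallelogram[OF assms] nonneg[of "x + y"] assms by simp

lemma triangle_sqrt:
  assumes "x \<in> S" "y \<in> S"
  shows "sqrt (Re (B (x + y) (x + y))) \<le> sqrt (Re (B x x)) + sqrt (Re (B y y))"
proof (rule real_le_lsqrt)
  have "Re (B x y) \<le> sqrt (Re (B x x)) * sqrt (Re (B y y))"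
    using cauchy_schwarz_sqrt[OF assms] complex_Re_le_cmod order_trans by blast
  moreover have "Re (B (x + y) (x + y)) = Re (B x x) + 2 * Re (B x y) + Re (B y y)"
    using diag_add_scale[OF assms, of 1] assms by simp
  ultimately show "Re (B (x + y) (x + y)) \<le> (sqrt (Re (B x x)) + sqrt (Re (B y y)))\<^sup>2"
    using nonneg assms by (simp add: power2_sum)
qed (use nonneg assms in auto)

text \<open>For \<open>shifted bottom\<close> this is the step from minimiser to eigenvector: a
  vector on which the nonnegative form vanishes is annihilated by it in every direction.\<close>

lemma null_right:
  assumes "x \<in> S" "y \<in> S" "Re (B x x) = 0"
  shows "B x y = 0"
  using cauchy_schwarz[OF assms(1,2)] assms(3) by simp

lemma tendsto_left:
  assumes "\<And>n. x n \<in> S" "u \<in> S" "y \<in> S" "(\<lambda>n. Re (B (x n - u) (x n - u))) \<longlonglongrightarrow> 0"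
  shows "(\<lambda>n. B (x n) y) \<longlonglongrightarrow> B u y"
proof (rule LIM_zero_cancel, rule tendsto_norm_zero_cancel, rule tendsto_zero_le)
  have "(\<lambda>n. sqrt (Re (B (x n - u) (x n - u))) * sqrt (Re (B y y))) \<longlonglongrightarrow> sqrt 0 * sqrt (Re (B y y))"
    by (intro tendsto_mult tendsto_real_sqrt assms tendsto_const)
  then show "(\<lambda>n. sqrt (Re (B (x n - u) (x n - u))) * sqrt (Re (B y y))) \<longlonglongrightarrow> 0" by simp
  show "norm (B (x n) y - B u y) \<le> sqrt (Re (B (x n - u) (x n - u))) * sqrt (Re (B y y))" for n
    using cauchy_schwarz_sqrt[of "x n - u" y] assms by (simp add: diff_left)
qed auto

lemma tendsto_diag:
  assumes "\<And>n. x n \<in> S" "u \<in> S" "(\<lambda>n. Re (B (x n - u) (x n - u))) \<longlonglongrightarrow> 0"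
  shows "(\<lambda>n. Re (B (x n) (x n))) \<longlonglongrightarrow> Re (B u u)"
proof -
  have "Re (B (x n) (x n)) = Re (B (x n - u) (x n - u)) + 2 * Re (B (x n) u) - Re (B u u)" for n
    using assms(1)[of n] assms(2) herm[of "x n" u] by (simp add: form_simps)
  moreover have "(\<lambda>n. Re (B (x n - u) (x n - u)) + 2 * Re (B (x n) u) - Re (B u u)) \<longlonglongrightarrow>
      0 + 2 * Re (B u u) - Re (B u u)"
    by (intro tendsto_intros assms tendsto_left)
  ultimately show ?thesis by simp
qed

end

section \<open>Completeness with respect to a form, and Riesz representation\<close>

definition form_Cauchy :: "('v::ab_group_add \<Rightarrow> 'v \<Rightarrow> complex) \<Rightarrow> (nat \<Rightarrow> 'v) \<Rightarrow> bool" where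
  "form_Cauchy B x \<longleftrightarrow> (\<forall>\<epsilon>>0. \<exists>N. \<forall>i\<ge>N. \<forall>j\<ge>N. Re (B (x i - x j) (x i - x j)) < \<epsilon>)"

definition form_complete :: "('v::ab_group_add \<Rightarrow> 'v \<Rightarrow> complex) \<Rightarrow> 'v set \<Rightarrow> bool" where
  "form_complete B S \<longleftrightarrow> (\<forall>x. (\<forall>n. x n \<in> S) \<longrightarrow> form_Cauchy B x \<longrightarrow>
     (\<exists>u\<in>S. (\<lambda>n. Re (B (x n - u) (x n - u))) \<longlonglongrightarrow> 0))"

lemma form_CauchyI:
  assumes "\<And>i j. Re (B (x i - x j) (x i - x j)) \<le> g i + g j" "g \<longlonglongrightarrow> 0"
  shows "form_Cauchy B x"
  unfolding form_Cauchy_def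
proof (intro allI impI)
  fix \<epsilon> :: real assume "\<epsilon> > 0"
  then obtain N where N: "\<And>n. n \<ge> N \<Longrightarrow> \<bar>g n\<bar> < \<epsilon> / 2"
    using assms(2)[THEN LIMSEQ_D, of "\<epsilon>/2"] by auto
  have "Re (B (x i - x j) (x i - x j)) < \<epsilon>" if "i \<ge> N" "j \<ge> N" for i j
    using assms(1)[of i j] N[OF that(1)] N[OF that(2)] by linarith
  then show "\<exists>N. \<forall>i\<ge>N. \<forall>j\<ge>N. Re (B (x i - x j) (x i - x j)) < \<epsilon>" by blast
qed

text \<open>Minimising \<open>B x x - 2 Re (l x)\<close>: the parallelogram law makes minimising sequences Cauchy.\<close>

lemma (in semi_ip) riesz:
  assumes complete: "form_complete B S"
    and l_add: "\<And>x y. x \<in> S \<Longrightarrow> y \<in> S \<Longrightarrow> l (x + y) = l x + l y"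
    and l_scale: "\<And>c x. x \<in> S \<Longrightarrow> l (s c x) = cnj c * l x"
    and bound: "\<And>x. x \<in> S \<Longrightarrow> (cmod (l x))\<^sup>2 \<le> C * Re (B x x)"
  shows "\<exists>u\<in>S. \<forall>x\<in>S. B u x = l x"
proof -
  define J where "J x = Re (B x x) - 2 * Re (l x)" for x
  \<comment> \<open>By the inequality of arithmetic and geometric means, |l x| is at most half of
    |C| + B x x, so the quadratic part of J absorbs all of the linear part except |C|.\<close>
  have bdd: "- \<bar>C\<bar> \<le> J x" if x: "x \<in> S" for x
  proof -
    have "(cmod (l x))\<^sup>2 \<le> \<bar>C\<bar> * Re (B x x)"
      using bound[OF x] nonneg[OF x] mult_right_mono[of C "\<bar>C\<bar>" "Re (B x x)"] by linarith
    also have "\<dots> \<le> ((\<bar>C\<bar> + Re (B x x)) / 2)\<^sup>2"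
      using sum_squares_bound[of "\<bar>C\<bar>" "Re (B x x)"] zero_le_power2[of "\<bar>C\<bar> - Re (B x x)"]
      by (simp add: power2_eq_square field_simps)
    finally have "cmod (l x) \<le> (\<bar>C\<bar> + Re (B x x)) / 2"
      by (rule power2_le_imp_le) (use nonneg[OF x] in simp)
    then show ?thesis using complex_Re_le_cmod[of "l x"] by (simp add: J_def)
  qed
  define d where "d = Inf (J ` S)"
  have bb: "bdd_below (J ` S)" using bdd by (auto intro!: bdd_belowI)
  have dle: "d \<le> J x" if "x \<in> S" for x
    unfolding d_def using bb that by (simp add: cInf_lower)
  have "\<exists>x\<in>S. J x < d + 1 / Suc n" for n
  proof -
    have "Inf (J ` S) < d + 1 / Suc n" by (simp add: d_def)
    moreover have "J ` S \<noteq> {}" using mem(1) by blast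
    ultimately show ?thesis using bb by (subst (asm) cInf_less_iff) auto
  qed
  then obtain x where x: "\<And>n. x n \<in> S" and Jx: "\<And>n. J (x n) < d + 1 / Suc n"
    by metis
  have "form_Cauchy B x"
  proof (rule form_CauchyI)
    fix i j
    define z where "z = s (1/2) (x i + x j)"
    have zS: "z \<in> S" using x by (auto simp: z_def)
    have "4 * Re (B z z) = Re (B (x i + x j) (x i + x j))" "2 * Re (l z) = Re (l (x i)) + Re (l (x j))"
      using x by (simp_all add: z_def form_simps l_add l_scale algebra_simps)
    then have "Re (B (x i - x j) (x i - x j)) = 2 * J (x i) + 2 * J (x j) - 4 * J z"
      using parallelogram[OF x x, of i j] by (simp add: J_def)
    then show "Re (B (x i - x j) (x i - x j)) \<le> 2 / Suc i + 2 / Suc j"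
      using Jx[of i] Jx[of j] dle[OF zS] by linarith
  next
    show "(\<lambda>i. 2 / real (Suc i)) \<longlonglongrightarrow> 0"
      using tendsto_mult[OF tendsto_const[of 2] LIMSEQ_Suc[OF lim_inverse_n]]
      by (simp add: divide_inverse)
  qed
  then obtain u where u: "u \<in> S" and lim: "(\<lambda>n. Re (B (x n - u) (x n - u))) \<longlonglongrightarrow> 0"
    using complete x unfolding form_complete_def by blast
  have "B u y = l y" if y: "y \<in> S" for y
  proof -
    \<comment> \<open>The n-th minimiser is optimal up to 1 / (n + 1), so the perturbed value in
      every direction t y stays above - 1 / (n + 1). The discriminant criterion turns this into
      smallness of the first variation.\<close>
    have est: "(cmod (B (x n) y - l y))\<^sup>2 \<le> (1 / Suc n) * Re (B y y)" for n
    proof (rule quadratic_nonneg_complex)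
      fix t
      have "J (x n + s t y) = J (x n) + 2 * Re (cnj t * (B (x n) y - l y)) + (cmod t)\<^sup>2 * Re (B y y)"
        using diag_add_scale[OF x y, of n t] x y by (simp add: J_def l_add l_scale algebra_simps)
      then show "0 \<le> 1 / Suc n + 2 * Re (cnj t * (B (x n) y - l y)) + (cmod t)\<^sup>2 * Re (B y y)"
        using dle[of "x n + s t y"] x[of n] y Jx[of n] by simp
    qed (use nonneg y in auto)
    have "(\<lambda>n. (cmod (B (x n) y - l y))\<^sup>2) \<longlonglongrightarrow> 0"
    proof (rule tendsto_zero_le)
      show "(\<lambda>n. (1 / Suc n) * Re (B y y)) \<longlonglongrightarrow> 0"
        using tendsto_mult[OF LIMSEQ_Suc[OF lim_inverse_n] tendsto_const[of "Re (B y y)"]]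
        by (simp add: divide_inverse)
    qed (use est in simp_all)
    moreover have "(\<lambda>n. (cmod (B (x n) y - l y))\<^sup>2) \<longlonglongrightarrow> (cmod (B u y - l y))\<^sup>2"
      by (intro tendsto_intros tendsto_left x u y lim)
    ultimately show ?thesis using LIMSEQ_unique by fastforce
  qed
  then show ?thesis using u by blast
qed

section \<open>Closed lower-bounded forms and the resolvents of their operators\<close>

locale form_op = ip: semi_ip s H ip + ef: herm_form s D e
  for s :: "complex \<Rightarrow> 'v::ab_group_add \<Rightarrow> 'v" and H ip D e +
  fixes M :: real
  assumes DH: "D \<subseteq> H"
    and lower: "x \<in> D \<Longrightarrow> - M * Re (ip x x) \<le> Re (e x x)"
    and complete: "form_complete (\<lambda>x y. e x y + of_real (M + 1) * ip x y) D"
begin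

lemma DHD [simp]: "x \<in> D \<Longrightarrow> x \<in> H"
  using DH by blast

definition shifted :: "real \<Rightarrow> 'v \<Rightarrow> 'v \<Rightarrow> complex" where
  "shifted c x y = e x y - of_real c * ip x y"

definition opr :: "'v \<Rightarrow> 'v \<Rightarrow> bool" where
  "opr \<psi> f \<longleftrightarrow> \<psi> \<in> D \<and> f \<in> H \<and> (\<forall>\<phi>\<in>D. e \<psi> \<phi> = ip f \<phi>)"

text \<open>Abstract counterpart of \<open>resolvent_pt\<close>: vanishing almost everywhere becomes
  vanishing of the seminorm.\<close>

definition res :: "complex \<Rightarrow> bool" where
  "res \<mu> \<longleftrightarrow> (\<forall>f\<in>H. \<exists>\<psi>. opr \<psi> (f + s \<mu> \<psi>)) \<and>
     (\<forall>\<psi>. opr \<psi> (s \<mu> \<psi>) \<longrightarrow> Re (ip \<psi> \<psi>) = 0) \<and>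
     (\<exists>C. \<forall>\<psi> f. f \<in> H \<longrightarrow> opr \<psi> (f + s \<mu> \<psi>) \<longrightarrow> Re (ip \<psi> \<psi>) \<le> C * Re (ip f f))"

sublocale sh: herm_form s D "shifted c" for c
proof
  show "ip.subspace D" by (rule ef.sub)
next
  fix x y assume "x \<in> D" "y \<in> D"
  then show "shifted c y x = cnj (shifted c x y)"
    by (simp add: shifted_def ef.herm[of x y] ip.herm[of x y])
next
  fix x y z assume "x \<in> D" "y \<in> D" "z \<in> D"
  then show "shifted c (x + y) z = shifted c x z + shifted c y z"
    by (simp add: shifted_def ef.add_left ip.add_left distrib_left)
next
  fix x z d assume "x \<in> D" "z \<in> D"
  then show "shifted c (s d x) z = d * shifted c x z"
    by (simp add: shifted_def ef.scale_left ip.scale_left right_diff_distrib)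
qed

text \<open>Measured from a real base point c, the equation (H - \<mu>) \<psi> = f is a perturbation
  of the hermitian form \<open>shifted c\<close> by the scalar \<mu> - c. This is how complex \<mu>
  becomes accessible from real c.\<close>

lemma opr_shift:
  "opr \<psi> (f + s \<mu> \<psi>) \<longleftrightarrow> \<psi> \<in> D \<and> f + s \<mu> \<psi> \<in> H \<and>
     (\<forall>\<phi>\<in>D. shifted c \<psi> \<phi> = ip f \<phi> + (\<mu> - of_real c) * ip \<psi> \<phi>)" if "f \<in> H"
  using that by (auto simp: opr_def shifted_def ip.form_simps algebra_simps)

lemma opr_eigen:
  "opr \<psi> (s \<mu> \<psi>) \<longleftrightarrow> \<psi> \<in> D \<and>
     (\<forall>\<phi>\<in>D. shifted c \<psi> \<phi> = (\<mu> - of_real c) * ip \<psi> \<phi>)"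
  by (auto simp: opr_def shifted_def ip.form_simps algebra_simps)

text \<open>The form norm. Shifting by M + 1 instead of M makes it dominate the norm of
  \<open>ip\<close>, so that completeness under it is exactly closedness of the form.\<close>

definition full :: "'v \<Rightarrow> 'v \<Rightarrow> complex" where
  "full x y = e x y + of_real (M + 1) * ip x y"

lemma full_complete: "form_complete full D"
  using complete by (simp add: full_def[abs_def])

lemma ip_le_full: "x \<in> D \<Longrightarrow> Re (ip x x) \<le> Re (full x x)"
  using lower[of x] by (simp add: full_def algebra_simps)

lemma shifted_le_full: "x \<in> D \<Longrightarrow> Re (shifted c x x) \<le> (1 + \<bar>c + M + 1\<bar>) * Re (full x x)"
proof -
  assume x: "x \<in> D"
  have "- (c + M + 1) * Re (ip x x) \<le> \<bar>c + M + 1\<bar> * Re (full x x)"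
    using mult_mono[OF abs_ge_minus_self[of "c + M + 1"] ip_le_full[OF x]] ip.nonneg[of x] x by auto
  then show ?thesis by (simp add: full_def shifted_def algebra_simps)
qed

text \<open>Together with \<open>shifted_le_full\<close> this makes the shifted form equivalent to
  the form norm wherever it is coercive, so Cauchy sequences and limits can be exchanged between the
  two.\<close>

lemma full_le_shifted:
  assumes "x \<in> D" "\<epsilon> > 0" "\<epsilon> * Re (ip x x) \<le> Re (shifted c x x)"
  shows "Re (full x x) \<le> (1 + \<bar>c + M + 1\<bar> / \<epsilon>) * Re (shifted c x x)"
proof -
  have "(c + M + 1) * Re (ip x x) \<le> \<bar>c + M + 1\<bar> * (Re (shifted c x x) / \<epsilon>)"
    using assms ip.nonneg[of x] by (intro mult_mono) (auto simp: field_simps)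
  moreover have "Re (full x x) = Re (shifted c x x) + (c + M + 1) * Re (ip x x)"
    by (simp add: full_def shifted_def algebra_simps)
  ultimately show ?thesis by (simp add: distrib_right)
qed

text \<open>Orthogonality to V survives limits in \<open>ip\<close>, which the form norm controls;
  hence T is closed in D. Coercivity on T then carries completeness from \<open>full\<close> over to
  \<open>shifted c\<close>.\<close>

lemma complete_orth:
  assumes "\<epsilon> > 0" and V: "V \<subseteq> H" and T: "T = {x \<in> D. \<forall>y\<in>V. ip x y = 0}"
    and coer: "\<And>x. x \<in> T \<Longrightarrow> \<epsilon> * Re (ip x x) \<le> Re (shifted c x x)"
  shows "form_complete (shifted c) T" "semi_ip s T (shifted c)"
proof -
  have subT: "ip.subspace T"
    unfolding ip.subspace_def
  proof (intro conjI ballI allI)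
    show "0 \<in> T" using V by (auto simp: T ip.zero_left)
    show "x + y \<in> T" if "x \<in> T" "y \<in> T" for x y
      using that V by (auto simp: T ip.add_left subset_eq)
    show "s d x \<in> T" if "x \<in> T" for x d
      using that V by (auto simp: T ip.scale_left subset_eq)
  qed
  have TD: "x \<in> D" if "x \<in> T" for x using that T by auto
  have TH: "x \<in> H" if "x \<in> T" for x using TD that by auto
  show "semi_ip s T (shifted c)"
  proof
    show "0 \<le> Re (shifted c x x)" if "x \<in> T" for x
      using coer[OF that] ip.nonneg[OF TH[OF that]] \<open>\<epsilon> > 0\<close>
      by (meson mult_nonneg_nonneg order_trans less_imp_le)
    show "shifted c y x = cnj (shifted c x y)" if "x \<in> T" "y \<in> T" for x y
      using sh.herm that TD by blast
    show "shifted c (x + y) z = shifted c x z + shifted c y z" if "x \<in> T" "y \<in> T" "z \<in> T" for x y z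
      using sh.add_left that TD by blast
    show "shifted c (s d x) z = d * shifted c x z" if "x \<in> T" "z \<in> T" for x z d
      using sh.scale_left that TD by blast
  qed (rule subT)
  interpret T: semi_ip s T "shifted c" by fact
  show "form_complete (shifted c) T"
    unfolding form_complete_def
  proof (intro allI impI)
    fix x assume x: "\<forall>n. x n \<in> T" and cau: "form_Cauchy (shifted c) x"
    define K where "K = 1 + \<bar>c + M + 1\<bar> / \<epsilon>"
    have K: "K > 0" using \<open>\<epsilon> > 0\<close> by (auto simp: K_def intro: add_pos_nonneg)
    have le: "Re (full (x i - x j) (x i - x j)) \<le> K * Re (shifted c (x i - x j) (x i - x j))" for i j
    proof -
      have "x i - x j \<in> T" using x by (intro T.mem) auto
      then show ?thesis unfolding K_def using full_le_shifted TD coer \<open>\<epsilon> > 0\<close> by blast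
    qed
    have "form_Cauchy full x"
      unfolding form_Cauchy_def
    proof (intro allI impI)
      fix \<delta> :: real assume "\<delta> > 0"
      then have "\<delta> / K > 0" using K by simp
      then obtain N where N: "\<forall>i\<ge>N. \<forall>j\<ge>N. Re (shifted c (x i - x j) (x i - x j)) < \<delta> / K"
        using cau unfolding form_Cauchy_def by blast
      have "Re (full (x i - x j) (x i - x j)) < \<delta>" if "i \<ge> N" "j \<ge> N" for i j
      proof -
        have "K * Re (shifted c (x i - x j) (x i - x j)) < \<delta>"
          using N that K by (simp add: field_simps)
        then show ?thesis using le[of i j] by linarith
      qed
      then show "\<exists>N. \<forall>i\<ge>N. \<forall>j\<ge>N. Re (full (x i - x j) (x i - x j)) < \<delta>" by blast
    qed
    then obtain u where u: "u \<in> D" and lim: "(\<lambda>n. Re (full (x n - u) (x n - u))) \<longlonglongrightarrow> 0"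
      using full_complete[unfolded form_complete_def, rule_format, of x] x TD by metis
    have xD: "x n - u \<in> D" "x n \<in> D" for n using x u TD by (auto intro!: ef.mem(3))
    have iplim: "(\<lambda>n. Re (ip (x n - u) (x n - u))) \<longlonglongrightarrow> 0"
      by (rule tendsto_zero_le[OF _ _ lim]) (simp_all add: xD ip_le_full ip.nonneg)
    have "ip u y = 0" if y: "y \<in> V" for y
    proof -
      have "(\<lambda>n. ip (x n) y) \<longlonglongrightarrow> ip u y"
        by (rule ip.tendsto_left[OF _ _ _ iplim]) (use xD u y V in \<open>simp_all add: subset_iff\<close>)
      moreover have "ip (x n) y = 0" for n using x y T by auto
      ultimately show ?thesis by (simp add: LIMSEQ_const_iff)
    qed
    then have uT: "u \<in> T" using u T by auto
    have "(\<lambda>n. Re (shifted c (x n - u) (x n - u))) \<longlonglongrightarrow> 0"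
    proof (rule tendsto_zero_le)
      show "(\<lambda>n. (1 + \<bar>c + M + 1\<bar>) * Re (full (x n - u) (x n - u))) \<longlonglongrightarrow> 0"
        using tendsto_mult[OF tendsto_const lim] by simp
    qed (simp_all only: shifted_le_full[OF xD(1)] T.nonneg T.mem(3)[OF x[rule_format] uT])
    then show "\<exists>u\<in>T. (\<lambda>n. Re (shifted c (x n - u) (x n - u))) \<longlonglongrightarrow> 0"
      using uT by blast
  qed
qed

lemma riesz_orth:
  assumes "\<epsilon> > 0" and V: "V \<subseteq> H" and T: "T = {x \<in> D. \<forall>y\<in>V. ip x y = 0}"
    and coer: "\<And>x. x \<in> T \<Longrightarrow> \<epsilon> * Re (ip x x) \<le> Re (shifted c x x)"
    and f: "f \<in> H"
  shows "\<exists>u\<in>T. \<forall>x\<in>T. shifted c u x = ip f x"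
proof -
  interpret T: semi_ip s T "shifted c"
    by (rule complete_orth[OF assms(1-4)])
  have TH: "x \<in> H" if "x \<in> T" for x using that T by auto
  show ?thesis
  proof (rule T.riesz)
    show "form_complete (shifted c) T" by (rule complete_orth[OF assms(1-4)])
    fix x assume x: "x \<in> T"
    have "(cmod (ip f x))\<^sup>2 \<le> Re (ip f f) * Re (ip x x)"
      using ip.cauchy_schwarz f TH x by blast
    also have "\<dots> \<le> Re (ip f f) * (Re (shifted c x x) / \<epsilon>)"
      using coer[OF x] \<open>\<epsilon> > 0\<close> ip.nonneg[OF f] by (intro mult_left_mono) (auto simp: field_simps)
    finally show "(cmod (ip f x))\<^sup>2 \<le> (Re (ip f f) / \<epsilon>) * Re (shifted c x x)" by simp
  qed (use f TH in \<open>auto simp: ip.form_simps\<close>)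
qed

text \<open>Banach iteration on top of the real resolvent; this reaches non-real spectral parameters.\<close>

lemma solve_orth:
  assumes eps: "\<epsilon> > 0" and V: "V \<subseteq> H" and T: "T = {x \<in> D. \<forall>y\<in>V. ip x y = 0}"
    and coer: "\<And>x. x \<in> T \<Longrightarrow> \<epsilon> * Re (ip x x) \<le> Re (shifted c x x)"
    and f: "f \<in> H" and \<zeta>: "cmod \<zeta> < \<epsilon>"
  shows "\<exists>u\<in>T. \<forall>x\<in>T. shifted c u x = ip f x + \<zeta> * ip u x"
proof -
  interpret T: semi_ip s T "shifted c"
    by (rule complete_orth[OF eps V T coer])
  have TH: "x \<in> H" if "x \<in> T" for x using that T by auto
  have "\<forall>g\<in>H. \<exists>u\<in>T. \<forall>x\<in>T. shifted c u x = ip g x"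
    using riesz_orth[OF eps V T coer] by blast
  then obtain R where R: "\<And>g. g \<in> H \<Longrightarrow> R g \<in> T" "\<And>g x. g \<in> H \<Longrightarrow> x \<in> T \<Longrightarrow> shifted c (R g) x = ip g x"
    by metis
  \<comment> \<open>The solution sought is a fixed point of v |-> R (f + \<zeta> v), where R is the
    Riesz solution operator on T.\<close>
  define u where "u = rec_nat 0 (\<lambda>_ v. R (f + s \<zeta> v))"
  have u_Suc: "u (Suc n) = R (f + s \<zeta> (u n))" for n by (simp add: u_def)
  have uT: "u n \<in> T" for n
    by (induction n) (simp_all add: u_def R f TH)
  have uS: "shifted c (u (Suc n)) x = ip f x + \<zeta> * ip (u n) x" if "x \<in> T" for n x
    using R(2)[of "f + s \<zeta> (u n)" x] that f TH uT by (simp add: u_Suc ip.form_simps)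
  define q where "q = cmod \<zeta> / \<epsilon>"
  have q: "0 \<le> q" "q < 1" using eps \<zeta> by (auto simp: q_def)
  define N where "N x = sqrt (Re (shifted c x x))" for x
  define Q where "Q x = sqrt (Re (ip x x))" for x
  have N0: "0 \<le> N x" if "x \<in> T" for x using T.nonneg that by (simp add: N_def)
  have QN: "Q x \<le> N x / sqrt \<epsilon>" if "x \<in> T" for x
    using coer[OF that] eps by (simp add: Q_def N_def real_sqrt_divide[symmetric] field_simps)
  have Q0: "0 \<le> Q x" if "x \<in> T" for x using ip.nonneg TH that by (simp add: Q_def)
  \<comment> \<open>Coercivity bounds the \<open>ip\<close> norm by the form norm divided by sqrt
    \<epsilon>. It is applied to both factors of the inner product of successive increments, which
    yields the ratio q = |\<zeta>| / \<epsilon> < 1.\<close>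
  have contr: "N (u (Suc (Suc n)) - u (Suc n)) \<le> q * N (u (Suc n) - u n)" for n
  proof -
    define d where "d = u (Suc (Suc n)) - u (Suc n)"
    define d' where "d' = u (Suc n) - u n"
    have dT: "d \<in> T" "d' \<in> T" using uT by (auto simp: d_def d'_def)
    have "shifted c d d = \<zeta> * ip d' d"
      using dT uT TH by (simp add: d_def[symmetric] d'_def T.diff_left[where x = "u (Suc (Suc n))" and y = "u (Suc n)", folded d_def] uS ip.diff_left algebra_simps)
    then have "(N d)\<^sup>2 \<le> cmod \<zeta> * cmod (ip d' d)"
      using complex_Re_le_cmod[of "\<zeta> * ip d' d"] T.nonneg[OF dT(1)] by (simp add: N_def norm_mult)
    also have "\<dots> \<le> cmod \<zeta> * (Q d' * Q d)"
      unfolding Q_def using ip.cauchy_schwarz_sqrt dT TH by (intro mult_left_mono) auto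
    also have "\<dots> \<le> cmod \<zeta> * ((N d' / sqrt \<epsilon>) * (N d / sqrt \<epsilon>))"
      using QN dT Q0 N0 eps by (intro mult_left_mono mult_mono) auto
    also have "\<dots> = (q * N d') * N d" using eps by (simp add: q_def field_simps)
    finally have "N d * N d \<le> (q * N d') * N d" by (simp add: power2_eq_square)
    then have "N d \<le> q * N d'"
      using N0[OF dT(1)] N0[OF dT(2)] q by (cases "N d = 0") (auto simp: mult_le_cancel_right)
    then show ?thesis by (simp add: d_def d'_def)
  qed
  define K where "K = N (u 1 - u 0)"
  have step: "N (u (Suc n) - u n) \<le> K * q ^ n" for n
  proof (induction n)
    case (Suc n)
    have "N (u (Suc (Suc n)) - u (Suc n)) \<le> q * (K * q ^ n)"
      using contr[of n] mult_left_mono[OF Suc q(1)] by linarith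
    then show ?case by (simp add: algebra_simps)
  qed (simp add: K_def)
  have K0: "0 \<le> K" using N0 uT by (simp add: K_def)
  \<comment> \<open>The partial geometric sum stays in closed form, because the cruder bound without
    the factor 1 - q ^ k is not inductive.\<close>
  have far: "N (u (n + k) - u n) \<le> K / (1 - q) * q ^ n * (1 - q ^ k)" for n k
  proof (induction k)
    case (Suc k)
    have "N (u (n + Suc k) - u n) = N ((u (Suc (n + k)) - u (n + k)) + (u (n + k) - u n))" by simp
    also have "\<dots> \<le> N (u (Suc (n + k)) - u (n + k)) + N (u (n + k) - u n)"
      unfolding N_def using uT by (intro T.triangle_sqrt) auto
    also have "\<dots> \<le> K * q ^ (n + k) + K / (1 - q) * q ^ n * (1 - q ^ k)"
      using step Suc by (intro add_mono)
    also have "\<dots> = K / (1 - q) * q ^ n * (1 - q ^ Suc k)"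
      using q by (simp add: field_simps power_add)
    finally show ?case .
  qed (use T.zero_left in \<open>simp add: N_def\<close>)
  define L where "L = (K / (1 - q))\<^sup>2"
  have far2: "Re (shifted c (u (n + k) - u n) (u (n + k) - u n)) \<le> L * (q\<^sup>2) ^ n" for n k
  proof -
    have "N (u (n + k) - u n) \<le> K / (1 - q) * q ^ n * 1"
      by (rule order_trans[OF far], rule mult_left_mono) (use q K0 in auto)
    then have "(N (u (n + k) - u n))\<^sup>2 \<le> (K / (1 - q) * q ^ n)\<^sup>2"
      using N0 uT by (intro power_mono) auto
    then show ?thesis using T.nonneg[of "u (n + k) - u n"] uT
      by (simp add: N_def L_def power_mult_distrib power_divide power_mult[symmetric] mult.commute)
  qed
  have "form_Cauchy (shifted c) u"
  proof (rule form_CauchyI)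
    fix i j
    have L: "0 \<le> L * (q\<^sup>2) ^ n" for n by (simp add: L_def)
    show "Re (shifted c (u i - u j) (u i - u j)) \<le> L * (q\<^sup>2) ^ i + L * (q\<^sup>2) ^ j"
    proof (cases "j \<le> i")
      case True
      then show ?thesis using far2[of j "i - j"] L[of i] by simp
    next
      case False
      have "shifted c (u i - u j) (u i - u j) = shifted c (u j - u i) (u j - u i)"
        using uT by (simp add: T.form_simps)
      then show ?thesis using False far2[of i "j - i"] L[of j] by simp
    qed
  next
    have "(\<lambda>i. L * (q\<^sup>2) ^ i) \<longlonglongrightarrow> L * 0"
      using q by (intro tendsto_intros LIMSEQ_realpow_zero) (auto simp: power_less_one_iff)
    then show "(\<lambda>i. L * (q\<^sup>2) ^ i) \<longlonglongrightarrow> 0" by simp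
  qed
  then obtain v where v: "v \<in> T" and lim: "(\<lambda>n. Re (shifted c (u n - v) (u n - v))) \<longlonglongrightarrow> 0"
    using complete_orth(1)[OF eps V T coer] uT unfolding form_complete_def by blast
  have iplim: "(\<lambda>n. Re (ip (u n - v) (u n - v))) \<longlonglongrightarrow> 0"
  proof (rule tendsto_zero_le)
    show "(\<lambda>n. Re (shifted c (u n - v) (u n - v)) / \<epsilon>) \<longlonglongrightarrow> 0"
      using tendsto_divide[OF lim tendsto_const[of \<epsilon>]] eps by simp
    show "Re (ip (u n - v) (u n - v)) \<le> Re (shifted c (u n - v) (u n - v)) / \<epsilon>" for n
      using coer[of "u n - v"] uT v eps by (simp add: field_simps)
  qed (use uT v TH ip.nonneg in auto)
  have "shifted c v x = ip f x + \<zeta> * ip v x" if x: "x \<in> T" for x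
  proof (rule LIMSEQ_unique)
    show "(\<lambda>n. shifted c (u (Suc n)) x) \<longlonglongrightarrow> shifted c v x"
      by (rule LIMSEQ_Suc, rule T.tendsto_left[OF _ _ _ lim]) (use uT v x in auto)
    show "(\<lambda>n. shifted c (u (Suc n)) x) \<longlonglongrightarrow> ip f x + \<zeta> * ip v x"
      unfolding uS[OF x] by (intro tendsto_intros ip.tendsto_left[OF _ _ _ iplim]) (use uT v x TH in auto)
  qed
  then show ?thesis using v by blast
qed

definition orthonormal :: "nat \<Rightarrow> (nat \<Rightarrow> 'v) \<Rightarrow> bool" where
  "orthonormal n es \<longleftrightarrow> (\<forall>i<n. es i \<in> D) \<and> (\<forall>i<n. \<forall>j<n. ip (es i) (es j) = (if i = j then 1 else 0))"

definition proj :: "nat \<Rightarrow> (nat \<Rightarrow> 'v) \<Rightarrow> 'v \<Rightarrow> 'v" where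
  "proj n es f = (\<Sum>i<n. s (ip f (es i)) (es i))"

lemma proj_mem: "orthonormal n es \<Longrightarrow> proj n es f \<in> D"
  unfolding proj_def orthonormal_def by (intro ef.mem) auto

lemma proj_orth:
  assumes "orthonormal n es" "f \<in> H" "j < n"
  shows "ip (f - proj n es f) (es j) = 0"
proof -
  have es: "es i \<in> H" if "i < n" for i using assms(1) that by (auto simp: orthonormal_def)
  have "ip (proj n es f) (es j) = (\<Sum>i<n. ip f (es i) * ip (es i) (es j))"
    unfolding proj_def using es assms(3) by (subst ip.sum_left) (auto simp: ip.scale_left)
  also have "\<dots> = (\<Sum>i<n. if i = j then ip f (es i) else 0)"
    using assms(1,3) by (intro sum.cong) (auto simp: orthonormal_def)
  also have "\<dots> = ip f (es j)" using assms(3) by simp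
  finally show ?thesis
    using assms es proj_mem[OF assms(1), of f] by (simp add: ip.diff_left)
qed

lemma orth_proj:
  assumes "orthonormal n es" "y \<in> H" "\<And>i. i < n \<Longrightarrow> ip y (es i) = 0"
  shows "ip (proj n es f) y = 0" "ip y (proj n es f) = 0"
proof -
  have es: "es i \<in> H" if "i < n" for i using assms(1) that by (auto simp: orthonormal_def)
  have "ip (es i) y = 0" if "i < n" for i
    using assms(3)[OF that] ip.herm[OF assms(2) es[OF that]] by simp
  then show 0: "ip (proj n es f) y = 0"
    unfolding proj_def using es assms(2) by (subst ip.sum_left) (auto simp: ip.scale_left)
  show "ip y (proj n es f) = 0"
    using ip.herm[of "proj n es f" y] 0 assms(2) proj_mem[OF assms(1), of f] by simp
qed

lemma res_criterion:
  assumes on: "orthonormal n es" and ker: "\<And>i \<phi>. i < n \<Longrightarrow> \<phi> \<in> D \<Longrightarrow> shifted m (es i) \<phi> = 0"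
    and eps: "\<epsilon> > 0"
    and coer: "\<And>x. x \<in> D \<Longrightarrow> (\<And>i. i < n \<Longrightarrow> ip x (es i) = 0) \<Longrightarrow> \<epsilon> * Re (ip x x) \<le> Re (shifted m x x)"
    and \<mu>: "cmod (\<mu> - of_real m) < \<epsilon>" and ne: "\<mu> \<noteq> of_real m \<or> n = 0"
  shows "res \<mu>"
proof -
  define \<zeta> where "\<zeta> = \<mu> - of_real m"
  define V where "V = es ` {..<n}"
  define T where "T = {x \<in> D. \<forall>y\<in>V. ip x y = 0}"
  have VH: "V \<subseteq> H" using on by (auto simp: V_def orthonormal_def)
  have inT: "x \<in> T \<longleftrightarrow> x \<in> D \<and> (\<forall>i<n. ip x (es i) = 0)" for x by (auto simp: T_def V_def)
  have coerT: "\<epsilon> * Re (ip x x) \<le> Re (shifted m x x)" if "x \<in> T" for x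
    using coer that by (auto simp: inT)
  have esD: "es i \<in> D" if "i < n" for i using on that by (auto simp: orthonormal_def)
  note pD = proj_mem[OF on]
  have kerp: "shifted m (proj n es f) \<phi> = 0" "shifted m \<phi> (proj n es f) = 0" if "\<phi> \<in> D" for f \<phi>
  proof -
    show 0: "shifted m (proj n es f) \<phi> = 0"
      unfolding proj_def using that esD ker by (subst sh.sum_left) (auto simp: sh.scale_left)
    show "shifted m \<phi> (proj n es f) = 0"
      using sh.herm[of "proj n es f" \<phi>] 0 that pD by simp
  qed
  have perpT: "x - proj n es x \<in> T" if "x \<in> D" for x
    using that pD proj_orth[OF on] by (simp add: inT)
  have surj: "\<exists>\<psi>. opr \<psi> (f + s \<mu> \<psi>)" if f: "f \<in> H" for f
  proof -
    define f' where "f' = f - proj n es f"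
    have f'H: "f' \<in> H" using f pD by (simp add: f'_def)
    obtain u where u: "u \<in> T" and eq: "\<And>x. x \<in> T \<Longrightarrow> shifted m u x = ip f' x + \<zeta> * ip u x"
      using solve_orth[OF eps VH T_def coerT f'H, of \<zeta>] \<mu> unfolding \<zeta>_def by blast
    have uD: "u \<in> D" using u inT by blast
    \<comment> \<open>Subtracting its projection from the test vector changes nothing: the
      projection is in the kernel of the form and is orthogonal to both f' and u.\<close>
    have eqD: "shifted m u x = ip f' x + \<zeta> * ip u x" if x: "x \<in> D" for x
    proof -
      have "ip f' (proj n es x) = 0" "ip u (proj n es x) = 0"
        using orth_proj(2)[OF on] proj_orth[OF on f] u f'H by (auto simp: inT f'_def)
      then show ?thesis
        using eq[OF perpT[OF x]] x uD f'H pD kerp(2)[OF uD]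
        by (simp add: sh.diff_right ip.diff_right)
    qed
    \<comment> \<open>On the span the form vanishes, so the equation there reads 0 = f-part +
      \<zeta> * \<psi>-part and forces the factor - 1 / \<zeta>. If \<zeta> = 0 the system is empty
      and the projection is 0.\<close>
    define \<psi> where "\<psi> = u + s (- 1 / \<zeta>) (proj n es f)"
    have \<psi>D: "\<psi> \<in> D" using uD pD by (simp add: \<psi>_def)
    have "shifted m \<psi> x = ip f x + \<zeta> * ip \<psi> x" if x: "x \<in> D" for x
    proof -
      have "shifted m \<psi> x = ip f' x + \<zeta> * ip u x"
        using uD pD x kerp(1) eqD by (simp add: \<psi>_def sh.add_left sh.diff_left sh.scale_left)
      also have "ip f' x = ip f x - ip (proj n es f) x"
        using f x pD by (simp add: f'_def ip.diff_left)
      also have "\<zeta> * ip \<psi> x = \<zeta> * ip u x - ip (proj n es f) x"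
      proof (cases "\<zeta> = 0")
        case True
        then have "n = 0" using ne by (simp add: \<zeta>_def)
        then show ?thesis using True x by (simp add: proj_def ip.zero_left)
      next
        case False
        then show ?thesis using uD pD x by (simp add: \<psi>_def ip.add_left ip.diff_left ip.scale_left algebra_simps)
      qed
      ultimately show ?thesis by simp
    qed
    then have "opr \<psi> (f + s \<mu> \<psi>)"
      using \<psi>D f unfolding opr_shift[OF f, of _ _ m] \<zeta>_def by simp
    then show ?thesis by blast
  qed
  \<comment> \<open>Squares of the two resolvent bounds, 1 / (\<epsilon> - |\<zeta>|) on the
    complement and 1 / |\<zeta>| on the span; the factors 2 come from the parallelogram law. For
    \<zeta> = 0 the second term is 0 by the convention on division, as is the projection.\<close>
  define C where "C = 2 * (1 / (\<epsilon> - cmod \<zeta>)\<^sup>2) + 2 * (1 / (cmod \<zeta>)\<^sup>2)"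
  have bnd: "Re (ip \<psi> \<psi>) \<le> C * Re (ip f f)" if f: "f \<in> H" and o: "opr \<psi> (f + s \<mu> \<psi>)" for \<psi> f
  proof -
    have \<psi>: "\<psi> \<in> D" and eq: "\<And>x. x \<in> D \<Longrightarrow> shifted m \<psi> x = ip f x + \<zeta> * ip \<psi> x"
      using o unfolding opr_shift[OF f, of _ _ m] \<zeta>_def by auto
    define p where "p = proj n es \<psi>"
    define u where "u = \<psi> - p"
    have pD': "p \<in> D" and uT: "u \<in> T" and uD: "u \<in> D"
      using pD perpT[OF \<psi>] \<psi> by (simp_all add: p_def u_def)
    have \<psi>eq: "\<psi> = u + p" by (simp add: u_def)
    have orth: "ip p u = 0" "ip u p = 0"
      using orth_proj[OF on, of u] uT uD by (auto simp: inT p_def)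
    have "shifted m u u = ip f u + \<zeta> * ip u u"
      using eq[OF uD] kerp(1)[OF uD, of \<psi>, folded p_def] uD pD' orth
      by (simp add: \<psi>eq sh.add_left ip.add_left)
    then have "Re (shifted m u u) \<le> cmod (ip f u) + cmod \<zeta> * Re (ip u u)"
    proof -
      assume "shifted m u u = ip f u + \<zeta> * ip u u"
      then have "Re (shifted m u u) \<le> cmod (ip f u + \<zeta> * ip u u)" by (simp only: complex_Re_le_cmod)
      also have "\<dots> \<le> cmod (ip f u) + cmod \<zeta> * cmod (ip u u)"
        by (metis norm_mult norm_triangle_ineq)
      also have "cmod (ip u u) = Re (ip u u)"
        using ip.diag_of_real[of u] ip.nonneg[of u] uD by (metis DHD abs_of_nonneg norm_of_real)
      finally show ?thesis .
    qed
    then have 1: "(\<epsilon> - cmod \<zeta>) * Re (ip u u) \<le> sqrt (Re (ip f f)) * sqrt (Re (ip u u))"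
      using coerT[OF uT] ip.cauchy_schwarz_sqrt[of f u] f uD by (simp add: left_diff_distrib)
    have "0 = ip f p + \<zeta> * ip p p"
      using eq[OF pD'] kerp(2)[OF \<psi>, of \<psi>, folded p_def] uD pD' orth
      by (simp add: \<psi>eq ip.add_left)
    then have "cmod (ip f p) = cmod \<zeta> * cmod (ip p p)"
      by (metis add.inverse_unique norm_minus_cancel norm_mult)
    then have 2: "cmod \<zeta> * Re (ip p p) \<le> sqrt (Re (ip f f)) * sqrt (Re (ip p p))"
      using ip.cauchy_schwarz_sqrt[of f p] f pD' ip.diag_of_real[of p] ip.nonneg[of p]
      by (metis DHD abs_of_nonneg norm_of_real)
    have key: "Re (ip y y) \<le> (1 / k\<^sup>2) * Re (ip f f)"
      if "k > 0" "y \<in> D" "k * Re (ip y y) \<le> sqrt (Re (ip f f)) * sqrt (Re (ip y y))" for k y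
    proof -
      have y0: "0 \<le> Re (ip y y)" "0 \<le> Re (ip f f)" using ip.nonneg that f by auto
      show ?thesis
      proof (cases "Re (ip y y) = 0")
        case True
        then show ?thesis using y0 by simp
      next
        case False
        have "k * sqrt (Re (ip y y)) * sqrt (Re (ip y y)) \<le> sqrt (Re (ip f f)) * sqrt (Re (ip y y))"
          using that(3) y0 by (simp add: mult.assoc)
        then have "k * sqrt (Re (ip y y)) \<le> sqrt (Re (ip f f))"
          using False y0 by (simp add: mult_le_cancel_right)
        then have "(k * sqrt (Re (ip y y)))\<^sup>2 \<le> (sqrt (Re (ip f f)))\<^sup>2"
          using \<open>k > 0\<close> y0 by (intro power_mono) auto
        then show ?thesis using y0 \<open>k > 0\<close> by (simp add: power_mult_distrib field_simps)
      qed
    qed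
    have "Re (ip p p) \<le> (1 / (cmod \<zeta>)\<^sup>2) * Re (ip f f)"
    proof (cases "\<zeta> = 0")
      case True
      then have "p = 0" using ne by (simp add: \<zeta>_def p_def proj_def)
      then show ?thesis using ip.zero_left[of 0] True by simp
    next
      case False
      then show ?thesis using key[of "cmod \<zeta>" p] 2 pD' by simp
    qed
    moreover have "Re (ip u u) \<le> (1 / (\<epsilon> - cmod \<zeta>)\<^sup>2) * Re (ip f f)"
      using key[of "\<epsilon> - cmod \<zeta>" u] 1 uD \<mu> by (simp add: \<zeta>_def)
    moreover have "Re (ip \<psi> \<psi>) \<le> 2 * Re (ip u u) + 2 * Re (ip p p)"
      using ip.parallelogram[of u p] ip.nonneg[of "u - p"] uD pD' by (simp add: \<psi>eq)
    ultimately show ?thesis unfolding C_def by (simp add: distrib_right)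
  qed
  have "Re (ip \<psi> \<psi>) = 0" if "opr \<psi> (s \<mu> \<psi>)" for \<psi>
  proof -
    have "opr \<psi> (0 + s \<mu> \<psi>)" using that by simp
    then have "Re (ip \<psi> \<psi>) \<le> C * Re (ip 0 0)" using bnd ip.mem(1) by blast
    then show ?thesis using ip.nonneg[of \<psi>] that by (simp add: ip.zero_left opr_def)
  qed
  then show ?thesis unfolding res_def using surj bnd by blast
qed

text \<open>With the empty orthonormal system the coercivity required by the criterion is the lower
  bound of the form itself. This keeps the real spectrum bounded below.\<close>

corollary res_below: "c < - M \<Longrightarrow> res (of_real c)"
  using lower
  by (intro res_criterion[where n = 0 and m = c and \<epsilon> = "- M - c"])
     (auto simp: orthonormal_def shifted_def algebra_simps)

section \<open>The infimum of the form: membership in the spectrum and isolation\<close>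

definition bottom :: real where
  "bottom = Inf {Re (e x x) | x. x \<in> D \<and> Re (ip x x) = 1}"

lemma normalise:
  assumes "x \<in> D" "Re (ip x x) > 0"
  defines "y \<equiv> s (of_real (1 / sqrt (Re (ip x x)))) x"
  shows "y \<in> D" "Re (ip y y) = 1" "Re (e y y) = Re (e x x) / Re (ip x x)"
    "Re (shifted c y y) = Re (shifted c x x) / Re (ip x x)" "z \<in> H \<Longrightarrow> ip x z = 0 \<Longrightarrow> ip y z = 0"
proof -
  define t where "t = complex_of_real (1 / sqrt (Re (ip x x)))"
  have tt: "t * cnj t = of_real (1 / Re (ip x x))"
  proof -
    have "t * cnj t = of_real ((1 / sqrt (Re (ip x x))) * (1 / sqrt (Re (ip x x))))"
      unfolding t_def by (simp only: complex_cnj_complex_of_real of_real_mult)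
    then show ?thesis using assms(2) by simp
  qed
  have y: "y = s t x" by (simp add: y_def t_def)
  show D: "y \<in> D" using assms(1) by (simp add: y)
  have "ip y y = t * cnj t * ip x x" "e y y = t * cnj t * e x x" "shifted c y y = t * cnj t * shifted c x x"
    using assms(1) by (simp_all add: y ip.form_simps ef.form_simps sh.form_simps)
  then show "Re (ip y y) = 1" "Re (e y y) = Re (e x x) / Re (ip x x)"
    "Re (shifted c y y) = Re (shifted c x x) / Re (ip x x)"
    using assms(2) unfolding tt by simp_all
  show "ip y z = 0" if "z \<in> H" "ip x z = 0"
    using that assms(1) by (simp add: y ip.scale_left)
qed

context
  fixes x0 assumes x0: "x0 \<in> D" "Re (ip x0 x0) > 0"
begin

lemma bottom_set: "{Re (e x x) | x. x \<in> D \<and> Re (ip x x) = 1} \<noteq> {}"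
  "bdd_below {Re (e x x) | x. x \<in> D \<and> Re (ip x x) = 1}"
proof -
  show "{Re (e x x) | x. x \<in> D \<and> Re (ip x x) = 1} \<noteq> {}"
    using normalise(1,2)[OF x0] by blast
  show "bdd_below {Re (e x x) | x. x \<in> D \<and> Re (ip x x) = 1}"
  proof (rule bdd_belowI[of _ "- M"])
    fix r assume "r \<in> {Re (e x x) | x. x \<in> D \<and> Re (ip x x) = 1}"
    then obtain x where "x \<in> D" "Re (ip x x) = 1" "r = Re (e x x)" by blast
    then show "- M \<le> r" using lower[of x] by simp
  qed
qed

lemma bottom_semi_ip: "semi_ip s D (shifted bottom)"
proof
  fix x assume x: "x \<in> D"
  show "0 \<le> Re (shifted bottom x x)"
  proof (cases "Re (ip x x) = 0")
    \<comment> \<open>A vector of seminorm 0 cannot be normalised and so is invisible to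
      \<open>bottom\<close>; for it the lower bound already says that e x x is nonnegative.\<close>
    case True
    then show ?thesis using lower[OF x] by (simp add: shifted_def)
  next
    case False
    then have pos: "Re (ip x x) > 0" using ip.nonneg[of x] x by simp
    have "bottom \<le> Re (e x x) / Re (ip x x)"
      unfolding bottom_def using normalise(1-3)[OF x pos] bottom_set(2)
      by (intro cInf_lower) (auto intro!: exI)
    then show ?thesis using pos by (simp add: shifted_def field_simps)
  qed
qed

lemma bottom_less: "Re (e x0 x0) < c * Re (ip x0 x0) \<Longrightarrow> bottom < c"
proof -
  assume "Re (e x0 x0) < c * Re (ip x0 x0)"
  then have "Re (e x0 x0) / Re (ip x0 x0) < c" using x0 by (simp add: field_simps)
  moreover have "bottom \<le> Re (e x0 x0) / Re (ip x0 x0)"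
    unfolding bottom_def using normalise(1-3)[OF x0] bottom_set(2)
    by (intro cInf_lower) (auto intro!: exI)
  ultimately show ?thesis by linarith
qed

lemma bottom_approx:
  assumes "\<epsilon> > 0"
  shows "\<exists>x\<in>D. Re (ip x x) = 1 \<and> Re (shifted bottom x x) < \<epsilon>"
proof -
  have "Inf {Re (e x x) | x. x \<in> D \<and> Re (ip x x) = 1} < bottom + \<epsilon>"
    using assms by (simp add: bottom_def)
  then obtain x where "x \<in> D" "Re (ip x x) = 1" "Re (e x x) < bottom + \<epsilon>"
    unfolding cInf_less_iff[OF bottom_set] by blast
  then show ?thesis by (intro bexI[of _ x]) (auto simp: shifted_def)
qed

text \<open>If the resolvent existed with bound C, a unit vector f in D would have a preimage \<psi>
  with \<open>shifted bottom\<close> \<psi> f = 1 and form value at most sqrt |C|. Cauchy-Schwarz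
  for the nonnegative shifted form then keeps the form value of f away from 0, against the
  definition of the infimum.\<close>

lemma bottom_spectrum: "\<not> res (of_real bottom)"
proof
  assume "res (of_real bottom)"
  then obtain C where surj: "\<And>f. f \<in> H \<Longrightarrow> \<exists>\<psi>. opr \<psi> (f + s (of_real bottom) \<psi>)"
    and C: "\<And>\<psi> f. f \<in> H \<Longrightarrow> opr \<psi> (f + s (of_real bottom) \<psi>) \<Longrightarrow> Re (ip \<psi> \<psi>) \<le> C * Re (ip f f)"
    unfolding res_def by blast
  interpret b: semi_ip s D "shifted bottom" by (rule bottom_semi_ip)
  define \<epsilon> where "\<epsilon> = 1 / (sqrt \<bar>C\<bar> + 1)"
  have "sqrt \<bar>C\<bar> + 1 > 0" by (auto intro: add_nonneg_pos)
  then have eps: "\<epsilon> > 0" "sqrt \<bar>C\<bar> * \<epsilon> < 1" by (auto simp: \<epsilon>_def field_simps)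
  obtain f where f: "f \<in> D" "Re (ip f f) = 1" "Re (shifted bottom f f) < \<epsilon>"
    using bottom_approx[OF eps(1)] by blast
  obtain \<psi> where o: "opr \<psi> (f + s (of_real bottom) \<psi>)" using surj[OF DHD[OF f(1)]] by blast
  have \<psi>: "\<psi> \<in> D" "\<And>x. x \<in> D \<Longrightarrow> shifted bottom \<psi> x = ip f x"
    using o f unfolding opr_shift[OF DHD[OF f(1)], of _ _ bottom] by auto
  have "cmod (ip f f) = 1" using ip.diag_of_real[of f] f by (metis DHD norm_one of_real_1)
  then have "1 = (cmod (shifted bottom \<psi> f))\<^sup>2" using \<psi> f by simp
  also have "\<dots> \<le> Re (shifted bottom \<psi> \<psi>) * Re (shifted bottom f f)"
    using b.cauchy_schwarz \<psi> f by blast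
  also have "\<dots> \<le> sqrt \<bar>C\<bar> * \<epsilon>"
  proof (intro mult_mono)
    have "Re (shifted bottom \<psi> \<psi>) \<le> cmod (ip f \<psi>)" using \<psi> complex_Re_le_cmod by simp
    also have "\<dots> \<le> sqrt (Re (ip f f)) * sqrt (Re (ip \<psi> \<psi>))"
      using ip.cauchy_schwarz_sqrt[OF DHD DHD] f(1) \<psi>(1) by blast
    also have "\<dots> \<le> sqrt \<bar>C\<bar>" using C[OF _ o] f by auto
    finally show "Re (shifted bottom \<psi> \<psi>) \<le> sqrt \<bar>C\<bar>" .
  qed (use f b.nonneg in auto)
  finally show False using eps by linarith
qed

text \<open>The finite-dimensionality clause is stated through a vanishing seminorm, since equality
  of vectors would be too strong for functions determined only almost everywhere.\<close>

lemma bottom_isolated: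
  assumes cpt: "\<And>x. (\<And>n. x n \<in> D) \<Longrightarrow> (\<And>n. Re (ip (x n) (x n)) = 1) \<Longrightarrow>
      (\<lambda>n. Re (shifted bottom (x n) (x n))) \<longlonglongrightarrow> 0 \<Longrightarrow>
      \<exists>r::nat \<Rightarrow> nat. strict_mono r \<and> form_Cauchy full (x \<circ> r)"
  shows "\<exists>\<psi>. opr \<psi> (s (of_real bottom) \<psi>) \<and> Re (ip \<psi> \<psi>) = 1"
    and "\<exists>\<epsilon>>0. \<forall>\<mu>. cmod (\<mu> - of_real bottom) < \<epsilon> \<longrightarrow> \<mu> \<noteq> of_real bottom \<longrightarrow> res \<mu>"
    and "\<exists>n es. \<forall>\<psi>. opr \<psi> (s (of_real bottom) \<psi>) \<longrightarrow>
      Re (ip (\<psi> - proj n es \<psi>) (\<psi> - proj n es \<psi>)) = 0 \<and> proj n es \<psi> \<in> D"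
proof -
  interpret b: semi_ip s D "shifted bottom" by (rule bottom_semi_ip)
  have limit: "\<exists>u\<in>D. \<exists>r::nat\<Rightarrow>nat. strict_mono r \<and> (\<lambda>n. Re (ip (x (r n) - u) (x (r n) - u))) \<longlonglongrightarrow> 0 \<and>
      Re (ip u u) = 1 \<and> Re (shifted bottom u u) = 0"
    if x: "\<And>n. x n \<in> D" "\<And>n. Re (ip (x n) (x n)) = 1" "(\<lambda>n. Re (shifted bottom (x n) (x n))) \<longlonglongrightarrow> 0" for x
  proof -
    obtain r where r: "strict_mono (r::nat\<Rightarrow>nat)" "form_Cauchy full (x \<circ> r)"
      using cpt[OF x] by blast
    then obtain u where u: "u \<in> D" "(\<lambda>n. Re (full ((x \<circ> r) n - u) ((x \<circ> r) n - u))) \<longlonglongrightarrow> 0"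
      using full_complete[unfolded form_complete_def, rule_format, of "x \<circ> r"] x(1) by auto
    have xr: "x (r n) - u \<in> D" for n using x u by simp
    have ipl: "(\<lambda>n. Re (ip (x (r n) - u) (x (r n) - u))) \<longlonglongrightarrow> 0"
      by (rule tendsto_zero_le[OF _ _ u(2)]) (simp_all add: xr ip_le_full ip.nonneg)
    have bl: "(\<lambda>n. Re (shifted bottom (x (r n) - u) (x (r n) - u))) \<longlonglongrightarrow> 0"
    proof (rule tendsto_zero_le)
      show "(\<lambda>n. (1 + \<bar>bottom + M + 1\<bar>) * Re (full (x (r n) - u) (x (r n) - u))) \<longlonglongrightarrow> 0"
        using tendsto_mult[OF tendsto_const u(2)] by simp
    qed (simp_all only: shifted_le_full[OF xr] b.nonneg[OF xr])
    have "(\<lambda>n. Re (ip (x (r n)) (x (r n)))) \<longlonglongrightarrow> Re (ip u u)"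
      by (rule ip.tendsto_diag[OF _ _ ipl]) (use x u in simp_all)
    then have 1: "Re (ip u u) = 1" using x(2) by (simp add: LIMSEQ_const_iff)
    have "(\<lambda>n. Re (shifted bottom (x (r n)) (x (r n)))) \<longlonglongrightarrow> Re (shifted bottom u u)"
      by (rule b.tendsto_diag[OF _ _ bl]) (use x u in simp_all)
    moreover have "(\<lambda>n. Re (shifted bottom (x (r n)) (x (r n)))) \<longlonglongrightarrow> 0"
      using LIMSEQ_subseq_LIMSEQ[OF x(3) r(1)] by (simp add: o_def)
    ultimately have "Re (shifted bottom u u) = 0" by (rule LIMSEQ_unique)
    then show ?thesis using u 1 r(1) ipl by blast
  qed
  \<comment> \<open>Both inclusions rest on nonnegativity: the eigenvalue equation at the bottom
    says that the shifted form annihilates \<psi>, and by \<open>null_right\<close> this already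
    follows from its diagonal value.\<close>
  have eig: "opr \<psi> (s (of_real bottom) \<psi>) \<longleftrightarrow> \<psi> \<in> D \<and> Re (shifted bottom \<psi> \<psi>) = 0" for \<psi>
    unfolding opr_eigen[of _ _ bottom] using b.null_right[of \<psi>] by auto
  have "\<exists>x. \<forall>n. x n \<in> D \<and> Re (ip (x n) (x n)) = 1 \<and> Re (shifted bottom (x n) (x n)) < 1 / Suc n"
    using bottom_approx[of "1 / real (Suc _)"] by (intro choice) auto
  then obtain x where x: "\<And>n. x n \<in> D" "\<And>n. Re (ip (x n) (x n)) = 1"
    "\<And>n. Re (shifted bottom (x n) (x n)) < 1 / Suc n" by blast
  have inv_lim: "(\<lambda>n. 1 / real (Suc n)) \<longlonglongrightarrow> 0"
    using LIMSEQ_Suc[OF lim_inverse_n] by (simp add: divide_inverse)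
  have "(\<lambda>n. Re (shifted bottom (x n) (x n))) \<longlonglongrightarrow> 0"
    by (rule tendsto_zero_le[OF _ _ inv_lim]) (use b.nonneg x in \<open>auto intro: less_imp_le\<close>)
  then show "\<exists>\<psi>. opr \<psi> (s (of_real bottom) \<psi>) \<and> Re (ip \<psi> \<psi>) = 1"
    using limit[of x] x unfolding eig by blast
  define maximal where "maximal n es \<longleftrightarrow> (\<forall>x\<in>D. Re (shifted bottom x x) = 0 \<longrightarrow>
      (\<forall>i<n. ip x (es i) = 0) \<longrightarrow> Re (ip x x) = 0)" for n :: nat and es
  \<comment> \<open>Otherwise orthonormal null vectors could be selected forever. Two of them are at
    squared distance 2, so no subsequence is Cauchy, whereas \<open>cpt\<close> provides
    one.\<close>
  have "\<exists>n es. orthonormal n es \<and> (\<forall>i<n. Re (shifted bottom (es i) (es i)) = 0) \<and> maximal n es"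
  proof (rule ccontr)
    assume no: "\<not> ?thesis"
    define P where "P f n r \<longleftrightarrow> r \<in> D \<and> Re (shifted bottom r r) = 0 \<and> Re (ip r r) = 1 \<and>
        (\<forall>i<n. ip r (f i) = 0)" for f :: "nat \<Rightarrow> 'v" and n r
    have "\<exists>f. \<forall>n. P f n (f n)"
    proof (rule dependent_wellorder_choice)
      fix f n assume Pf: "\<And>y. y < n \<Longrightarrow> P f y (f y)"
      have "ip (f i) (f j) = (if i = j then 1 else 0)" if "i < n" "j < n" for i j
      proof (cases i j rule: linorder_cases)
        case less
        then show ?thesis
          using Pf[OF that(2)] Pf[OF that(1)] ip.herm[of "f j" "f i"] by (auto simp: P_def)
      next
        case equal
        then show ?thesis using Pf[OF that(2)] ip.diag_of_real[of "f j"] by (auto simp: P_def)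
      next
        case greater
        then show ?thesis using Pf[OF that(1)] by (auto simp: P_def)
      qed
      then have "orthonormal n f" using Pf by (auto simp: orthonormal_def P_def)
      moreover have "\<forall>i<n. Re (shifted bottom (f i) (f i)) = 0" using Pf by (auto simp: P_def)
      ultimately have "\<not> maximal n f" using no by blast
      then obtain x where x: "x \<in> D" "Re (shifted bottom x x) = 0" "\<forall>i<n. ip x (f i) = 0" "Re (ip x x) \<noteq> 0"
        unfolding maximal_def by blast
      then have pos: "Re (ip x x) > 0" using ip.nonneg[of x] by simp
      have fH: "f i \<in> H" if "i < n" for i using Pf[OF that] by (simp add: P_def)
      show "\<exists>r. P f n r"
        unfolding P_def using normalise(1,2)[OF x(1) pos] normalise(4)[OF x(1) pos, of bottom] x(2,3)
          normalise(5)[OF x(1) pos] fH by (intro exI) auto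
    qed (simp add: P_def)
    then obtain f where f: "\<And>n. P f n (f n)" by blast
    have fD: "f n \<in> D" "Re (ip (f n) (f n)) = 1" "Re (shifted bottom (f n) (f n)) = 0" for n
      using f[of n] by (auto simp: P_def)
    obtain r where r: "strict_mono (r::nat\<Rightarrow>nat)" "form_Cauchy full (f \<circ> r)"
      using cpt[of f] fD by auto
    obtain N where N: "\<forall>i\<ge>N. \<forall>j\<ge>N. Re (full ((f \<circ> r) i - (f \<circ> r) j) ((f \<circ> r) i - (f \<circ> r) j)) < 1"
      using r(2) unfolding form_Cauchy_def by (meson zero_less_one)
    define y z where "y = f (r (Suc N))" and "z = f (r N)"
    have D: "y \<in> D" "z \<in> D" using fD by (simp_all add: y_def z_def)
    have "Re (full (y - z) (y - z)) < 1"
      using N[rule_format, of "Suc N" N] by (simp add: y_def z_def)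
    then have "Re (ip (y - z) (y - z)) < 1" using ip_le_full[of "y - z"] D by simp
    moreover have "r N < r (Suc N)" using r(1) by (simp add: strict_monoD)
    then have 0: "ip y z = 0" using f[of "r (Suc N)"] by (auto simp: P_def y_def z_def)
    then have "ip z y = 0" using ip.herm[of y z] D by simp
    then have "Re (ip (y - z) (y - z)) = 2"
      using 0 D fD by (simp add: ip.form_simps) (simp add: y_def z_def)
    ultimately show False by simp
  qed
  then obtain n es where on: "orthonormal n es" and ker: "\<And>i. i < n \<Longrightarrow> Re (shifted bottom (es i) (es i)) = 0"
    and max: "maximal n es" by blast
  have esD: "es i \<in> D" if "i < n" for i using on that by (auto simp: orthonormal_def)
  have pker: "Re (shifted bottom (proj n es \<psi>) (proj n es \<psi>)) = 0" for \<psi>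
  proof -
    have "shifted bottom (proj n es \<psi>) z = 0" if "z \<in> D" for z
      unfolding proj_def using that esD ker b.null_right by (subst sh.sum_left) (auto simp: sh.scale_left)
    from this[OF proj_mem[OF on]] show ?thesis by simp
  qed
  show "\<exists>n es. \<forall>\<psi>. opr \<psi> (s (of_real bottom) \<psi>) \<longrightarrow>
      Re (ip (\<psi> - proj n es \<psi>) (\<psi> - proj n es \<psi>)) = 0 \<and> proj n es \<psi> \<in> D"
  proof (intro exI allI impI conjI)
    fix \<psi> assume "opr \<psi> (s (of_real bottom) \<psi>)"
    then have \<psi>: "\<psi> \<in> D" "Re (shifted bottom \<psi> \<psi>) = 0" using eig by auto
    let ?y = "\<psi> - proj n es \<psi>"
    have "?y \<in> D" using \<psi> proj_mem[OF on] by simp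
    moreover have "Re (shifted bottom ?y ?y) \<le> 2 * Re (shifted bottom \<psi> \<psi>) + 2 * Re (shifted bottom (proj n es \<psi>) (proj n es \<psi>))"
      using b.diff_diag_le \<psi> proj_mem[OF on] by blast
    then have "Re (shifted bottom ?y ?y) = 0"
      using \<psi> pker b.nonneg[OF \<open>?y \<in> D\<close>] by simp
    ultimately show "Re (ip ?y ?y) = 0"
      using max proj_orth[OF on, of \<psi>] \<psi> unfolding maximal_def by simp
    show "proj n es \<psi> \<in> D" by (rule proj_mem[OF on])
  qed
  \<comment> \<open>Without a gap there are unit vectors orthogonal to the system whose form values
    tend to 0. By compactness they accumulate at a unit null vector that is still orthogonal to the
    system, contradicting maximality.\<close>
  have "\<exists>\<epsilon>>0. \<forall>x\<in>D. (\<forall>i<n. ip x (es i) = 0) \<longrightarrow> \<epsilon> * Re (ip x x) \<le> Re (shifted bottom x x)"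
  proof (rule ccontr)
    assume no: "\<not> ?thesis"
    have "\<exists>y. y \<in> D \<and> (\<forall>i<n. ip y (es i) = 0) \<and> Re (ip y y) = 1 \<and> Re (shifted bottom y y) < 1 / Suc k" for k
    proof -
      obtain x where x: "x \<in> D" "\<forall>i<n. ip x (es i) = 0" "Re (shifted bottom x x) < 1 / Suc k * Re (ip x x)"
        using no[simplified, rule_format, of "1 / Suc k"] by (auto simp: not_le)
      then have "0 < 1 / Suc k * Re (ip x x)" using b.nonneg[of x] by linarith
      then have pos: "Re (ip x x) > 0" by (simp add: zero_less_divide_iff)
      then have "Re (shifted bottom x x) / Re (ip x x) < 1 / Suc k" using x(3) by (simp add: field_simps)
      then show ?thesis
        using normalise(1,2)[OF x(1) pos] normalise(4)[OF x(1) pos, of bottom] x(2)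
          normalise(5)[OF x(1) pos] esD by (intro exI) auto
    qed
    then obtain y where y: "\<And>k. y k \<in> D" "\<And>k i. i < n \<Longrightarrow> ip (y k) (es i) = 0" "\<And>k. Re (ip (y k) (y k)) = 1"
      "\<And>k. Re (shifted bottom (y k) (y k)) < 1 / Suc k" by metis
    have "(\<lambda>n. Re (shifted bottom (y n) (y n))) \<longlonglongrightarrow> 0"
      by (rule tendsto_zero_le[OF _ _ inv_lim]) (use b.nonneg y in \<open>auto intro: less_imp_le\<close>)
    then obtain u r where u: "u \<in> D" "Re (ip u u) = 1" "Re (shifted bottom u u) = 0"
      and l: "(\<lambda>n. Re (ip (y (r n) - u) (y (r n) - u))) \<longlonglongrightarrow> 0"
      using limit[of y] y by blast
    have "ip u (es i) = 0" if "i < n" for i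
    proof -
      have "(\<lambda>k. ip (y (r k)) (es i)) \<longlonglongrightarrow> ip u (es i)"
        by (rule ip.tendsto_left[OF _ _ _ l]) (use y u esD that in simp_all)
      then show ?thesis using y(2)[OF that] by (simp add: LIMSEQ_const_iff)
    qed
    then show False using max u unfolding maximal_def by auto
  qed
  then obtain \<epsilon> where "\<epsilon> > 0"
    and coer: "\<And>x. x \<in> D \<Longrightarrow> (\<And>i. i < n \<Longrightarrow> ip x (es i) = 0) \<Longrightarrow> \<epsilon> * Re (ip x x) \<le> Re (shifted bottom x x)"
    by blast
  then show "\<exists>\<epsilon>>0. \<forall>\<mu>. cmod (\<mu> - of_real bottom) < \<epsilon> \<longrightarrow> \<mu> \<noteq> of_real bottom \<longrightarrow> res \<mu>"
    using res_criterion[OF on _ \<open>\<epsilon> > 0\<close> coer] b.null_right ker esD by blast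
qed

end

end

section \<open>Square-integrable functions\<close>

definition cscale :: "complex \<Rightarrow> ('a \<Rightarrow> complex) \<Rightarrow> 'a \<Rightarrow> complex" where
  "cscale c f = (\<lambda>x. c * f x)"

lemma cscale_apply [simp]: "cscale c f x = c * f x"
  by (simp add: cscale_def)

lemma vector_space_cscale: "vector_space (cscale :: complex \<Rightarrow> ('a \<Rightarrow> complex) \<Rightarrow> _)"
  by unfold_locales (auto simp: fun_eq_iff algebra_simps)

lemma sum_fun_apply: "(\<Sum>i\<in>A. f i) x = (\<Sum>i\<in>A. (f i :: 'a \<Rightarrow> complex) x)"
  by (induction A rule: infinite_finite_induct) auto

lemma borel_measurable_cnj [measurable (raw)]:
  "f \<in> borel_measurable M \<Longrightarrow> (\<lambda>x. cnj (f x)) \<in> borel_measurable M"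
  by (rule borel_measurable_continuous_on[of cnj]) (auto intro: continuous_intros)

lemma sq_int_measurable [measurable_dest]: "sq_int f \<Longrightarrow> f \<in> borel_measurable borel"
  by (simp add: sq_int_def)

lemma sq_int_integrable: "sq_int f \<Longrightarrow> integrable lborel (\<lambda>x. (cmod (f x))\<^sup>2)"
  by (simp add: sq_int_def)

lemma sq_intI_bound:
  assumes [measurable]: "f \<in> borel_measurable borel" and "integrable lborel w" "\<And>x. (cmod (f x))\<^sup>2 \<le> w x"
  shows "sq_int f"
  unfolding sq_int_def
proof
  show "integrable lborel (\<lambda>x. (cmod (f x))\<^sup>2)"
    by (rule Bochner_Integration.integrable_bound[OF assms(2)]) (use assms(3) order_trans[OF assms(3) abs_ge_self] in auto)
qed simp

text \<open>Stands in for the triangle inequality throughout, because \<open>L2norm2\<close> is the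
  square of the norm.\<close>

lemma sum_sq_bound: "(cmod (x + y))\<^sup>2 \<le> 2 * (cmod x)\<^sup>2 + 2 * (cmod y)\<^sup>2"
proof -
  have "(cmod (x + y))\<^sup>2 \<le> (cmod x + cmod y)\<^sup>2"
    by (intro power_mono norm_triangle_ineq) auto
  also have "\<dots> \<le> 2 * (cmod x)\<^sup>2 + 2 * (cmod y)\<^sup>2"
    using zero_le_power2[of "cmod x - cmod y"] by (simp add: power2_sum power2_diff)
  finally show ?thesis .
qed

lemma sq_int_add:
  assumes "sq_int f" "sq_int g"
  shows "sq_int (\<lambda>x. f x + g x)"
proof (rule sq_intI_bound)
  show "integrable lborel (\<lambda>x. 2 * (cmod (f x))\<^sup>2 + 2 * (cmod (g x))\<^sup>2)"
    using assms by (auto simp: sq_int_def)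
qed (use assms sum_sq_bound in \<open>auto simp: sq_int_def\<close>)

lemma sq_int_scale: "sq_int f \<Longrightarrow> sq_int (\<lambda>x. c * f x)"
  by (auto simp: sq_int_def norm_mult power_mult_distrib)

lemma sq_int_diff: "sq_int f \<Longrightarrow> sq_int g \<Longrightarrow> sq_int (\<lambda>x. f x - g x)"
  using sq_int_add[of f "\<lambda>x. (-1) * g x"] sq_int_scale[of g "-1"] by simp

lemma sq_int_zero: "sq_int (\<lambda>_. 0)"
  by (simp add: sq_int_def)

lemma sq_int_mult_integrable:
  assumes "sq_int f" "sq_int g"
  shows "integrable lborel (\<lambda>x. f x * cnj (g x))" "integrable lborel (\<lambda>x. f x * g x)"
    "integrable lborel (\<lambda>x. cmod (f x) * cmod (g x))"
proof -
  note [measurable] = assms[THEN sq_int_measurable]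
  have w: "integrable lborel (\<lambda>x. (cmod (f x))\<^sup>2 + (cmod (g x))\<^sup>2)"
    using assms by (auto simp: sq_int_def)
  have le: "cmod (f x) * cmod (g x) \<le> (cmod (f x))\<^sup>2 + (cmod (g x))\<^sup>2" for x
  proof -
    have "2 * cmod (f x) * cmod (g x) \<le> (cmod (f x))\<^sup>2 + (cmod (g x))\<^sup>2" by (rule sum_squares_bound)
    moreover have "0 \<le> cmod (f x) * cmod (g x)" by simp
    ultimately show ?thesis by linarith
  qed
  have le': "norm (cmod (f x) * cmod (g x)) \<le> norm ((cmod (f x))\<^sup>2 + (cmod (g x))\<^sup>2)" for x
    using le[of x] by simp
  show "integrable lborel (\<lambda>x. f x * cnj (g x))"
    by (rule Bochner_Integration.integrable_bound[OF w]) (use le' in \<open>simp_all add: norm_mult\<close>)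
  show "integrable lborel (\<lambda>x. f x * g x)"
    by (rule Bochner_Integration.integrable_bound[OF w]) (use le' in \<open>simp_all add: norm_mult\<close>)
  show "integrable lborel (\<lambda>x. cmod (f x) * cmod (g x))"
    by (rule Bochner_Integration.integrable_bound[OF w]) (use le' in simp_all)
qed

lemma Re_L2inner: "Re (L2inner f f) = L2norm2 f"
proof -
  have "L2inner f f = (\<integral>x. complex_of_real ((cmod (f x))\<^sup>2) \<partial>lborel)"
    unfolding L2inner_def
    by (intro Bochner_Integration.integral_cong refl) (simp only: complex_norm_square)
  then show ?thesis by (simp add: L2norm2_def del: of_real_power)
qed

lemma L2norm2_nonneg [simp]: "0 \<le> L2norm2 f"
  unfolding L2norm2_def by (rule Bochner_Integration.integral_nonneg) auto

lemma L2_semi_ip: "semi_ip cscale {f :: 'a::euclidean_space \<Rightarrow> complex. sq_int f} L2inner"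
proof -
  interpret vector_space "cscale :: complex \<Rightarrow> ('a \<Rightarrow> complex) \<Rightarrow> _" by (rule vector_space_cscale)
  show ?thesis
  proof
    show "subspace {f :: 'a \<Rightarrow> complex. sq_int f}"
      unfolding subspace_def
      by (auto simp: plus_fun_def cscale_def zero_fun_def sq_int_add sq_int_scale sq_int_zero)
  next
    fix f g h :: "'a \<Rightarrow> complex" assume "f \<in> {f. sq_int f}" "g \<in> {f. sq_int f}" "h \<in> {f. sq_int f}"
    then show "L2inner (f + g) h = L2inner f h + L2inner g h"
      unfolding L2inner_def by (simp add: distrib_right sq_int_mult_integrable)
  next
    fix f h :: "'a \<Rightarrow> complex" and c assume "f \<in> {f. sq_int f}" "h \<in> {f. sq_int f}"
    then show "L2inner (cscale c f) h = c * L2inner f h"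
      unfolding L2inner_def by (simp add: mult.assoc)
  next
    fix f h :: "'a \<Rightarrow> complex" and c assume "f \<in> {f. sq_int f}" "h \<in> {f. sq_int f}"
    show "L2inner h f = cnj (L2inner f h)"
      unfolding L2inner_def by (subst Bochner_Integration.integral_cnj[symmetric]) (simp add: mult.commute)
  next
    show "0 \<le> Re (L2inner f f)" for f :: "'a \<Rightarrow> complex" by (simp add: Re_L2inner)
  qed
qed

interpretation L2: semi_ip cscale "{f :: 'a::euclidean_space \<Rightarrow> complex. sq_int f}" L2inner
  by (rule L2_semi_ip)

lemma L2norm2_eq_0_iff: "sq_int f \<Longrightarrow> L2norm2 f = 0 \<longleftrightarrow> (AE x in lborel. f x = 0)"
  unfolding L2norm2_def sq_int_def by (subst integral_nonneg_eq_0_iff_AE) auto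

lemma L2norm2_cong_AE:
  assumes "sq_int f" "sq_int g" "AE x in lborel. f x = g x"
  shows "L2norm2 f = L2norm2 g"
  unfolding L2norm2_def using assms by (intro integral_cong_AE) (auto simp: sq_int_def)

lemma L2norm2_minus: "L2norm2 (\<lambda>x. f x - g x) = L2norm2 (\<lambda>x. g x - f x)"
  by (simp add: L2norm2_def norm_minus_commute)

lemma L2norm2_scale: "L2norm2 (\<lambda>x. c * f x) = (cmod c)\<^sup>2 * L2norm2 f"
  by (simp add: L2norm2_def norm_mult power_mult_distrib)

lemma L2norm2_add_le:
  assumes "sq_int f" "sq_int g"
  shows "L2norm2 (\<lambda>x. f x + g x) \<le> 2 * L2norm2 f + 2 * L2norm2 g"
proof -
  have "L2norm2 (\<lambda>x. f x + g x) \<le> (\<integral>x. 2 * (cmod (f x))\<^sup>2 + 2 * (cmod (g x))\<^sup>2 \<partial>lborel)"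
    unfolding L2norm2_def using sq_int_add[OF assms] assms sum_sq_bound
    by (intro integral_mono) (auto simp: sq_int_def)
  then show ?thesis using assms by (simp add: L2norm2_def sq_int_def)
qed

lemma L2norm2_diff_le:
  assumes "sq_int f" "sq_int g"
  shows "L2norm2 (\<lambda>x. f x - g x) \<le> 2 * L2norm2 f + 2 * L2norm2 g"
  using L2norm2_add_le[of f "\<lambda>x. (-1) * g x"] assms sq_int_scale[of g "-1"] L2norm2_scale[of "-1" g] by simp

lemma L2norm2_diff_triangle:
  assumes "sq_int f" "sq_int g" "sq_int h"
  shows "L2norm2 (\<lambda>x. f x - h x) \<le> 2 * L2norm2 (\<lambda>x. f x - g x) + 2 * L2norm2 (\<lambda>x. g x - h x)"
  using L2norm2_add_le[OF sq_int_diff[OF assms(1,2)] sq_int_diff[OF assms(2,3)]] by simp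

lemma L2inner_le: "sq_int f \<Longrightarrow> sq_int g \<Longrightarrow> (cmod (L2inner f g))\<^sup>2 \<le> L2norm2 f * L2norm2 g"
  using L2.cauchy_schwarz[of f g] by (simp add: Re_L2inner)

lemma L2inner_tendsto:
  assumes f: "\<And>n. sq_int (F n)" "sq_int f" "(\<lambda>n. L2norm2 (\<lambda>x. F n x - f x)) \<longlonglongrightarrow> 0"
    and g: "\<And>n. sq_int (G n)" "sq_int g" "(\<lambda>n. L2norm2 (\<lambda>x. G n x - g x)) \<longlonglongrightarrow> 0"
  shows "(\<lambda>n. L2inner (F n) (G n)) \<longlonglongrightarrow> L2inner f g"
proof -
  have norm: "(\<lambda>n. L2norm2 (F n)) \<longlonglongrightarrow> L2norm2 f"
    using L2.tendsto_diag[of F f] f by (simp add: Re_L2inner fun_diff_def)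
  have "(\<lambda>n. L2inner (F n) (G n - g)) \<longlonglongrightarrow> 0"
  proof (rule tendsto_norm_zero_cancel, rule tendsto_zero_le)
    show "norm (L2inner (F n) (G n - g)) \<le> sqrt (L2norm2 (F n)) * sqrt (L2norm2 (\<lambda>x. G n x - g x))" for n
      using L2.cauchy_schwarz_sqrt[of "F n" "G n - g"] f g by (simp add: Re_L2inner fun_diff_def sq_int_diff)
    show "(\<lambda>n. sqrt (L2norm2 (F n)) * sqrt (L2norm2 (\<lambda>x. G n x - g x))) \<longlonglongrightarrow> 0"
      using tendsto_mult[OF tendsto_real_sqrt[OF norm] tendsto_real_sqrt[OF g(3)]] by simp
  qed auto
  moreover have "(\<lambda>n. L2inner (F n) g) \<longlonglongrightarrow> L2inner f g"
    by (rule L2.tendsto_left) (use f g in \<open>auto simp: Re_L2inner fun_diff_def\<close>)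
  ultimately have "(\<lambda>n. L2inner (F n) (G n - g) + L2inner (F n) g) \<longlonglongrightarrow> 0 + L2inner f g"
    by (rule tendsto_add)
  moreover have "L2inner (F n) (G n - g) + L2inner (F n) g = L2inner (F n) (G n)" for n
    using f g by (simp add: L2.diff_right)
  ultimately show ?thesis by simp
qed

lemma L2norm2_tendsto:
  assumes "\<And>n. sq_int (F n)" "sq_int f" "(\<lambda>n. L2norm2 (\<lambda>x. F n x - f x)) \<longlonglongrightarrow> 0"
  shows "(\<lambda>n. L2norm2 (F n)) \<longlonglongrightarrow> L2norm2 f"
  using tendsto_Re[OF L2inner_tendsto[OF assms assms]] by (simp add: Re_L2inner)

lemma L2_limit_unique:
  assumes "\<And>n. sq_int (F n)" "sq_int f" "sq_int g"
    "(\<lambda>n. L2norm2 (\<lambda>x. F n x - f x)) \<longlonglongrightarrow> 0" "(\<lambda>n. L2norm2 (\<lambda>x. F n x - g x)) \<longlonglongrightarrow> 0"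
  shows "AE x in lborel. f x = g x"
proof -
  have "L2norm2 (\<lambda>x. f x - g x) \<le> 2 * L2norm2 (\<lambda>x. F n x - f x) + 2 * L2norm2 (\<lambda>x. F n x - g x)" for n
    using L2norm2_diff_triangle[OF assms(2) assms(1)[of n] assms(3)] L2norm2_minus[of f "F n"] by simp
  moreover have "(\<lambda>n. 2 * L2norm2 (\<lambda>x. F n x - f x) + 2 * L2norm2 (\<lambda>x. F n x - g x)) \<longlonglongrightarrow> 2 * 0 + 2 * 0"
    by (intro tendsto_intros assms)
  ultimately have "L2norm2 (\<lambda>x. f x - g x) \<le> 0"
    by (intro LIMSEQ_le_const[of _ 0]) auto
  then have "L2norm2 (\<lambda>x. f x - g x) = 0" using L2norm2_nonneg[of "\<lambda>x. f x - g x"] by linarith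
  then show ?thesis using L2norm2_eq_0_iff[OF sq_int_diff[OF assms(2,3)]] by auto
qed

lemma L2norm2_add_tendsto:
  assumes "\<And>n. sq_int (F n)" "sq_int f" "(\<lambda>n. L2norm2 (\<lambda>x. F n x - f x)) \<longlonglongrightarrow> 0"
    and "\<And>n. sq_int (G n)" "sq_int g" "(\<lambda>n. L2norm2 (\<lambda>x. G n x - g x)) \<longlonglongrightarrow> 0"
  shows "(\<lambda>n. L2norm2 (\<lambda>x. (F n x + c * G n x) - (f x + c * g x))) \<longlonglongrightarrow> 0"
proof (rule tendsto_zero_le)
  show "L2norm2 (\<lambda>x. (F n x + c * G n x) - (f x + c * g x)) \<le>
      2 * L2norm2 (\<lambda>x. F n x - f x) + 2 * ((cmod c)\<^sup>2 * L2norm2 (\<lambda>x. G n x - g x))" for n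
    using L2norm2_add_le[OF sq_int_diff[OF assms(1,2)] sq_int_scale[OF sq_int_diff[OF assms(4,5)]], of n c n]
    unfolding L2norm2_scale by (simp add: algebra_simps)
  have "(\<lambda>n. 2 * L2norm2 (\<lambda>x. F n x - f x) + 2 * ((cmod c)\<^sup>2 * L2norm2 (\<lambda>x. G n x - g x))) \<longlonglongrightarrow>
      2 * 0 + 2 * ((cmod c)\<^sup>2 * 0)"
    by (intro tendsto_intros assms)
  then show "(\<lambda>n. 2 * L2norm2 (\<lambda>x. F n x - f x) + 2 * ((cmod c)\<^sup>2 * L2norm2 (\<lambda>x. G n x - g x))) \<longlonglongrightarrow> 0"
    by simp
qed simp

lemma L2_dominated:
  fixes F :: "nat \<Rightarrow> 'a::euclidean_space \<Rightarrow> complex"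
  assumes [measurable]: "\<And>n. F n \<in> borel_measurable borel"
    and lim: "\<And>x. (\<lambda>n. F n x) \<longlonglongrightarrow> f x"
    and w: "integrable lborel (\<lambda>x. (w x)\<^sup>2)" and le: "\<And>n x. cmod (F n x) \<le> w x"
  shows "\<And>n. sq_int (F n)" "sq_int f" "(\<lambda>n. L2norm2 (\<lambda>x. F n x - f x)) \<longlonglongrightarrow> 0"
proof -
  have w0: "0 \<le> w x" for x using le[of 0 x] norm_ge_zero order_trans by blast
  have [measurable]: "f \<in> borel_measurable borel"
    by (rule borel_measurable_LIMSEQ_metric[OF _ lim]) simp
  have fle: "cmod (f x) \<le> w x" for x
    by (rule LIMSEQ_le_const2[OF tendsto_norm[OF lim]]) (use le in auto)
  show sF: "sq_int (F n)" for n
    by (rule sq_intI_bound[OF _ w]) (use le in \<open>auto intro!: power_mono\<close>)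
  show sf: "sq_int f"
    by (rule sq_intI_bound[OF _ w]) (use fle in \<open>auto intro!: power_mono\<close>)
  have "(\<lambda>n. \<integral>x. (cmod (F n x - f x))\<^sup>2 \<partial>lborel) \<longlonglongrightarrow> (\<integral>x. 0 \<partial>(lborel :: 'a measure))"
  proof (rule integral_dominated_convergence[where w = "\<lambda>x. 4 * (w x)\<^sup>2"])
    show "AE x in lborel. (\<lambda>n. (cmod (F n x - f x))\<^sup>2) \<longlonglongrightarrow> 0"
    proof (rule AE_I2)
      fix x show "(\<lambda>n. (cmod (F n x - f x))\<^sup>2) \<longlonglongrightarrow> 0"
        using tendsto_power[OF tendsto_norm[OF LIM_zero[OF lim[of x]]], of 2] by simp
    qed
    show "AE x in lborel. norm ((cmod (F n x - f x))\<^sup>2) \<le> 4 * (w x)\<^sup>2" for n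
    proof (rule AE_I2)
      fix x
      have "cmod (F n x - f x) \<le> 2 * w x"
        using norm_triangle_ineq4[of "F n x" "f x"] le[of n x] fle[of x] by linarith
      then have "(cmod (F n x - f x))\<^sup>2 \<le> (2 * w x)\<^sup>2" by (intro power_mono) auto
      then show "norm ((cmod (F n x - f x))\<^sup>2) \<le> 4 * (w x)\<^sup>2" by (simp add: power_mult_distrib)
    qed
  qed (use w in auto)
  then show "(\<lambda>n. L2norm2 (\<lambda>x. F n x - f x)) \<longlonglongrightarrow> 0" by (simp add: L2norm2_def)
qed

lemma nn_integral_L2norm2: "sq_int f \<Longrightarrow> (\<integral>\<^sup>+x. ennreal ((cmod (f x))\<^sup>2) \<partial>lborel) = ennreal (L2norm2 f)"
  unfolding L2norm2_def sq_int_def by (subst nn_integral_eq_integral) auto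

text \<open>Riesz-Fischer. A subsequence with squared distances below 4^-k has increments that are
  absolutely summable at almost every point; Fatou's lemma then shows that the pointwise limit is
  also the limit in mean square.\<close>

lemma L2_complete_Cauchy:
  fixes F :: "nat \<Rightarrow> 'a::euclidean_space \<Rightarrow> complex"
  assumes sq: "\<And>n. sq_int (F n)"
    and cau: "\<And>\<epsilon>. \<epsilon> > 0 \<Longrightarrow> \<exists>N. \<forall>i\<ge>N. \<forall>j\<ge>N. L2norm2 (\<lambda>x. F i x - F j x) < \<epsilon>"
  shows "\<exists>f. sq_int f \<and> (\<lambda>n. L2norm2 (\<lambda>x. F n x - f x)) \<longlonglongrightarrow> 0"
proof -
  note [measurable] = sq[THEN sq_int_measurable]
  have "\<exists>r::nat\<Rightarrow>nat. \<forall>k. (\<forall>i\<ge>r k. \<forall>j\<ge>r k. L2norm2 (\<lambda>x. F i x - F j x) < (1/4)^k) \<and> r k < r (Suc k)"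
  proof (rule dependent_nat_choice)
    show "\<exists>N. \<forall>i\<ge>N. \<forall>j\<ge>N. L2norm2 (\<lambda>x. F i x - F j x) < (1/4)^0" using cau[of 1] by simp
    fix N k
    obtain N' where N': "\<forall>i\<ge>N'. \<forall>j\<ge>N'. L2norm2 (\<lambda>x. F i x - F j x) < (1/4)^Suc k"
      using cau[of "(1/4)^Suc k"] by auto
    then show "\<exists>y. (\<forall>i\<ge>y. \<forall>j\<ge>y. L2norm2 (\<lambda>x. F i x - F j x) < (1/4)^Suc k) \<and> N < y"
      by (intro exI[of _ "max N' (Suc N)"]) auto
  qed
  then obtain r where r: "\<And>k i j. i \<ge> r k \<Longrightarrow> j \<ge> r k \<Longrightarrow> L2norm2 (\<lambda>x. F i x - F j x) < (1/4)^k"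
    and "\<And>k. r k < r (Suc k)" by blast
  then have mono: "strict_mono r" by (simp add: strict_mono_Suc_iff)
  define d where "d k x = cmod (F (r (Suc k)) x - F (r k) x)" for k x
  have [measurable]: "d k \<in> borel_measurable borel" for k unfolding d_def by measurable
  have "(\<integral>\<^sup>+x. (\<Sum>k. ennreal (2^k * (d k x)\<^sup>2)) \<partial>lborel) = (\<Sum>k. \<integral>\<^sup>+x. ennreal (2^k * (d k x)\<^sup>2) \<partial>lborel)"
    by (rule nn_integral_suminf) simp
  also have "\<dots> = (\<Sum>k. ennreal (2^k * L2norm2 (\<lambda>x. F (r (Suc k)) x - F (r k) x)))"
    using nn_integral_L2norm2[OF sq_int_diff[OF sq sq]]
    by (simp add: d_def ennreal_mult nn_integral_cmult)
  also have "\<dots> \<le> (\<Sum>k. ennreal ((1/2)^k))"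
  proof (intro suminf_le ennreal_leI)
    fix k
    have "2^k * L2norm2 (\<lambda>x. F (r (Suc k)) x - F (r k) x) \<le> 2^k * (1/4)^k"
      using r[of k "r (Suc k)" "r k"] mono by (intro mult_left_mono) (auto simp: strict_mono_less_eq intro: less_imp_le)
    also have "\<dots> = (1/2::real)^k" by (simp add: power_mult_distrib[symmetric])
    finally show "2^k * L2norm2 (\<lambda>x. F (r (Suc k)) x - F (r k) x) \<le> (1/2)^k" .
  qed auto
  also have "\<dots> = ennreal (\<Sum>k. (1/2)^k)" by (rule suminf_ennreal_eq) (auto intro: geometric_sums summable_sums)
  finally have "(\<integral>\<^sup>+x. (\<Sum>k. ennreal (2^k * (d k x)\<^sup>2)) \<partial>lborel) \<noteq> \<infinity>"
    using le_less_trans[OF _ ennreal_less_top] by (metis infinity_ennreal_def less_irrefl)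
  then have AE_fin: "AE x in lborel. (\<Sum>k. ennreal (2^k * (d k x)\<^sup>2)) \<noteq> \<infinity>"
    by (intro nn_integral_PInf_AE) auto
  have AE_conv: "AE x in lborel. convergent (\<lambda>k. F (r k) x)"
    using AE_fin
  proof eventually_elim
    fix x assume "(\<Sum>k. ennreal (2^k * (d k x)\<^sup>2)) \<noteq> \<infinity>"
    then have "summable (\<lambda>k. 2^k * (d k x)\<^sup>2)" by (intro summable_suminf_not_top) auto
    then have s: "summable (\<lambda>k. 2^k * (d k x)\<^sup>2 + (1/2)^k)" by (intro summable_add) auto
    \<comment> \<open>From s \<le> s^2 + 1 with s = 2^k d. The weight 2^k is small enough to be
      summed against 4^-k, and large enough to turn squares into first powers at the cost of a
      summable 2^-k.\<close>
    have "d k x \<le> 2^k * (d k x)\<^sup>2 + (1/2)^k" for k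
    proof -
      have "2 * (2^k * d k x) \<le> (2^k * d k x)\<^sup>2 + 1"
        using zero_le_power2[of "2^k * d k x - 1"] by (simp add: power2_diff)
      moreover have "0 \<le> 2^k * d k x" by (simp add: d_def)
      ultimately have "2^k * d k x \<le> (2^k * d k x)\<^sup>2 + 1" by linarith
      then have "2^k * d k x \<le> 2^k * (2^k * (d k x)\<^sup>2 + (1/2)^k)"
        by (simp add: algebra_simps power2_eq_square power_one_over)
      then show ?thesis by simp
    qed
    then have "summable (\<lambda>k. F (r (Suc k)) x - F (r k) x)"
      by (intro summable_comparison_test'[OF s, of 0]) (auto simp: d_def)
    then have "convergent (\<lambda>n. \<Sum>k<n. F (r (Suc k)) x - F (r k) x)"
      by (simp add: summable_iff_convergent)
    then have "convergent (\<lambda>n. F (r n) x - F (r 0) x)"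
      using sum_lessThan_telescope[of "\<lambda>k. F (r k) x"] by simp
    then have "convergent (\<lambda>n. (F (r n) x - F (r 0) x) + F (r 0) x)"
      by (intro convergent_add convergent_const)
    then show "convergent (\<lambda>k. F (r k) x)" by simp
  qed
  define f where "f x = lim (\<lambda>k. F (r k) x)" for x
  have [measurable]: "f \<in> borel_measurable borel"
    unfolding f_def by measurable
  have AE_lim: "AE x in lborel. (\<lambda>k. F (r k) x) \<longlonglongrightarrow> f x"
    using AE_conv unfolding f_def by eventually_elim (simp add: convergent_LIMSEQ_iff)
  \<comment> \<open>Fatou along the subsequence: the integrand is a limit of the squared distances
    between F i and later members, all of which are below 4^-k.\<close>
  have bound: "(\<integral>\<^sup>+x. ennreal ((cmod (F i x - f x))\<^sup>2) \<partial>lborel) \<le> ennreal ((1/4)^k)" if "i \<ge> r k" for i k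
  proof -
    have "(\<integral>\<^sup>+x. ennreal ((cmod (F i x - f x))\<^sup>2) \<partial>lborel) =
        (\<integral>\<^sup>+x. liminf (\<lambda>j. ennreal ((cmod (F i x - F (r j) x))\<^sup>2)) \<partial>lborel)"
    proof (rule nn_integral_cong_AE)
      show "AE x in lborel. ennreal ((cmod (F i x - f x))\<^sup>2) = liminf (\<lambda>j. ennreal ((cmod (F i x - F (r j) x))\<^sup>2))"
        using AE_lim
      proof eventually_elim
        fix x assume "(\<lambda>k. F (r k) x) \<longlonglongrightarrow> f x"
        then have "(\<lambda>j. ennreal ((cmod (F i x - F (r j) x))\<^sup>2)) \<longlonglongrightarrow> ennreal ((cmod (F i x - f x))\<^sup>2)"
          by (intro tendsto_intros)
        then show "ennreal ((cmod (F i x - f x))\<^sup>2) = liminf (\<lambda>j. ennreal ((cmod (F i x - F (r j) x))\<^sup>2))"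
          by (intro lim_imp_Liminf[symmetric]) auto
      qed
    qed
    also have "\<dots> \<le> liminf (\<lambda>j. \<integral>\<^sup>+x. ennreal ((cmod (F i x - F (r j) x))\<^sup>2) \<partial>lborel)"
      by (rule nn_integral_liminf) simp
    also have "\<dots> \<le> ennreal ((1/4)^k)"
    proof (rule Liminf_le)
      show "\<forall>\<^sub>F j in sequentially. (\<integral>\<^sup>+x. ennreal ((cmod (F i x - F (r j) x))\<^sup>2) \<partial>lborel) \<le> ennreal ((1/4)^k)"
        unfolding eventually_sequentially nn_integral_L2norm2[OF sq_int_diff[OF sq sq]]
        using r[OF that] mono by (intro exI[of _ k]) (auto simp: strict_mono_less_eq intro!: ennreal_leI less_imp_le)
    qed simp
    finally show ?thesis .
  qed
  have dif: "sq_int (\<lambda>x. F i x - f x)" if "i \<ge> r 0" for i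
    unfolding sq_int_def using bound[OF that]
    by (auto simp: integrable_iff_bounded intro: le_less_trans)
  have sf: "sq_int f"
    using sq_int_diff[OF sq dif[of "r 0"], of "r 0"] by simp
  have "(\<lambda>n. L2norm2 (\<lambda>x. F n x - f x)) \<longlonglongrightarrow> 0"
  proof (rule LIMSEQ_I)
    fix \<epsilon> :: real assume "\<epsilon> > 0"
    then obtain k where k: "(1/4)^k < \<epsilon>" using real_arch_pow_inv[of \<epsilon> "1/4"] by auto
    have "norm (L2norm2 (\<lambda>x. F n x - f x) - 0) < \<epsilon>" if "n \<ge> r k" for n
    proof -
      have "ennreal (L2norm2 (\<lambda>x. F n x - f x)) \<le> ennreal ((1/4)^k)"
        using bound[OF that] nn_integral_L2norm2[OF sq_int_diff[OF sq sf]] by simp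
      then show ?thesis using k by (simp add: ennreal_le_iff)
    qed
    then show "\<exists>N. \<forall>n\<ge>N. norm (L2norm2 (\<lambda>x. F n x - f x) - 0) < \<epsilon>" by blast
  qed
  then show ?thesis using sf by blast
qed

section \<open>Density of continuous functions with bounded support\<close>

definition Cc :: "('a::euclidean_space \<Rightarrow> complex) \<Rightarrow> bool" where
  "Cc g \<longleftrightarrow> continuous_on UNIV g \<and> (\<exists>R. \<forall>x. norm x > R \<longrightarrow> g x = 0)"

lemma Cc_bounded:
  assumes "Cc g" shows "\<exists>B. \<forall>x. cmod (g x) \<le> B"
proof -
  obtain R where R: "\<And>x. norm x > R \<Longrightarrow> g x = 0" using assms by (auto simp: Cc_def)
  have "compact (g ` cball 0 R)"
    using assms by (intro compact_continuous_image) (auto simp: Cc_def intro: continuous_on_subset)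
  then have "bounded (g ` cball 0 R)" by (rule compact_imp_bounded)
  then obtain B where B: "\<And>y. y \<in> g ` cball 0 R \<Longrightarrow> norm y \<le> B"
    unfolding bounded_iff by blast
  have "cmod (g x) \<le> \<bar>B\<bar>" for x
    using B[of "g x"] R[of x] by (cases "norm x \<le> R") (auto intro: order_trans)
  then show ?thesis by blast
qed

lemma Cc_measurable: "Cc g \<Longrightarrow> g \<in> borel_measurable borel"
  by (simp add: Cc_def borel_measurable_continuous_onI)

lemma integrable_bounded_support:
  fixes g :: "'a::euclidean_space \<Rightarrow> 'b::{banach, second_countable_topology}"
  assumes "g \<in> borel_measurable borel" "\<And>x. norm (g x) \<le> B" "\<And>x. norm x > R \<Longrightarrow> g x = 0"
  shows "integrable lborel g"
proof (rule Bochner_Integration.integrable_bound)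
  show "integrable lborel (\<lambda>x. B * indicator (cball 0 R) x)"
    by (intro integrable_mult_right integrable_real_indicator) (auto simp: emeasure_lborel_cball_finite simp flip: infinity_ennreal_def)
  show "AE x in lborel. norm (g x) \<le> norm (B * indicator (cball 0 R) x)"
    using assms(2,3) by (auto simp: indicator_def not_le intro!: order_trans[OF assms(2) abs_ge_self])
qed (use assms in simp)

lemma Cc_sq_int:
  assumes "Cc g" shows "sq_int g"
proof -
  obtain R B where "\<And>x. norm x > R \<Longrightarrow> g x = 0" "\<And>x. cmod (g x) \<le> B"
    using assms Cc_bounded by (metis Cc_def)
  then show ?thesis unfolding sq_int_def using Cc_measurable[OF assms]
    by (auto intro!: integrable_bounded_support[where B = "B\<^sup>2" and R = R] power_mono)
qed

lemma Cc_integrable: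
  assumes "Cc g" shows "integrable lborel g"
proof -
  obtain R B where "\<And>x. norm x > R \<Longrightarrow> g x = 0" "\<And>x. cmod (g x) \<le> B"
    using assms Cc_bounded by (metis Cc_def)
  then show ?thesis using Cc_measurable[OF assms]
    by (auto intro!: integrable_bounded_support[where B = B and R = R])
qed

lemma Cc_add_scale:
  assumes "Cc f" "Cc g" shows "Cc (\<lambda>x. f x + c * g x)"
proof -
  obtain R S where "\<And>x. norm x > R \<Longrightarrow> f x = 0" "\<And>x. norm x > S \<Longrightarrow> g x = 0"
    using assms by (metis Cc_def)
  then show ?thesis using assms unfolding Cc_def
    by (auto intro!: continuous_intros exI[of _ "max R S"])
qed

definition Cc_approx :: "('a::euclidean_space \<Rightarrow> complex) \<Rightarrow> bool" where
  "Cc_approx f \<longleftrightarrow> sq_int f \<and> (\<forall>\<epsilon>>0. \<exists>g. Cc g \<and> L2norm2 (\<lambda>x. f x - g x) < \<epsilon>)"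

lemma Cc_approx_closed:
  assumes f: "sq_int f" and "\<And>\<epsilon>. \<epsilon> > 0 \<Longrightarrow> \<exists>h. Cc_approx h \<and> L2norm2 (\<lambda>x. f x - h x) < \<epsilon>"
  shows "Cc_approx f"
  unfolding Cc_approx_def
proof (intro conjI allI impI f)
  fix \<epsilon> :: real assume "\<epsilon> > 0"
  then obtain h where h: "Cc_approx h" "L2norm2 (\<lambda>x. f x - h x) < \<epsilon> / 4"
    using assms(2)[of "\<epsilon>/4"] by auto
  then obtain g where g: "Cc g" "L2norm2 (\<lambda>x. h x - g x) < \<epsilon> / 4"
    using \<open>\<epsilon> > 0\<close> unfolding Cc_approx_def by (metis divide_pos_pos zero_less_numeral)
  have "L2norm2 (\<lambda>x. f x - g x) \<le> 2 * L2norm2 (\<lambda>x. f x - h x) + 2 * L2norm2 (\<lambda>x. h x - g x)"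
    using L2norm2_diff_triangle f h(1) Cc_sq_int[OF g(1)] by (auto simp: Cc_approx_def)
  then show "\<exists>g. Cc g \<and> L2norm2 (\<lambda>x. f x - g x) < \<epsilon>" using g h by auto
qed

lemma Cc_approx_limit:
  assumes "\<And>n. Cc_approx (F n)" "sq_int f" "(\<lambda>n. L2norm2 (\<lambda>x. F n x - f x)) \<longlonglongrightarrow> 0"
  shows "Cc_approx f"
proof (rule Cc_approx_closed[OF assms(2)])
  fix \<epsilon> :: real assume "\<epsilon> > 0"
  then obtain n where "L2norm2 (\<lambda>x. F n x - f x) < \<epsilon>"
    using LIMSEQ_D[OF assms(3), of \<epsilon>] by auto
  then show "\<exists>h. Cc_approx h \<and> L2norm2 (\<lambda>x. f x - h x) < \<epsilon>"
    using assms(1) L2norm2_minus[of f "F n"] by (intro exI[of _ "F n"]) simp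
qed

lemma Cc_imp_approx: "Cc g \<Longrightarrow> Cc_approx g"
  unfolding Cc_approx_def by (auto simp: Cc_sq_int L2norm2_def intro!: exI[of _ g])

lemma Cc_approx_add_scale:
  assumes "Cc_approx f" "Cc_approx g"
  shows "Cc_approx (\<lambda>x. f x + c * g x)"
  unfolding Cc_approx_def
proof (intro conjI allI impI)
  have sq: "sq_int f" "sq_int g" using assms by (auto simp: Cc_approx_def)
  then show "sq_int (\<lambda>x. f x + c * g x)" by (intro sq_int_add sq_int_scale)
  fix \<epsilon> :: real assume "\<epsilon> > 0"
  define \<delta> where "\<delta> = \<epsilon> / (1 + (cmod c)\<^sup>2) / 4"
  have \<delta>: "\<delta> > 0" using \<open>\<epsilon> > 0\<close> by (simp add: \<delta>_def add_pos_nonneg)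
  then obtain u v where u: "Cc u" "L2norm2 (\<lambda>x. f x - u x) < \<delta>" and v: "Cc v" "L2norm2 (\<lambda>x. g x - v x) < \<delta>"
    using assms by (metis Cc_approx_def)
  have "L2norm2 (\<lambda>x. (f x + c * g x) - (u x + c * v x)) \<le>
      2 * L2norm2 (\<lambda>x. f x - u x) + 2 * ((cmod c)\<^sup>2 * L2norm2 (\<lambda>x. g x - v x))"
    using L2norm2_add_le[OF sq_int_diff[OF sq(1) Cc_sq_int[OF u(1)]]
        sq_int_scale[OF sq_int_diff[OF sq(2) Cc_sq_int[OF v(1)]], of c]]
    unfolding L2norm2_scale by (simp add: algebra_simps)
  also have "\<dots> \<le> 2 * \<delta> + 2 * ((cmod c)\<^sup>2 * \<delta>)"
    using u v by (intro add_mono mult_left_mono) auto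
  also have "\<dots> = 2 * (\<delta> * (1 + (cmod c)\<^sup>2))" by (simp add: algebra_simps)
  also have "\<dots> = \<epsilon> / 2" using add_pos_nonneg[of 1 "(cmod c)\<^sup>2"] by (simp add: \<delta>_def divide_simps)
  also have "\<dots> < \<epsilon>" using \<open>\<epsilon> > 0\<close> by simp
  finally show "\<exists>h. Cc h \<and> L2norm2 (\<lambda>x. f x + c * g x - h x) < \<epsilon>"
    using Cc_add_scale[OF u(1) v(1)] by blast
qed

lemma Cc_approx_indicator_compact:
  fixes K :: "'a::euclidean_space set"
  assumes "compact K" shows "Cc_approx (indicator K)"
proof (cases "K = {}")
  case True
  have "Cc (\<lambda>x::'a. 0)" by (auto simp: Cc_def)
  moreover have "(indicator {} :: 'a \<Rightarrow> complex) = (\<lambda>_. 0)" by (simp add: fun_eq_iff)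
  ultimately show ?thesis using Cc_imp_approx True by simp
next
  case False
  \<comment> \<open>Tent functions over K with slope n; they decrease to the indicator because K is
    closed.\<close>
  define G where "G n x = complex_of_real (max 0 (1 - real n * infdist x K))" for n x
  have "bounded K" using assms by (rule compact_imp_bounded)
  then obtain R where "\<forall>x\<in>K. norm x \<le> R" unfolding bounded_iff by blast
  then have R: "K \<subseteq> cball 0 R" by auto
  have Gc: "continuous_on UNIV (G n)" for n
    unfolding G_def by (intro continuous_intros)
  have far: "G (Suc n) x = 0" if "norm x > R + 1" for n x
  proof -
    have "1 \<le> infdist x K"
      unfolding infdist_notempty[OF False]
    proof (rule cINF_greatest[OF False])
      fix y assume "y \<in> K"
      then have "norm y \<le> R" using R by auto
      then show "1 \<le> dist x y" using that norm_triangle_ineq2[of x y] by (simp add: dist_norm)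
    qed
    then have "1 \<le> real (Suc n) * infdist x K" using mult_mono[of 1 "real (Suc n)" 1 "infdist x K"] by simp
    then show ?thesis by (simp add: G_def)
  qed
  \<comment> \<open>The index starts at \<open>Suc n\<close>: \<open>G 0\<close> is the constant 1
    and has unbounded support.\<close>
  have Cc: "Cc (G (Suc n))" for n using Gc far unfolding Cc_def by blast
  have le1: "cmod (G n x) \<le> 1" for n x
    by (simp add: G_def infdist_nonneg)
  have lim: "(\<lambda>n. G (Suc n) x) \<longlonglongrightarrow> indicator K x" for x
  proof (cases "x \<in> K")
    case True
    then show ?thesis by (simp add: G_def)
  next
    case False
    have closed: "closed K" using assms by (rule compact_imp_closed)
    have "infdist x K > 0" using False \<open>K \<noteq> {}\<close> closed infdist_nonneg[of x K] in_closed_iff_infdist_zero[of K x] by (metis less_eq_real_def)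
    then obtain N where N: "1 < real N * infdist x K" using reals_Archimedean3 by blast
    have "G (Suc n) x = 0" if "n \<ge> N" for n
    proof -
      have "real N * infdist x K \<le> real (Suc n) * infdist x K"
        using that by (intro mult_right_mono) (auto simp: infdist_nonneg)
      then show ?thesis using N by (simp add: G_def)
    qed
    then have "\<forall>\<^sub>F n in sequentially. G (Suc n) x = 0" unfolding eventually_sequentially by blast
    then show ?thesis using False tendsto_eventually by (auto simp: indicator_def)
  qed
  have w: "integrable lborel (\<lambda>x::'a. (indicator (cball 0 (R + 1)) x :: real)\<^sup>2)"
    by (rule integrable_bounded_support[where B = 1 and R = "R + 1"]) (auto simp: indicator_def)
  have le: "cmod (G (Suc n) x) \<le> indicator (cball 0 (R + 1)) x" for n x
    using le1[of "Suc n" x] far[of x n] by (auto simp: indicator_def)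
  show ?thesis
  proof (rule Cc_approx_limit[of "\<lambda>n. G (Suc n)"])
    show "Cc_approx (G (Suc n))" for n by (rule Cc_imp_approx[OF Cc])
    show "sq_int (indicator K)" "(\<lambda>n. L2norm2 (\<lambda>x. G (Suc n) x - indicator K x)) \<longlonglongrightarrow> 0"
      by (rule L2_dominated[of "\<lambda>n. G (Suc n)", OF Cc_measurable[OF Cc] lim w le])+
  qed
qed

lemma L2norm2_indicator_diff:
  assumes "A \<in> sets lborel" "B \<in> sets lborel" "B \<subseteq> A"
  shows "L2norm2 (\<lambda>x. indicator A x - indicator B x) = measure lborel (A - B)"
proof -
  have "(\<lambda>x. (cmod (indicator A x - indicator B x))\<^sup>2) = (indicator (A - B) :: _ \<Rightarrow> real)"
    using assms(3) by (auto simp: fun_eq_iff indicator_def)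
  then show ?thesis using assms by (simp add: L2norm2_def)
qed

lemma sq_int_indicator:
  assumes "A \<in> sets lborel" "emeasure lborel A < \<infinity>" shows "sq_int (indicator A)"
proof -
  have "(\<lambda>x. (cmod (indicator A x))\<^sup>2) = (indicator A :: _ \<Rightarrow> real)"
    by (auto simp: fun_eq_iff indicator_def)
  then show ?thesis using assms by (simp add: sq_int_def integrable_real_indicator)
qed

text \<open>Inner regularity replaces A by a closed subset, and intersecting with growing balls
  replaces that by compact sets.\<close>

lemma Cc_approx_indicator:
  fixes A :: "'a::euclidean_space set"
  assumes A: "A \<in> sets lborel" "emeasure lborel A < \<infinity>"
  shows "Cc_approx (indicator A)"
proof (rule Cc_approx_closed[OF sq_int_indicator[OF A]])
  fix \<epsilon> :: real assume eps: "\<epsilon> > 0"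
  have "A \<in> sets lebesgue" using A(1) by simp
  then obtain T where T: "closed T" "T \<subseteq> A" and lt: "emeasure lebesgue (A - T) < ennreal \<epsilon>"
    using eps by (rule sets_lebesgue_inner_closed)
  have [measurable]: "T \<in> sets borel" using T by auto
  have finT: "emeasure lborel T < \<infinity>" using emeasure_mono[OF T(2), of lborel] A by (auto intro: le_less_trans)
  have "Cc_approx (indicator T)"
  proof (rule Cc_approx_limit)
    show "Cc_approx (indicator (T \<inter> cball 0 (real n)))" for n
      using T by (intro Cc_approx_indicator_compact) (auto simp: closed_Int_compact)
    have w: "integrable lborel (\<lambda>x. (indicator T x :: real)\<^sup>2)"
    proof -
      have "(\<lambda>x. (indicator T x :: real)\<^sup>2) = indicator T" by (auto simp: fun_eq_iff indicator_def)
      then show ?thesis using finT by (simp add: integrable_real_indicator)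
    qed
    have lim: "(\<lambda>n. indicator (T \<inter> cball 0 (real n)) x :: complex) \<longlonglongrightarrow> indicator T x" for x
    proof (rule tendsto_eventually)
      obtain N where N: "norm x \<le> real N" using real_arch_simple by blast
      then show "\<forall>\<^sub>F n in sequentially. indicator (T \<inter> cball 0 (real n)) x = (indicator T x :: complex)"
        unfolding eventually_sequentially by (intro exI[of _ N]) (auto simp: indicator_def)
    qed
    show "sq_int (indicator T)" using finT by (intro sq_int_indicator) auto
    show "(\<lambda>n. L2norm2 (\<lambda>x. indicator (T \<inter> cball 0 (real n)) x - indicator T x)) \<longlonglongrightarrow> 0"
      by (rule L2_dominated(3)[OF _ lim w]) (auto simp: indicator_def)
  qed
  moreover have "L2norm2 (\<lambda>x. indicator A x - indicator T x) < \<epsilon>"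
  proof -
    have "emeasure lborel (A - T) < ennreal \<epsilon>" using lt A by (simp add: emeasure_completion)
    then have "measure lborel (A - T) < \<epsilon>"
      by (metis eps enn2real_less_iff ennreal_less_top measure_def order_less_trans)
    then show ?thesis using A T by (simp add: L2norm2_indicator_diff)
  qed
  ultimately show "\<exists>h. Cc_approx h \<and> L2norm2 (\<lambda>x. indicator A x - h x) < \<epsilon>" by blast
qed

theorem sq_int_Cc_approx:
  fixes f :: "'a::euclidean_space \<Rightarrow> complex"
  assumes f: "sq_int f" shows "Cc_approx f"
proof -
  have [measurable]: "f \<in> borel_measurable lborel" using f by (simp add: sq_int_def)
  obtain S where S: "\<And>i. simple_function lborel (S i)" "\<And>x. (\<lambda>i. S i x) \<longlonglongrightarrow> f x"
    "\<And>i x. cmod (S i x) \<le> 2 * cmod (f x)"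
    using borel_measurable_implies_sequence_metric[of f lborel 0] by auto
  have Sm: "S i \<in> borel_measurable borel" for i using borel_measurable_simple_function[OF S(1)[of i]] by simp
  have w: "integrable lborel (\<lambda>x. (2 * cmod (f x))\<^sup>2)" using f by (simp add: sq_int_def power_mult_distrib)
  note dom = L2_dominated[of S, OF Sm S(2) w S(3)]
  show ?thesis
  proof (rule Cc_approx_limit[OF _ f dom(3)])
    fix i
    have fin: "finite (range (S i))" using S(1)[of i] by (simp add: simple_function_def)
    \<comment> \<open>The value 0 is left out because its level set may have infinite measure; every
      other level set has finite measure by square integrability.\<close>
    have part: "Cc_approx (\<lambda>x. \<Sum>y\<in>Y. y * indicator (S i -` {y}) x)" if "finite Y" "0 \<notin> Y" for Y
      using that
    proof (induction Y rule: finite_induct)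
      case empty
      have "Cc (\<lambda>x::'a. 0)" by (auto simp: Cc_def)
      then show ?case using Cc_imp_approx by simp
    next
      case (insert y Y)
      have sets: "S i -` {y} \<in> sets lborel"
        using measurable_sets[OF Sm[of i], of "{y}"] by simp
      have "emeasure lborel (S i -` {y}) < \<infinity>"
      proof -
        have "(cmod y)\<^sup>2 * indicator (S i -` {y}) x \<le> (cmod (S i x))\<^sup>2" for x by (auto simp: indicator_def)
        then have "integrable lborel (\<lambda>x. (cmod y)\<^sup>2 * indicator (S i -` {y}) x)"
          using sets by (intro Bochner_Integration.integrable_bound[OF sq_int_integrable[OF dom(1)[of i]]])
            (auto simp: abs_mult)
        then have "integrable lborel (\<lambda>x. inverse ((cmod y)\<^sup>2) * ((cmod y)\<^sup>2 * indicator (S i -` {y}) x))"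
          by (rule integrable_mult_right)
        moreover have "(\<lambda>x. inverse ((cmod y)\<^sup>2) * ((cmod y)\<^sup>2 * indicator (S i -` {y}) x)) = (indicator (S i -` {y}) :: 'a \<Rightarrow> real)"
          using insert by (auto simp: fun_eq_iff)
        ultimately have "integrable lborel (indicator (S i -` {y}) :: 'a \<Rightarrow> real)" by simp
        then show ?thesis using sets by (simp add: integrable_indicator_iff)
      qed
      then have "Cc_approx (\<lambda>x. (\<Sum>y\<in>Y. y * indicator (S i -` {y}) x) + y * indicator (S i -` {y}) x)"
        using insert sets by (intro Cc_approx_add_scale Cc_approx_indicator) auto
      moreover have "(\<Sum>z\<in>insert y Y. z * indicator (S i -` {z}) x) =
          (\<Sum>y\<in>Y. y * indicator (S i -` {y}) x) + y * indicator (S i -` {y}) x" for x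
        by (subst sum.insert) (use insert in \<open>auto simp only: add.commute\<close>)
      ultimately show ?case by presburger
    qed
    have "S i x = (\<Sum>y\<in>range (S i) - {0}. y * indicator (S i -` {y}) x)" for x
    proof -
      have "(\<Sum>y\<in>range (S i) - {0}. y * indicator (S i -` {y}) x) = (\<Sum>y\<in>range (S i) - {0}. if y = S i x then y else 0)"
        by (intro sum.cong) (auto simp: indicator_def)
      also have "\<dots> = S i x" using fin by simp
      finally show ?thesis by simp
    qed
    then have "S i = (\<lambda>x. \<Sum>y\<in>range (S i) - {0}. y * indicator (S i -` {y}) x)" by blast
    then show "Cc_approx (S i)" using part[of "range (S i) - {0}"] fin by simp
  qed
qed

section \<open>Smooth functions and test functions\<close>

declare dderiv.simps(2) [simp del]

lemma dderiv_append: "dderiv (us @ vs) f = dderiv us (dderiv vs f)"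
  by (induction us) (auto simp: dderiv.simps(2))

text \<open>Smoothness quantifies over all lists of directions. A class of differentiable functions
  that is stable under directional derivatives settles all lists at once, without formulas for
  iterated derivatives.\<close>

lemma smooth_coinduct:
  assumes "f \<in> S" and step: "\<And>f x. f \<in> S \<Longrightarrow> f differentiable (at x)" "\<And>f v. f \<in> S \<Longrightarrow> dderiv [v] f \<in> S"
  shows "smooth_fun f"
proof -
  have "dderiv vs f \<in> S" for vs
    by (induction vs) (use assms(1) step(2) in \<open>auto simp: dderiv.simps(2)\<close>)
  then show ?thesis unfolding smooth_fun_def using step(1) by blast
qed

lemma smooth_dderiv: "smooth_fun f \<Longrightarrow> smooth_fun (dderiv [v] f)"
  unfolding smooth_fun_def by (metis dderiv_append)

lemma smooth_has_derivative:
  assumes "smooth_fun f"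
  shows "(f has_derivative (\<lambda>v. dderiv [v] f x)) (at x)"
proof -
  have "f differentiable (at x)" using assms[unfolded smooth_fun_def, rule_format, of "[]" x] by simp
  then show ?thesis by (simp add: frechet_derivative_works[symmetric] dderiv.simps(2))
qed

lemma dderiv_eqI: "(\<And>x. (f has_derivative D x) (at x)) \<Longrightarrow> dderiv [v] f = (\<lambda>x. D x v)"
proof (rule ext)
  fix x assume "\<And>x. (f has_derivative D x) (at x)"
  then show "dderiv [v] f x = D x v" using frechet_derivative_at[of f "D x" x] by (simp add: dderiv.simps(2))
qed

lemma smooth_continuous: "smooth_fun f \<Longrightarrow> continuous_on UNIV f"
  by (rule has_derivative_continuous_on[of _ _ "\<lambda>x v. dderiv [v] f x"])
     (rule has_derivative_at_withinI, rule smooth_has_derivative)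

lemma smooth_const: "smooth_fun (\<lambda>_. c)"
proof (rule smooth_coinduct[of _ "range (\<lambda>c _. c)"])
  show "dderiv [v] f \<in> range (\<lambda>c _. c)" if "f \<in> range (\<lambda>c _. c)" for f :: "'a \<Rightarrow> complex" and v
    using that dderiv_eqI[of f "\<lambda>_ _. 0" v] by auto
qed auto

text \<open>Products alone are not stable under differentiation; by the Leibniz rule their finite
  sums are.\<close>

inductive_set prod_alg :: "('a::euclidean_space \<Rightarrow> complex) set" where
  mult: "smooth_fun f \<Longrightarrow> smooth_fun g \<Longrightarrow> (\<lambda>x. f x * g x) \<in> prod_alg"
| add: "f \<in> prod_alg \<Longrightarrow> g \<in> prod_alg \<Longrightarrow> (\<lambda>x. f x + g x) \<in> prod_alg"

lemma dderiv_mult: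
  assumes "smooth_fun f" "smooth_fun g"
  shows "dderiv [v] (\<lambda>x. f x * g x) = (\<lambda>x. f x * dderiv [v] g x + dderiv [v] f x * g x)"
  by (rule dderiv_eqI) (intro has_derivative_mult smooth_has_derivative assms)

lemma prod_alg_derivative:
  assumes "f \<in> prod_alg"
  shows "\<exists>D. (\<forall>x. (f has_derivative (\<lambda>v. D v x)) (at x)) \<and> (\<forall>v. D v \<in> prod_alg)"
  using assms
proof induction
  case (mult f g)
  show ?case
  proof (intro exI conjI allI)
    show "((\<lambda>x. f x * g x) has_derivative (\<lambda>v. (\<lambda>v x. f x * dderiv [v] g x + dderiv [v] f x * g x) v x)) (at x)" for x
      using has_derivative_mult[OF mult[THEN smooth_has_derivative], of x] by simp
    show "(\<lambda>x. f x * dderiv [v] g x + dderiv [v] f x * g x) \<in> prod_alg" for v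
      using mult smooth_dderiv by (intro prod_alg.intros) auto
  qed
next
  case (add f g)
  then obtain D E where D: "\<forall>x. (f has_derivative (\<lambda>v. D v x)) (at x)" "\<forall>v. D v \<in> prod_alg"
    "\<forall>x. (g has_derivative (\<lambda>v. E v x)) (at x)" "\<forall>v. E v \<in> prod_alg" by blast
  then show ?case
    by (intro exI[of _ "\<lambda>v x. D v x + E v x"]) (auto intro: has_derivative_add prod_alg.add)
qed

lemma prod_alg_smooth: "f \<in> prod_alg \<Longrightarrow> smooth_fun f"
proof (erule smooth_coinduct)
  show "f differentiable (at x)" if "f \<in> prod_alg" for f :: "'a \<Rightarrow> complex" and x
    using prod_alg_derivative[OF that] differentiable_def by blast
  show "dderiv [v] f \<in> prod_alg" if f: "f \<in> prod_alg" for f :: "'a \<Rightarrow> complex" and v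
  proof -
    obtain D where "\<And>x. (f has_derivative (\<lambda>v. D v x)) (at x)" "\<And>v. D v \<in> prod_alg"
      using prod_alg_derivative[OF f] by blast
    then show ?thesis using dderiv_eqI[of f "\<lambda>x v. D v x" v] by simp
  qed
qed

lemma smooth_mult: "smooth_fun f \<Longrightarrow> smooth_fun g \<Longrightarrow> smooth_fun (\<lambda>x. f x * g x)"
  by (rule prod_alg_smooth[OF prod_alg.mult])

lemma smooth_add:
  assumes "smooth_fun f" "smooth_fun g" shows "smooth_fun (\<lambda>x. f x + g x)"
proof -
  have "(\<lambda>x. 1 * f x + 1 * g x) \<in> prod_alg"
    by (intro prod_alg.intros assms smooth_const)
  then show ?thesis using prod_alg_smooth by force
qed

lemma smooth_add_scale: "smooth_fun f \<Longrightarrow> smooth_fun g \<Longrightarrow> smooth_fun (\<lambda>x. f x + c * g x)"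
  by (intro smooth_add smooth_mult smooth_const)

lemma dderiv_add_scale:
  assumes "smooth_fun f" "smooth_fun g"
  shows "dderiv [v] (\<lambda>x. f x + c * g x) = (\<lambda>x. dderiv [v] f x + c * dderiv [v] g x)"
  by (rule dderiv_eqI) (intro has_derivative_add has_derivative_mult_right smooth_has_derivative assms)

lemma smooth_affine:
  fixes f :: "'a::euclidean_space \<Rightarrow> complex" and L :: "'b::euclidean_space \<Rightarrow> 'a"
  assumes f: "smooth_fun f" and L: "bounded_linear L"
  shows "smooth_fun (\<lambda>y. f (c + L y))" "dderiv [v] (\<lambda>y. f (c + L y)) = (\<lambda>y. dderiv [L v] f (c + L y))"
proof -
  have der: "((\<lambda>y. g (c + L y)) has_derivative (\<lambda>v. dderiv [L v] g (c + L y))) (at y)"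
    if "smooth_fun g" for g :: "'a \<Rightarrow> complex" and y
  proof -
    have "((\<lambda>y. c + L y) has_derivative L) (at y)"
      by (auto intro!: derivative_eq_intros bounded_linear_imp_has_derivative L)
    then show ?thesis
      using diff_chain_at[OF _ smooth_has_derivative[OF that], of "\<lambda>y. c + L y" L y] by (simp add: o_def)
  qed
  have eq: "dderiv [v] (\<lambda>y. g (c + L y)) = (\<lambda>y. dderiv [L v] g (c + L y))"
    if "smooth_fun g" for g :: "'a \<Rightarrow> complex" and v
    by (rule dderiv_eqI) (rule der[OF that])
  then show "dderiv [v] (\<lambda>y. f (c + L y)) = (\<lambda>y. dderiv [L v] f (c + L y))" using f by blast
  show "smooth_fun (\<lambda>y. f (c + L y))"
  proof (rule smooth_coinduct[of _ "{\<lambda>y. g (c + L y) | g. smooth_fun g}"])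
    show "(\<lambda>y. f (c + L y)) \<in> {\<lambda>y. g (c + L y) | g. smooth_fun g}" using f by blast
    show "h differentiable (at x)" if "h \<in> {\<lambda>y. g (c + L y) | g. smooth_fun g}" for h x
      using that der differentiable_def by blast
    show "dderiv [v] h \<in> {\<lambda>y. g (c + L y) | g. smooth_fun g}" if "h \<in> {\<lambda>y. g (c + L y) | g. smooth_fun g}" for h v
      using that eq smooth_dderiv by blast
  qed
qed

lemma test_fun_iff: "test_fun f \<longleftrightarrow> smooth_fun f \<and> (\<exists>R. \<forall>x. norm x > R \<longrightarrow> f x = 0)"
proof -
  have "compact (closure {x. f x \<noteq> 0}) \<longleftrightarrow> bounded {x. f x \<noteq> 0}"
    by (auto simp: compact_eq_bounded_closed bounded_closure_image intro: bounded_closure bounded_subset[OF _ closure_subset])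
  also have "\<dots> \<longleftrightarrow> (\<exists>R. \<forall>x. norm x > R \<longrightarrow> f x = 0)"
    unfolding bounded_iff by (metis (mono_tags, lifting) mem_Collect_eq not_le)
  finally show ?thesis by (simp add: test_fun_def)
qed

lemma test_smooth: "test_fun f \<Longrightarrow> smooth_fun f"
  by (simp add: test_fun_iff)

lemma test_Cc: "test_fun f \<Longrightarrow> Cc f"
  by (auto simp: test_fun_iff Cc_def smooth_continuous)

lemmas test_sq_int = Cc_sq_int[OF test_Cc]

lemma test_dderiv:
  assumes "test_fun f" shows "test_fun (dderiv [v] f)"
proof -
  obtain R where R: "\<And>x. norm x > R \<Longrightarrow> f x = 0" and sm: "smooth_fun f" using assms by (auto simp: test_fun_iff)
  have "dderiv [v] f x = 0" if x: "norm x > R" for x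
  proof -
    have "open {x::'a. R < norm x}" by (intro open_Collect_less continuous_intros)
    then have "(f has_derivative (\<lambda>_. 0)) (at x)"
      using x R by (intro has_derivative_transform_within_open[OF has_derivative_const[of 0]]) auto
    then have "(\<lambda>v. dderiv [v] f x) = (\<lambda>_. 0)" by (rule has_derivative_unique[OF smooth_has_derivative[OF sm]])
    then show ?thesis by (rule fun_cong)
  qed
  then show ?thesis using sm smooth_dderiv by (auto simp: test_fun_iff)
qed

lemma test_mult: "smooth_fun f \<Longrightarrow> test_fun g \<Longrightarrow> test_fun (\<lambda>x. f x * g x)"
  by (auto simp: test_fun_iff smooth_mult)

lemma test_add_scale:
  assumes "test_fun f" "test_fun g" shows "test_fun (\<lambda>x. f x + c * g x)"
proof -
  obtain R S where "\<And>x. norm x > R \<Longrightarrow> f x = 0" "\<And>x. norm x > S \<Longrightarrow> g x = 0"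
    using assms by (metis test_fun_iff)
  then show ?thesis using assms unfolding test_fun_iff
    by (auto intro!: smooth_add_scale exI[of _ "max R S"])
qed

lemma test_zero: "test_fun (\<lambda>_. 0)"
  by (auto simp: test_fun_iff smooth_const)

lemma test_tensor:
  fixes f g :: "real \<Rightarrow> complex"
  assumes "test_fun f" "test_fun g"
  shows "test_fun (\<lambda>p. f (fst p) * g (snd p))"
    "dderiv [(1, 0)] (\<lambda>p. f (fst p) * g (snd p)) = (\<lambda>p. dderiv [1] f (fst p) * g (snd p))"
    "dderiv [(0, 1)] (\<lambda>p. f (fst p) * g (snd p)) = (\<lambda>p. f (fst p) * dderiv [1] g (snd p))"
proof -
  have sf: "smooth_fun (\<lambda>p::real\<times>real. f (fst p))" and sg: "smooth_fun (\<lambda>p::real\<times>real. g (snd p))"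
    using smooth_affine(1)[of f fst 0] smooth_affine(1)[of g snd 0] assms test_smooth
    by (auto simp: bounded_linear_fst bounded_linear_snd)
  have d: "dderiv [v] (\<lambda>p::real\<times>real. f (fst p)) = (\<lambda>p. dderiv [fst v] f (fst p))"
    "dderiv [v] (\<lambda>p::real\<times>real. g (snd p)) = (\<lambda>p. dderiv [snd v] g (snd p))" for v
    using smooth_affine(2)[where L = fst and f = f and c = 0 and v = v]
      smooth_affine(2)[where L = snd and f = g and c = 0 and v = v]
      test_smooth[OF assms(1)] test_smooth[OF assms(2)]
    by (simp_all add: bounded_linear_fst bounded_linear_snd)
  have z: "dderiv [0] f = (\<lambda>_. 0)" "dderiv [0] g = (\<lambda>_. 0)"
    using linear_0[OF has_derivative_linear[OF smooth_has_derivative[OF test_smooth[OF assms(1)]]]]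
      linear_0[OF has_derivative_linear[OF smooth_has_derivative[OF test_smooth[OF assms(2)]]]]
    by auto
  show "dderiv [(1, 0)] (\<lambda>p. f (fst p) * g (snd p)) = (\<lambda>p. dderiv [1] f (fst p) * g (snd p))"
    "dderiv [(0, 1)] (\<lambda>p. f (fst p) * g (snd p)) = (\<lambda>p. f (fst p) * dderiv [1] g (snd p))"
    unfolding dderiv_mult[OF sf sg] d by (simp_all add: z)
  obtain R S where RS: "\<And>x. norm x > R \<Longrightarrow> f x = 0" "\<And>x. norm x > S \<Longrightarrow> g x = 0"
    using assms by (metis test_fun_iff)
  have "f (fst p) * g (snd p) = 0" if "norm p > \<bar>R\<bar> + \<bar>S\<bar>" for p
  proof -
    have "norm p \<le> norm (fst p) + norm (snd p)"
      using norm_Pair_le[of "fst p" "snd p"] by simp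
    then have "norm (fst p) > R \<or> norm (snd p) > S" using that by linarith
    then show ?thesis using RS by auto
  qed
  then show "test_fun (\<lambda>p. f (fst p) * g (snd p))"
    unfolding test_fun_iff using smooth_mult[OF sf sg] by blast
qed

subsection \<open>Bump functions\<close>

text \<open>The classical function exp (- 1 / t), with a polynomial in 1 / t as prefactor so that
  the family is closed under differentiation.\<close>

definition flat :: "real poly \<Rightarrow> real \<Rightarrow> real" where
  "flat p t = (if t > 0 then poly p (1 / t) * exp (- (1 / t)) else 0)"

lemma poly_exp_tendsto: "((\<lambda>s. poly p s * exp (- s)) \<longlongrightarrow> (0::real)) at_top"
proof -
  have "((\<lambda>s. \<Sum>i\<le>degree p. coeff p i * (s ^ i / exp s)) \<longlongrightarrow> (\<Sum>i\<le>degree p. coeff p i * 0)) at_top"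
    by (intro tendsto_sum tendsto_mult tendsto_const tendsto_power_div_exp_0)
  moreover have "(\<Sum>i\<le>degree p. coeff p i * (s ^ i / exp s)) = poly p s * exp (- s)" for s
    by (simp add: poly_altdef sum_distrib_right exp_minus divide_inverse mult.assoc)
  ultimately show ?thesis by simp
qed

text \<open>In the variable s = 1 / t the chain rule gives the new prefactor s^2 (p - p'). At t = 0
  the exponential decay beats every polynomial.\<close>

lemma flat_DERIV: "(flat p has_field_derivative flat ([:0, 0, 1:] * (p - pderiv p)) t) (at t)"
proof (cases t "0::real" rule: linorder_cases)
  case greater
  have "((\<lambda>t. poly p (1 / t) * exp (- (1 / t))) has_field_derivative
      flat ([:0, 0, 1:] * (p - pderiv p)) t) (at t)"
    using greater
    by (auto intro!: derivative_eq_intros poly_DERIV[THEN DERIV_chain2]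
        simp: flat_def field_simps power2_eq_square)
  then show ?thesis
    by (rule has_field_derivative_transform_within_open[of _ _ _ "{0<..}"]) (use greater in \<open>auto simp: flat_def\<close>)
next
  case less
  have "((\<lambda>t. 0) has_field_derivative flat ([:0, 0, 1:] * (p - pderiv p)) t) (at t)"
    using less by (simp add: flat_def)
  then show ?thesis
    by (rule has_field_derivative_transform_within_open[of _ _ _ "{..<0}"]) (use less in \<open>auto simp: flat_def\<close>)
next
  case equal
  have "((\<lambda>h. flat p h / h) \<longlongrightarrow> 0) (at 0)"
  proof (rule filterlim_split_at)
    show "((\<lambda>h. flat p h / h) \<longlongrightarrow> 0) (at_left 0)"
      by (rule tendsto_eventually) (auto simp: eventually_at_left_field flat_def intro!: exI[of _ "-1"])
    \<comment> \<open>The difference quotient at h = 1 / s is s p(s) exp (- s), and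
      \<open>pCons 0 p\<close> is the polynomial s p(s).\<close>
    have "((\<lambda>s. poly (pCons 0 p) s * exp (- s)) \<longlongrightarrow> 0) at_top" by (rule poly_exp_tendsto)
    then have "((\<lambda>s. flat p (inverse s) / inverse s) \<longlongrightarrow> 0) at_top"
    proof (rule Lim_transform_eventually)
      show "\<forall>\<^sub>F s in at_top. poly (pCons 0 p) s * exp (- s) = flat p (inverse s) / inverse s"
        using eventually_gt_at_top[of 0] by eventually_elim (simp add: flat_def inverse_eq_divide)
    qed
    then show "((\<lambda>h. flat p h / h) \<longlongrightarrow> 0) (at_right 0)" by (simp add: filterlim_at_right_to_top)
  qed
  then show ?thesis using equal by (simp add: DERIV_def flat_def)
qed

text \<open>The derivative of r - |x - c|^2 is affine in x, so adding the affine functions and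
  closing under sums and products gives a class stable under differentiation.\<close>

inductive_set bump_alg :: "real \<Rightarrow> 'a::euclidean_space \<Rightarrow> ('a \<Rightarrow> complex) set" for r c where
  bump: "(\<lambda>x. of_real (flat p (r - (x - c) \<bullet> (x - c)))) \<in> bump_alg r c"
| lin: "(\<lambda>x. of_real (u + x \<bullet> v)) \<in> bump_alg r c"
| add: "f \<in> bump_alg r c \<Longrightarrow> g \<in> bump_alg r c \<Longrightarrow> (\<lambda>x. f x + g x) \<in> bump_alg r c"
| mult: "f \<in> bump_alg r c \<Longrightarrow> g \<in> bump_alg r c \<Longrightarrow> (\<lambda>x. f x * g x) \<in> bump_alg r c"

lemma bump_alg_derivative:
  assumes "f \<in> bump_alg r c"
  shows "\<exists>D. (\<forall>x. (f has_derivative (\<lambda>v. D v x)) (at x)) \<and> (\<forall>v. D v \<in> bump_alg r c)"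
  using assms
proof induction
  case (bump p)
  define q where "q = [:0, 0, 1:] * (p - pderiv p)"
  define D where "D v x = complex_of_real (flat q (r - (x - c) \<bullet> (x - c))) * complex_of_real (2 * (c \<bullet> v) + x \<bullet> (- 2 *\<^sub>R v))" for v x
  have "((\<lambda>x. complex_of_real (flat p (r - (x - c) \<bullet> (x - c)))) has_derivative (\<lambda>v. D v x)) (at x)" for x
  proof -
    have "((\<lambda>x. r - (x - c) \<bullet> (x - c)) has_derivative (\<lambda>v. - (2 * ((x - c) \<bullet> v)))) (at x)"
      by (auto intro!: derivative_eq_intros simp: inner_commute)
    from DERIV_compose_FDERIV[OF flat_DERIV this, of p]
    have "((\<lambda>x. flat p (r - (x - c) \<bullet> (x - c))) has_derivative
        (\<lambda>v. - (2 * ((x - c) \<bullet> v)) * flat q (r - (x - c) \<bullet> (x - c)))) (at x)"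
      by (simp add: q_def)
    from has_derivative_of_real[OF this]
    have "((\<lambda>x. complex_of_real (flat p (r - (x - c) \<bullet> (x - c)))) has_derivative
        (\<lambda>v. complex_of_real (- (2 * ((x - c) \<bullet> v)) * flat q (r - (x - c) \<bullet> (x - c))))) (at x)" .
    moreover have "complex_of_real (- (2 * ((x - c) \<bullet> v)) * flat q (r - (x - c) \<bullet> (x - c))) = D v x" for v
      unfolding D_def of_real_mult[symmetric] by (simp add: inner_diff_left algebra_simps)
    ultimately show ?thesis by simp
  qed
  moreover have "D v \<in> bump_alg r c" for v
    unfolding D_def by (intro bump_alg.intros)
  ultimately show ?case by blast
next
  case (lin u v)
  have "((\<lambda>x. complex_of_real (u + x \<bullet> v)) has_derivative (\<lambda>w. of_real (w \<bullet> v))) (at x)" for x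
    by (intro has_derivative_of_real) (auto intro!: derivative_eq_intros)
  moreover have "(\<lambda>x. complex_of_real (w \<bullet> v)) \<in> bump_alg r c" for w
    using bump_alg.lin[of "w \<bullet> v" 0 r c] by simp
  ultimately show ?case by (intro exI[of _ "\<lambda>w _. of_real (w \<bullet> v)"]) auto
next
  case (add f g)
  then obtain D E where D: "\<forall>x. (f has_derivative (\<lambda>v. D v x)) (at x)" "\<forall>v. D v \<in> bump_alg r c"
    "\<forall>x. (g has_derivative (\<lambda>v. E v x)) (at x)" "\<forall>v. E v \<in> bump_alg r c" by blast
  then show ?case
    by (intro exI[of _ "\<lambda>v x. D v x + E v x"]) (auto intro: has_derivative_add bump_alg.add)
next
  case (mult f g)
  then obtain D E where D: "\<forall>x. (f has_derivative (\<lambda>v. D v x)) (at x)" "\<forall>v. D v \<in> bump_alg r c"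
    "\<forall>x. (g has_derivative (\<lambda>v. E v x)) (at x)" "\<forall>v. E v \<in> bump_alg r c" by blast
  then show ?case using mult(1,2)
    by (intro exI[of _ "\<lambda>v x. f x * E v x + D v x * g x"] conjI allI has_derivative_mult
        bump_alg.add bump_alg.mult) auto
qed

lemma bump_alg_smooth:
  fixes f :: "'a::euclidean_space \<Rightarrow> complex"
  assumes "f \<in> bump_alg r c" shows "smooth_fun f"
  using assms
proof (rule smooth_coinduct)
  show "f differentiable (at x)" if "f \<in> bump_alg r c" for f :: "'a \<Rightarrow> complex" and x
    using bump_alg_derivative[OF that] differentiable_def by blast
  show "dderiv [v] f \<in> bump_alg r c" if f: "f \<in> bump_alg r c" for f :: "'a \<Rightarrow> complex" and v
  proof -
    obtain D where "\<And>x. (f has_derivative (\<lambda>v. D v x)) (at x)" "\<And>v. D v \<in> bump_alg r c"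
      using bump_alg_derivative[OF f] by blast
    then show ?thesis using dderiv_eqI[of f "\<lambda>x v. D v x" v] by simp
  qed
qed

definition bump :: "real \<Rightarrow> 'a::euclidean_space \<Rightarrow> real" where
  "bump r x = flat 1 (r\<^sup>2 - x \<bullet> x)"

lemma bump_nonneg: "0 \<le> bump r x"
  by (simp add: bump_def flat_def)

lemma bump_pos: "norm x < r \<Longrightarrow> 0 < bump r x"
  by (simp add: bump_def flat_def power2_norm_eq_inner[symmetric] power_strict_mono)

lemma bump_zero: "r > 0 \<Longrightarrow> norm x \<ge> r \<Longrightarrow> bump r x = 0"
  by (simp add: bump_def flat_def power2_norm_eq_inner[symmetric] power_mono not_less)

lemma bump_even: "bump r (- x) = bump r x"
  by (simp add: bump_def)

lemma bump_test:
  assumes "r > 0" shows "test_fun (\<lambda>x::'a::euclidean_space. complex_of_real (bump r x))"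
proof -
  have "smooth_fun (\<lambda>x::'a. complex_of_real (bump r x))"
    using bump_alg_smooth[OF bump_alg.bump[of 1 "r\<^sup>2" 0]] by (simp add: bump_def)
  then show ?thesis unfolding test_fun_iff 
    by (intro conjI exI[of _ r] allI impI) (simp_all add: bump_zero assms less_imp_le)
qed

section \<open>Mollification\<close>

lemma Cc_uniformly_continuous:
  assumes "Cc g" "\<epsilon> > 0"
  shows "\<exists>d>0. \<forall>x y. norm (x - y) < d \<longrightarrow> cmod (g x - g y) < \<epsilon>"
proof -
  obtain R where R: "\<And>x. norm x > R \<Longrightarrow> g x = 0" and c: "continuous_on UNIV g" using assms by (auto simp: Cc_def)
  have "uniformly_continuous_on (cball 0 (R + 1)) g"
    by (intro compact_uniformly_continuous continuous_on_subset[OF c]) auto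
  then obtain d where d: "d > 0" "\<And>x y. x \<in> cball 0 (R + 1) \<Longrightarrow> y \<in> cball 0 (R + 1) \<Longrightarrow> dist y x < d \<Longrightarrow> dist (g y) (g x) < \<epsilon>"
    unfolding uniformly_continuous_on_def using \<open>\<epsilon> > 0\<close> by metis
  have "cmod (g x - g y) < \<epsilon>" if "norm (x - y) < min d 1" for x y
  proof (cases "norm x \<le> R + 1 \<and> norm y \<le> R + 1")
    case True
    then show ?thesis using d(2)[of y x] that by (simp add: dist_norm)
  next
    case False
    have "norm x \<le> norm y + norm (x - y)" "norm y \<le> norm x + norm (x - y)"
      using norm_triangle_ineq2[of x y] norm_triangle_ineq3[of x y] by linarith+
    then have "norm x > R \<and> norm y > R" using False that by linarith
    then show ?thesis using R \<open>\<epsilon> > 0\<close> by simp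
  qed
  then show ?thesis using d(1) by (intro exI[of _ "min d 1"]) auto
qed

lemma dderiv_linear: "smooth_fun f \<Longrightarrow> linear (\<lambda>v. dderiv [v] f x)"
  by (rule has_derivative_linear[OF smooth_has_derivative])

lemma dderiv_basis_expansion:
  assumes "smooth_fun f"
  shows "dderiv [v] f x = (\<Sum>b\<in>Basis. (v \<bullet> b) *\<^sub>R dderiv [b] f x)"
proof -
  interpret linear "\<lambda>v. dderiv [v] f x" by (rule dderiv_linear[OF assms])
  have "dderiv [\<Sum>b\<in>Basis. (v \<bullet> b) *\<^sub>R b] f x = (\<Sum>b\<in>Basis. dderiv [(v \<bullet> b) *\<^sub>R b] f x)"
    by (rule sum)
  then show ?thesis by (simp add: euclidean_representation scale)
qed

lemma sum_Basis_norm_le: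
  fixes v :: "'a::euclidean_space" and c :: "'a \<Rightarrow> complex"
  assumes "\<And>b. b \<in> Basis \<Longrightarrow> cmod (c b) \<le> K"
  shows "cmod (\<Sum>b\<in>Basis. (v \<bullet> b) *\<^sub>R c b) \<le> real DIM('a) * K * norm v"
proof -
  have "cmod (\<Sum>b\<in>Basis. (v \<bullet> b) *\<^sub>R c b) \<le> (\<Sum>b\<in>(Basis::'a set). norm v * K)"
    using assms by (intro sum_norm_le) (auto intro!: mult_mono Basis_le_norm)
  then show ?thesis by (simp add: mult_ac)
qed

text \<open>The partial derivatives are uniformly continuous, so one d serves all base points. This
  uniformity allows differentiation under the convolution integral and the translation argument of
  \<open>test_integral_dderiv\<close>. Dividing \<epsilon> by the dimension pays for the sum over
  the basis.\<close>

lemma test_uniformly_differentiable: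
  fixes \<kappa> :: "'a::euclidean_space \<Rightarrow> complex"
  assumes "test_fun \<kappa>" "\<epsilon> > 0"
  shows "\<exists>d>0. \<forall>z h. norm h < d \<longrightarrow> cmod (\<kappa> (z + h) - \<kappa> z - dderiv [h] \<kappa> z) \<le> \<epsilon> * norm h"
proof -
  define \<eta> where "\<eta> = \<epsilon> / real DIM('a)"
  have \<eta>: "\<eta> > 0" "real DIM('a) * \<eta> = \<epsilon>" using assms(2) by (auto simp: \<eta>_def)
  have sm: "smooth_fun \<kappa>" using assms(1) test_smooth by blast
  have "\<forall>b. \<exists>d>0. \<forall>x y. norm (x - y) < d \<longrightarrow> cmod (dderiv [b] \<kappa> x - dderiv [b] \<kappa> y) < \<eta>"
    using Cc_uniformly_continuous[OF test_Cc[OF test_dderiv[OF assms(1)]] \<eta>(1)] by blast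
  then obtain D where D: "\<And>b. D b > 0" "\<And>b x y. norm (x - y) < D b \<Longrightarrow> cmod (dderiv [b] \<kappa> x - dderiv [b] \<kappa> y) < \<eta>"
    by metis
  define d where "d = Min (D ` (Basis :: 'a set))"
  have d: "d > 0" using D(1) by (auto simp: d_def)
  have dD: "d \<le> D b" if "b \<in> Basis" for b using that by (auto simp: d_def)
  have "cmod (\<kappa> (z + h) - \<kappa> z - dderiv [h] \<kappa> z) \<le> \<epsilon> * norm h" if h: "norm h < d" for z h
  proof -
    have "norm (\<kappa> (z + h) - \<kappa> z - (\<lambda>v. dderiv [v] \<kappa> z) (z + h - z)) \<le> norm (z + h - z) * \<epsilon>"
    proof (rule differentiable_bound_linearization[where S = "ball z d"])
      show "z + t *\<^sub>R (z + h - z) \<in> ball z d" if "t \<in> {0..1}" for t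
      proof -
        have "t * norm h \<le> 1 * norm h" using that by (intro mult_right_mono) auto
        then show ?thesis using that h by (simp add: dist_norm)
      qed
      show "(\<kappa> has_derivative (\<lambda>v. dderiv [v] \<kappa> x)) (at x within ball z d)" for x
        by (rule has_derivative_at_withinI[OF smooth_has_derivative[OF sm]])
      show "onorm ((\<lambda>v. dderiv [v] \<kappa> x) - (\<lambda>v. dderiv [v] \<kappa> z)) \<le> \<epsilon>" if x: "x \<in> ball z d" for x
      proof (rule onorm_le)
        fix v
        have "((\<lambda>v. dderiv [v] \<kappa> x) - (\<lambda>v. dderiv [v] \<kappa> z)) v =
            (\<Sum>b\<in>Basis. (v \<bullet> b) *\<^sub>R (dderiv [b] \<kappa> x - dderiv [b] \<kappa> z))"
          by (simp only: minus_apply dderiv_basis_expansion[OF sm, of v] sum_subtractf scaleR_diff_right)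
        moreover have "cmod (dderiv [b] \<kappa> x - dderiv [b] \<kappa> z) \<le> \<eta>" if "b \<in> Basis" for b
          using D(2)[of x z b] dD[OF that] x by (auto simp: dist_norm norm_minus_commute intro: less_imp_le)
        ultimately show "norm (((\<lambda>v. dderiv [v] \<kappa> x) - (\<lambda>v. dderiv [v] \<kappa> z)) v) \<le> \<epsilon> * norm v"
          using sum_Basis_norm_le[of "\<lambda>b. dderiv [b] \<kappa> x - dderiv [b] \<kappa> z" \<eta> v] \<eta> by simp
      qed
      show "z \<in> ball z d" using d by simp
    qed
    then show ?thesis by (simp add: mult.commute)
  qed
  then show ?thesis using d by blast
qed

lemma test_dderiv_bound:
  fixes \<kappa> :: "'a::euclidean_space \<Rightarrow> complex"
  assumes "test_fun \<kappa>"
  shows "\<exists>K\<ge>0. \<forall>v z. cmod (dderiv [v] \<kappa> z) \<le> K * norm v"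
proof -
  have "\<forall>b. \<exists>K. \<forall>z. cmod (dderiv [b] \<kappa> z) \<le> K"
    using Cc_bounded[OF test_Cc[OF test_dderiv[OF assms]]] by blast
  then obtain K where K: "\<And>b z. cmod (dderiv [b] \<kappa> z) \<le> K b" by metis
  define M where "M = Max (K ` (Basis :: 'a set))"
  have M: "cmod (dderiv [b] \<kappa> z) \<le> \<bar>M\<bar>" if "b \<in> Basis" for b z
  proof -
    have "K b \<le> M" using that by (simp add: M_def)
    then show ?thesis using K[of b z] by linarith
  qed
  have "cmod (dderiv [v] \<kappa> z) \<le> (real DIM('a) * \<bar>M\<bar>) * norm v" for v z
    using sum_Basis_norm_le[of "\<lambda>b. dderiv [b] \<kappa> z" "\<bar>M\<bar>" v] M dderiv_basis_expansion[OF test_smooth[OF assms], of v z]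
    by simp
  then show ?thesis by (intro exI[of _ "real DIM('a) * \<bar>M\<bar>"]) auto
qed

definition conv :: "('a::euclidean_space \<Rightarrow> complex) \<Rightarrow> ('a \<Rightarrow> complex) \<Rightarrow> 'a \<Rightarrow> complex" where
  "conv \<kappa> f x = (\<integral>y. \<kappa> (x - y) * f y \<partial>lborel)"

lemma conv_integrable:
  assumes "Cc \<kappa>" "integrable lborel f"
  shows "integrable lborel (\<lambda>y. \<kappa> (x - y) * f y)"
proof -
  obtain B where B: "\<And>x. cmod (\<kappa> x) \<le> B" using Cc_bounded[OF assms(1)] by blast
  note [measurable] = Cc_measurable[OF assms(1)] borel_measurable_integrable[OF assms(2)]
  have B0: "0 \<le> B" using B[of 0] norm_ge_zero order_trans by blast
  show ?thesis
    by (rule Bochner_Integration.integrable_bound[OF integrable_mult_right[OF assms(2), of "of_real B"]])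
       (use B B0 in \<open>auto simp: norm_mult intro!: mult_right_mono\<close>)
qed

text \<open>All differentiability comes from the kernel: its Taylor remainder is uniformly small,
  and integrating it against |f| preserves the smallness.\<close>

lemma conv_has_derivative:
  fixes \<kappa> f :: "'a::euclidean_space \<Rightarrow> complex"
  assumes \<kappa>: "test_fun \<kappa>" and f: "integrable lborel f"
  shows "(conv \<kappa> f has_derivative (\<lambda>v. conv (dderiv [v] \<kappa>) f x)) (at x)"
  unfolding has_derivative_at_alt
proof (intro conjI allI impI)
  have sm: "smooth_fun \<kappa>" using \<kappa> test_smooth by blast
  define I where "I = (\<integral>y. cmod (f y) \<partial>lborel)"
  have I0: "0 \<le> I" unfolding I_def by simp
  have int: "integrable lborel (\<lambda>y. \<kappa> (x - y) * f y)" "integrable lborel (\<lambda>y. dderiv [v] \<kappa> (x - y) * f y)" for x v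
    using conv_integrable[OF _ f] test_Cc \<kappa> test_dderiv by blast+
  obtain K where K: "K \<ge> 0" "\<And>v z. cmod (dderiv [v] \<kappa> z) \<le> K * norm v"
    using test_dderiv_bound[OF \<kappa>] by blast
  show "bounded_linear (\<lambda>v. conv (dderiv [v] \<kappa>) f x)"
  proof (rule bounded_linear_intro)
    fix u v
    show "conv (dderiv [u + v] \<kappa>) f x = conv (dderiv [u] \<kappa>) f x + conv (dderiv [v] \<kappa>) f x"
      using int by (simp add: conv_def linear_add[OF dderiv_linear[OF sm]] distrib_right)
  next
    fix r v
    show "conv (dderiv [r *\<^sub>R v] \<kappa>) f x = r *\<^sub>R conv (dderiv [v] \<kappa>) f x"
      by (simp add: conv_def linear_scale[OF dderiv_linear[OF sm]] scaleR_conv_of_real mult.assoc)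
  next
    fix v
    have "cmod (conv (dderiv [v] \<kappa>) f x) \<le> (\<integral>y. cmod (dderiv [v] \<kappa> (x - y) * f y) \<partial>lborel)"
      unfolding conv_def by (rule integral_norm_bound)
    also have "\<dots> \<le> (\<integral>y. (K * norm v) * cmod (f y) \<partial>lborel)"
      using int(2) f K by (intro integral_mono integrable_norm integrable_mult_right) (auto simp: norm_mult mult_right_mono)
    finally show "norm (conv (dderiv [v] \<kappa>) f x) \<le> norm v * (K * I)" by (simp add: I_def mult_ac)
  qed
  fix \<epsilon> :: real assume "\<epsilon> > 0"
  define \<eta> where "\<eta> = \<epsilon> / (I + 1)"
  have \<eta>: "\<eta> > 0" "\<eta> * I \<le> \<epsilon>" using \<open>\<epsilon> > 0\<close> I0 by (auto simp: \<eta>_def field_simps)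
  obtain d where d: "d > 0" "\<And>z h. norm h < d \<Longrightarrow> cmod (\<kappa> (z + h) - \<kappa> z - dderiv [h] \<kappa> z) \<le> \<eta> * norm h"
    using test_uniformly_differentiable[OF \<kappa> \<eta>(1)] by blast
  have "norm (conv \<kappa> f y - conv \<kappa> f x - conv (dderiv [y - x] \<kappa>) f x) \<le> \<epsilon> * norm (y - x)" if "norm (y - x) < d" for y
  proof -
    have eq: "conv \<kappa> f y - conv \<kappa> f x - conv (dderiv [y - x] \<kappa>) f x =
        (\<integral>z. (\<kappa> (y - z) - \<kappa> (x - z) - dderiv [y - x] \<kappa> (x - z)) * f z \<partial>lborel)"
      unfolding conv_def left_diff_distrib
      by (simp only: Bochner_Integration.integral_diff Bochner_Integration.integrable_diff int)
    have "cmod (\<integral>z. (\<kappa> (y - z) - \<kappa> (x - z) - dderiv [y - x] \<kappa> (x - z)) * f z \<partial>lborel) \<le>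
        (\<integral>z. cmod ((\<kappa> (y - z) - \<kappa> (x - z) - dderiv [y - x] \<kappa> (x - z)) * f z) \<partial>lborel)"
      by (rule integral_norm_bound)
    also have "\<dots> \<le> (\<integral>z. (\<eta> * norm (y - x)) * cmod (f z) \<partial>lborel)"
    proof (rule integral_mono)
      show "integrable lborel (\<lambda>z. cmod ((\<kappa> (y - z) - \<kappa> (x - z) - dderiv [y - x] \<kappa> (x - z)) * f z))"
        unfolding left_diff_distrib by (intro integrable_norm Bochner_Integration.integrable_diff int)
      show "cmod ((\<kappa> (y - z) - \<kappa> (x - z) - dderiv [y - x] \<kappa> (x - z)) * f z) \<le> (\<eta> * norm (y - x)) * cmod (f z)" for z
      proof -
        have "x - z + (y - x) = y - z" by simp
        then show ?thesis using d(2)[OF that, of "x - z"] by (simp only: norm_mult mult_right_mono norm_ge_zero)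
      qed
    qed (use f in simp)
    also have "\<dots> = (\<eta> * I) * norm (y - x)" by (simp add: I_def)
    also have "\<dots> \<le> \<epsilon> * norm (y - x)" using \<eta> by (intro mult_right_mono) auto
    finally show ?thesis unfolding eq .
  qed
  then show "\<exists>d>0. \<forall>y. norm (y - x) < d \<longrightarrow>
      norm (conv \<kappa> f y - conv \<kappa> f x - conv (dderiv [y - x] \<kappa>) f x) \<le> \<epsilon> * norm (y - x)"
    using d(1) by blast
qed

lemma conv_dderiv:
  "test_fun \<kappa> \<Longrightarrow> integrable lborel f \<Longrightarrow> dderiv [v] (conv \<kappa> f) = conv (dderiv [v] \<kappa>) f"
  by (rule dderiv_eqI[of _ "\<lambda>x v. conv (dderiv [v] \<kappa>) f x"]) (rule conv_has_derivative)

lemma conv_smooth: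
  fixes \<kappa> f :: "'a::euclidean_space \<Rightarrow> complex"
  assumes "test_fun \<kappa>" and f: "integrable lborel f"
  shows "smooth_fun (conv \<kappa> f)"
proof (rule smooth_coinduct[of _ "{conv \<kappa> f | \<kappa>. test_fun \<kappa>}"])
  show "conv \<kappa> f \<in> {conv \<kappa> f | \<kappa>. test_fun \<kappa>}" using assms by blast
  show "g differentiable (at x)" if "g \<in> {conv \<kappa> f | \<kappa>. test_fun \<kappa>}" for g x
    using that conv_has_derivative[OF _ f] differentiable_def by blast
  show "dderiv [v] g \<in> {conv \<kappa> f | \<kappa>. test_fun \<kappa>}" if "g \<in> {conv \<kappa> f | \<kappa>. test_fun \<kappa>}" for g v
    using that conv_dderiv[OF _ f] test_dderiv by blast
qed

lemma conv_support:
  assumes "\<And>x. norm x > R \<Longrightarrow> \<kappa> x = 0" "\<And>x. norm x > S \<Longrightarrow> f x = 0" "norm x > R + S"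
  shows "conv \<kappa> f x = 0"
proof -
  have "\<kappa> (x - y) * f y = 0" for y
  proof -
    have "norm x \<le> norm (x - y) + norm y" using norm_triangle_sub[of x y] by linarith
    then have "norm (x - y) > R \<or> norm y > S" using assms(3) by linarith
    then show ?thesis using assms by auto
  qed
  then show ?thesis by (simp only: conv_def Bochner_Integration.integral_zero)
qed

lemma conv_test:
  assumes "test_fun \<kappa>" "integrable lborel f" "\<And>x. norm x > S \<Longrightarrow> f x = 0"
  shows "test_fun (conv \<kappa> f)"
proof -
  obtain R where "\<And>x. norm x > R \<Longrightarrow> \<kappa> x = 0" using assms(1) by (auto simp: test_fun_iff)
  then have "\<And>x. norm x > R + S \<Longrightarrow> conv \<kappa> f x = 0" using conv_support assms(3) by blast
  then show ?thesis using conv_smooth[OF assms(1,2)] by (auto simp: test_fun_iff)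
qed

lemma test_reflect:
  assumes "test_fun \<kappa>"
  shows "test_fun (\<lambda>y. \<kappa> (x - y))" "dderiv [b] (\<lambda>y. \<kappa> (x - y)) = (\<lambda>y. - dderiv [b] \<kappa> (x - y))"
proof -
  have bl: "bounded_linear (\<lambda>y. - y :: 'a)" by (intro bounded_linear_minus bounded_linear_ident)
  note a = smooth_affine[OF test_smooth[OF assms] bl, where c = x]
  obtain R where R: "\<And>x. norm x > R \<Longrightarrow> \<kappa> x = 0" using assms by (auto simp: test_fun_iff)
  have "\<kappa> (x - y) = 0" if "norm y > R + norm x" for y
    using R[of "x - y"] that norm_triangle_ineq2[of y x] by (simp add: norm_minus_commute)
  then show "test_fun (\<lambda>y. \<kappa> (x - y))" using a(1) by (auto simp: test_fun_iff)
  have "dderiv [- b] \<kappa> z = - dderiv [b] \<kappa> z" for z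
    by (rule linear_neg[OF dderiv_linear[OF test_smooth[OF assms]]])
  then show "dderiv [b] (\<lambda>y. \<kappa> (x - y)) = (\<lambda>y. - dderiv [b] \<kappa> (x - y))" using a(2)[where v = b] by simp
qed

text \<open>The reflected translate of the kernel is itself a test function; the sign from the
  reflection cancels the sign in the definition of the weak derivative.\<close>

lemma conv_weak_deriv:
  assumes "weak_deriv \<psi> b g" "test_fun \<kappa>"
  shows "conv (dderiv [b] \<kappa>) \<psi> x = conv \<kappa> g x"
proof -
  have "(\<integral>y. \<psi> y * dderiv [b] (\<lambda>y. \<kappa> (x - y)) y \<partial>lborel) = - (\<integral>y. g y * \<kappa> (x - y) \<partial>lborel)"
    using assms test_reflect(1) unfolding weak_deriv_def by blast
  then show ?thesis unfolding test_reflect(2)[OF assms(2)] conv_def by (simp add: mult.commute)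
qed

subsection \<open>The standard mollifier\<close>

definition rho :: "real \<Rightarrow> 'a::euclidean_space \<Rightarrow> real" where
  "rho r x = bump r x / (\<integral>z. bump r (z::'a) \<partial>lborel)"

definition moll :: "nat \<Rightarrow> ('a::euclidean_space \<Rightarrow> complex) \<Rightarrow> 'a \<Rightarrow> complex" where
  "moll n = conv (\<lambda>x. of_real (rho (1 / Suc n) x))"

lemma Cc_bump: "r > 0 \<Longrightarrow> Cc (\<lambda>x::'a::euclidean_space. complex_of_real (bump r x))"
  by (rule test_Cc[OF bump_test])

lemma bump_integrable:
  assumes "r > 0" shows "integrable lborel (bump r :: 'a::euclidean_space \<Rightarrow> real)"
  using integrable_Re[OF Cc_integrable[OF Cc_bump[OF assms, where 'a = 'a]]] by simp

lemma bump_measurable: "bump r \<in> borel_measurable (borel :: 'a::euclidean_space measure)"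
proof -
  have "continuous_on UNIV (flat 1)"
    by (rule DERIV_continuous_on) (rule has_field_derivative_at_within[OF flat_DERIV])
  then have "continuous_on UNIV (\<lambda>x::'a. flat 1 (r\<^sup>2 - x \<bullet> x))"
    by (intro continuous_on_compose2[of UNIV "flat 1" UNIV "\<lambda>x::'a. r\<^sup>2 - x \<bullet> x"] continuous_intros) auto
  then show ?thesis unfolding bump_def by (rule borel_measurable_continuous_onI)
qed

lemma bump_integral_pos:
  assumes "r > 0" shows "0 < (\<integral>z. bump r (z::'a::euclidean_space) \<partial>lborel)"
proof -
  have "0 \<le> (\<integral>z. bump r (z::'a) \<partial>lborel)" by (simp add: bump_nonneg)
  moreover have "(\<integral>z. bump r (z::'a) \<partial>lborel) \<noteq> 0"
  proof
    assume "(\<integral>z. bump r (z::'a) \<partial>lborel) = 0"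
    then have "AE z in lborel. bump r (z::'a) = 0"
      using integral_nonneg_eq_0_iff_AE[OF bump_integrable[OF assms]] bump_nonneg by auto
    then have "AE z in lborel. (z::'a) \<notin> ball 0 r"
      by eventually_elim (use bump_pos in \<open>fastforce\<close>)
    then have "ball (0::'a) r \<in> null_sets lborel" by (simp add: AE_iff_null_sets)
    then have "measure lborel (ball (0::'a) r) = 0" by (simp add: measure_eq_0_null_sets)
    then show False using content_ball_pos[OF assms, of "0::'a"] by simp
  qed
  ultimately show ?thesis by simp
qed

lemma rho_nonneg: "0 \<le> rho r x"
  unfolding rho_def by (intro divide_nonneg_nonneg Bochner_Integration.integral_nonneg bump_nonneg)

lemma rho_abs [simp]: "\<bar>rho r x\<bar> = rho r x"
  by (simp add: rho_nonneg)

lemma rho_zero: "r > 0 \<Longrightarrow> norm x \<ge> r \<Longrightarrow> rho r x = 0"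
  by (simp add: rho_def bump_zero)

lemma rho_even: "rho r (x - y) = rho r (y - x)"
  unfolding rho_def using bump_even[of r "x - y"] by simp

lemma rho_measurable [measurable]: "rho r \<in> borel_measurable borel"
  unfolding rho_def using bump_measurable by measurable

lemma rho_integral: "r > 0 \<Longrightarrow> (\<integral>x. rho r (x::'a::euclidean_space) \<partial>lborel) = 1"
  using bump_integral_pos[of r, where 'a = 'a] by (simp add: rho_def)

lemma rho_integrable: "r > 0 \<Longrightarrow> integrable lborel (rho r :: 'a::euclidean_space \<Rightarrow> real)"
  unfolding rho_def[abs_def] by (intro integrable_divide_zero bump_integrable) auto

lemma rho_test:
  assumes "r > 0" shows "test_fun (\<lambda>x::'a::euclidean_space. complex_of_real (rho r x))"
  using test_mult[OF smooth_const[of "of_real (1 / (\<integral>z. bump r (z::'a) \<partial>lborel))"] bump_test[OF assms, where 'a = 'a]]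
  by (simp add: rho_def)

lemma rho_nn_integral:
  assumes "r > 0" shows "(\<integral>\<^sup>+x. ennreal (rho r (x - (y::'a::euclidean_space))) \<partial>lborel) = 1"
proof -
  have "(\<integral>\<^sup>+x. ennreal (rho r (x - y)) \<partial>lborel) = (\<integral>\<^sup>+x. ennreal (rho r x) \<partial>distr lborel borel ((+) (- y)))"
    by (subst nn_integral_distr) (auto simp: algebra_simps)
  also have "\<dots> = (\<integral>\<^sup>+x. ennreal (rho r (x::'a)) \<partial>lborel)" by (simp add: lborel_distr_plus)
  also have "\<dots> = ennreal (\<integral>x. rho r (x::'a) \<partial>lborel)"
    by (intro nn_integral_eq_integral rho_integrable assms) (simp add: rho_nonneg)
  finally show ?thesis using rho_integral[OF assms] by simp
qed

lemma rho_translate: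
  assumes "r > 0"
  shows "integrable lborel (\<lambda>y. rho r (x - y :: 'a::euclidean_space))" "(\<integral>y. rho r (x - y) \<partial>lborel) = 1"
proof -
  have nn: "(\<integral>\<^sup>+y. ennreal (rho r (x - y)) \<partial>lborel) = 1"
    using rho_nn_integral[OF assms, of x] by (simp add: rho_even)
  show "integrable lborel (\<lambda>y. rho r (x - y))"
    by (rule integrableI_nonneg) (use nn rho_nonneg in auto)
  show "(\<integral>y. rho r (x - y) \<partial>lborel) = 1"
    by (rule integral_eq_nn_integral[THEN trans]) (use nn rho_nonneg in auto)
qed

lemma sq_int_rho_reflect:
  assumes "r > 0" shows "sq_int (\<lambda>y. complex_of_real (rho r (x - y :: 'a::euclidean_space)))"
  by (rule test_sq_int[OF test_reflect(1)[OF rho_test[OF assms]]])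

text \<open>Jensen's inequality for the probability density rho (x - y): with mean B and second
  moment A of |f|, the variance A - B^2 is nonnegative.\<close>

lemma conv_sq_le:
  fixes f :: "'a::euclidean_space \<Rightarrow> complex"
  assumes "r > 0" "sq_int f"
  shows "ennreal ((cmod (conv (\<lambda>x. of_real (rho r x)) f x))\<^sup>2) \<le> (\<integral>\<^sup>+y. ennreal (rho r (x - y) * (cmod (f y))\<^sup>2) \<partial>lborel)"
proof -
  define A B where "A = (\<integral>y. rho r (x - y) * (cmod (f y))\<^sup>2 \<partial>lborel)" and "B = (\<integral>y. rho r (x - y) * cmod (f y) \<partial>lborel)"
  have [measurable]: "f \<in> borel_measurable borel" using assms(2) by (rule sq_int_measurable)
  obtain K where K: "\<And>z::'a. cmod (of_real (rho r z)) \<le> K" using Cc_bounded[OF test_Cc[OF rho_test[OF assms(1)]]] by blast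
  have K': "\<bar>rho r (z::'a)\<bar> \<le> K" for z using K[of z] by simp
  have iB: "integrable lborel (\<lambda>y. rho r (x - y) * cmod (f y))"
    using sq_int_mult_integrable(3)[OF sq_int_rho_reflect[OF assms(1), of x] assms(2)] by simp
  have iA: "integrable lborel (\<lambda>y. rho r (x - y) * (cmod (f y))\<^sup>2)"
  proof (rule Bochner_Integration.integrable_bound[OF integrable_mult_right[OF sq_int_integrable[OF assms(2)], of K]])
    show "AE y in lborel. norm (rho r (x - y) * (cmod (f y))\<^sup>2) \<le> norm (K * (cmod (f y))\<^sup>2)"
    proof (rule AE_I2)
      fix y
      have "\<bar>rho r (x - y)\<bar> * (cmod (f y))\<^sup>2 \<le> \<bar>K\<bar> * (cmod (f y))\<^sup>2"
        using K'[of "x - y"] by (intro mult_right_mono) auto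
      then show "norm (rho r (x - y) * (cmod (f y))\<^sup>2) \<le> norm (K * (cmod (f y))\<^sup>2)" by (simp add: abs_mult)
    qed
  qed simp
  have "0 \<le> (\<integral>y. rho r (x - y) * (cmod (f y) - B)\<^sup>2 \<partial>lborel)"
    by (intro Bochner_Integration.integral_nonneg mult_nonneg_nonneg rho_nonneg) auto
  also have "(\<lambda>y. rho r (x - y) * (cmod (f y) - B)\<^sup>2) =
      (\<lambda>y. rho r (x - y) * (cmod (f y))\<^sup>2 - 2 * B * (rho r (x - y) * cmod (f y)) + B\<^sup>2 * rho r (x - y))"
    by (auto simp: fun_eq_iff power2_eq_square algebra_simps)
  also have "(\<integral>y. (rho r (x - y) * (cmod (f y))\<^sup>2 - 2 * B * (rho r (x - y) * cmod (f y)) + B\<^sup>2 * rho r (x - y)) \<partial>lborel) =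
      A - 2 * B * B + B\<^sup>2"
    using iA iB rho_translate[OF assms(1), of x] by (simp add: A_def B_def)
  finally have "B\<^sup>2 \<le> A" by (simp add: power2_eq_square)
  moreover have "cmod (conv (\<lambda>x. of_real (rho r x)) f x) \<le> B"
  proof -
    have "cmod (conv (\<lambda>x. of_real (rho r x)) f x) \<le> (\<integral>y. cmod (of_real (rho r (x - y)) * f y) \<partial>lborel)"
      unfolding conv_def by (rule integral_norm_bound)
    then show ?thesis by (simp add: B_def norm_mult rho_nonneg)
  qed
  ultimately have "(cmod (conv (\<lambda>x. of_real (rho r x)) f x))\<^sup>2 \<le> A"
    using power_mono[of "cmod (conv (\<lambda>x. of_real (rho r x)) f x)" B 2] by simp
  then have "ennreal ((cmod (conv (\<lambda>x. of_real (rho r x)) f x))\<^sup>2) \<le> ennreal A" by (rule ennreal_leI)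
  also have "ennreal A = (\<integral>\<^sup>+y. ennreal (rho r (x - y) * (cmod (f y))\<^sup>2) \<partial>lborel)"
    unfolding A_def by (rule nn_integral_eq_integral[symmetric, OF iA]) (simp add: rho_nonneg)
  finally show ?thesis .
qed

lemma conv_measurable:
  assumes [measurable]: "\<kappa> \<in> borel_measurable borel" "f \<in> borel_measurable borel"
  shows "conv \<kappa> f \<in> borel_measurable borel"
  unfolding conv_def by measurable

text \<open>Integrate the Jensen bound over x and exchange the order of integration; the kernel has
  mass 1 in x as well.\<close>

lemma conv_contraction:
  fixes f :: "'a::euclidean_space \<Rightarrow> complex"
  assumes "r > 0" "sq_int f"
  shows "sq_int (conv (\<lambda>x. of_real (rho r x)) f)" "L2norm2 (conv (\<lambda>x. of_real (rho r x)) f) \<le> L2norm2 f"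
proof -
  define g where "g = conv (\<lambda>x. of_real (rho r x)) f"
  have [measurable]: "f \<in> borel_measurable borel" using assms(2) by (rule sq_int_measurable)
  have [measurable]: "g \<in> borel_measurable borel" unfolding g_def by (intro conv_measurable) auto
  have "(\<integral>\<^sup>+x. ennreal ((cmod (g x))\<^sup>2) \<partial>lborel) \<le> (\<integral>\<^sup>+x. \<integral>\<^sup>+y. ennreal (rho r (x - y) * (cmod (f y))\<^sup>2) \<partial>lborel \<partial>lborel)"
    unfolding g_def by (intro nn_integral_mono conv_sq_le assms)
  also have "\<dots> = (\<integral>\<^sup>+y. \<integral>\<^sup>+x. ennreal (rho r (x - y) * (cmod (f y))\<^sup>2) \<partial>lborel \<partial>lborel)"
    by (rule lborel_pair.Fubini') measurable
  also have "\<dots> = (\<integral>\<^sup>+y. ennreal ((cmod (f y))\<^sup>2) \<partial>lborel)"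
    by (simp add: ennreal_mult rho_nonneg nn_integral_multc rho_nn_integral[OF assms(1)])
  also have "\<dots> = ennreal (L2norm2 f)" by (rule nn_integral_L2norm2[OF assms(2)])
  finally have le: "(\<integral>\<^sup>+x. ennreal ((cmod (g x))\<^sup>2) \<partial>lborel) \<le> ennreal (L2norm2 f)" .
  then have "sq_int g"
    unfolding sq_int_def by (auto simp: integrable_iff_bounded intro: le_less_trans)
  moreover have "L2norm2 g \<le> L2norm2 f"
    using le nn_integral_L2norm2[OF calculation] by simp
  ultimately show "sq_int (conv (\<lambda>x. of_real (rho r x)) f)" "L2norm2 (conv (\<lambda>x. of_real (rho r x)) f) \<le> L2norm2 f"
    by (simp_all add: g_def)
qed

lemma moll_sq_int: "sq_int f \<Longrightarrow> sq_int (moll n f)"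
  and moll_contraction: "sq_int f \<Longrightarrow> L2norm2 (moll n f) \<le> L2norm2 f"
  unfolding moll_def by (simp_all add: conv_contraction)

lemma moll_diff:
  assumes "sq_int f" "sq_int g"
  shows "moll n (\<lambda>x. f x - g x) x = moll n f x - moll n g x"
proof -
  have "integrable lborel (\<lambda>y. complex_of_real (rho (1 / Suc n) (x - y)) * h y)" if "sq_int h" for h
    by (rule sq_int_mult_integrable(2)[OF sq_int_rho_reflect that]) simp
  then show ?thesis using assms by (simp add: moll_def conv_def right_diff_distrib)
qed

text \<open>Convergence is pointwise because the kernel at x sees only points where g is close to g
  x; a common bound on a common ball upgrades this to mean square.\<close>

lemma moll_Cc_tendsto:
  fixes g :: "'a::euclidean_space \<Rightarrow> complex"
  assumes g: "Cc g"
  shows "(\<lambda>n. L2norm2 (\<lambda>x. moll n g x - g x)) \<longlonglongrightarrow> 0"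
proof -
  obtain B where B: "\<And>x. cmod (g x) \<le> B" using Cc_bounded[OF g] by blast
  obtain R where R: "\<And>x. norm x > R \<Longrightarrow> g x = 0" using g by (auto simp: Cc_def)
  have [measurable]: "g \<in> borel_measurable borel" using g by (rule Cc_measurable)
  have int: "integrable lborel (\<lambda>y. complex_of_real (rho (1 / Suc n) (x - y)) * g y)" for n x
    by (rule sq_int_mult_integrable(2)[OF sq_int_rho_reflect Cc_sq_int[OF g]]) simp
  have bound: "cmod (moll n g x) \<le> B" for n x
  proof -
    have "cmod (moll n g x) \<le> (\<integral>y. cmod (of_real (rho (1 / Suc n) (x - y)) * g y) \<partial>lborel)"
      unfolding moll_def conv_def by (rule integral_norm_bound)
    also have "\<dots> \<le> (\<integral>y. rho (1 / Suc n) (x - y) * B \<partial>lborel)"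
    proof (rule integral_mono)
      show "integrable lborel (\<lambda>y. cmod (complex_of_real (rho (1 / Suc n) (x - y)) * g y))"
        by (rule integrable_norm[OF int])
      show "integrable lborel (\<lambda>y. rho (1 / Suc n) (x - y) * B)"
        using rho_translate(1)[of "1 / Suc n" x] by simp
      show "cmod (complex_of_real (rho (1 / Suc n) (x - y)) * g y) \<le> rho (1 / Suc n) (x - y) * B" for y
        by (simp add: norm_mult mult_left_mono B rho_nonneg)
    qed
    also have "\<dots> = B" using rho_translate[of "1 / Suc n" x] by simp
    finally show ?thesis .
  qed
  have supp: "moll n g x = 0" if "norm x > 1 + R" for n x
    unfolding moll_def
  proof (rule conv_support[OF _ R that])
    fix y :: 'a assume "norm y > 1"
    moreover have "1 / real (Suc n) \<le> 1" by simp
    ultimately have "1 / real (Suc n) \<le> norm y" by linarith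
    then show "complex_of_real (rho (1 / real (Suc n)) y) = 0" by (simp add: rho_zero)
  qed
  show ?thesis
  proof (rule L2_dominated(3)[where w = "\<lambda>x. B * indicator (cball 0 (1 + R)) x"])
  show "moll n g \<in> borel_measurable borel" for n unfolding moll_def by (intro conv_measurable) auto
  show "cmod (moll n g x) \<le> B * indicator (cball 0 (1 + R)) x" for n x
    using bound[of n x] supp[of x n] by (auto simp: indicator_def)
  show "integrable lborel (\<lambda>x::'a. (B * indicator (cball 0 (1 + R)) x)\<^sup>2)"
    by (rule integrable_bounded_support[where B = "B\<^sup>2" and R = "1 + R"]) (auto simp: indicator_def)
  show "(\<lambda>n. moll n g x) \<longlonglongrightarrow> g x" for x
  proof (rule LIMSEQ_I)
    fix \<epsilon> :: real assume "\<epsilon> > 0"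
    then obtain d where d: "d > 0" "\<And>x y. norm (x - y) < d \<Longrightarrow> cmod (g x - g y) < \<epsilon> / 2"
      using Cc_uniformly_continuous[OF g, of "\<epsilon>/2"] by auto
    obtain N where N: "inverse (real (Suc N)) < d" using reals_Archimedean d(1) by blast
    have "norm (moll n g x - g x) < \<epsilon>" if "n \<ge> N" for n
    proof -
      let ?r = "1 / real (Suc n)"
      have r: "?r < d"
      proof -
        have "?r \<le> inverse (real (Suc N))" using that by (simp add: field_simps)
        then show ?thesis using N by linarith
      qed
      have it: "integrable lborel (\<lambda>y. complex_of_real (rho ?r (x - y)) * (g y - g x))"
        using int[of n x] rho_translate(1)[of ?r x] by (simp add: right_diff_distrib)
      have "(\<integral>y. complex_of_real (rho ?r (x - y)) * g x \<partial>lborel) = g x"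
        using rho_translate(2)[of ?r x] by simp
      then have "moll n g x - g x = (\<integral>y. of_real (rho ?r (x - y)) * (g y - g x) \<partial>lborel)"
        using int[of n x] rho_translate(1)[of ?r x] by (simp add: moll_def conv_def right_diff_distrib)
      also have "cmod \<dots> \<le> (\<integral>y. cmod (of_real (rho ?r (x - y)) * (g y - g x)) \<partial>lborel)"
        by (rule integral_norm_bound)
      also have "\<dots> \<le> (\<integral>y. rho ?r (x - y) * (\<epsilon> / 2) \<partial>lborel)"
      proof (rule integral_mono)
        show "integrable lborel (\<lambda>y. cmod (complex_of_real (rho ?r (x - y)) * (g y - g x)))"
          using it by (rule integrable_norm)
        show "integrable lborel (\<lambda>y. rho ?r (x - y) * (\<epsilon> / 2))" using rho_translate(1)[of ?r x] by simp
        show "cmod (complex_of_real (rho ?r (x - y)) * (g y - g x)) \<le> rho ?r (x - y) * (\<epsilon> / 2)" for y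
        proof (cases "norm (x - y) < ?r")
          case True
          then have "cmod (g y - g x) \<le> \<epsilon> / 2" using d(2)[of y x] r by (simp add: norm_minus_commute)
          from mult_left_mono[OF this rho_nonneg[of ?r "x - y"]] show ?thesis by (simp add: norm_mult)
        next
          case False
          then show ?thesis using rho_zero[of ?r "x - y"] by simp
        qed
      qed
      also have "\<dots> = \<epsilon> / 2" using rho_translate[of ?r x] by simp
      finally show ?thesis using \<open>\<epsilon> > 0\<close> by simp
    qed
    then show "\<exists>N. \<forall>n\<ge>N. norm (moll n g x - g x) < \<epsilon>" by blast
  qed
qed
qed

lemma moll_tendsto:
  fixes f :: "'a::euclidean_space \<Rightarrow> complex"
  assumes f: "sq_int f"
  shows "(\<lambda>n. L2norm2 (\<lambda>x. moll n f x - f x)) \<longlonglongrightarrow> 0"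
proof (rule LIMSEQ_I)
  fix \<epsilon> :: real assume "\<epsilon> > 0"
  \<comment> \<open>The estimates below add up to six times the approximation error plus four times
    the mollification error of g, and 10 / 12 < 1.\<close>
  then obtain g where g: "Cc g" "L2norm2 (\<lambda>x. f x - g x) < \<epsilon> / 12"
    using sq_int_Cc_approx[OF f] unfolding Cc_approx_def by (metis divide_pos_pos zero_less_numeral)
  have gs: "sq_int g" using g(1) by (rule Cc_sq_int)
  obtain N where N: "\<And>n. n \<ge> N \<Longrightarrow> L2norm2 (\<lambda>x. moll n g x - g x) < \<epsilon> / 12"
    using LIMSEQ_D[OF moll_Cc_tendsto[OF g(1)], of "\<epsilon>/12"] \<open>\<epsilon> > 0\<close> by auto
  have "norm (L2norm2 (\<lambda>x. moll n f x - f x) - 0) < \<epsilon>" if "n \<ge> N" for n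
  proof -
    have "L2norm2 (\<lambda>x. moll n f x - f x) \<le> 2 * L2norm2 (\<lambda>x. moll n f x - moll n g x) + 2 * L2norm2 (\<lambda>x. moll n g x - f x)"
      using f gs by (intro L2norm2_diff_triangle moll_sq_int)
    also have "L2norm2 (\<lambda>x. moll n f x - moll n g x) \<le> L2norm2 (\<lambda>x. f x - g x)"
      using moll_contraction[OF sq_int_diff[OF f gs], of n] by (simp only: moll_diff[OF f gs, of n, abs_def])
    also have "L2norm2 (\<lambda>x. moll n g x - f x) \<le> 2 * L2norm2 (\<lambda>x. moll n g x - g x) + 2 * L2norm2 (\<lambda>x. g x - f x)"
      using f gs by (intro L2norm2_diff_triangle moll_sq_int)
    finally have "L2norm2 (\<lambda>x. moll n f x - f x) \<le> 2 * L2norm2 (\<lambda>x. f x - g x) +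
        2 * (2 * L2norm2 (\<lambda>x. moll n g x - g x) + 2 * L2norm2 (\<lambda>x. g x - f x))" by simp
    then show ?thesis using g N[OF that] L2norm2_minus[of g f] L2norm2_nonneg[of "\<lambda>x. moll n f x - f x"] \<open>\<epsilon> > 0\<close>
      by (simp del: L2norm2_nonneg)
  qed
  then show "\<exists>N. \<forall>n\<ge>N. norm (L2norm2 (\<lambda>x. moll n f x - f x) - 0) < \<epsilon>" by blast
qed

text \<open>Mollifying at a point is testing against a reflected kernel, so f and g have the same
  mollifications, and these converge to both functions.\<close>

lemma sq_int_eq_by_test:
  assumes "sq_int f" "sq_int g"
    "\<And>\<phi>. test_fun \<phi> \<Longrightarrow> (\<integral>x. f x * \<phi> x \<partial>lborel) = (\<integral>x. g x * \<phi> x \<partial>lborel)"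
  shows "AE x in lborel. f x = g x"
proof (rule L2_limit_unique[of "\<lambda>n. moll n f"])
  have "moll n f = moll n g" for n
    using assms(3)[OF test_reflect(1)[OF rho_test]]
    by (auto simp: fun_eq_iff moll_def conv_def mult.commute)
  then show "(\<lambda>n. L2norm2 (\<lambda>x. moll n f x - g x)) \<longlonglongrightarrow> 0" using moll_tendsto[OF assms(2)] by simp
qed (use assms moll_sq_int moll_tendsto in auto)

section \<open>The Sobolev space\<close>

lemma W12_sq_int: "W12 \<psi> \<Longrightarrow> sq_int \<psi>"
  by (simp add: W12_def)

lemma wd_props:
  assumes "W12 \<psi>" "b \<in> Basis"
  shows "sq_int (wd \<psi> b)" "weak_deriv \<psi> b (wd \<psi> b)"
proof -
  have "\<exists>g. sq_int g \<and> weak_deriv \<psi> b g" using assms by (auto simp: W12_def)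
  then have "sq_int (wd \<psi> b) \<and> weak_deriv \<psi> b (wd \<psi> b)" unfolding wd_def by (rule someI_ex)
  then show "sq_int (wd \<psi> b)" "weak_deriv \<psi> b (wd \<psi> b)" by auto
qed

lemma weak_deriv_unique:
  assumes "weak_deriv \<psi> b g" "weak_deriv \<psi> b h" "sq_int g" "sq_int h"
  shows "AE x in lborel. g x = h x"
  using assms by (intro sq_int_eq_by_test) (auto simp: weak_deriv_def)

lemma weak_deriv_cutoff:
  fixes \<psi> :: "'a::euclidean_space \<Rightarrow> complex"
  assumes w: "weak_deriv \<psi> b g" and sq: "sq_int \<psi>" "sq_int g" and \<theta>: "test_fun \<theta>"
  shows "weak_deriv (\<lambda>x. \<theta> x * \<psi> x) b (\<lambda>x. \<theta> x * g x + dderiv [b] \<theta> x * \<psi> x)"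
  unfolding weak_deriv_def
proof (intro conjI allI impI)
  note [measurable] = sq[THEN sq_int_measurable] Cc_measurable[OF test_Cc[OF \<theta>]]
    Cc_measurable[OF test_Cc[OF test_dderiv[OF \<theta>]]]
  show "(\<lambda>x. \<theta> x * g x + dderiv [b] \<theta> x * \<psi> x) \<in> borel_measurable lborel" by simp
  fix \<phi> :: "'a \<Rightarrow> complex" assume \<phi>: "test_fun \<phi>"
  have t: "test_fun (\<lambda>x. \<theta> x * \<phi> x)" "test_fun (\<lambda>x. dderiv [b] \<theta> x * \<phi> x)" "test_fun (\<lambda>x. \<theta> x * dderiv [b] \<phi> x)"
    using \<theta> \<phi> test_smooth test_dderiv test_mult by blast+
  have i: "integrable lborel (\<lambda>x. \<psi> x * (dderiv [b] \<theta> x * \<phi> x))" "integrable lborel (\<lambda>x. \<psi> x * (\<theta> x * dderiv [b] \<phi> x))"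
    "integrable lborel (\<lambda>x. g x * (\<theta> x * \<phi> x))"
    using sq_int_mult_integrable(2) sq t test_sq_int by blast+
  have "(\<integral>x. \<psi> x * dderiv [b] (\<lambda>x. \<theta> x * \<phi> x) x \<partial>lborel) = - (\<integral>x. g x * (\<theta> x * \<phi> x) \<partial>lborel)"
    using w t(1) unfolding weak_deriv_def by blast
  then have "(\<integral>x. \<psi> x * (\<theta> x * dderiv [b] \<phi> x) \<partial>lborel) + (\<integral>x. \<psi> x * (dderiv [b] \<theta> x * \<phi> x) \<partial>lborel) = - (\<integral>x. g x * (\<theta> x * \<phi> x) \<partial>lborel)"
    unfolding dderiv_mult[OF test_smooth[OF \<theta>] test_smooth[OF \<phi>]] using i by (simp add: distrib_left)
  moreover have "(\<integral>x. (\<theta> x * g x + dderiv [b] \<theta> x * \<psi> x) * \<phi> x \<partial>lborel) =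
      (\<integral>x. g x * (\<theta> x * \<phi> x) + \<psi> x * (dderiv [b] \<theta> x * \<phi> x) \<partial>lborel)"
    by (intro Bochner_Integration.integral_cong) (auto simp: algebra_simps)
  moreover have "(\<integral>x. \<theta> x * \<psi> x * dderiv [b] \<phi> x \<partial>lborel) = (\<integral>x. \<psi> x * (\<theta> x * dderiv [b] \<phi> x) \<partial>lborel)"
    by (intro Bochner_Integration.integral_cong) (auto simp: algebra_simps)
  ultimately show "(\<integral>x. \<theta> x * \<psi> x * dderiv [b] \<phi> x \<partial>lborel) = - (\<integral>x. (\<theta> x * g x + dderiv [b] \<theta> x * \<psi> x) * \<phi> x \<partial>lborel)"
    using i by (simp add: algebra_simps add_eq_0_iff)
qed

text \<open>A bump of height 1 at the origin, stretched by k + 1. It serves twice: as the truncation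
  in the density theorem and as the slowly varying longitudinal factor of the trial
  functions.\<close>

definition cutoff :: "nat \<Rightarrow> 'a::euclidean_space \<Rightarrow> complex" where
  "cutoff k x = of_real (bump 1 ((1 / Suc k) *\<^sub>R x) / bump 1 (0::'a))"

lemma fixes x :: "'a::euclidean_space"
  shows cutoff_test: "test_fun (cutoff k :: 'a \<Rightarrow> complex)"
  and cutoff_le: "cmod (cutoff k x) \<le> 1"
  and cutoff_tendsto: "(\<lambda>k. cutoff k x) \<longlonglongrightarrow> 1"
  and cutoff_dderiv: "\<exists>C\<ge>0. \<forall>k x. cmod (dderiv [v] (cutoff k :: 'a \<Rightarrow> complex) x) \<le> C / Suc k"
proof -
  define \<beta> where "\<beta> x = complex_of_real (bump 1 x / bump 1 (0::'a))" for x :: 'a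
  have b0: "bump 1 (0::'a) > 0" by (rule bump_pos) simp
  have \<beta>: "test_fun \<beta>"
    using test_mult[OF smooth_const[of "of_real (1 / bump 1 (0::'a))"] bump_test[of 1, where 'a = 'a]]
    by (simp add: \<beta>_def[abs_def])
  have L: "bounded_linear (\<lambda>x::'a. (1 / Suc k) *\<^sub>R x)" for k by (rule bounded_linear_scaleR_right)
  have cut: "cutoff k = (\<lambda>x::'a. \<beta> ((1 / Suc k) *\<^sub>R x))" for k by (simp add: cutoff_def[abs_def] \<beta>_def)
  note a = smooth_affine[OF test_smooth[OF \<beta>] L, where c = 0, simplified add_0]
  obtain R where R: "\<And>x. norm x > R \<Longrightarrow> \<beta> x = 0" using \<beta> by (auto simp: test_fun_iff)
  have "cutoff k x = 0" if "norm x > R * real (Suc k)" for k and x :: 'a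
    unfolding cut using that by (intro R) (simp add: field_simps)
  then show "test_fun (cutoff k :: 'a \<Rightarrow> complex)" for k
    unfolding test_fun_iff using a(1) unfolding cut by blast
  have "bump 1 y \<le> bump 1 (0::'a)" for y :: 'a
  proof (cases "norm y < 1")
    case True
    then have "0 < 1 - y \<bullet> y" by (simp add: power2_norm_eq_inner[symmetric] power_less_one_iff)
    moreover have "1 \<le> 1 / (1 - y \<bullet> y)" using calculation by (simp add: field_simps)
    ultimately show ?thesis by (simp add: bump_def flat_def)
  next
    case False
    then show ?thesis using bump_zero[of 1 y] b0 by simp
  qed
  then show "cmod (cutoff k x) \<le> 1" for k and x :: 'a
    unfolding cutoff_def using b0 by (simp add: norm_divide divide_le_eq abs_of_nonneg[OF bump_nonneg])
  show "(\<lambda>k. cutoff k x) \<longlonglongrightarrow> 1" for x :: 'a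
  proof -
    have "isCont \<beta> 0" using smooth_continuous[OF test_smooth[OF \<beta>]] by (simp add: continuous_on_eq_continuous_at)
    moreover have "(\<lambda>k. (1 / real (Suc k)) *\<^sub>R x) \<longlonglongrightarrow> 0 *\<^sub>R x"
      by (intro tendsto_intros) (use LIMSEQ_Suc[OF lim_inverse_n] in \<open>simp add: divide_inverse\<close>)
    ultimately have "(\<lambda>k. \<beta> ((1 / Suc k) *\<^sub>R x)) \<longlonglongrightarrow> \<beta> 0"
      by (intro isCont_tendsto_compose[of 0 \<beta>]) auto
    then show ?thesis unfolding cut using b0 by (simp add: \<beta>_def)
  qed
  obtain K where K: "K \<ge> 0" "\<And>v z. cmod (dderiv [v] \<beta> z) \<le> K * norm v" using test_dderiv_bound[OF \<beta>] by blast
  have "cmod (dderiv [v] (cutoff k :: 'a \<Rightarrow> complex) x) \<le> (K * norm v) / Suc k" for k x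
    using K(2)[of "(1 / Suc k) *\<^sub>R v" "(1 / Suc k) *\<^sub>R x"] unfolding cut a(2) by simp
  then show "\<exists>C\<ge>0. \<forall>k x. cmod (dderiv [v] (cutoff k :: 'a \<Rightarrow> complex) x) \<le> C / Suc k"
    using K(1) by (intro exI[of _ "K * norm v"]) auto
qed

text \<open>Cut off, then mollify. After the cutoff the mollification has bounded support and is a
  test function, and mollification commutes with weak derivatives, so function and gradient converge
  together.\<close>

theorem W12_test_dense:
  fixes \<psi> :: "'a::euclidean_space \<Rightarrow> complex"
  assumes "W12 \<psi>"
  shows "\<exists>\<phi>s. (\<forall>n. test_fun (\<phi>s n)) \<and> W12_lim \<phi>s \<psi>"
proof -
  have sq: "sq_int \<psi>" using assms by (rule W12_sq_int)
  have [measurable]: "\<psi> \<in> borel_measurable borel" using sq by (rule sq_int_measurable)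
  define \<psi>k where "\<psi>k k x = cutoff k x * \<psi> x" for k x
  define g where "g b k x = cutoff k x * wd \<psi> b x + dderiv [b] (cutoff k) x * \<psi> x" for b k x
  have cm [measurable]: "cutoff k \<in> borel_measurable (borel :: 'a measure)"
    "dderiv [b] (cutoff k) \<in> borel_measurable (borel :: 'a measure)" for k b
    using Cc_measurable[OF test_Cc] cutoff_test test_dderiv by blast+
  have psik: "sq_int (\<psi>k k)" "(\<lambda>k. L2norm2 (\<lambda>x. \<psi>k k x - \<psi> x)) \<longlonglongrightarrow> 0" for k
  proof -
    have m: "\<psi>k k \<in> borel_measurable borel" for k unfolding \<psi>k_def by measurable
    have l: "(\<lambda>k. \<psi>k k x) \<longlonglongrightarrow> \<psi> x" for x
      unfolding \<psi>k_def using tendsto_mult[OF cutoff_tendsto tendsto_const[of "\<psi> x"]] by simp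
    have d: "cmod (\<psi>k k x) \<le> cmod (\<psi> x)" for k x
      unfolding \<psi>k_def using mult_right_mono[OF cutoff_le[of k x], of "cmod (\<psi> x)"] by (simp add: norm_mult)
    show "sq_int (\<psi>k k)" "(\<lambda>k. L2norm2 (\<lambda>x. \<psi>k k x - \<psi> x)) \<longlonglongrightarrow> 0"
      using L2_dominated[of \<psi>k, OF m l sq_int_integrable[OF sq] d] by auto
  qed
  have gk: "sq_int (g b k)" "(\<lambda>k. L2norm2 (\<lambda>x. g b k x - wd \<psi> b x)) \<longlonglongrightarrow> 0"
    if b: "b \<in> Basis" for b k
  proof -
    note wd = wd_props[OF assms b]
    have [measurable]: "wd \<psi> b \<in> borel_measurable borel" using wd(1) by (rule sq_int_measurable)
    obtain C where C: "C \<ge> 0" "\<And>k x. cmod (dderiv [b] (cutoff k :: 'a \<Rightarrow> complex) x) \<le> C / Suc k"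
      using cutoff_dderiv[of b] by blast
    have C': "cmod (dderiv [b] (cutoff k :: 'a \<Rightarrow> complex) x) \<le> C" for k x
    proof -
      have "C / Suc k \<le> C" using C(1) by (simp add: field_simps)
      then show ?thesis using C(2)[of k x] by linarith
    qed
    have m: "g b k \<in> borel_measurable borel" for k unfolding g_def by measurable
    have l: "(\<lambda>k. g b k x) \<longlonglongrightarrow> wd \<psi> b x" for x
    proof -
      have "(\<lambda>k. dderiv [b] (cutoff k) x) \<longlonglongrightarrow> 0"
      proof (rule tendsto_norm_zero_cancel, rule tendsto_zero_le)
        show "(\<lambda>k. C / Suc k) \<longlonglongrightarrow> 0"
          using tendsto_mult[OF tendsto_const[of C] LIMSEQ_Suc[OF lim_inverse_n]] by (simp add: divide_inverse)
      qed (use C(2) in auto)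
      from tendsto_add[OF tendsto_mult[OF cutoff_tendsto tendsto_const] tendsto_mult[OF this tendsto_const]]
      show ?thesis unfolding g_def by (rule tendsto_eq_rhs) simp
    qed
    have w: "integrable lborel (\<lambda>x. (cmod (wd \<psi> b x) + C * cmod (\<psi> x))\<^sup>2)"
    proof -
      have s: "sq_int (\<lambda>x. complex_of_real (cmod (wd \<psi> b x)))" "sq_int (\<lambda>x. complex_of_real (cmod (\<psi> x)))"
        using wd(1) sq by (auto simp: sq_int_def)
      have "sq_int (\<lambda>x. complex_of_real (cmod (wd \<psi> b x)) + of_real C * complex_of_real (cmod (\<psi> x)))"
        by (rule sq_int_add[OF s(1) sq_int_scale[OF s(2)]])
      then show ?thesis unfolding sq_int_def by (simp flip: of_real_mult of_real_add)
    qed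
    have d: "cmod (g b k x) \<le> cmod (wd \<psi> b x) + C * cmod (\<psi> x)" for k x
      unfolding g_def using mult_right_mono[OF cutoff_le[of k x], of "cmod (wd \<psi> b x)"]
        mult_right_mono[OF C'[of k x], of "cmod (\<psi> x)"]
      by (intro norm_triangle_le) (simp add: norm_mult)
    show "sq_int (g b k)" "(\<lambda>k. L2norm2 (\<lambda>x. g b k x - wd \<psi> b x)) \<longlonglongrightarrow> 0"
      using L2_dominated[of "g b", OF m l w d] by auto
  qed
  have supp: "\<exists>R. \<forall>x. norm x > R \<longrightarrow> \<psi>k k x = 0" for k
    using cutoff_test[of k, where 'a = 'a] unfolding test_fun_iff \<psi>k_def by auto
  \<comment> \<open>Square integrability gives integrability only on sets of finite measure; here
    the cutoff confines the function to a ball.\<close>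
  have int: "integrable lborel (\<psi>k k)" for k
  proof -
    obtain R where R: "\<And>x. norm x > R \<Longrightarrow> \<psi>k k x = 0" using supp by blast
    have s: "sq_int (indicator (cball 0 R) :: 'a \<Rightarrow> complex)"
      by (rule sq_int_indicator) (simp_all add: emeasure_lborel_cball_finite flip: infinity_ennreal_def)
    have "\<psi>k k = (\<lambda>x. \<psi>k k x * indicator (cball 0 R) x)" using R by (auto simp: fun_eq_iff indicator_def not_le)
    then show ?thesis using sq_int_mult_integrable(2)[OF psik(1)[of k] s] by simp
  qed
  have mt: "test_fun (moll n (\<psi>k k))" for n k
  proof -
    obtain R where R: "\<And>x. norm x > R \<Longrightarrow> \<psi>k k x = 0" using supp by blast
    show ?thesis unfolding moll_def by (rule conv_test[OF rho_test int R]) auto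
  qed
  have md: "dderiv [b] (moll n (\<psi>k k)) = moll n (g b k)" if b: "b \<in> Basis" for n k b
  proof -
    have "weak_deriv (\<psi>k k) b (g b k)"
      unfolding \<psi>k_def g_def using weak_deriv_cutoff[OF wd_props(2)[OF assms b] sq wd_props(1)[OF assms b] cutoff_test] by simp
    then show ?thesis unfolding moll_def
      using conv_dderiv[OF rho_test int, of "1 / Suc n" b k] conv_weak_deriv[of "\<psi>k k" b "g b k", OF _ rho_test[of "1 / Suc n"]]
      by (auto simp: fun_eq_iff)
  qed
  \<comment> \<open>A diagonal choice: there are finitely many derivatives, so one mollification
    scale per k serves the function and its whole gradient.\<close>
  have "\<exists>n. L2norm2 (\<lambda>x. moll n (\<psi>k k) x - \<psi>k k x) < 1 / Suc k \<and>
      (\<forall>b\<in>Basis. L2norm2 (\<lambda>x. moll n (g b k) x - g b k x) < 1 / Suc k)" for k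
  proof -
    have "\<forall>\<^sub>F n in sequentially. L2norm2 (\<lambda>x. moll n (\<psi>k k) x - \<psi>k k x) < 1 / Suc k \<and>
        (\<forall>b\<in>Basis. L2norm2 (\<lambda>x. moll n (g b k) x - g b k x) < 1 / Suc k)"
      by (intro eventually_conj eventually_ball_finite ballI order_tendstoD(2)[OF moll_tendsto[OF psik(1)]]
          order_tendstoD(2)[OF moll_tendsto[OF gk(1)]]) auto
    then show ?thesis using eventually_happens trivial_limit_sequentially by blast
  qed
  then obtain N where N: "\<And>k. L2norm2 (\<lambda>x. moll (N k) (\<psi>k k) x - \<psi>k k x) < 1 / Suc k"
    "\<And>k b. b \<in> Basis \<Longrightarrow> L2norm2 (\<lambda>x. moll (N k) (g b k) x - g b k x) < 1 / Suc k" by metis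
  have combine: "(\<lambda>k. L2norm2 (\<lambda>x. moll (N k) (h k) x - f x)) \<longlonglongrightarrow> 0"
    if "\<And>k. sq_int (h k)" "sq_int f" "(\<lambda>k. L2norm2 (\<lambda>x. h k x - f x)) \<longlonglongrightarrow> 0"
      "\<And>k. L2norm2 (\<lambda>x. moll (N k) (h k) x - h k x) < 1 / Suc k" for h f
  proof (rule tendsto_zero_le)
    show "L2norm2 (\<lambda>x. moll (N k) (h k) x - f x) \<le> 2 * (1 / Suc k) + 2 * L2norm2 (\<lambda>x. h k x - f x)" for k
      using L2norm2_diff_triangle[OF moll_sq_int[OF that(1)] that(1,2), of "N k" k k] that(4)[of k] by simp
    have "(\<lambda>k. 2 * (1 / real (Suc k)) + 2 * L2norm2 (\<lambda>x. h k x - f x)) \<longlonglongrightarrow> 2 * 0 + 2 * 0"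
      by (intro tendsto_intros that(3)) (use LIMSEQ_Suc[OF lim_inverse_n] in \<open>simp add: divide_inverse\<close>)
    then show "(\<lambda>k. 2 * (1 / real (Suc k)) + 2 * L2norm2 (\<lambda>x. h k x - f x)) \<longlonglongrightarrow> 0" by simp
  qed simp
  show ?thesis
  proof (intro exI conjI allI)
    show "test_fun (moll (N k) (\<psi>k k))" for k by (rule mt)
    show "W12_lim (\<lambda>k. moll (N k) (\<psi>k k)) \<psi>"
      unfolding W12_lim_def
    proof (intro conjI ballI)
      show "(\<lambda>k. L2norm2 (\<lambda>x. moll (N k) (\<psi>k k) x - \<psi> x)) \<longlonglongrightarrow> 0"
        using combine[of \<psi>k \<psi>] psik sq N by blast
      fix b :: 'a assume b: "b \<in> Basis"
      show "(\<lambda>k. L2norm2 (\<lambda>x. dderiv [b] (moll (N k) (\<psi>k k)) x - wd \<psi> b x)) \<longlonglongrightarrow> 0"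
        unfolding md[OF b] using combine[of "g b" "wd \<psi> b"] gk[OF b] wd_props(1)[OF assms b] N(2)[OF b] by blast
    qed
  qed
qed

lemma integral_as_L2inner: "(\<integral>x. f x * \<phi> x \<partial>lborel) = L2inner f (\<lambda>x. cnj (\<phi> x))"
  by (simp add: L2inner_def)

lemma sq_int_cnj: "sq_int f \<Longrightarrow> sq_int (\<lambda>x. cnj (f x))"
  by (auto simp: sq_int_def intro!: borel_measurable_cnj)

text \<open>By translation invariance \<eta> and its translate by h = t b have equal integrals, so t
  times the wanted integral is only the integral of a Taylor remainder. That remainder is at most
  \<epsilon> |h| and lives in a fixed ball, hence the integral is below every positive bound. This
  works in any dimension without slicing.\<close>

lemma test_integral_dderiv:
  fixes \<eta> :: "'a::euclidean_space \<Rightarrow> complex"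
  assumes "test_fun \<eta>" shows "(\<integral>x. dderiv [b] \<eta> x \<partial>lborel) = 0"
proof -
  define I where "I = (\<integral>x. dderiv [b] \<eta> x \<partial>lborel)"
  obtain R where R: "\<And>x. norm x > R \<Longrightarrow> \<eta> x = 0" using assms by (auto simp: test_fun_iff)
  obtain S where S: "\<And>x. norm x > S \<Longrightarrow> dderiv [b] \<eta> x = 0" using test_dderiv[OF assms] by (auto simp: test_fun_iff)
  define T where "T = max R S + 1"
  define \<mu> where "\<mu> = measure lborel (cball (0::'a) T)"
  have bound: "cmod I \<le> \<epsilon> * (norm b * \<mu>)" if eps: "\<epsilon> > 0" for \<epsilon>
  proof -
    obtain d where d: "d > 0" "\<And>z h. norm h < d \<Longrightarrow> cmod (\<eta> (z + h) - \<eta> z - dderiv [h] \<eta> z) \<le> \<epsilon> * norm h"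
      using test_uniformly_differentiable[OF assms eps] by blast
    \<comment> \<open>Keeps |h| below both d, for the Taylor estimate, and 1, so that the translate
      stays inside the ball of radius T; the summand 1 in the denominator covers b = 0.\<close>
    define t where "t = min d 1 / (norm b + 1)"
    have t: "t > 0" using d(1) by (simp add: t_def add_nonneg_pos)
    define h where "h = t *\<^sub>R b"
    have nh: "norm h = t * norm b" using t by (simp add: h_def)
    have "t * norm b < min d 1"
    proof -
      have "t * (norm b + 1) = min d 1" using add_nonneg_pos[of "norm b" 1] by (simp add: t_def)
      then have "t * norm b + t = min d 1" by (simp add: distrib_left)
      then show ?thesis using t by linarith
    qed
    then have hd: "norm h < d" "norm h < 1" by (simp_all add: nh)
    have th: "test_fun (\<lambda>x. \<eta> (h + x))"
    proof -
      have "\<eta> (h + x) = 0" if "norm x > R + norm h" for x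
        using R[of "h + x"] that norm_diff_ineq[of x h] by (simp add: add.commute)
      then show ?thesis using smooth_affine(1)[OF test_smooth[OF assms] bounded_linear_ident, of h]
        by (auto simp: test_fun_iff)
    qed
    have dh: "dderiv [h] \<eta> x = t *\<^sub>R dderiv [b] \<eta> x" for x
      unfolding h_def by (rule linear_scale[OF dderiv_linear[OF test_smooth[OF assms]]])
    have int: "integrable lborel (\<lambda>x. \<eta> (h + x))" "integrable lborel \<eta>" "integrable lborel (dderiv [b] \<eta>)"
      using Cc_integrable test_Cc assms th test_dderiv by blast+
    have "(\<integral>x. \<eta> (h + x) \<partial>lborel) = (\<integral>x. \<eta> x \<partial>distr lborel borel ((+) h))"
      using Cc_measurable[OF test_Cc[OF assms]] by (subst integral_distr) auto
    then have shift: "(\<integral>x. \<eta> (h + x) \<partial>lborel) = (\<integral>x. \<eta> x \<partial>lborel)" by (simp add: lborel_distr_plus)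
    have "t *\<^sub>R I = (\<integral>x. \<eta> x - \<eta> (h + x) + t *\<^sub>R dderiv [b] \<eta> x \<partial>lborel)"
      using int shift by (simp add: I_def)
    also have "cmod \<dots> \<le> (\<integral>x. cmod (\<eta> x - \<eta> (h + x) + t *\<^sub>R dderiv [b] \<eta> x) \<partial>lborel)"
      by (rule integral_norm_bound)
    also have "\<dots> \<le> (\<integral>x. \<epsilon> * (t * norm b) * indicator (cball (0::'a) T) x \<partial>lborel)"
    proof (rule integral_mono)
      show "integrable lborel (\<lambda>x. cmod (\<eta> x - \<eta> (h + x) + t *\<^sub>R dderiv [b] \<eta> x))" using int by simp
      show "integrable lborel (\<lambda>x::'a. \<epsilon> * (t * norm b) * indicator (cball 0 T) x)"
        by (intro integrable_mult_right integrable_real_indicator) (auto simp: emeasure_lborel_cball_finite simp flip: infinity_ennreal_def)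
      fix x
      show "cmod (\<eta> x - \<eta> (h + x) + t *\<^sub>R dderiv [b] \<eta> x) \<le> \<epsilon> * (t * norm b) * indicator (cball 0 T) x"
      proof (cases "norm x \<le> T")
        case True
        have "\<eta> x - \<eta> (h + x) + t *\<^sub>R dderiv [b] \<eta> x = - (\<eta> (x + h) - \<eta> x - dderiv [h] \<eta> x)"
          by (simp add: dh add.commute)
        then show ?thesis using d(2)[OF hd(1), of x] True nh by (simp only: norm_minus_cancel) simp
      next
        case False
        then have "norm x > R" "norm x > S" "norm (h + x) > R"
          using hd(2) norm_diff_ineq[of x h] by (auto simp: T_def add.commute)
        then show ?thesis using R S False by simp
      qed
    qed
    also have "\<dots> = t * (\<epsilon> * (norm b * \<mu>))" by (simp add: \<mu>_def)
    finally have "t * cmod I \<le> t * (\<epsilon> * (norm b * \<mu>))" using t by simp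
    then show ?thesis using t by simp
  qed
  have "cmod I \<le> 0"
  proof (rule field_le_epsilon)
    fix e :: real assume "e > 0"
    define K where "K = norm b * \<mu> + 1"
    have K: "K > 0" by (simp add: K_def \<mu>_def add_nonneg_pos)
    have "cmod I \<le> (e / K) * (norm b * \<mu>)" using bound[of "e / K"] K \<open>e > 0\<close> by simp
    also have "\<dots> \<le> (e / K) * K" using K \<open>e > 0\<close> by (intro mult_left_mono) (auto simp: K_def)
    finally show "cmod I \<le> 0 + e" using K by simp
  qed
  then show ?thesis by (simp add: I_def)
qed

lemma test_weak_deriv:
  assumes "test_fun \<phi>" shows "weak_deriv \<phi> b (dderiv [b] \<phi>)"
  unfolding weak_deriv_def
proof (intro conjI allI impI)
  show "dderiv [b] \<phi> \<in> borel_measurable lborel" using Cc_measurable[OF test_Cc[OF test_dderiv[OF assms]]] by simp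
  fix \<eta> :: "'a \<Rightarrow> complex" assume \<eta>: "test_fun \<eta>"
  have "(\<integral>x. \<phi> x * dderiv [b] \<eta> x + dderiv [b] \<phi> x * \<eta> x \<partial>lborel) = 0"
    using test_integral_dderiv[OF test_mult[OF test_smooth[OF assms] \<eta>], of b]
    by (simp add: dderiv_mult test_smooth assms \<eta>)
  moreover have "integrable lborel (\<lambda>x. \<phi> x * dderiv [b] \<eta> x)" "integrable lborel (\<lambda>x. dderiv [b] \<phi> x * \<eta> x)"
    using sq_int_mult_integrable(2) test_sq_int test_dderiv assms \<eta> by blast+
  ultimately show "(\<integral>x. \<phi> x * dderiv [b] \<eta> x \<partial>lborel) = - (\<integral>x. dderiv [b] \<phi> x * \<eta> x \<partial>lborel)"
    by (simp add: add_eq_0_iff)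
qed

lemma W12I:
  assumes "sq_int \<psi>" "\<And>b. b \<in> Basis \<Longrightarrow> sq_int (g b)" "\<And>b. b \<in> Basis \<Longrightarrow> weak_deriv \<psi> b (g b)"
  shows "W12 \<psi>" "\<And>b. b \<in> Basis \<Longrightarrow> AE x in lborel. wd \<psi> b x = g b x"
proof -
  show W: "W12 \<psi>" unfolding W12_def using assms by blast
  show "AE x in lborel. wd \<psi> b x = g b x" if "b \<in> Basis" for b
    using weak_deriv_unique[OF wd_props(2)[OF W that] assms(3)[OF that] wd_props(1)[OF W that] assms(2)[OF that]] .
qed

lemma test_W12:
  assumes "test_fun \<phi>"
  shows "W12 \<phi>" "b \<in> Basis \<Longrightarrow> AE x in lborel. wd \<phi> b x = dderiv [b] \<phi> x"
  using W12I[of \<phi> "\<lambda>b. dderiv [b] \<phi>"] test_weak_deriv test_sq_int test_dderiv assms by blast+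

lemma weak_deriv_add_scale:
  fixes \<psi> \<phi> :: "'a::euclidean_space \<Rightarrow> complex"
  assumes "weak_deriv \<psi> b g" "weak_deriv \<phi> b h" "sq_int \<psi>" "sq_int g" "sq_int \<phi>" "sq_int h"
  shows "weak_deriv (\<lambda>x. \<psi> x + c * \<phi> x) b (\<lambda>x. g x + c * h x)"
  unfolding weak_deriv_def
proof (intro conjI allI impI)
  show "(\<lambda>x. g x + c * h x) \<in> borel_measurable lborel" using assms sq_int_add[OF assms(4) sq_int_scale[OF assms(6)]] by (simp only: sq_int_def)
  fix \<eta> :: "'a \<Rightarrow> complex" assume \<eta>: "test_fun \<eta>"
  have i: "integrable lborel (\<lambda>x. f x * \<eta> x)" "integrable lborel (\<lambda>x. f x * dderiv [b] \<eta> x)" if "sq_int f" for f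
    using sq_int_mult_integrable(2)[OF that] test_sq_int test_dderiv \<eta> by blast+
  have "(\<integral>x. \<psi> x * dderiv [b] \<eta> x \<partial>lborel) = - (\<integral>x. g x * \<eta> x \<partial>lborel)"
    "(\<integral>x. \<phi> x * dderiv [b] \<eta> x \<partial>lborel) = - (\<integral>x. h x * \<eta> x \<partial>lborel)"
    using assms(1,2) \<eta> unfolding weak_deriv_def by blast+
  then show "(\<integral>x. (\<psi> x + c * \<phi> x) * dderiv [b] \<eta> x \<partial>lborel) = - (\<integral>x. (g x + c * h x) * \<eta> x \<partial>lborel)"
    using i assms(3-6) by (simp add: distrib_right mult.assoc)
qed

lemma W12_add_scale:
  assumes "W12 \<psi>" "W12 \<phi>"
  shows "W12 (\<lambda>x. \<psi> x + c * \<phi> x)"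
    "b \<in> Basis \<Longrightarrow> AE x in lborel. wd (\<lambda>x. \<psi> x + c * \<phi> x) b x = wd \<psi> b x + c * wd \<phi> b x"
proof -
  note p = wd_props[OF assms(1)] and q = wd_props[OF assms(2)] and s = W12_sq_int[OF assms(1)] W12_sq_int[OF assms(2)]
  have "sq_int (\<lambda>x. \<psi> x + c * \<phi> x)" by (intro sq_int_add sq_int_scale s)
  moreover have "sq_int (\<lambda>x. wd \<psi> b x + c * wd \<phi> b x)" if "b \<in> Basis" for b
    by (intro sq_int_add sq_int_scale p q that)
  moreover have "weak_deriv (\<lambda>x. \<psi> x + c * \<phi> x) b (\<lambda>x. wd \<psi> b x + c * wd \<phi> b x)" if "b \<in> Basis" for b
    by (intro weak_deriv_add_scale p q that s)
  ultimately show "W12 (\<lambda>x. \<psi> x + c * \<phi> x)"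
    "b \<in> Basis \<Longrightarrow> AE x in lborel. wd (\<lambda>x. \<psi> x + c * \<phi> x) b x = wd \<psi> b x + c * wd \<phi> b x"
    using W12I[of "\<lambda>x. \<psi> x + c * \<phi> x" "\<lambda>b x. wd \<psi> b x + c * wd \<phi> b x"] by blast+
qed

lemma W12_diff:
  assumes "W12 \<psi>" "W12 \<phi>"
  shows "W12 (\<lambda>x. \<psi> x - \<phi> x)"
    "b \<in> Basis \<Longrightarrow> AE x in lborel. wd (\<lambda>x. \<psi> x - \<phi> x) b x = wd \<psi> b x - wd \<phi> b x"
  using W12_add_scale[OF assms, where c = "-1"] by simp_all

lemma W12_subspace: "module.subspace cscale {\<psi> :: 'a::euclidean_space \<Rightarrow> complex. W12 \<psi>}"
proof -
  have z: "W12 (\<lambda>x::'a. 0)" by (rule test_W12[OF test_zero])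
  show ?thesis
    unfolding L2.subspace_def
  proof (intro conjI ballI allI)
    show "0 \<in> {\<psi> :: 'a \<Rightarrow> complex. W12 \<psi>}" using z by (simp add: zero_fun_def)
    show "f + g \<in> {\<psi>. W12 \<psi>}" if "f \<in> {\<psi>. W12 \<psi>}" "g \<in> {\<psi>. W12 \<psi>}" for f g :: "'a \<Rightarrow> complex"
      using W12_add_scale(1)[of f g 1] that by (simp add: plus_fun_def)
    show "cscale c f \<in> {\<psi>. W12 \<psi>}" if "f \<in> {\<psi>. W12 \<psi>}" for c and f :: "'a \<Rightarrow> complex"
      using W12_add_scale(1)[OF z, of f c] that by (simp add: cscale_def)
  qed
qed

text \<open>Closedness of the weak gradient: both sides of the defining identity are inner products
  with a fixed test function and pass to the limit. It is the source of completeness of the form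
  domain.\<close>

lemma W12_limit:
  fixes \<psi> :: "'a::euclidean_space \<Rightarrow> complex"
  assumes W: "\<And>n. W12 (\<Psi> n)" and sq: "sq_int \<psi>" "\<And>b. b \<in> Basis \<Longrightarrow> sq_int (g b)"
    and lim: "(\<lambda>n. L2norm2 (\<lambda>x. \<Psi> n x - \<psi> x)) \<longlonglongrightarrow> 0"
      "\<And>b. b \<in> Basis \<Longrightarrow> (\<lambda>n. L2norm2 (\<lambda>x. wd (\<Psi> n) b x - g b x)) \<longlonglongrightarrow> 0"
  shows "W12 \<psi>" "\<And>b. b \<in> Basis \<Longrightarrow> AE x in lborel. wd \<psi> b x = g b x"
proof -
  have "weak_deriv \<psi> b (g b)" if b: "b \<in> Basis" for b
    unfolding weak_deriv_def
  proof (intro conjI allI impI)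
    show "g b \<in> borel_measurable lborel" using sq(2)[OF b] by (simp add: sq_int_def)
    fix \<eta> :: "'a \<Rightarrow> complex" assume \<eta>: "test_fun \<eta>"
    have s: "sq_int (\<lambda>x. cnj (\<eta> x))" "sq_int (\<lambda>x. cnj (dderiv [b] \<eta> x))"
      using sq_int_cnj test_sq_int test_dderiv \<eta> by blast+
    have tl: "(\<lambda>n. L2inner (F n) h) \<longlonglongrightarrow> L2inner f h"
      if "\<And>n. sq_int (F n)" "sq_int f" "sq_int h" "(\<lambda>n. L2norm2 (\<lambda>x. F n x - f x)) \<longlonglongrightarrow> 0" for F f and h :: "'a \<Rightarrow> complex"
      using that by (intro L2.tendsto_left) (auto simp: Re_L2inner fun_diff_def)
    have "(\<lambda>n. L2inner (\<Psi> n) (\<lambda>x. cnj (dderiv [b] \<eta> x))) \<longlonglongrightarrow> L2inner \<psi> (\<lambda>x. cnj (dderiv [b] \<eta> x))"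
      by (rule tl[OF W12_sq_int[OF W] sq(1) s(2) lim(1)])
    moreover have "(\<lambda>n. - L2inner (wd (\<Psi> n) b) (\<lambda>x. cnj (\<eta> x))) \<longlonglongrightarrow> - L2inner (g b) (\<lambda>x. cnj (\<eta> x))"
      by (intro tendsto_minus tl wd_props(1) W b sq(2) s(1) lim(2))
    moreover have "L2inner (\<Psi> n) (\<lambda>x. cnj (dderiv [b] \<eta> x)) = - L2inner (wd (\<Psi> n) b) (\<lambda>x. cnj (\<eta> x))" for n
      using wd_props(2)[OF W[of n] b] \<eta> unfolding weak_deriv_def integral_as_L2inner by blast
    ultimately show "(\<integral>x. \<psi> x * dderiv [b] \<eta> x \<partial>lborel) = - (\<integral>x. g b x * \<eta> x \<partial>lborel)"
      unfolding integral_as_L2inner using LIMSEQ_unique by fastforce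
  qed
  then show "W12 \<psi>" "\<And>b. b \<in> Basis \<Longrightarrow> AE x in lborel. wd \<psi> b x = g b x"
    using W12I[of \<psi> g] sq by blast+
qed

lemma L2norm2_cong_AE_diff:
  assumes "sq_int f" "sq_int g" "sq_int h" "AE x in lborel. f x = g x"
  shows "L2norm2 (\<lambda>x. f x - h x) = L2norm2 (\<lambda>x. g x - h x)" "L2norm2 (\<lambda>x. h x - f x) = L2norm2 (\<lambda>x. h x - g x)"
  using assms by (auto intro!: L2norm2_cong_AE sq_int_diff)

lemma L2inner_cong_AE:
  assumes "sq_int f" "sq_int g" "sq_int h" "sq_int k" "AE x in lborel. f x = g x" "AE x in lborel. h x = k x"
  shows "L2inner f h = L2inner g k"
  unfolding L2inner_def using assms by (intro integral_cong_AE) (auto simp: sq_int_def)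

lemma W12_lim_D:
  assumes "W12_lim \<phi>s \<psi>"
  shows "(\<lambda>n. L2norm2 (\<lambda>x. \<phi>s n x - \<psi> x)) \<longlonglongrightarrow> 0"
    "b \<in> Basis \<Longrightarrow> (\<lambda>n. L2norm2 (\<lambda>x. dderiv [b] (\<phi>s n) x - wd \<psi> b x)) \<longlonglongrightarrow> 0"
  using assms by (auto simp: W12_lim_def)

lemma W12_lim_const: "test_fun \<phi> \<Longrightarrow> W12_lim (\<lambda>_. \<phi>) \<phi>"
  unfolding W12_lim_def
proof (intro conjI ballI)
  fix b :: 'a assume t: "test_fun \<phi>" and b: "b \<in> Basis"
  have "AE x in lborel. dderiv [b] \<phi> x - wd \<phi> b x = 0"
    using test_W12(2)[OF t b] by eventually_elim simp
  then have "L2norm2 (\<lambda>x. dderiv [b] \<phi> x - wd \<phi> b x) = 0"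
    by (subst L2norm2_eq_0_iff) (intro sq_int_diff test_sq_int test_dderiv t wd_props test_W12 b)
  then show "(\<lambda>n. L2norm2 (\<lambda>x. dderiv [b] \<phi> x - wd \<phi> b x)) \<longlonglongrightarrow> 0" by simp
qed (simp add: L2norm2_def)

lemma W12_lim_add_scale:
  assumes "\<And>n. test_fun (\<phi>s n)" "W12_lim \<phi>s \<psi>" "W12 \<psi>" "\<And>n. test_fun (\<eta>s n)" "W12_lim \<eta>s \<phi>" "W12 \<phi>"
  shows "W12_lim (\<lambda>n x. \<phi>s n x + c * \<eta>s n x) (\<lambda>x. \<psi> x + c * \<phi> x)"
  unfolding W12_lim_def
proof (intro conjI ballI)
  note t = test_sq_int[OF assms(1)] test_sq_int[OF assms(4)] W12_sq_int[OF assms(3)] W12_sq_int[OF assms(6)]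
  show "(\<lambda>n. L2norm2 (\<lambda>x. \<phi>s n x + c * \<eta>s n x - (\<psi> x + c * \<phi> x))) \<longlonglongrightarrow> 0"
    by (intro L2norm2_add_tendsto t W12_lim_D assms)
  fix b :: 'a assume b: "b \<in> Basis"
  note d = test_sq_int[OF test_dderiv[OF assms(1)]] test_sq_int[OF test_dderiv[OF assms(4)]]
    wd_props(1)[OF assms(3) b] wd_props(1)[OF assms(6) b]
  have "(\<lambda>n. L2norm2 (\<lambda>x. dderiv [b] (\<phi>s n) x + c * dderiv [b] (\<eta>s n) x - (wd \<psi> b x + c * wd \<phi> b x))) \<longlonglongrightarrow> 0"
    by (intro L2norm2_add_tendsto d W12_lim_D assms b)
  moreover have "L2norm2 (\<lambda>x. dderiv [b] (\<lambda>x. \<phi>s n x + c * \<eta>s n x) x - wd (\<lambda>x. \<psi> x + c * \<phi> x) b x) =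
      L2norm2 (\<lambda>x. dderiv [b] (\<phi>s n) x + c * dderiv [b] (\<eta>s n) x - (wd \<psi> b x + c * wd \<phi> b x))" for n
    unfolding dderiv_add_scale[OF test_smooth[OF assms(1)] test_smooth[OF assms(4)]]
    by (intro L2norm2_cong_AE_diff sq_int_add sq_int_scale d wd_props W12_add_scale assms b)
  ultimately show "(\<lambda>n. L2norm2 (\<lambda>x. dderiv [b] (\<lambda>x. \<phi>s n x + c * \<eta>s n x) x - wd (\<lambda>x. \<psi> x + c * \<phi> x) b x)) \<longlonglongrightarrow> 0"
    by simp
qed

section \<open>The transverse one-dimensional problem\<close>

lemma test_has_vector_derivative:
  fixes \<phi> :: "real \<Rightarrow> complex"
  assumes "test_fun \<phi>"
  shows "(\<phi> has_vector_derivative dderiv [1] \<phi> x) (at x)"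
proof -
  have "dderiv [v *\<^sub>R 1] \<phi> x = v *\<^sub>R dderiv [1] \<phi> x" for v
    by (rule linear_scale[OF dderiv_linear[OF test_smooth[OF assms]]])
  then have "dderiv [v] \<phi> x = v *\<^sub>R dderiv [1] \<phi> x" for v
    unfolding real_scaleR_def mult_1_right .
  then show ?thesis
    unfolding has_vector_derivative_def
    by (intro has_derivative_eq_rhs[OF smooth_has_derivative[OF test_smooth[OF assms]]] ext)
qed

text \<open>Links the gauge integral, for which the fundamental theorem tolerates finitely many
  exceptional points, with the Lebesgue integral. The exceptional set accommodates the kinks of the
  ground state at a and - a.\<close>

lemma integral_up_to_FTC:
  fixes F h :: "real \<Rightarrow> complex"
  assumes F: "continuous_on UNIV F" and S: "finite S" "\<And>x. x \<notin> S \<Longrightarrow> (F has_vector_derivative h x) (at x)"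
    and h: "integrable lborel h" "\<And>x. x < - R \<Longrightarrow> h x = 0" and F0: "\<And>x. x \<le> - R \<Longrightarrow> F x = 0"
  shows "(\<integral>x. indicator {..c} x *\<^sub>R h x \<partial>lborel) = F c"
proof -
  define R' where "R' = max R (- c)"
  have "(h has_integral (F c - F (- R'))) {- R'..c}"
    using S by (intro fundamental_theorem_of_calculus_interior_strong[OF S(1)] continuous_on_subset[OF F])
      (auto simp: R'_def)
  moreover have "F (- R') = 0" by (rule F0) (simp add: R'_def)
  ultimately have "((\<lambda>x. if x \<in> {- R'..c} then h x else 0) has_integral F c) UNIV"
    by (simp only: has_integral_restrict_UNIV diff_zero)
  moreover have "(\<lambda>x. if x \<in> {- R'..c} then h x else 0) = (\<lambda>x. indicator {..c} x *\<^sub>R h x)"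
    using h(2) by (auto simp: fun_eq_iff indicator_def R'_def)
  moreover have "((\<lambda>x. indicator {..c} x *\<^sub>R h x) has_integral (\<integral>x. indicator {..c} x *\<^sub>R h x \<partial>lborel)) UNIV"
    by (intro has_integral_integral_lborel integrable_mult_indicator h) auto
  ultimately show ?thesis using has_integral_unique by metis
qed

text \<open>A common class for test functions and the ground state \<open>gs\<close>, which is not
  differentiable at a and - a.\<close>

definition piecewise_C1_L2 :: "(real \<Rightarrow> complex) \<Rightarrow> (real \<Rightarrow> complex) \<Rightarrow> bool" where
  "piecewise_C1_L2 f g \<longleftrightarrow> continuous_on UNIV f \<and> sq_int f \<and> sq_int g \<and>
     (\<exists>S. finite S \<and> (\<forall>x. x \<notin> S \<longrightarrow> (f has_vector_derivative g x) (at x)))"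

lemma test_piecewise_C1: "test_fun \<phi> \<Longrightarrow> piecewise_C1_L2 \<phi> (dderiv [1] \<phi>)"
  unfolding piecewise_C1_L2_def
  by (intro conjI exI[of _ "{}"] allI impI smooth_continuous test_smooth test_sq_int test_dderiv
      test_has_vector_derivative) auto

lemma piecewise_C1_parts:
  assumes pc: "piecewise_C1_L2 f g" and \<theta>: "test_fun \<theta>"
  shows "(\<integral>x. indicator {..c} x *\<^sub>R (f x * dderiv [1] \<theta> x + g x * \<theta> x) \<partial>lborel) = f c * \<theta> c"
proof -
  obtain S where S: "finite S" "\<And>x. x \<notin> S \<Longrightarrow> (f has_vector_derivative g x) (at x)"
    using pc by (auto simp: piecewise_C1_L2_def)
  have f: "continuous_on UNIV f" "sq_int f" "sq_int g" using pc by (auto simp: piecewise_C1_L2_def)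
  obtain R1 R2 where R: "\<And>x. norm x > R1 \<Longrightarrow> \<theta> x = 0" "\<And>x. norm x > R2 \<Longrightarrow> dderiv [1] \<theta> x = 0"
    using \<theta> test_dderiv[OF \<theta>] by (metis test_fun_iff)
  define R where "R = \<bar>R1\<bar> + \<bar>R2\<bar> + 1"
  show ?thesis
  proof (rule integral_up_to_FTC[where S = S and R = R])
    show "continuous_on UNIV (\<lambda>x. f x * \<theta> x)"
      using f smooth_continuous[OF test_smooth[OF \<theta>]] by (intro continuous_intros)
    show "((\<lambda>x. f x * \<theta> x) has_vector_derivative f x * dderiv [1] \<theta> x + g x * \<theta> x) (at x)" if "x \<notin> S" for x
      using has_vector_derivative_mult[OF S(2)[OF that] test_has_vector_derivative[OF \<theta>]] by simp
    show "integrable lborel (\<lambda>x. f x * dderiv [1] \<theta> x + g x * \<theta> x)"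
      using f \<theta> test_sq_int test_dderiv by (intro Bochner_Integration.integrable_add sq_int_mult_integrable(2)) blast+
    show "f x * dderiv [1] \<theta> x + g x * \<theta> x = 0" if "x < - R" for x
      using R[of x] that by (simp add: R_def)
    show "f x * \<theta> x = 0" if "x \<le> - R" for x
      using R[of x] that by (simp add: R_def)
  qed (rule S(1))
qed

lemma piecewise_C1_weak_deriv:
  assumes pc: "piecewise_C1_L2 f g" shows "weak_deriv f 1 g"
  unfolding weak_deriv_def
proof (intro conjI allI impI)
  have f: "sq_int f" "sq_int g" using pc by (auto simp: piecewise_C1_L2_def)
  show "g \<in> borel_measurable lborel" using f by (simp add: sq_int_def)
  fix \<theta> :: "real \<Rightarrow> complex" assume \<theta>: "test_fun \<theta>"
  obtain R1 R2 where R: "\<And>x. norm x > R1 \<Longrightarrow> \<theta> x = 0" "\<And>x. norm x > R2 \<Longrightarrow> dderiv [1] \<theta> x = 0"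
    using \<theta> test_dderiv[OF \<theta>] by (metis test_fun_iff)
  define c where "c = \<bar>R1\<bar> + \<bar>R2\<bar> + 1"
  have "f x * dderiv [1] \<theta> x + g x * \<theta> x = indicator {..c} x *\<^sub>R (f x * dderiv [1] \<theta> x + g x * \<theta> x)" for x
    using R[of x] by (auto simp: indicator_def c_def)
  then have "(\<integral>x. f x * dderiv [1] \<theta> x + g x * \<theta> x \<partial>lborel) = f c * \<theta> c"
    using piecewise_C1_parts[OF pc \<theta>, of c] by presburger
  also have "\<dots> = 0" using R(1)[of c] by (simp add: c_def)
  finally have "(\<integral>x. f x * dderiv [1] \<theta> x + g x * \<theta> x \<partial>lborel) = 0" .
  moreover have "integrable lborel (\<lambda>x. f x * dderiv [1] \<theta> x)" "integrable lborel (\<lambda>x. g x * \<theta> x)"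
    using f \<theta> test_sq_int test_dderiv sq_int_mult_integrable(2) by blast+
  ultimately show "(\<integral>x. f x * dderiv [1] \<theta> x \<partial>lborel) = - (\<integral>x. g x * \<theta> x \<partial>lborel)"
    by (simp add: add_eq_0_iff)
qed

lemma piecewise_C1_W12:
  assumes pc: "piecewise_C1_L2 f g"
  shows "W12 f" "AE x in lborel. wd f 1 x = g x"
  using W12I[of f "\<lambda>_. g"] piecewise_C1_weak_deriv[OF pc] pc by (auto simp: piecewise_C1_L2_def)

text \<open>Point evaluation is the \<open>W\<^sup>1\<^sup>,\<^sup>2\<close>-continuous functional \<open>f \<mapsto> \<langle>f', A\<rangle> + \<langle>f, B\<rangle>\<close>
  with \<open>A\<close>, \<open>B\<close> the truncations to \<open>{..c}\<close> of a test function and its derivative.\<close>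

lemma point_evaluation:
  fixes c :: real
  obtains A B where "sq_int A" "sq_int B" "\<And>f g. piecewise_C1_L2 f g \<Longrightarrow> f c = L2inner g A + L2inner f B"
proof -
  have "\<forall>\<^sub>F k in sequentially. cutoff k c \<noteq> 0"
    by (rule tendsto_imp_eventually_ne[OF cutoff_tendsto]) simp
  then obtain k where k: "cutoff k c \<noteq> 0" using eventually_happens trivial_limit_sequentially by blast
  define \<theta> :: "real \<Rightarrow> complex" where "\<theta> = cutoff k"
  have \<theta>: "test_fun \<theta>" "\<theta> c \<noteq> 0" using k cutoff_test by (auto simp: \<theta>_def)
  define A where "A x = cnj (indicator {..c} x * (\<theta> x / \<theta> c))" for x
  define B where "B x = cnj (indicator {..c} x * (dderiv [1] \<theta> x / \<theta> c))" for x
  have sq: "sq_int (\<lambda>x. cnj (indicator {..c} x * (\<eta> x / \<theta> c)))" if "test_fun \<eta>" for \<eta> :: "real \<Rightarrow> complex"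
  proof -
    have [measurable]: "\<eta> \<in> borel_measurable borel" using Cc_measurable[OF test_Cc[OF that]] .
    have s: "sq_int (\<lambda>x. (1 / \<theta> c) * \<eta> x)" using sq_int_scale[OF test_sq_int[OF that]] .
    show ?thesis
      by (rule sq_intI_bound[OF _ sq_int_integrable[OF s]])
         (auto simp: norm_mult norm_divide indicator_def intro!: borel_measurable_cnj)
  qed
  show ?thesis
  proof (rule that)
    show AB: "sq_int A" "sq_int B" unfolding A_def B_def by (intro sq test_dderiv \<theta>)+
    fix f g assume pc: "piecewise_C1_L2 f g"
    then have f: "sq_int f" "sq_int g" by (auto simp: piecewise_C1_L2_def)
    have "L2inner g A + L2inner f B = (\<integral>x. g x * cnj (A x) + f x * cnj (B x) \<partial>lborel)"
      unfolding L2inner_def using AB f by (simp add: sq_int_mult_integrable)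
    also have "\<dots> = (\<integral>x. (indicator {..c} x *\<^sub>R (f x * dderiv [1] \<theta> x + g x * \<theta> x)) / \<theta> c \<partial>lborel)"
      by (intro Bochner_Integration.integral_cong) (auto simp: A_def B_def indicator_def add_divide_distrib)
    also have "\<dots> = f c" using piecewise_C1_parts[OF pc \<theta>(1), of c] \<theta>(2) by simp
    finally show "f c = L2inner g A + L2inner f B" by simp
  qed
qed

lemma W12_real_limD:
  fixes \<psi> :: "real \<Rightarrow> complex"
  assumes "W12 \<psi>" "\<And>n. test_fun (\<phi>s n)" "W12_lim \<phi>s \<psi>" "sq_int f"
  shows "(\<lambda>n. L2inner (\<phi>s n) f) \<longlonglongrightarrow> L2inner \<psi> f" "(\<lambda>n. L2inner (dderiv [1] (\<phi>s n)) f) \<longlonglongrightarrow> L2inner (wd \<psi> 1) f"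
    "(\<lambda>n. L2inner f (\<phi>s n)) \<longlonglongrightarrow> L2inner f \<psi>" "(\<lambda>n. L2inner f (dderiv [1] (\<phi>s n))) \<longlonglongrightarrow> L2inner f (wd \<psi> 1)"
    "(\<lambda>n. L2norm2 (\<phi>s n)) \<longlonglongrightarrow> L2norm2 \<psi>" "(\<lambda>n. L2norm2 (dderiv [1] (\<phi>s n))) \<longlonglongrightarrow> L2norm2 (wd \<psi> 1)"
proof -
  note s = test_sq_int[OF assms(2)] W12_sq_int[OF assms(1)] W12_lim_D(1)[OF assms(3)]
  have 1: "(1::real) \<in> Basis" by simp
  note d = test_sq_int[OF test_dderiv[OF assms(2)]] wd_props(1)[OF assms(1) 1] W12_lim_D(2)[OF assms(3) 1]
  have z: "(\<lambda>n. L2norm2 (\<lambda>x. f x - f x)) \<longlonglongrightarrow> 0" by (simp add: L2norm2_def)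
  note f = assms(4) assms(4) z
  show "(\<lambda>n. L2inner (\<phi>s n) f) \<longlonglongrightarrow> L2inner \<psi> f" by (rule L2inner_tendsto[OF s f])
  show "(\<lambda>n. L2inner (dderiv [1] (\<phi>s n)) f) \<longlonglongrightarrow> L2inner (wd \<psi> 1) f" by (rule L2inner_tendsto[OF d f])
  show "(\<lambda>n. L2inner f (\<phi>s n)) \<longlonglongrightarrow> L2inner f \<psi>" by (rule L2inner_tendsto[OF f s])
  show "(\<lambda>n. L2inner f (dderiv [1] (\<phi>s n))) \<longlonglongrightarrow> L2inner f (wd \<psi> 1)" by (rule L2inner_tendsto[OF f d])
  show "(\<lambda>n. L2norm2 (\<phi>s n)) \<longlonglongrightarrow> L2norm2 \<psi>" by (rule L2norm2_tendsto[OF s])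
  show "(\<lambda>n. L2norm2 (dderiv [1] (\<phi>s n))) \<longlonglongrightarrow> L2norm2 (wd \<psi> 1)" by (rule L2norm2_tendsto[OF d])
qed

text \<open>Point evaluation on test functions is continuous in the \<open>W12\<close> sense, so the
  limit of the values at c is the same for every approximating sequence. Hence the choice in
  \<open>tr_pt\<close> is forced, and the trace inherits the formula.\<close>

lemma tr_pt_functional:
  fixes c :: real
  obtains A B where "sq_int A" "sq_int B"
    "\<And>f g. piecewise_C1_L2 f g \<Longrightarrow> f c = L2inner g A + L2inner f B"
    "\<And>\<psi>. W12 \<psi> \<Longrightarrow> tr_pt \<psi> c = L2inner (wd \<psi> 1) A + L2inner \<psi> B"
    "\<And>\<psi> \<phi>s. W12 \<psi> \<Longrightarrow> (\<And>n. test_fun (\<phi>s n)) \<Longrightarrow> W12_lim \<phi>s \<psi> \<Longrightarrow> (\<lambda>n. \<phi>s n c) \<longlonglongrightarrow> tr_pt \<psi> c"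
proof -
  obtain A B where AB: "sq_int A" "sq_int B" and ev: "\<And>f g. piecewise_C1_L2 f g \<Longrightarrow> f c = L2inner g A + L2inner f B"
    using point_evaluation by blast
  have lim: "(\<lambda>n. \<phi>s n c) \<longlonglongrightarrow> L2inner (wd \<psi> 1) A + L2inner \<psi> B"
    if "W12 \<psi>" "\<And>n. test_fun (\<phi>s n)" "W12_lim \<phi>s \<psi>" for \<psi> \<phi>s
    unfolding ev[OF test_piecewise_C1[OF that(2)]]
    by (intro tendsto_add W12_real_limD that AB)
  have tr: "tr_pt \<psi> c = L2inner (wd \<psi> 1) A + L2inner \<psi> B" if W: "W12 \<psi>" for \<psi>
  proof -
    obtain \<phi>s where "\<forall>n. test_fun (\<phi>s n)" "W12_lim \<phi>s \<psi>" using W12_test_dense[OF W] by blast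
    then have "\<exists>z. is_trace_pt \<psi> c z" unfolding is_trace_pt_def using lim[OF W] by blast
    then have "is_trace_pt \<psi> c (tr_pt \<psi> c)" unfolding tr_pt_def by (rule someI_ex)
    then show ?thesis unfolding is_trace_pt_def using lim[OF W] LIMSEQ_unique by blast
  qed
  show ?thesis using that[OF AB ev tr] lim tr by auto
qed

lemma tr_pt_tendsto:
  "W12 \<psi> \<Longrightarrow> (\<And>n. test_fun (\<phi>s n)) \<Longrightarrow> W12_lim \<phi>s \<psi> \<Longrightarrow> (\<lambda>n. \<phi>s n c) \<longlonglongrightarrow> tr_pt \<psi> c"
  by (rule tr_pt_functional[of c]) blast

lemma tr_pt_piecewise_C1:
  assumes "piecewise_C1_L2 f g" shows "tr_pt f c = f c"
proof -
  obtain A B where AB: "sq_int A" "sq_int B"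
    and f: "f c = L2inner g A + L2inner f B" "tr_pt f c = L2inner (wd f 1) A + L2inner f B"
    using tr_pt_functional[of c] assms piecewise_C1_W12(1)[OF assms] by metis
  have "L2inner (wd f 1) A = L2inner g A"
    using piecewise_C1_W12[OF assms] AB assms wd_props(1)[OF piecewise_C1_W12(1)[OF assms], of 1]
    by (intro L2inner_cong_AE) (auto simp: piecewise_C1_L2_def)
  then show ?thesis using f by simp
qed

subsection \<open>Riccati inequalities\<close>

lemma test_continuous_density:
  fixes \<phi> :: "real \<Rightarrow> complex"
  assumes "test_fun \<phi>"
  shows "continuous_on UNIV (\<lambda>x. (cmod (dderiv [1] \<phi> x))\<^sup>2 + K * (cmod (\<phi> x))\<^sup>2)"
  using smooth_continuous test_smooth test_dderiv assms by (intro continuous_intros) blast+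

text \<open>Integrate \<open>\<bar>\<phi>' - w\<phi>\<bar>\<^sup>2 \<ge> 0\<close> by parts for a solution \<open>w\<close> of \<open>w' + w\<^sup>2 = K\<close>.\<close>

lemma riccati_interval:
  fixes \<phi> :: "real \<Rightarrow> complex"
  assumes \<phi>: "test_fun \<phi>" and "p \<le> q"
    and w: "\<And>x. x \<in> {p..q} \<Longrightarrow> (w has_real_derivative (K - (w x)\<^sup>2)) (at x)"
  shows "w q * (cmod (\<phi> q))\<^sup>2 - w p * (cmod (\<phi> p))\<^sup>2 \<le> integral {p..q} (\<lambda>x. (cmod (dderiv [1] \<phi> x))\<^sup>2 + K * (cmod (\<phi> x))\<^sup>2)"
proof -
  let ?d = "dderiv [1] \<phi>"
  have u: "((\<lambda>x. (cmod (\<phi> x))\<^sup>2) has_real_derivative 2 * (\<phi> x \<bullet> ?d x)) (at x)" for x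
  proof -
    have "((\<lambda>x. \<phi> x \<bullet> \<phi> x) has_derivative (\<lambda>h. \<phi> x \<bullet> (h *\<^sub>R ?d x) + (h *\<^sub>R ?d x) \<bullet> \<phi> x)) (at x)"
      using test_has_vector_derivative[OF \<phi>, of x] unfolding has_vector_derivative_def by (intro has_derivative_inner)
    then show ?thesis
      unfolding has_field_derivative_def power2_norm_eq_inner
      by (rule has_derivative_eq_rhs) (auto simp: fun_eq_iff inner_commute)
  qed
  define h where "h x = (K - (w x)\<^sup>2) * (cmod (\<phi> x))\<^sup>2 + 2 * (\<phi> x \<bullet> ?d x) * w x" for x
  have 1: "(h has_integral (w q * (cmod (\<phi> q))\<^sup>2 - w p * (cmod (\<phi> p))\<^sup>2)) {p..q}"
  proof (rule fundamental_theorem_of_calculus[OF \<open>p \<le> q\<close>])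
    fix x assume "x \<in> {p..q}"
    from DERIV_mult[OF w[OF this] u]
    show "((\<lambda>x. w x * (cmod (\<phi> x))\<^sup>2) has_vector_derivative h x) (at x within {p..q})"
      unfolding h_def has_real_derivative_iff_has_vector_derivative[symmetric]
      by (rule has_field_derivative_at_within)
  qed
  have 2: "(\<lambda>x. (cmod (?d x))\<^sup>2 + K * (cmod (\<phi> x))\<^sup>2) integrable_on {p..q}"
    by (intro integrable_continuous_real continuous_on_subset[OF test_continuous_density[OF \<phi>]]) auto
  have "h x \<le> (cmod (?d x))\<^sup>2 + K * (cmod (\<phi> x))\<^sup>2" for x
  proof -
    have "0 \<le> (?d x - w x *\<^sub>R \<phi> x) \<bullet> (?d x - w x *\<^sub>R \<phi> x)" by simp
    also have "\<dots> = (cmod (?d x))\<^sup>2 - 2 * w x * (\<phi> x \<bullet> ?d x) + (w x)\<^sup>2 * (cmod (\<phi> x))\<^sup>2"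
      by (simp add: power2_norm_eq_inner inner_diff_left inner_diff_right inner_commute power2_eq_square[of "w x"])
    finally show ?thesis unfolding h_def by (simp add: algebra_simps)
  qed
  then show ?thesis using has_integral_le[OF 1 integrable_integral[OF 2]] by blast
qed

lemma test_integral_le_L2norm2:
  fixes \<phi> :: "real \<Rightarrow> complex"
  assumes \<phi>: "test_fun \<phi>" and "K \<ge> 0"
  shows "integral {p..q} (\<lambda>x. (cmod (dderiv [1] \<phi> x))\<^sup>2 + K * (cmod (\<phi> x))\<^sup>2) \<le> L2norm2 (dderiv [1] \<phi>) + K * L2norm2 \<phi>"
proof -
  let ?h = "\<lambda>x. (cmod (dderiv [1] \<phi> x))\<^sup>2 + K * (cmod (\<phi> x))\<^sup>2"
  have int: "integrable lborel ?h"
    using sq_int_integrable test_sq_int test_dderiv \<phi> by (intro Bochner_Integration.integrable_add integrable_mult_right) blast+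
  have "integral {p..q} ?h \<le> integral UNIV ?h"
    using \<open>K \<ge> 0\<close>
    by (intro integral_subset_le integrable_continuous_real continuous_on_subset[OF test_continuous_density[OF \<phi>]] integrable_on_lborel[OF int]) auto
  also have "\<dots> = L2norm2 (dderiv [1] \<phi>) + K * L2norm2 \<phi>"
    unfolding integral_lborel[OF int] L2norm2_def
    using sq_int_integrable[OF test_sq_int[OF \<phi>]] sq_int_integrable[OF test_sq_int[OF test_dderiv[OF \<phi>, of 1]]] by simp
  finally show ?thesis .
qed

text \<open>The constant w = \<delta> solves the Riccati equation with K = \<delta>^2; the left end
  is placed outside the support, so only the boundary term at c remains.\<close>

lemma point_bound:
  fixes \<phi> :: "real \<Rightarrow> complex"
  assumes \<phi>: "test_fun \<phi>" and "\<delta> > 0"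
  shows "\<delta> * (cmod (\<phi> c))\<^sup>2 \<le> L2norm2 (dderiv [1] \<phi>) + \<delta>\<^sup>2 * L2norm2 \<phi>"
proof -
  obtain R where R: "\<And>x. norm x > R \<Longrightarrow> \<phi> x = 0" using \<phi> by (auto simp: test_fun_iff)
  define p where "p = - (\<bar>R\<bar> + \<bar>c\<bar> + 1)"
  have "\<phi> p = 0" by (rule R) (auto simp: p_def)
  moreover have "p \<le> c" by (simp add: p_def)
  ultimately have "\<delta> * (cmod (\<phi> c))\<^sup>2 \<le> integral {p..c} (\<lambda>x. (cmod (dderiv [1] \<phi> x))\<^sup>2 + \<delta>\<^sup>2 * (cmod (\<phi> x))\<^sup>2)"
    using riccati_interval[OF \<phi>, of p c "\<lambda>_. \<delta>" "\<delta>\<^sup>2"] by simp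
  also have "\<dots> \<le> L2norm2 (dderiv [1] \<phi>) + \<delta>\<^sup>2 * L2norm2 \<phi>" by (rule test_integral_le_L2norm2[OF \<phi>]) simp
  finally show ?thesis .
qed

text \<open>The logarithmic derivative w of the ground state has three branches: k, then k tanh (k
  x), then - k. Each solves w' + w^2 = k^2, and at both - a and a the value drops by k + k tanh (k
  a) = \<alpha>. Summing the three intervals leaves exactly these drops.\<close>

lemma two_point_bound:
  fixes \<phi> :: "real \<Rightarrow> complex"
  assumes \<phi>: "test_fun \<phi>" and "a > 0" and \<alpha>: "k * (1 + tanh (k * a)) = \<alpha>"
  shows "\<alpha> * ((cmod (\<phi> a))\<^sup>2 + (cmod (\<phi> (- a)))\<^sup>2) \<le> L2norm2 (dderiv [1] \<phi>) + k\<^sup>2 * L2norm2 \<phi>"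
proof -
  let ?h = "\<lambda>x. (cmod (dderiv [1] \<phi> x))\<^sup>2 + k\<^sup>2 * (cmod (\<phi> x))\<^sup>2"
  obtain R where R: "\<And>x. norm x > R \<Longrightarrow> \<phi> x = 0" using \<phi> by (auto simp: test_fun_iff)
  define p where "p = \<bar>R\<bar> + a + 1"
  have z: "\<phi> p = 0" "\<phi> (- p) = 0" by (rule R, use \<open>a > 0\<close> in \<open>simp add: p_def\<close>)+
  have le: "- p \<le> - a" "- a \<le> a" "a \<le> p" using \<open>a > 0\<close> by (auto simp: p_def)
  have th: "((\<lambda>x. k * tanh (k * x)) has_real_derivative (k\<^sup>2 - (k * tanh (k * x))\<^sup>2)) (at x)" for x :: real
    by (auto intro!: derivative_eq_intros simp: power2_eq_square algebra_simps)
  have i: "?h integrable_on {u..v}" for u v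
    by (intro integrable_continuous_real continuous_on_subset[OF test_continuous_density[OF \<phi>]]) auto
  have "k * (cmod (\<phi> (- a)))\<^sup>2 \<le> integral {- p..- a} ?h"
    using riccati_interval[OF \<phi> le(1), of "\<lambda>_. k" "k\<^sup>2"] z by simp
  moreover have "k * tanh (k * a) * (cmod (\<phi> a))\<^sup>2 + k * tanh (k * a) * (cmod (\<phi> (- a)))\<^sup>2 \<le> integral {- a..a} ?h"
    using riccati_interval[OF \<phi> le(2), of "\<lambda>x. k * tanh (k * x)" "k\<^sup>2"] th by simp
  moreover have "k * (cmod (\<phi> a))\<^sup>2 \<le> integral {a..p} ?h"
    using riccati_interval[OF \<phi> le(3), of "\<lambda>_. - k" "k\<^sup>2"] z by simp
  moreover have "integral {- p..- a} ?h + integral {- a..a} ?h = integral {- p..a} ?h"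
    using le by (intro Henstock_Kurzweil_Integration.integral_combine i) auto
  moreover have "integral {- p..a} ?h + integral {a..p} ?h = integral {- p..p} ?h"
    using le by (intro Henstock_Kurzweil_Integration.integral_combine i) auto
  moreover have "integral {- p..p} ?h \<le> L2norm2 (dderiv [1] \<phi>) + k\<^sup>2 * L2norm2 \<phi>"
    by (rule test_integral_le_L2norm2[OF \<phi>]) simp
  moreover have "\<alpha> * ((cmod (\<phi> a))\<^sup>2 + (cmod (\<phi> (- a)))\<^sup>2) = k * (cmod (\<phi> (- a)))\<^sup>2 +
      (k * tanh (k * a) * (cmod (\<phi> a))\<^sup>2 + k * tanh (k * a) * (cmod (\<phi> (- a)))\<^sup>2) + k * (cmod (\<phi> a))\<^sup>2"
    unfolding \<alpha>[symmetric] by (simp add: algebra_simps)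
  ultimately show ?thesis by linarith
qed

text \<open>The equation matches the derivative jump of the even bound state with decay rate k to
  the strength \<alpha>. The left side is 0 at k = 0 and at least \<alpha> at k = \<alpha>.\<close>

lemma exists_decay_rate:
  fixes a \<alpha> :: real
  assumes "a > 0" "\<alpha> > 0"
  obtains k where "k > 0" "k * (1 + tanh (k * a)) = \<alpha>"
proof -
  have "\<exists>k. 0 \<le> k \<and> k \<le> \<alpha> \<and> k * (1 + tanh (k * a)) = \<alpha>"
  proof (rule IVT'[of "\<lambda>k. k * (1 + tanh (k * a))"])
    show "\<alpha> \<le> \<alpha> * (1 + tanh (\<alpha> * a))" using assms by simp
    show "continuous_on {0..\<alpha>} (\<lambda>k. k * (1 + tanh (k * a)))" by (intro continuous_intros) auto
  qed (use assms in auto)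
  then obtain k where k: "0 \<le> k" "k * (1 + tanh (k * a)) = \<alpha>" by blast
  then have "k \<noteq> 0" using assms by auto
  then show ?thesis using that[of k] k by simp
qed

subsection \<open>The transverse ground state\<close>

text \<open>Up to the factor c, the function is the exponential density plus its reflection, except
  at 0, where the sum is larger.\<close>

lemma exp_abs_integrable:
  fixes c :: real assumes "c > 0" shows "integrable lborel (\<lambda>x::real. exp (- c * \<bar>x\<bar>))"
proof -
  interpret prob_space "density lborel (exponential_density c)"
    by (rule prob_space_exponential_density[OF assms])
  have "(\<integral>\<^sup>+x. ennreal (exponential_density c x) \<partial>lborel) = 1"
    using emeasure_space_1 by (simp add: emeasure_density)
  then have i: "integrable lborel (exponential_density c)"
    using exponential_density_nonneg[OF assms] by (intro integrableI_nonneg) auto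
  have j: "integrable lborel (\<lambda>x. exponential_density c (- x))"
    using lborel_integrable_real_affine[OF i, of "-1" 0] by simp
  show ?thesis
  proof (rule Bochner_Integration.integrable_bound)
    show "integrable lborel (\<lambda>x. (1 / c) * (exponential_density c x + exponential_density c (- x)))"
      using i j by simp
    show "AE x in lborel. norm (exp (- c * \<bar>x\<bar>)) \<le> norm ((1 / c) * (exponential_density c x + exponential_density c (- x)))"
      using assms by (auto simp: exponential_density_def mult.commute)
  qed simp
qed

context
  fixes a k \<alpha> :: real
  assumes a: "a > 0" and k: "k > 0" and rate: "k * (1 + tanh (k * a)) = \<alpha>"
begin

text \<open>A single expression with clamped arguments, so that continuity is immediate;
  \<open>gs_eq\<close> recovers the three branches. The normalisation gives the value 1 at both a
  and - a.\<close>

definition gs :: "real \<Rightarrow> complex" where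
  "gs x = of_real (exp (- k * max 0 (\<bar>x\<bar> - a)) * cosh (k * max (- a) (min a x)) / cosh (k * a))"

definition gs' :: "real \<Rightarrow> complex" where
  "gs' x = of_real (if x < - a then k * exp (k * (x + a)) else if x \<le> a then k * sinh (k * x) / cosh (k * a)
     else - k * exp (- k * (x - a)))"

lemma gs_eq:
  "x \<le> - a \<Longrightarrow> gs x = of_real (exp (k * (x + a)))"
  "- a \<le> x \<Longrightarrow> x \<le> a \<Longrightarrow> gs x = of_real (cosh (k * x) / cosh (k * a))"
  "a \<le> x \<Longrightarrow> gs x = of_real (exp (- k * (x - a)))"
  using a by (auto simp: gs_def max_def min_def abs_if algebra_simps)

lemma gs_at: "gs a = 1" "gs (- a) = 1"
  using gs_eq(3)[of a] gs_eq(1)[of "- a"] by auto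

lemma gs_bound: "cmod (gs x) \<le> exp (k * a) * exp (- k * \<bar>x\<bar>)" "cmod (gs' x) \<le> k * (exp (k * a) * exp (- k * \<bar>x\<bar>))"
proof -
  have e: "exp (k * a) * exp (- k * \<bar>x\<bar>) = exp (- k * (\<bar>x\<bar> - a))" by (simp add: exp_add[symmetric] algebra_simps)
  have c: "cosh (k * x) / cosh (k * a) \<le> exp (- k * (\<bar>x\<bar> - a))" if "\<bar>x\<bar> \<le> a"
  proof -
    have "cosh (k * x) = cosh (\<bar>k * x\<bar>)" by simp
    also have "\<dots> \<le> cosh (k * a)"
      by (subst cosh_real_nonneg_le_iff) (use that k a in \<open>auto simp: abs_mult\<close>)
    finally have "cosh (k * x) / cosh (k * a) \<le> 1" by simp
    also have "1 \<le> exp (- k * (\<bar>x\<bar> - a))" using that k by (simp add: mult_nonneg_nonpos)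
    finally show ?thesis .
  qed
  consider "x < - a" | "\<bar>x\<bar> \<le> a" | "x > a" by linarith
  then show "cmod (gs x) \<le> exp (k * a) * exp (- k * \<bar>x\<bar>)"
  proof cases
    case 2
    then have "gs x = of_real (cosh (k * x) / cosh (k * a))" by (intro gs_eq(2)) auto
    then show ?thesis unfolding e using c[OF 2] by (simp only: norm_of_real) simp
  next
    case 1
    then show ?thesis unfolding e using gs_eq(1)[of x] a by (simp only: norm_of_real) (simp add: algebra_simps)
  next
    case 3
    then show ?thesis unfolding e using gs_eq(3)[of x] a by (simp only: norm_of_real) simp
  qed
  have s: "\<bar>sinh (k * x)\<bar> \<le> cosh (k * x)" by (rule power2_le_imp_le) (simp_all add: cosh_square_eq)
  consider "x < - a" | "\<bar>x\<bar> \<le> a" | "x > a" by linarith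
  then show "cmod (gs' x) \<le> k * (exp (k * a) * exp (- k * \<bar>x\<bar>))"
  proof cases
    case 2
    then have "\<not> x < - a" "x \<le> a" by auto
    then have "gs' x = of_real (k * (sinh (k * x) / cosh (k * a)))" by (simp add: gs'_def)
    then have "cmod (gs' x) = k * (\<bar>sinh (k * x)\<bar> / cosh (k * a))" using k by (simp only: norm_of_real) (simp add: abs_mult)
    also have "\<dots> \<le> k * (cosh (k * x) / cosh (k * a))" using s k by (intro mult_left_mono divide_right_mono) auto
    also have "\<dots> \<le> k * exp (- k * (\<bar>x\<bar> - a))" using c[OF 2] k by (intro mult_left_mono) auto
    finally show ?thesis unfolding e .
  next
    case 1
    then have "gs' x = of_real (k * exp (k * (x + a)))" by (simp add: gs'_def)
    then show ?thesis unfolding e using 1 a k by (simp only: norm_of_real) (simp add: abs_mult algebra_simps)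
  next
    case 3
    then have "gs' x = of_real (- k * exp (- k * (x - a)))" using a by (simp add: gs'_def)
    then show ?thesis unfolding e using 3 a k by (simp only: norm_of_real) (simp add: abs_mult)
  qed
qed

lemma gs_sq_int: "sq_int gs" "sq_int gs'"
proof -
  have w: "integrable lborel (\<lambda>x::real. C * exp (- (2 * k) * \<bar>x\<bar>))" for C
    using exp_abs_integrable[of "2 * k"] k by simp
  have sq: "(exp (k * a) * exp (- k * \<bar>x\<bar>))\<^sup>2 = (exp (k * a))\<^sup>2 * exp (- (2 * k) * \<bar>x\<bar>)" for x
    by (simp add: power_mult_distrib exp_double[symmetric] mult.assoc)
  show "sq_int gs"
  proof (rule sq_intI_bound[OF _ w])
    show "gs \<in> borel_measurable borel" unfolding gs_def[abs_def] by (intro borel_measurable_continuous_onI continuous_intros) auto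
    show "(cmod (gs x))\<^sup>2 \<le> (exp (k * a))\<^sup>2 * exp (- (2 * k) * \<bar>x\<bar>)" for x
      unfolding sq[symmetric] by (intro power_mono gs_bound) auto
  qed
  show "sq_int gs'"
  proof (rule sq_intI_bound[OF _ w])
    have [measurable]: "(\<lambda>x. sinh (k * x)) \<in> borel_measurable borel" "(\<lambda>x. exp (- k * (x - a))) \<in> borel_measurable borel"
      by (intro borel_measurable_continuous_onI continuous_intros)+
    show "gs' \<in> borel_measurable borel" unfolding gs'_def[abs_def] by measurable
    show "(cmod (gs' x))\<^sup>2 \<le> (k\<^sup>2 * (exp (k * a))\<^sup>2) * exp (- (2 * k) * \<bar>x\<bar>)" for x
      unfolding mult.assoc sq[symmetric] unfolding power_mult_distrib[symmetric] by (intro power_mono gs_bound) auto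
  qed
qed

lemma gs_piecewise_C1: "piecewise_C1_L2 gs gs'"
  unfolding piecewise_C1_L2_def
proof (intro conjI exI[of _ "{- a, a}"] allI impI gs_sq_int)
  show "continuous_on UNIV gs" unfolding gs_def[abs_def] by (intro continuous_intros) auto
  fix x assume "x \<notin> {- a, a}"
  then consider "x < - a" | "- a < x" "x < a" | "x > a" by fastforce
  then show "(gs has_vector_derivative gs' x) (at x)"
  proof cases
    case 1
    have "((\<lambda>x. exp (k * (x + a))) has_real_derivative k * exp (k * (x + a))) (at x)"
      by (auto intro!: derivative_eq_intros)
    then have "((\<lambda>x. complex_of_real (exp (k * (x + a)))) has_vector_derivative gs' x) (at x)"
      using 1 by (simp add: gs'_def has_vector_derivative_of_real has_real_derivative_iff_has_vector_derivative del: of_real_mult)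
    then show ?thesis
      by (rule has_vector_derivative_transform_within_open[of _ _ _ "{..<- a}"]) (use 1 gs_eq(1) in auto)
  next
    case 2
    have "((\<lambda>x. cosh (k * x) / cosh (k * a)) has_real_derivative k * sinh (k * x) / cosh (k * a)) (at x)"
      by (auto intro!: derivative_eq_intros)
    then have "((\<lambda>x. complex_of_real (cosh (k * x) / cosh (k * a))) has_vector_derivative gs' x) (at x)"
      using 2 by (simp add: gs'_def has_vector_derivative_of_real has_real_derivative_iff_has_vector_derivative del: of_real_mult of_real_divide)
    then show ?thesis
      by (rule has_vector_derivative_transform_within_open[of _ _ _ "{- a<..<a}"]) (use 2 gs_eq(2) in auto)
  next
    case 3
    have "((\<lambda>x. exp (- k * (x - a))) has_real_derivative - k * exp (- k * (x - a))) (at x)"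
      by (auto intro!: derivative_eq_intros)
    then have "((\<lambda>x. complex_of_real (exp (- k * (x - a)))) has_vector_derivative gs' x) (at x)"
      using 3 a by (simp add: gs'_def has_vector_derivative_of_real has_real_derivative_iff_has_vector_derivative del: of_real_mult of_real_minus)
    then show ?thesis
      by (rule has_vector_derivative_transform_within_open[of _ _ _ "{a<..}"]) (use 3 gs_eq(3) in auto)
  qed
qed simp

text \<open>On each branch gs'' = k^2 gs, so the integrand is the derivative of gs' times the
  conjugate of \<phi>. The boundary terms at the two lines are the jumps of gs', each of size
  \<alpha> by the choice of k.\<close>

lemma gs_weak_equation:
  assumes \<phi>: "test_fun \<phi>"
  shows "L2inner gs' (dderiv [1] \<phi>) + of_real (k\<^sup>2) * L2inner gs \<phi> = of_real \<alpha> * (cnj (\<phi> a) + cnj (\<phi> (- a)))"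
proof -
  define h where "h x = gs' x * cnj (dderiv [1] \<phi> x) + of_real (k\<^sup>2) * (gs x * cnj (\<phi> x))" for x
  have hi: "integrable lborel h"
    unfolding h_def using sq_int_mult_integrable(1) gs_sq_int test_sq_int test_dderiv \<phi>
    by (intro Bochner_Integration.integrable_add integrable_mult_right) blast+
  obtain R1 R2 where R: "\<And>x. norm x > R1 \<Longrightarrow> \<phi> x = 0" "\<And>x. norm x > R2 \<Longrightarrow> dderiv [1] \<phi> x = 0"
    using \<phi> test_dderiv[OF \<phi>] by (metis test_fun_iff)
  define p where "p = \<bar>R1\<bar> + \<bar>R2\<bar> + a + 1"
  have z: "\<phi> p = 0" "\<phi> (- p) = 0" by (rule R(1), use a in \<open>simp add: p_def\<close>)+
  have le: "- p \<le> - a" "- a \<le> a" "a \<le> p" using a by (auto simp: p_def)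
  \<comment> \<open>Here f extends gs' smoothly beyond the ends of its branch, so that the boundary
    values are the one-sided ones although gs' itself jumps there.\<close>
  have piece: "(h has_integral (of_real (f v) * cnj (\<phi> v) - of_real (f u) * cnj (\<phi> u))) {u..v}"
    if "u \<le> v" and f: "\<And>x. (f has_real_derivative f' x) (at x)"
      and h: "\<And>x. x \<in> {u<..<v} \<Longrightarrow> gs' x = of_real (f x) \<and> of_real (k\<^sup>2) * gs x = of_real (f' x)" for u v f f'
  proof (rule fundamental_theorem_of_calculus_interior[OF \<open>u \<le> v\<close>])
    have d: "((\<lambda>x. complex_of_real (f x) * cnj (\<phi> x)) has_vector_derivative
        of_real (f x) * cnj (dderiv [1] \<phi> x) + of_real (f' x) * cnj (\<phi> x)) (at x)" for x
      using f[of x] test_has_vector_derivative[OF \<phi>, of x]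
      by (intro has_vector_derivative_mult has_vector_derivative_of_real has_vector_derivative_cnj)
         (auto simp: has_real_derivative_iff_has_vector_derivative)
    show "continuous_on {u..v} (\<lambda>x. complex_of_real (f x) * cnj (\<phi> x))"
      by (intro continuous_at_imp_continuous_on ballI has_vector_derivative_continuous[OF d])
    fix x assume "x \<in> {u<..<v}"
    from h[OF this] have "h x = of_real (f x) * cnj (dderiv [1] \<phi> x) + of_real (f' x) * cnj (\<phi> x)"
      unfolding h_def by (metis mult.assoc)
    with d[of x] show "((\<lambda>x. complex_of_real (f x) * cnj (\<phi> x)) has_vector_derivative h x) (at x)" by simp
  qed
  define T where "T = k * tanh (k * a)"
  have "(h has_integral (of_real (k * exp (k * (- a + a))) * cnj (\<phi> (- a)) - of_real (k * exp (k * (- p + a))) * cnj (\<phi> (- p)))) {- p..- a}"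
    by (rule piece[OF le(1), of "\<lambda>x. k * exp (k * (x + a))" "\<lambda>x. k\<^sup>2 * exp (k * (x + a))"])
       (auto intro!: derivative_eq_intros simp: gs'_def gs_eq power2_eq_square)
  then have 1: "(h has_integral of_real k * cnj (\<phi> (- a))) {- p..- a}" using z by simp
  have "(h has_integral (of_real (k * sinh (k * a) / cosh (k * a)) * cnj (\<phi> a) - of_real (k * sinh (k * (- a)) / cosh (k * a)) * cnj (\<phi> (- a)))) {- a..a}"
    by (rule piece[OF le(2), of "\<lambda>x. k * sinh (k * x) / cosh (k * a)" "\<lambda>x. k\<^sup>2 * cosh (k * x) / cosh (k * a)"])
       (auto intro!: derivative_eq_intros simp: gs'_def gs_eq power2_eq_square)
  then have 2: "(h has_integral of_real T * (cnj (\<phi> a) + cnj (\<phi> (- a)))) {- a..a}"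
    by (simp add: T_def tanh_def algebra_simps add_divide_distrib)
  have "(h has_integral (of_real (- k * exp (- k * (p - a))) * cnj (\<phi> p) - of_real (- k * exp (- k * (a - a))) * cnj (\<phi> a))) {a..p}"
    using a by (intro piece[OF le(3), of "\<lambda>x. - k * exp (- k * (x - a))" "\<lambda>x. k\<^sup>2 * exp (- k * (x - a))"])
       (auto intro!: derivative_eq_intros simp: gs'_def gs_eq power2_eq_square)
  then have 3: "(h has_integral of_real k * cnj (\<phi> a)) {a..p}" using z by simp
  have "(h has_integral (of_real k * cnj (\<phi> (- a)) + of_real T * (cnj (\<phi> a) + cnj (\<phi> (- a))) + of_real k * cnj (\<phi> a))) {- p..p}"
    by (rule has_integral_combine[OF _ le(3) has_integral_combine[OF le(1,2) 1 2] 3]) (use le in linarith)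
  then have "((\<lambda>x. if x \<in> {- p..p} then h x else 0) has_integral
      (of_real k * cnj (\<phi> (- a)) + of_real T * (cnj (\<phi> a) + cnj (\<phi> (- a))) + of_real k * cnj (\<phi> a))) UNIV"
    by (simp only: has_integral_restrict_UNIV)
  moreover have "(\<lambda>x. if x \<in> {- p..p} then h x else 0) = h"
  proof
    fix x show "(if x \<in> {- p..p} then h x else 0) = h x"
      using R[of x] a by (auto simp: h_def p_def)
  qed
  ultimately have "(\<integral>x. h x \<partial>lborel) = of_real k * cnj (\<phi> (- a)) + of_real T * (cnj (\<phi> a) + cnj (\<phi> (- a))) + of_real k * cnj (\<phi> a)"
    using has_integral_unique[OF has_integral_integral_lborel[OF hi]] by simp
  also have "\<dots> = of_real (k * (1 + tanh (k * a))) * (cnj (\<phi> a) + cnj (\<phi> (- a)))"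
    by (simp add: T_def algebra_simps)
  also have "(\<integral>x. h x \<partial>lborel) = L2inner gs' (dderiv [1] \<phi>) + of_real (k\<^sup>2) * L2inner gs \<phi>"
    unfolding h_def L2inner_def
    using sq_int_mult_integrable(1)[OF gs_sq_int(2) test_sq_int[OF test_dderiv[OF \<phi>, of 1]]]
      sq_int_mult_integrable(1)[OF gs_sq_int(1) test_sq_int[OF \<phi>]] by simp
  finally show ?thesis unfolding rate .
qed

lemma gs_eigen: "op_rel W12 (eps_form a \<alpha>) gs (\<lambda>x. of_real (- k\<^sup>2) * gs x)"
  unfolding op_rel_def
proof (intro conjI allI impI)
  show Wg: "W12 gs" by (rule piecewise_C1_W12[OF gs_piecewise_C1])
  show "sq_int (\<lambda>x. of_real (- k\<^sup>2) * gs x)" by (rule sq_int_scale[OF gs_sq_int(1)])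
  fix \<phi> :: "real \<Rightarrow> complex" assume W: "W12 \<phi>"
  obtain \<phi>s where \<phi>s: "\<And>n. test_fun (\<phi>s n)" "W12_lim \<phi>s \<phi>" using W12_test_dense[OF W] by blast
  have tr: "tr_pt gs a = 1" "tr_pt gs (- a) = 1"
    using tr_pt_piecewise_C1[OF gs_piecewise_C1] gs_at by auto
  have "L2inner (wd gs 1) (wd \<phi> 1) = L2inner gs' (wd \<phi> 1)"
    using piecewise_C1_W12(2)[OF gs_piecewise_C1] wd_props(1)[OF Wg, of 1] wd_props(1)[OF W, of 1] gs_sq_int
    by (intro L2inner_cong_AE) auto
  then have e: "eps_form a \<alpha> gs \<phi> = L2inner gs' (wd \<phi> 1) - of_real \<alpha> * (cnj (tr_pt \<phi> a) + cnj (tr_pt \<phi> (- a)))"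
    unfolding eps_form_def L2inner_def tr by (simp add: algebra_simps)
  have l1: "(\<lambda>n. L2inner gs' (dderiv [1] (\<phi>s n)) - of_real \<alpha> * (cnj (\<phi>s n a) + cnj (\<phi>s n (- a)))) \<longlonglongrightarrow> eps_form a \<alpha> gs \<phi>"
    unfolding e by (intro tendsto_intros W12_real_limD(4)[OF W \<phi>s gs_sq_int(2)] tr_pt_tendsto[OF W \<phi>s])
  have eqn: "L2inner gs' (dderiv [1] (\<phi>s n)) - of_real \<alpha> * (cnj (\<phi>s n a) + cnj (\<phi>s n (- a))) = - of_real (k\<^sup>2) * L2inner gs (\<phi>s n)" for n
    using gs_weak_equation[OF \<phi>s(1)[of n]] by (simp add: algebra_simps)
  have l2: "(\<lambda>n. - of_real (k\<^sup>2) * L2inner gs (\<phi>s n)) \<longlonglongrightarrow> - of_real (k\<^sup>2) * L2inner gs \<phi>"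
    by (intro tendsto_intros W12_real_limD(3)[OF W \<phi>s gs_sq_int(1)])
  have "eps_form a \<alpha> gs \<phi> = - of_real (k\<^sup>2) * L2inner gs \<phi>"
    by (rule LIMSEQ_unique[OF l1[unfolded eqn] l2])
  then show "eps_form a \<alpha> gs \<phi> = L2inner (\<lambda>x. of_real (- k\<^sup>2) * gs x) \<phi>"
    by (simp add: L2inner_def mult.assoc)
qed

text \<open>\<open>LEAST\<close> over the reals needs an attained minimum: \<open>gs\<close> attains
  - k^2, and the Riccati bound, extended to \<open>W12\<close> by density, excludes smaller
  eigenvalues by testing the equation with the eigenfunction itself.\<close>

lemma xi0_eq: "xi0 a \<alpha> = - k\<^sup>2"
  unfolding xi0_def
proof (rule Least_equality)
  have "\<not> (AE x in lborel. gs x = 0)"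
  proof
    assume "AE x in lborel. gs x = 0"
    moreover have "gs x \<noteq> 0" for x by (simp add: gs_def)
    ultimately have "AE x in (lborel :: real measure). False" by simp
    then show False by (simp add: eventually_False ae_filter_eq_bot_iff)
  qed
  then show "is_eigenvalue W12 (eps_form a \<alpha>) (of_real (- k\<^sup>2))"
    unfolding is_eigenvalue_def using gs_eigen by blast
next
  fix lam :: real assume "is_eigenvalue W12 (eps_form a \<alpha>) (of_real lam)"
  then obtain \<psi> where o: "op_rel W12 (eps_form a \<alpha>) \<psi> (\<lambda>x. of_real lam * \<psi> x)" and nz: "\<not> (AE x in lborel. \<psi> x = 0)"
    unfolding is_eigenvalue_def by blast
  then have W: "W12 \<psi>" and eq: "eps_form a \<alpha> \<psi> \<psi> = L2inner (\<lambda>x. of_real lam * \<psi> x) \<psi>"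
    unfolding op_rel_def by auto
  have sq: "sq_int \<psi>" by (rule W12_sq_int[OF W])
  have "L2inner (\<lambda>x. of_real lam * \<psi> x) \<psi> = of_real lam * L2inner \<psi> \<psi>" by (simp add: L2inner_def mult.assoc)
  then have "Re (eps_form a \<alpha> \<psi> \<psi>) = lam * L2norm2 \<psi>" unfolding eq by (simp add: Re_L2inner)
  moreover have "Re (eps_form a \<alpha> \<psi> \<psi>) = L2norm2 (wd \<psi> 1) - \<alpha> * ((cmod (tr_pt \<psi> a))\<^sup>2 + (cmod (tr_pt \<psi> (- a)))\<^sup>2)"
    unfolding eps_form_def Re_L2inner[symmetric] L2inner_def
    by (simp add: mult.assoc cmod_power2 power2_eq_square[symmetric]) (simp add: algebra_simps)
  moreover obtain \<phi>s where \<phi>s: "\<And>n. test_fun (\<phi>s n)" "W12_lim \<phi>s \<psi>" using W12_test_dense[OF W] by blast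
  have "\<alpha> * ((cmod (tr_pt \<psi> a))\<^sup>2 + (cmod (tr_pt \<psi> (- a)))\<^sup>2) \<le> L2norm2 (wd \<psi> 1) + k\<^sup>2 * L2norm2 \<psi>"
  proof (rule LIMSEQ_le)
    show "(\<lambda>n. \<alpha> * ((cmod (\<phi>s n a))\<^sup>2 + (cmod (\<phi>s n (- a)))\<^sup>2)) \<longlonglongrightarrow> \<alpha> * ((cmod (tr_pt \<psi> a))\<^sup>2 + (cmod (tr_pt \<psi> (- a)))\<^sup>2)"
      by (intro tendsto_intros tr_pt_tendsto[OF W \<phi>s])
    show "(\<lambda>n. L2norm2 (dderiv [1] (\<phi>s n)) + k\<^sup>2 * L2norm2 (\<phi>s n)) \<longlonglongrightarrow> L2norm2 (wd \<psi> 1) + k\<^sup>2 * L2norm2 \<psi>"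
      by (intro tendsto_intros W12_real_limD(5,6)[OF W \<phi>s sq])
  qed (use two_point_bound[OF \<phi>s(1) a rate] in blast)
  ultimately have "- k\<^sup>2 * L2norm2 \<psi> \<le> lam * L2norm2 \<psi>" by simp
  moreover have "L2norm2 \<psi> > 0"
    using L2norm2_eq_0_iff[OF sq] nz L2norm2_nonneg[of \<psi>] by linarith
  ultimately show "- k\<^sup>2 \<le> lam" by (simp only: mult_le_cancel_right_pos)
qed

end

section \<open>Traces on lines\<close>

lemma Basis_plane: "(Basis :: (real \<times> real) set) = {(1, 0), (0, 1)}"
  by (auto simp: Basis_prod_def)

lemma slices:
  fixes \<phi> :: "real \<times> real \<Rightarrow> complex"
  assumes \<phi>: "test_fun \<phi>"
  shows "test_fun (\<lambda>s. \<phi> (s, t))" "dderiv [1] (\<lambda>s. \<phi> (s, t)) = (\<lambda>s. dderiv [(1, 0)] \<phi> (s, t))"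
    "test_fun (\<lambda>t. \<phi> (s, t))" "dderiv [1] (\<lambda>t. \<phi> (s, t)) = (\<lambda>t. dderiv [(0, 1)] \<phi> (s, t))"
proof -
  have L1: "bounded_linear (\<lambda>x::real. (x, 0::real))" and L2: "bounded_linear (\<lambda>x::real. (0::real, x))"
    by (auto intro: bounded_linear_Pair bounded_linear_ident bounded_linear_zero)
  obtain R where R: "\<And>x. norm x > R \<Longrightarrow> \<phi> x = 0" using \<phi> by (auto simp: test_fun_iff)
  have n: "norm s \<le> norm (s, t)" "norm t \<le> norm (s, t)" for s t :: real
    by (rule norm_fst_le norm_snd_le)+
  have z: "\<phi> (s, t) = 0" if "norm s > R \<or> norm t > R" for s t
    using R[of "(s, t)"] n[where s = s and t = t] that by fastforce
  note 1 = smooth_affine[OF test_smooth[OF \<phi>] L1, where c = "(0, t)"]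
  note 2 = smooth_affine[OF test_smooth[OF \<phi>] L2, where c = "(s, 0)"]
  show "test_fun (\<lambda>s. \<phi> (s, t))" "test_fun (\<lambda>t. \<phi> (s, t))"
    unfolding test_fun_iff using 1(1) 2(1) z by auto
  show "dderiv [1] (\<lambda>s. \<phi> (s, t)) = (\<lambda>s. dderiv [(1, 0)] \<phi> (s, t))" using 1(2)[where v = 1] by simp
  show "dderiv [1] (\<lambda>t. \<phi> (s, t)) = (\<lambda>t. dderiv [(0, 1)] \<phi> (s, t))" using 2(2)[where v = 1] by simp
qed

lemma plane_fubini:
  fixes f :: "real \<times> real \<Rightarrow> real"
  assumes "integrable lborel f"
  shows "integrable lborel (\<lambda>s. \<integral>t. f (s, t) \<partial>lborel)" "(\<integral>s. \<integral>t. f (s, t) \<partial>lborel \<partial>lborel) = (\<integral>p. f p \<partial>lborel)"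
    "integrable lborel (\<lambda>t. \<integral>s. f (s, t) \<partial>lborel)" "(\<integral>t. \<integral>s. f (s, t) \<partial>lborel \<partial>lborel) = (\<integral>p. f p \<partial>lborel)"
proof -
  have i: "integrable (lborel \<Otimes>\<^sub>M lborel) f" using assms by (simp add: lborel_prod)
  then have j: "integrable (lborel \<Otimes>\<^sub>M lborel) (\<lambda>(x, y). f (x, y))" by simp
  show "integrable lborel (\<lambda>s. \<integral>t. f (s, t) \<partial>lborel)" using lborel_pair.integrable_fst'[OF i] .
  show "(\<integral>s. \<integral>t. f (s, t) \<partial>lborel \<partial>lborel) = (\<integral>p. f p \<partial>lborel)"
    using lborel_pair.integral_fst'[OF i] by (simp add: lborel_prod)
  show "integrable lborel (\<lambda>t. \<integral>s. f (s, t) \<partial>lborel)" using lborel_pair.integrable_snd[OF j] .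
  show "(\<integral>t. \<integral>s. f (s, t) \<partial>lborel \<partial>lborel) = (\<integral>p. f p \<partial>lborel)"
    using lborel_pair.integral_snd[OF j] by (simp add: lborel_prod)
qed

lemma L2norm2_plane:
  fixes f :: "real \<times> real \<Rightarrow> complex"
  assumes "sq_int f"
  shows "integrable lborel (\<lambda>s. L2norm2 (\<lambda>t. f (s, t)))" "(\<integral>s. L2norm2 (\<lambda>t. f (s, t)) \<partial>lborel) = L2norm2 f"
  using plane_fubini(1,2)[OF sq_int_integrable[OF assms]] by (auto simp: L2norm2_def)

lemma L2norm2_tensor:
  fixes f g :: "real \<Rightarrow> complex"
  assumes "sq_int (\<lambda>p. f (fst p) * g (snd p))"
  shows "L2norm2 (\<lambda>p. f (fst p) * g (snd p)) = L2norm2 f * L2norm2 g"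
proof -
  have "L2norm2 (\<lambda>p. f (fst p) * g (snd p)) = (\<integral>s. L2norm2 (\<lambda>t. f s * g t) \<partial>lborel)"
    using L2norm2_plane(2)[OF assms] by simp
  also have "\<dots> = L2norm2 f * L2norm2 g" unfolding L2norm2_scale by (simp add: L2norm2_def)
  finally show ?thesis .
qed

text \<open>The point bound on each transverse slice, integrated along the line. The free parameter
  \<delta> makes the trace term arbitrarily small relative to the gradient, at the cost of a larger
  multiple of the norm.\<close>

lemma line_bound:
  fixes \<phi> :: "real \<times> real \<Rightarrow> complex"
  assumes \<phi>: "test_fun \<phi>" and "\<delta> > 0"
  shows "\<delta> * L2norm2 (\<lambda>s. \<phi> (s, c)) \<le> L2norm2 (dderiv [(0, 1)] \<phi>) + \<delta>\<^sup>2 * L2norm2 \<phi>"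
proof -
  note f = L2norm2_plane[OF test_sq_int[OF \<phi>]] L2norm2_plane[OF test_sq_int[OF test_dderiv[OF \<phi>, of "(0, 1)"]]]
  have "\<delta> * L2norm2 (\<lambda>s. \<phi> (s, c)) = (\<integral>s. \<delta> * (cmod (\<phi> (s, c)))\<^sup>2 \<partial>lborel)" by (simp add: L2norm2_def)
  also have "\<dots> \<le> (\<integral>s. L2norm2 (\<lambda>t. dderiv [(0, 1)] \<phi> (s, t)) + \<delta>\<^sup>2 * L2norm2 (\<lambda>t. \<phi> (s, t)) \<partial>lborel)"
  proof (rule integral_mono)
    show "integrable lborel (\<lambda>s. \<delta> * (cmod (\<phi> (s, c)))\<^sup>2)"
      using sq_int_integrable[OF test_sq_int[OF slices(1)[OF \<phi>]]] by simp
    show "integrable lborel (\<lambda>s. L2norm2 (\<lambda>t. dderiv [(0, 1)] \<phi> (s, t)) + \<delta>\<^sup>2 * L2norm2 (\<lambda>t. \<phi> (s, t)))"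
      using f by simp
    show "\<delta> * (cmod (\<phi> (s, c)))\<^sup>2 \<le> L2norm2 (\<lambda>t. dderiv [(0, 1)] \<phi> (s, t)) + \<delta>\<^sup>2 * L2norm2 (\<lambda>t. \<phi> (s, t))" for s
      using point_bound[OF slices(3)[OF \<phi>] \<open>\<delta> > 0\<close>, of s c] unfolding slices(4)[OF \<phi>] .
  qed
  also have "\<dots> = L2norm2 (dderiv [(0, 1)] \<phi>) + \<delta>\<^sup>2 * L2norm2 \<phi>" using f by simp
  finally show ?thesis .
qed

lemma two_line_bound:
  fixes \<phi> :: "real \<times> real \<Rightarrow> complex"
  assumes \<phi>: "test_fun \<phi>" and "a > 0" "k * (1 + tanh (k * a)) = \<alpha>"
  shows "\<alpha> * (L2norm2 (\<lambda>s. \<phi> (s, a)) + L2norm2 (\<lambda>s. \<phi> (s, - a))) \<le> L2norm2 (dderiv [(0, 1)] \<phi>) + k\<^sup>2 * L2norm2 \<phi>"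
proof -
  note f = L2norm2_plane[OF test_sq_int[OF \<phi>]] L2norm2_plane[OF test_sq_int[OF test_dderiv[OF \<phi>, of "(0, 1)"]]]
  note i = sq_int_integrable[OF test_sq_int[OF slices(1)[OF \<phi>]]]
  have "\<alpha> * (L2norm2 (\<lambda>s. \<phi> (s, a)) + L2norm2 (\<lambda>s. \<phi> (s, - a))) =
      (\<integral>s. \<alpha> * ((cmod (\<phi> (s, a)))\<^sup>2 + (cmod (\<phi> (s, - a)))\<^sup>2) \<partial>lborel)" using i by (simp add: L2norm2_def)
  also have "\<dots> \<le> (\<integral>s. L2norm2 (\<lambda>t. dderiv [(0, 1)] \<phi> (s, t)) + k\<^sup>2 * L2norm2 (\<lambda>t. \<phi> (s, t)) \<partial>lborel)"
  proof (rule integral_mono)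
    show "integrable lborel (\<lambda>s. \<alpha> * ((cmod (\<phi> (s, a)))\<^sup>2 + (cmod (\<phi> (s, - a)))\<^sup>2))" using i by simp
    show "integrable lborel (\<lambda>s. L2norm2 (\<lambda>t. dderiv [(0, 1)] \<phi> (s, t)) + k\<^sup>2 * L2norm2 (\<lambda>t. \<phi> (s, t)))" using f by simp
    show "\<alpha> * ((cmod (\<phi> (s, a)))\<^sup>2 + (cmod (\<phi> (s, - a)))\<^sup>2) \<le> L2norm2 (\<lambda>t. dderiv [(0, 1)] \<phi> (s, t)) + k\<^sup>2 * L2norm2 (\<lambda>t. \<phi> (s, t))" for s
      using two_point_bound[OF slices(3)[OF \<phi>] assms(2,3), of s] unfolding slices(4)[OF \<phi>] .
  qed
  also have "\<dots> = L2norm2 (dderiv [(0, 1)] \<phi>) + k\<^sup>2 * L2norm2 \<phi>" using f by simp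
  finally show ?thesis .
qed

lemma test_diff: "test_fun f \<Longrightarrow> test_fun g \<Longrightarrow> test_fun (\<lambda>x. f x - g x)"
  using test_add_scale[of f g "-1"] by simp

lemma dderiv_diff:
  "test_fun f \<Longrightarrow> test_fun g \<Longrightarrow> dderiv [v] (\<lambda>x. f x - g x) = (\<lambda>x. dderiv [v] f x - dderiv [v] g x)"
  using dderiv_add_scale[of f g v "-1"] by (simp add: test_smooth)

lemma line_bound_diff:
  fixes f g :: "real \<times> real \<Rightarrow> complex"
  assumes "test_fun f" "test_fun g"
  shows "L2norm2 (\<lambda>s. f (s, c) - g (s, c)) \<le>
    L2norm2 (\<lambda>x. dderiv [(0, 1)] f x - dderiv [(0, 1)] g x) + L2norm2 (\<lambda>x. f x - g x)"
  using line_bound[OF test_diff[OF assms], of 1 c] by (simp add: dderiv_diff[OF assms])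

text \<open>By the line bound applied to differences, traces of approximating sequences are Cauchy,
  and two approximating sequences have asymptotically equal traces. So the function picked by
  \<open>SOME\<close> is the limit along every approximating sequence.\<close>

lemma tr_line_tendsto:
  fixes \<psi> :: "real \<times> real \<Rightarrow> complex"
  assumes W: "W12 \<psi>"
  shows "sq_int (tr_line \<psi> c)"
    and "\<And>\<phi>s. (\<And>n. test_fun (\<phi>s n)) \<Longrightarrow> W12_lim \<phi>s \<psi> \<Longrightarrow> (\<lambda>n. L2norm2 (\<lambda>s. \<phi>s n (s, c) - tr_line \<psi> c s)) \<longlonglongrightarrow> 0"
proof -
  have b: "(0, 1) \<in> (Basis :: (real \<times> real) set)" by (simp add: Basis_plane)
  define g where "g \<phi> = L2norm2 (\<lambda>x. dderiv [(0, 1)] \<phi> x - wd \<psi> (0, 1) x) + L2norm2 (\<lambda>x. \<phi> x - \<psi> x)" for \<phi>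
  have g0: "(\<lambda>n. g (\<phi>s n)) \<longlonglongrightarrow> 0" if "W12_lim \<phi>s \<psi>" for \<phi>s
    unfolding g_def using tendsto_add[OF W12_lim_D(2)[OF that b] W12_lim_D(1)[OF that]] by simp
  have gd: "L2norm2 (\<lambda>s. f (s, c) - h (s, c)) \<le> 2 * g f + 2 * g h" if "test_fun f" "test_fun h" for f h
  proof -
    note s = test_sq_int[OF that(1)] test_sq_int[OF that(2)] test_sq_int[OF test_dderiv[OF that(1), of "(0, 1)"]]
      test_sq_int[OF test_dderiv[OF that(2), of "(0, 1)"]] W12_sq_int[OF W] wd_props(1)[OF W b]
    have "L2norm2 (\<lambda>x. f x - h x) \<le> 2 * L2norm2 (\<lambda>x. f x - \<psi> x) + 2 * L2norm2 (\<lambda>x. h x - \<psi> x)"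
      using L2norm2_diff_triangle[OF s(1,5,2)] L2norm2_minus[of \<psi> h] by simp
    moreover have "L2norm2 (\<lambda>x. dderiv [(0, 1)] f x - dderiv [(0, 1)] h x) \<le>
        2 * L2norm2 (\<lambda>x. dderiv [(0, 1)] f x - wd \<psi> (0, 1) x) + 2 * L2norm2 (\<lambda>x. dderiv [(0, 1)] h x - wd \<psi> (0, 1) x)"
      using L2norm2_diff_triangle[OF s(3,6,4)] L2norm2_minus[of "wd \<psi> (0, 1)" "dderiv [(0, 1)] h"] by simp
    ultimately show ?thesis using line_bound_diff[OF that, of c] by (simp add: g_def)
  qed
  have sl: "sq_int (\<lambda>s. \<phi> (s, c))" if "test_fun \<phi>" for \<phi> :: "real \<times> real \<Rightarrow> complex"
    by (rule test_sq_int[OF slices(1)[OF that]])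
  obtain \<phi>s where \<phi>s: "\<And>n. test_fun (\<phi>s n)" "W12_lim \<phi>s \<psi>" using W12_test_dense[OF W] by blast
  have "\<exists>\<tau>. sq_int \<tau> \<and> (\<lambda>n. L2norm2 (\<lambda>s. \<phi>s n (s, c) - \<tau> s)) \<longlonglongrightarrow> 0"
  proof (rule L2_complete_Cauchy[of "\<lambda>n s. \<phi>s n (s, c)"])
    show "sq_int (\<lambda>s. \<phi>s n (s, c))" for n by (rule sl[OF \<phi>s(1)])
    fix \<epsilon> :: real assume "\<epsilon> > 0"
    then obtain N where N: "\<And>n. n \<ge> N \<Longrightarrow> \<bar>g (\<phi>s n)\<bar> < \<epsilon> / 4"
      using LIMSEQ_D[OF g0[OF \<phi>s(2)], of "\<epsilon>/4"] by auto
    have "L2norm2 (\<lambda>s. \<phi>s i (s, c) - \<phi>s j (s, c)) < \<epsilon>" if "i \<ge> N" "j \<ge> N" for i j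
      using gd[OF \<phi>s(1) \<phi>s(1), of i j] N[OF that(1)] N[OF that(2)] by linarith
    then show "\<exists>N. \<forall>i\<ge>N. \<forall>j\<ge>N. L2norm2 (\<lambda>s. \<phi>s i (s, c) - \<phi>s j (s, c)) < \<epsilon>" by blast
  qed
  then have "\<exists>\<tau>. is_trace_line \<psi> c \<tau>" unfolding is_trace_line_def using \<phi>s by blast
  then have "is_trace_line \<psi> c (tr_line \<psi> c)" unfolding tr_line_def by (rule someI_ex)
  then obtain \<eta>s where sq: "sq_int (tr_line \<psi> c)" and \<eta>s: "\<And>n. test_fun (\<eta>s n)" "W12_lim \<eta>s \<psi>"
    "(\<lambda>n. L2norm2 (\<lambda>s. \<eta>s n (s, c) - tr_line \<psi> c s)) \<longlonglongrightarrow> 0"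
    unfolding is_trace_line_def by blast
  show "sq_int (tr_line \<psi> c)" by (rule sq)
  fix \<phi>s assume \<phi>s: "\<And>n. test_fun (\<phi>s n)" "W12_lim \<phi>s \<psi>"
  show "(\<lambda>n. L2norm2 (\<lambda>s. \<phi>s n (s, c) - tr_line \<psi> c s)) \<longlonglongrightarrow> 0"
  proof (rule tendsto_zero_le)
    show "L2norm2 (\<lambda>s. \<phi>s n (s, c) - tr_line \<psi> c s) \<le>
        2 * (2 * g (\<phi>s n) + 2 * g (\<eta>s n)) + 2 * L2norm2 (\<lambda>s. \<eta>s n (s, c) - tr_line \<psi> c s)" for n
      by (rule order_trans[OF L2norm2_diff_triangle[OF sl[OF \<phi>s(1)] sl[OF \<eta>s(1)] sq, of n n]])
         (use gd[OF \<phi>s(1) \<eta>s(1), of n n] in simp)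
    have "(\<lambda>n. 2 * (2 * g (\<phi>s n) + 2 * g (\<eta>s n)) + 2 * L2norm2 (\<lambda>s. \<eta>s n (s, c) - tr_line \<psi> c s)) \<longlonglongrightarrow> 2 * (2 * 0 + 2 * 0) + 2 * 0"
      by (intro tendsto_intros g0 \<phi>s \<eta>s)
    then show "(\<lambda>n. 2 * (2 * g (\<phi>s n) + 2 * g (\<eta>s n)) + 2 * L2norm2 (\<lambda>s. \<eta>s n (s, c) - tr_line \<psi> c s)) \<longlonglongrightarrow> 0" by simp
  qed simp
qed

lemma tr_line_test: "test_fun \<phi> \<Longrightarrow> AE s in lborel. tr_line \<phi> c s = \<phi> (s, c)"
  using tr_line_tendsto(2)[OF test_W12(1) _ W12_lim_const, of \<phi> c] tr_line_tendsto(1)[OF test_W12(1), of \<phi> c]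
    test_sq_int[OF slices(1), of \<phi> c]
  by (intro L2_limit_unique[of "\<lambda>_ s. \<phi> (s, c)"]) (auto simp: L2norm2_def)

lemma tr_line_add_scale:
  assumes "W12 \<psi>" "W12 \<phi>"
  shows "AE s in lborel. tr_line (\<lambda>x. \<psi> x + b * \<phi> x) c s = tr_line \<psi> c s + b * tr_line \<phi> c s"
proof -
  obtain \<psi>s where p: "\<And>n. test_fun (\<psi>s n)" "W12_lim \<psi>s \<psi>" using W12_test_dense[OF assms(1)] by blast
  obtain \<phi>s where f: "\<And>n. test_fun (\<phi>s n)" "W12_lim \<phi>s \<phi>" using W12_test_dense[OF assms(2)] by blast
  have sl: "sq_int (\<lambda>s. \<phi> (s, c))" if "test_fun \<phi>" for \<phi> :: "real \<times> real \<Rightarrow> complex"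
    by (rule test_sq_int[OF slices(1)[OF that]])
  note t = tr_line_tendsto[OF assms(1), where c = c] tr_line_tendsto[OF assms(2), where c = c]
    tr_line_tendsto[OF W12_add_scale(1)[OF assms, where c = b], where c = c]
  show ?thesis
  proof (rule L2_limit_unique[of "\<lambda>n s. \<psi>s n (s, c) + b * \<phi>s n (s, c)"])
    show "sq_int (\<lambda>s. \<psi>s n (s, c) + b * \<phi>s n (s, c))" for n by (intro sq_int_add sq_int_scale sl p f)
    show "sq_int (\<lambda>s. tr_line \<psi> c s + b * tr_line \<phi> c s)" by (intro sq_int_add sq_int_scale t)
    show "sq_int (tr_line (\<lambda>x. \<psi> x + b * \<phi> x) c)" by (rule t)
    show "(\<lambda>n. L2norm2 (\<lambda>s. \<psi>s n (s, c) + b * \<phi>s n (s, c) - tr_line (\<lambda>x. \<psi> x + b * \<phi> x) c s)) \<longlonglongrightarrow> 0"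
      by (rule t(6)[of "\<lambda>n x. \<psi>s n x + b * \<phi>s n x"]) (intro test_add_scale W12_lim_add_scale p f assms)+
    show "(\<lambda>n. L2norm2 (\<lambda>s. \<psi>s n (s, c) + b * \<phi>s n (s, c) - (tr_line \<psi> c s + b * tr_line \<phi> c s))) \<longlonglongrightarrow> 0"
      by (intro L2norm2_add_tendsto sl p f t)
  qed
qed

lemma W12_planeD:
  fixes \<psi> :: "real \<times> real \<Rightarrow> complex"
  assumes W: "W12 \<psi>" and t: "\<And>n. test_fun (\<phi>s n)" "W12_lim \<phi>s \<psi>"
  shows "(\<lambda>n. L2norm2 (\<phi>s n)) \<longlonglongrightarrow> L2norm2 \<psi>"
    "b \<in> Basis \<Longrightarrow> (\<lambda>n. L2norm2 (dderiv [b] (\<phi>s n))) \<longlonglongrightarrow> L2norm2 (wd \<psi> b)"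
    "(\<lambda>n. L2norm2 (\<lambda>s. \<phi>s n (s, c))) \<longlonglongrightarrow> L2norm2 (tr_line \<psi> c)"
  by (intro L2norm2_tendsto test_sq_int test_dderiv t W12_sq_int W wd_props W12_lim_D slices tr_line_tendsto; assumption)+

lemma W12_line_bound:
  assumes W: "W12 \<psi>" and "\<delta> > 0"
  shows "\<delta> * L2norm2 (tr_line \<psi> c) \<le> L2norm2 (wd \<psi> (0, 1)) + \<delta>\<^sup>2 * L2norm2 \<psi>"
proof -
  obtain \<phi>s where t: "\<And>n. test_fun (\<phi>s n)" "W12_lim \<phi>s \<psi>" using W12_test_dense[OF W] by blast
  show ?thesis
    by (rule LIMSEQ_le[OF tendsto_mult[OF tendsto_const W12_planeD(3)[OF W t]]
        tendsto_add[OF W12_planeD(2)[OF W t] tendsto_mult[OF tendsto_const W12_planeD(1)[OF W t]]]])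
       (use line_bound[OF t(1) \<open>\<delta> > 0\<close>] in \<open>auto simp: Basis_plane\<close>)
qed

lemma W12_two_line_bound:
  assumes W: "W12 \<psi>" and "a > 0" "k * (1 + tanh (k * a)) = \<alpha>"
  shows "\<alpha> * (L2norm2 (tr_line \<psi> a) + L2norm2 (tr_line \<psi> (- a))) \<le> L2norm2 (wd \<psi> (0, 1)) + k\<^sup>2 * L2norm2 \<psi>"
proof -
  obtain \<phi>s where t: "\<And>n. test_fun (\<phi>s n)" "W12_lim \<phi>s \<psi>" using W12_test_dense[OF W] by blast
  show ?thesis
    by (rule LIMSEQ_le[OF tendsto_mult[OF tendsto_const tendsto_add[OF W12_planeD(3)[OF W t] W12_planeD(3)[OF W t]]]
        tendsto_add[OF W12_planeD(2)[OF W t] tendsto_mult[OF tendsto_const W12_planeD(1)[OF W t]]]])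
       (use two_line_bound[OF t(1) assms(2,3)] in \<open>auto simp: Basis_plane\<close>)
qed

section \<open>The form of the double strip\<close>

lemma L2inner_add_scale:
  assumes "sq_int f" "sq_int g" "sq_int h"
  shows "L2inner (\<lambda>x. f x + b * g x) h = L2inner f h + b * L2inner g h"
  unfolding L2inner_def using sq_int_mult_integrable(1)[OF assms(1,3)] sq_int_mult_integrable(1)[OF assms(2,3)]
  by (simp add: distrib_right mult.assoc)

definition wform :: "(real \<Rightarrow> real) \<Rightarrow> (real \<Rightarrow> complex) \<Rightarrow> (real \<Rightarrow> complex) \<Rightarrow> complex" where
  "wform V f g = (\<integral>s. of_real (V s) * f s * cnj (g s) \<partial>lborel)"

definition bdd_weight :: "real \<Rightarrow> (real \<Rightarrow> real) \<Rightarrow> bool" where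
  "bdd_weight C V \<longleftrightarrow> V \<in> borel_measurable borel \<and> (AE s in lborel. \<bar>V s\<bar> \<le> C)"

lemma bdd_weight_sq_int:
  assumes V: "bdd_weight C V" and f: "sq_int f"
  shows "sq_int (\<lambda>s. of_real (V s) * f s)"
proof -
  have [measurable]: "V \<in> borel_measurable borel" "f \<in> borel_measurable borel"
    using assms by (auto simp: bdd_weight_def sq_int_def)
  have "integrable lborel (\<lambda>s. (cmod (of_real (V s) * f s))\<^sup>2)"
  proof (rule Bochner_Integration.integrable_bound)
    show "integrable lborel (\<lambda>s. C\<^sup>2 * (cmod (f s))\<^sup>2)" using sq_int_integrable[OF f] by simp
    have "AE s in lborel. \<bar>V s\<bar> \<le> C" using V by (simp add: bdd_weight_def)
    then show "AE s in lborel. norm ((cmod (of_real (V s) * f s))\<^sup>2) \<le> norm (C\<^sup>2 * (cmod (f s))\<^sup>2)"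
    proof eventually_elim
      fix s assume "\<bar>V s\<bar> \<le> C"
      then have "(V s)\<^sup>2 \<le> C\<^sup>2" by (metis abs_ge_zero power2_abs power_mono)
      then show "norm ((cmod (of_real (V s) * f s))\<^sup>2) \<le> norm (C\<^sup>2 * (cmod (f s))\<^sup>2)"
        by (simp add: norm_mult power_mult_distrib mult_right_mono)
    qed
  qed simp
  then show ?thesis by (simp add: sq_int_def)
qed

text \<open>A bounded weight acts as a multiplication operator on square-integrable functions;
  through this identity the weighted form inherits its properties from the inner product.\<close>

lemma wform_L2inner: "wform V f g = L2inner (\<lambda>s. of_real (V s) * f s) g"
  by (simp add: wform_def L2inner_def)

lemma wform_add_scale:
  assumes V: "bdd_weight C V" and "sq_int f" "sq_int g" "sq_int h"
  shows "wform V (\<lambda>s. f s + b * g s) h = wform V f h + b * wform V g h"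
proof -
  have "(\<lambda>s. of_real (V s) * (f s + b * g s)) = (\<lambda>s. of_real (V s) * f s + b * (of_real (V s) * g s))"
    by (simp add: fun_eq_iff algebra_simps)
  then show ?thesis
    unfolding wform_L2inner by (simp only: L2inner_add_scale bdd_weight_sq_int[OF V] assms)
qed

lemma wform_herm: "wform V g f = cnj (wform V f g)"
  unfolding wform_def by (subst Bochner_Integration.integral_cnj[symmetric]) (simp add: mult_ac)

lemma wform_cong_AE:
  assumes V: "bdd_weight C V" and "sq_int f" "sq_int f'" "sq_int g" "sq_int g'"
    "AE s in lborel. f s = f' s" "AE s in lborel. g s = g' s"
  shows "wform V f g = wform V f' g'"
  unfolding wform_L2inner using assms by (intro L2inner_cong_AE bdd_weight_sq_int[OF V]) auto

lemma Re_wform: "Re (wform V f f) = (\<integral>s. V s * (cmod (f s))\<^sup>2 \<partial>lborel)"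
proof -
  have "wform V f f = (\<integral>s. complex_of_real (V s * (cmod (f s))\<^sup>2) \<partial>lborel)"
    unfolding wform_def
    by (intro Bochner_Integration.integral_cong refl) (simp only: of_real_mult complex_norm_square mult.assoc)
  then show ?thesis by (simp only: integral_complex_of_real Re_complex_of_real)
qed

lemma wform_integrable:
  assumes V: "bdd_weight C V" and f: "sq_int f"
  shows "integrable lborel (\<lambda>s. V s * (cmod (f s))\<^sup>2)"
proof -
  have "integrable lborel (\<lambda>s. Re ((of_real (V s) * f s) * cnj (f s)))"
    by (intro integrable_Re sq_int_mult_integrable(1) bdd_weight_sq_int[OF V] f)
  moreover have "Re ((of_real (V s) * f s) * cnj (f s)) = V s * (cmod (f s))\<^sup>2" for s
    unfolding cmod_power2 by (simp add: power2_eq_square algebra_simps)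
  ultimately show ?thesis by simp
qed

lemma wform_bound:
  assumes V: "bdd_weight C V" and f: "sq_int f"
  shows "\<bar>Re (wform V f f)\<bar> \<le> C * L2norm2 f"
proof -
  have C: "AE s in lborel. \<bar>V s\<bar> \<le> C" using V by (simp add: bdd_weight_def)
  have i: "integrable lborel (\<lambda>s. C * (cmod (f s))\<^sup>2)" using sq_int_integrable[OF f] by simp
  have "\<bar>\<integral>s. V s * (cmod (f s))\<^sup>2 \<partial>lborel\<bar> \<le> (\<integral>s. \<bar>V s * (cmod (f s))\<^sup>2\<bar> \<partial>lborel)"
    by (rule integral_abs_bound)
  also have "\<dots> \<le> (\<integral>s. C * (cmod (f s))\<^sup>2 \<partial>lborel)"
  proof (rule integral_mono_AE)
    show "integrable lborel (\<lambda>s. \<bar>V s * (cmod (f s))\<^sup>2\<bar>)" by (intro integrable_abs wform_integrable[OF V f])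
    show "AE s in lborel. \<bar>V s * (cmod (f s))\<^sup>2\<bar> \<le> C * (cmod (f s))\<^sup>2"
      using C by eventually_elim (simp add: abs_mult mult_right_mono)
  qed (rule i)
  finally show ?thesis by (simp add: Re_wform L2norm2_def)
qed

locale double_line =
  fixes a \<alpha> C :: real and Vp Vm :: "real \<Rightarrow> real"
  assumes a: "a > 0" and \<alpha>: "\<alpha> > 0" and C: "C \<ge> 0"
    and Vp: "bdd_weight C Vp" and Vm: "bdd_weight C Vm"
begin

abbreviation "E \<equiv> E_form a \<alpha> Vp Vm"

definition K where "K = C + \<alpha>"

lemma K_pos: "K > 0" using C \<alpha> by (simp add: K_def)

definition grad :: "(real \<times> real \<Rightarrow> complex) \<Rightarrow> real" where
  "grad \<psi> = L2norm2 (wd \<psi> (1, 0)) + L2norm2 (wd \<psi> (0, 1))"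

lemma grad_nonneg: "0 \<le> grad \<psi>" by (simp add: grad_def)

lemma weights: "bdd_weight K (\<lambda>s. Vp s - \<alpha>)" "bdd_weight K (\<lambda>s. Vm s - \<alpha>)"
proof -
  have "bdd_weight K (\<lambda>s. V s - \<alpha>)" if V: "bdd_weight C V" for V
  proof -
    have "AE s in lborel. \<bar>V s\<bar> \<le> C" using V by (simp add: bdd_weight_def)
    then have "AE s in lborel. \<bar>V s - \<alpha>\<bar> \<le> K" by eventually_elim (use \<alpha> in \<open>auto simp: K_def\<close>)
    then show ?thesis using V by (auto simp: bdd_weight_def)
  qed
  then show "bdd_weight K (\<lambda>s. Vp s - \<alpha>)" "bdd_weight K (\<lambda>s. Vm s - \<alpha>)" using Vp Vm by auto
qed

lemma E_decomp:
  assumes "W12 \<psi>" "W12 \<phi>"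
  shows "E \<psi> \<phi> = L2inner (wd \<psi> (1, 0)) (wd \<phi> (1, 0)) + L2inner (wd \<psi> (0, 1)) (wd \<phi> (0, 1)) +
    wform (\<lambda>s. Vp s - \<alpha>) (tr_line \<psi> a) (tr_line \<phi> a) + wform (\<lambda>s. Vm s - \<alpha>) (tr_line \<psi> (- a)) (tr_line \<phi> (- a))"
proof -
  have b: "(1, 0) \<in> (Basis :: (real \<times> real) set)" "(0, 1) \<in> (Basis :: (real \<times> real) set)" by (auto simp: Basis_plane)
  have "(\<integral>x. (\<Sum>b\<in>Basis. wd \<psi> b x * cnj (wd \<phi> b x)) \<partial>lborel) =
      (\<integral>x. wd \<psi> (1, 0) x * cnj (wd \<phi> (1, 0) x) + wd \<psi> (0, 1) x * cnj (wd \<phi> (0, 1) x) \<partial>lborel)"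
    unfolding Basis_plane by simp
  also have "\<dots> = L2inner (wd \<psi> (1, 0)) (wd \<phi> (1, 0)) + L2inner (wd \<psi> (0, 1)) (wd \<phi> (0, 1))"
    unfolding L2inner_def
    using sq_int_mult_integrable(1)[OF wd_props(1)[OF assms(1)] wd_props(1)[OF assms(2)]] b by simp
  finally show ?thesis unfolding E_form_def wform_def by simp
qed

lemma E_add_scale:
  assumes "W12 \<psi>" "W12 \<phi>" "W12 \<eta>"
  shows "E (\<lambda>x. \<psi> x + b * \<phi> x) \<eta> = E \<psi> \<eta> + b * E \<phi> \<eta>"
proof -
  have B: "(1, 0) \<in> (Basis :: (real \<times> real) set)" "(0, 1) \<in> (Basis :: (real \<times> real) set)" by (auto simp: Basis_plane)
  note W = W12_add_scale(1)[OF assms(1,2), of b]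
  have d: "L2inner (wd (\<lambda>x. \<psi> x + b * \<phi> x) v) (wd \<eta> v) = L2inner (wd \<psi> v) (wd \<eta> v) + b * L2inner (wd \<phi> v) (wd \<eta> v)"
    if v: "v \<in> Basis" for v
  proof -
    note s = wd_props(1)[OF assms(1) v] wd_props(1)[OF assms(2) v] wd_props(1)[OF assms(3) v] wd_props(1)[OF W v]
    have "L2inner (wd (\<lambda>x. \<psi> x + b * \<phi> x) v) (wd \<eta> v) = L2inner (\<lambda>x. wd \<psi> v x + b * wd \<phi> v x) (wd \<eta> v)"
      using W12_add_scale(2)[OF assms(1,2) v] s by (intro L2inner_cong_AE sq_int_add sq_int_scale) auto
    then show ?thesis using s by (simp add: L2inner_add_scale)
  qed
  have t: "wform V (tr_line (\<lambda>x. \<psi> x + b * \<phi> x) c) (tr_line \<eta> c) =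
      wform V (tr_line \<psi> c) (tr_line \<eta> c) + b * wform V (tr_line \<phi> c) (tr_line \<eta> c)" if V: "bdd_weight K V" for V c
  proof -
    note s = tr_line_tendsto(1)[OF assms(1)] tr_line_tendsto(1)[OF assms(2)] tr_line_tendsto(1)[OF assms(3)] tr_line_tendsto(1)[OF W]
    have "wform V (tr_line (\<lambda>x. \<psi> x + b * \<phi> x) c) (tr_line \<eta> c) = wform V (\<lambda>s. tr_line \<psi> c s + b * tr_line \<phi> c s) (tr_line \<eta> c)"
      using tr_line_add_scale[OF assms(1,2)] s by (intro wform_cong_AE[OF V] sq_int_add sq_int_scale) auto
    then show ?thesis using wform_add_scale[OF V] s by simp
  qed
  show ?thesis
    unfolding E_decomp[OF W assms(3)] E_decomp[OF assms(1,3)] E_decomp[OF assms(2,3)]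
      d[OF B(1)] d[OF B(2)] t[OF weights(1)] t[OF weights(2)] by (simp add: algebra_simps)
qed

lemma E_herm_form: "herm_form cscale {\<psi>. W12 \<psi>} E"
proof -
  have z: "W12 (\<lambda>x::real \<times> real. 0)" by (rule test_W12[OF test_zero])
  have scale: "E (\<lambda>x. c * \<psi> x) \<eta> = c * E \<psi> \<eta>" if "W12 \<psi>" "W12 \<eta>" for c \<psi> \<eta>
    using E_add_scale[OF z that(1,2), of c] E_add_scale[OF z z that(2), of 1] by simp
  show ?thesis
  proof
    show "L2.subspace {\<psi> :: real \<times> real \<Rightarrow> complex. W12 \<psi>}" by (rule W12_subspace)
    fix x y z :: "real \<times> real \<Rightarrow> complex" assume "x \<in> {\<psi>. W12 \<psi>}" "y \<in> {\<psi>. W12 \<psi>}" "z \<in> {\<psi>. W12 \<psi>}"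
    then show "E (x + y) z = E x z + E y z" using E_add_scale[of x y z 1] by (simp add: plus_fun_def)
  next
    fix x z :: "real \<times> real \<Rightarrow> complex" and c assume "x \<in> {\<psi>. W12 \<psi>}" "z \<in> {\<psi>. W12 \<psi>}"
    then show "E (cscale c x) z = c * E x z" using scale[of x z c] by (simp add: cscale_def)
  next
    fix x y :: "real \<times> real \<Rightarrow> complex" assume xy: "x \<in> {\<psi>. W12 \<psi>}" "y \<in> {\<psi>. W12 \<psi>}"
    have h: "L2inner g f = cnj (L2inner f g)" if "sq_int f" "sq_int g" for f g :: "real \<times> real \<Rightarrow> complex"
      using L2.herm[of f g] that by simp
    have "(1, 0) \<in> (Basis :: (real \<times> real) set)" "(0, 1) \<in> (Basis :: (real \<times> real) set)" by (auto simp: Basis_plane)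
    then have "L2inner (wd y v) (wd x v) = cnj (L2inner (wd x v) (wd y v))" if "v \<in> {(1, 0), (0, 1)}" for v
      using that xy wd_props(1) by (intro h) auto
    then show "E y x = cnj (E x y)"
      using xy wform_herm[where g = "tr_line y a"] wform_herm[where g = "tr_line y (- a)"] by (simp add: E_decomp)
  qed
qed

lemma Re_E:
  assumes "W12 \<psi>"
  shows "Re (E \<psi> \<psi>) = grad \<psi> + Re (wform (\<lambda>s. Vp s - \<alpha>) (tr_line \<psi> a) (tr_line \<psi> a)) +
    Re (wform (\<lambda>s. Vm s - \<alpha>) (tr_line \<psi> (- a)) (tr_line \<psi> (- a)))"
  by (simp add: E_decomp[OF assms assms] Re_L2inner grad_def)

text \<open>Each of the two line terms is bounded by the trace inequality with \<delta> = 4 K, which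
  costs a quarter of the gradient and 4 K^2 times the squared norm. Half of the gradient is left
  over.\<close>

definition M where "M = 8 * K\<^sup>2"

lemma E_lower:
  assumes W: "W12 \<psi>" shows "grad \<psi> / 2 - M * L2norm2 \<psi> \<le> Re (E \<psi> \<psi>)"
proof -
  have tb: "K * L2norm2 (tr_line \<psi> c) \<le> L2norm2 (wd \<psi> (0, 1)) / 4 + 4 * K\<^sup>2 * L2norm2 \<psi>" for c
    using W12_line_bound[OF W, of "4 * K" c] K_pos by (simp add: power_mult_distrib)
  have "- (K * L2norm2 (tr_line \<psi> a)) \<le> Re (wform (\<lambda>s. Vp s - \<alpha>) (tr_line \<psi> a) (tr_line \<psi> a))"
    "- (K * L2norm2 (tr_line \<psi> (- a))) \<le> Re (wform (\<lambda>s. Vm s - \<alpha>) (tr_line \<psi> (- a)) (tr_line \<psi> (- a)))"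
    using wform_bound[OF weights(1) tr_line_tendsto(1)[OF W, of a]] wform_bound[OF weights(2) tr_line_tendsto(1)[OF W, of "- a"]]
    by linarith+
  then show ?thesis
    using tb[of a] tb[of "- a"] L2norm2_nonneg[of "wd \<psi> (1, 0)"] unfolding Re_E[OF W] grad_def M_def by argo
qed

lemma E_upper:
  assumes W: "W12 \<psi>" shows "Re (E \<psi> \<psi>) \<le> (1 + 2 * K) * (grad \<psi> + L2norm2 \<psi>)"
proof -
  have "K * L2norm2 (tr_line \<psi> c) \<le> K * (grad \<psi> + L2norm2 \<psi>)" for c
  proof (rule mult_left_mono)
    have "L2norm2 (tr_line \<psi> c) \<le> L2norm2 (wd \<psi> (0, 1)) + L2norm2 \<psi>" using W12_line_bound[OF W, of 1 c] by simp
    then show "L2norm2 (tr_line \<psi> c) \<le> grad \<psi> + L2norm2 \<psi>"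
      using L2norm2_nonneg[of "wd \<psi> (1, 0)"] unfolding grad_def by linarith
  qed (use K_pos in simp)
  from add_mono[OF this[of a] this[of "- a"]]
  have "K * L2norm2 (tr_line \<psi> a) + K * L2norm2 (tr_line \<psi> (- a)) \<le> 2 * (K * (grad \<psi> + L2norm2 \<psi>))"
    by (simp only: mult_2)
  moreover have "Re (E \<psi> \<psi>) \<le> grad \<psi> + (K * L2norm2 (tr_line \<psi> a) + K * L2norm2 (tr_line \<psi> (- a)))"
    unfolding Re_E[OF W]
    using wform_bound[OF weights(1) tr_line_tendsto(1)[OF W, of a]] wform_bound[OF weights(2) tr_line_tendsto(1)[OF W, of "- a"]]
    by linarith
  moreover have "(1 + 2 * K) * (grad \<psi> + L2norm2 \<psi>) = grad \<psi> + L2norm2 \<psi> + 2 * (K * (grad \<psi> + L2norm2 \<psi>))"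
    by (simp add: algebra_simps)
  ultimately show ?thesis using L2norm2_nonneg[of \<psi>] by linarith
qed

lemma grad_diff:
  assumes "W12 \<psi>" "W12 \<phi>"
  shows "grad (\<lambda>x. \<psi> x - \<phi> x) = L2norm2 (\<lambda>x. wd \<psi> (1, 0) x - wd \<phi> (1, 0) x) + L2norm2 (\<lambda>x. wd \<psi> (0, 1) x - wd \<phi> (0, 1) x)"
proof -
  have "L2norm2 (wd (\<lambda>x. \<psi> x - \<phi> x) v) = L2norm2 (\<lambda>x. wd \<psi> v x - wd \<phi> v x)" if v: "v \<in> Basis" for v
    by (intro L2norm2_cong_AE sq_int_diff wd_props(1) W12_diff assms v)
  then show ?thesis by (simp add: grad_def Basis_plane)
qed

text \<open>By \<open>E_lower\<close> the form norm controls half the gradient and the norm, so a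
  Cauchy sequence converges together with its weak derivatives; \<open>E_upper\<close> turns that
  convergence back into convergence of the form.\<close>

lemma E_complete: "form_complete (\<lambda>x y. E x y + of_real (M + 1) * L2inner x y) {\<psi>. W12 \<psi>}"
  unfolding form_complete_def
proof (intro allI impI)
  fix x :: "nat \<Rightarrow> real \<times> real \<Rightarrow> complex"
  assume "\<forall>n. x n \<in> {\<psi>. W12 \<psi>}" and cau: "form_Cauchy (\<lambda>x y. E x y + of_real (M + 1) * L2inner x y) x"
  then have x: "\<And>n. W12 (x n)" by simp
  have B: "(1, 0) \<in> (Basis :: (real \<times> real) set)" "(0, 1) \<in> (Basis :: (real \<times> real) set)" by (auto simp: Basis_plane)
  have low: "grad (\<lambda>p. x i p - x j p) / 2 + L2norm2 (\<lambda>p. x i p - x j p) \<le>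
      Re (E (x i - x j) (x i - x j) + of_real (M + 1) * L2inner (x i - x j) (x i - x j))" for i j
    using E_lower[OF W12_diff(1)[OF x x], of i j] by (simp add: fun_diff_def Re_L2inner algebra_simps)
  have small: "\<exists>N. \<forall>i\<ge>N. \<forall>j\<ge>N. L2norm2 (\<lambda>p. x i p - x j p) < \<epsilon> \<and> grad (\<lambda>p. x i p - x j p) < \<epsilon>" if eps: "\<epsilon> > 0" for \<epsilon>
  proof -
    obtain N where N: "\<forall>i\<ge>N. \<forall>j\<ge>N. Re (E (x i - x j) (x i - x j) + of_real (M + 1) * L2inner (x i - x j) (x i - x j)) < \<epsilon> / 2"
      using cau[unfolded form_Cauchy_def, rule_format, OF half_gt_zero[OF eps]] by blast
    have "L2norm2 (\<lambda>p. x i p - x j p) < \<epsilon> \<and> grad (\<lambda>p. x i p - x j p) < \<epsilon>" if "i \<ge> N" "j \<ge> N" for i j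
      using low[of i j] N[rule_format, OF that] grad_nonneg[of "\<lambda>p. x i p - x j p"] L2norm2_nonneg[of "\<lambda>p. x i p - x j p"]
      by linarith
    then show ?thesis by blast
  qed
  have "\<exists>u. sq_int u \<and> (\<lambda>n. L2norm2 (\<lambda>p. x n p - u p)) \<longlonglongrightarrow> 0"
    by (rule L2_complete_Cauchy[OF W12_sq_int[OF x]]) (use small in blast)
  then obtain u where u: "sq_int u" "(\<lambda>n. L2norm2 (\<lambda>p. x n p - u p)) \<longlonglongrightarrow> 0" by blast
  have "\<exists>g. sq_int g \<and> (\<lambda>n. L2norm2 (\<lambda>p. wd (x n) v p - g p)) \<longlonglongrightarrow> 0" if v: "v \<in> Basis" for v
  proof (rule L2_complete_Cauchy[OF wd_props(1)[OF x v]])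
    have "L2norm2 (\<lambda>p. wd (x i) v p - wd (x j) v p) \<le> grad (\<lambda>p. x i p - x j p)" for i j
      unfolding grad_diff[OF x x] using v by (auto simp: Basis_plane)
    then show "\<exists>N. \<forall>i\<ge>N. \<forall>j\<ge>N. L2norm2 (\<lambda>p. wd (x i) v p - wd (x j) v p) < \<epsilon>" if "\<epsilon> > 0" for \<epsilon>
      using small[OF that] by (meson le_less_trans)
  qed
  then have "\<forall>v\<in>Basis. \<exists>g. sq_int g \<and> (\<lambda>n. L2norm2 (\<lambda>p. wd (x n) v p - g p)) \<longlonglongrightarrow> 0" ..
  from bchoice[OF this] obtain g where
    "\<forall>v\<in>Basis. sq_int (g v) \<and> (\<lambda>n. L2norm2 (\<lambda>p. wd (x n) v p - g v p)) \<longlonglongrightarrow> 0" ..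
  then have g: "\<And>v. v \<in> Basis \<Longrightarrow> sq_int (g v)" "\<And>v. v \<in> Basis \<Longrightarrow> (\<lambda>n. L2norm2 (\<lambda>p. wd (x n) v p - g v p)) \<longlonglongrightarrow> 0"
    by blast+
  have Wu: "W12 u" "\<And>v. v \<in> Basis \<Longrightarrow> AE p in lborel. wd u v p = g v p"
    using W12_limit[of x u g] x u g by blast+
  have lim_wd: "(\<lambda>n. L2norm2 (\<lambda>p. wd (x n) v p - wd u v p)) \<longlonglongrightarrow> 0" if v: "v \<in> Basis" for v
    using g(2)[OF v] L2norm2_cong_AE_diff(2)[OF wd_props(1)[OF Wu(1) v] g(1)[OF v] wd_props(1)[OF x v] Wu(2)[OF v]] by simp
  have "(\<lambda>n. Re (E (x n - u) (x n - u) + of_real (M + 1) * L2inner (x n - u) (x n - u))) \<longlonglongrightarrow> 0"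
  proof (rule tendsto_zero_le)
    fix n
    show "0 \<le> Re (E (x n - u) (x n - u) + of_real (M + 1) * L2inner (x n - u) (x n - u))"
      using E_lower[OF W12_diff(1)[OF x Wu(1)], of n] grad_nonneg[of "\<lambda>p. x n p - u p"] L2norm2_nonneg[of "\<lambda>p. x n p - u p"]
      by (simp add: fun_diff_def Re_L2inner algebra_simps del: L2norm2_nonneg)
    show "Re (E (x n - u) (x n - u) + of_real (M + 1) * L2inner (x n - u) (x n - u)) \<le>
        (1 + 2 * K) * ((L2norm2 (\<lambda>p. wd (x n) (1, 0) p - wd u (1, 0) p) + L2norm2 (\<lambda>p. wd (x n) (0, 1) p - wd u (0, 1) p)) +
        L2norm2 (\<lambda>p. x n p - u p)) + (M + 1) * L2norm2 (\<lambda>p. x n p - u p)"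
      using E_upper[OF W12_diff(1)[OF x Wu(1)], of n] grad_diff[OF x Wu(1), of n] by (simp add: fun_diff_def Re_L2inner)
  next
    have "(\<lambda>n. (1 + 2 * K) * ((L2norm2 (\<lambda>p. wd (x n) (1, 0) p - wd u (1, 0) p) + L2norm2 (\<lambda>p. wd (x n) (0, 1) p - wd u (0, 1) p)) +
        L2norm2 (\<lambda>p. x n p - u p)) + (M + 1) * L2norm2 (\<lambda>p. x n p - u p)) \<longlonglongrightarrow> (1 + 2 * K) * ((0 + 0) + 0) + (M + 1) * 0"
      by (intro tendsto_intros lim_wd u(2) B)
    then show "(\<lambda>n. (1 + 2 * K) * ((L2norm2 (\<lambda>p. wd (x n) (1, 0) p - wd u (1, 0) p) + L2norm2 (\<lambda>p. wd (x n) (0, 1) p - wd u (0, 1) p)) +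
        L2norm2 (\<lambda>p. x n p - u p)) + (M + 1) * L2norm2 (\<lambda>p. x n p - u p)) \<longlonglongrightarrow> 0" by simp
  qed
  then show "\<exists>u\<in>{\<psi>. W12 \<psi>}. (\<lambda>n. Re (E (x n - u) (x n - u) + of_real (M + 1) * L2inner (x n - u) (x n - u))) \<longlonglongrightarrow> 0"
    using Wu(1) by blast
qed

lemma E_form_op: "form_op cscale {f. sq_int f} L2inner {\<psi>. W12 \<psi>} E M"
proof -
  interpret herm_form cscale "{\<psi>. W12 \<psi>}" E by (rule E_herm_form)
  show ?thesis
  proof
    show "{\<psi>. W12 \<psi>} \<subseteq> {f :: real \<times> real \<Rightarrow> complex. sq_int f}" using W12_sq_int by blast
    show "- M * Re (L2inner x x) \<le> Re (E x x)" if "x \<in> {\<psi>. W12 \<psi>}" for x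
      using E_lower[of x] that grad_nonneg[of x] by (simp add: Re_L2inner)
    show "form_complete (\<lambda>x y. E x y + of_real (M + 1) * L2inner x y) {\<psi>. W12 \<psi>}" by (rule E_complete)
  qed
qed

sublocale op: form_op cscale "{f. sq_int f}" L2inner "{\<psi>. W12 \<psi>}" E M
  by (rule E_form_op)

lemma opr_iff: "op_rel W12 E \<psi> f \<longleftrightarrow> op.opr \<psi> f"
  by (simp add: op_rel_def op.opr_def)

lemma res_iff: "resolvent_pt W12 E lam \<longleftrightarrow> op.res lam"
proof -
  have z: "(AE x in lborel. \<psi> x = 0) \<longleftrightarrow> L2norm2 \<psi> = 0" if "op_rel W12 E \<psi> f" for \<psi> f
    using L2norm2_eq_0_iff[of \<psi>] W12_sq_int[of \<psi>] that by (auto simp: op_rel_def)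
  show ?thesis
    unfolding resolvent_pt_def op.res_def Re_L2inner plus_fun_def cscale_def opr_iff[symmetric] using z by auto
qed

end

section \<open>The trial function\<close>

text \<open>Stretching by n + 1 divides the squared derivative by (n + 1)^2 and lengthens the
  support by n + 1 only. That the energy vanishes while the cutoff tends to 1 is special to one
  longitudinal dimension.\<close>

lemma cutoff_deriv_tendsto: "(\<lambda>n. L2norm2 (dderiv [1] (cutoff n :: real \<Rightarrow> complex))) \<longlonglongrightarrow> 0"
proof -
  define \<beta> where "\<beta> = dderiv [1] (cutoff 0 :: real \<Rightarrow> complex)"
  have t: "test_fun (cutoff 0 :: real \<Rightarrow> complex)" by (rule cutoff_test)
  have "L2norm2 (dderiv [1] (cutoff n :: real \<Rightarrow> complex)) = (1 / Suc n) * L2norm2 \<beta>" for n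
  proof -
    define c where "c = 1 / real (Suc n)"
    have c: "c > 0" by (simp add: c_def)
    have L: "bounded_linear (\<lambda>x::real. c *\<^sub>R x)" by (rule bounded_linear_scaleR_right)
    have cut: "cutoff n = (\<lambda>x::real. cutoff 0 (0 + c *\<^sub>R x))" by (simp add: cutoff_def[abs_def] c_def)
    have "dderiv [c *\<^sub>R 1] (cutoff 0 :: real \<Rightarrow> complex) y = c *\<^sub>R \<beta> y" for y
      unfolding \<beta>_def by (rule linear_scale[OF dderiv_linear[OF test_smooth[OF t]]])
    then have d: "dderiv [1] (cutoff n :: real \<Rightarrow> complex) = (\<lambda>x. of_real c * \<beta> (c * x))"
      unfolding cut smooth_affine(2)[OF test_smooth[OF t] L] by (simp add: scaleR_conv_of_real)
    have "L2norm2 \<beta> = c * (\<integral>x. (cmod (\<beta> (c * x)))\<^sup>2 \<partial>lborel)"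
      unfolding L2norm2_def using c lborel_integral_real_affine[of c "\<lambda>x. (cmod (\<beta> x))\<^sup>2" 0] by simp
    then show ?thesis unfolding d L2norm2_scale c_def[symmetric] using c by (simp add: L2norm2_def power2_eq_square)
  qed
  then show ?thesis
    using tendsto_mult[OF LIMSEQ_Suc[OF lim_inverse_n] tendsto_const[of "L2norm2 \<beta>"]] by (simp add: divide_inverse)
qed

context double_line
begin

lemma Re_E_tensor:
  assumes g: "test_fun g" and f: "test_fun f"
  defines "\<psi> \<equiv> \<lambda>p. g (fst p) * f (snd p)"
  shows "W12 \<psi>" "L2norm2 \<psi> = L2norm2 g * L2norm2 f"
    "Re (E \<psi> \<psi>) = L2norm2 (dderiv [1] g) * L2norm2 f + L2norm2 g * L2norm2 (dderiv [1] f) +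
      (cmod (f a))\<^sup>2 * (\<integral>s. (Vp s - \<alpha>) * (cmod (g s))\<^sup>2 \<partial>lborel) + (cmod (f (- a)))\<^sup>2 * (\<integral>s. (Vm s - \<alpha>) * (cmod (g s))\<^sup>2 \<partial>lborel)"
proof -
  note t = test_tensor[OF g f, folded \<psi>_def]
  have B: "(1, 0) \<in> (Basis :: (real \<times> real) set)" "(0, 1) \<in> (Basis :: (real \<times> real) set)" by (auto simp: Basis_plane)
  show W: "W12 \<psi>" by (rule test_W12[OF t(1)])
  show "L2norm2 \<psi> = L2norm2 g * L2norm2 f"
    unfolding \<psi>_def by (rule L2norm2_tensor) (use test_sq_int[OF t(1)] in \<open>simp add: \<psi>_def\<close>)
  have d: "L2norm2 (wd \<psi> v) = L2norm2 (dderiv [v] \<psi>)" if "v \<in> Basis" for v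
    by (intro L2norm2_cong_AE wd_props W test_sq_int test_dderiv t test_W12 that)
  have "L2norm2 (wd \<psi> (1, 0)) = L2norm2 (dderiv [1] g) * L2norm2 f"
    unfolding d[OF B(1)] t(2)
    by (rule L2norm2_tensor) (use test_sq_int[OF test_dderiv[OF t(1), of "(1, 0)"]] in \<open>simp add: t(2)\<close>)
  moreover have "L2norm2 (wd \<psi> (0, 1)) = L2norm2 g * L2norm2 (dderiv [1] f)"
    unfolding d[OF B(2)] t(3)
    by (rule L2norm2_tensor) (use test_sq_int[OF test_dderiv[OF t(1), of "(0, 1)"]] in \<open>simp add: t(3)\<close>)
  moreover have "Re (wform V (tr_line \<psi> c) (tr_line \<psi> c)) = (cmod (f c))\<^sup>2 * (\<integral>s. V s * (cmod (g s))\<^sup>2 \<partial>lborel)"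
    if V: "bdd_weight K V" for V c
  proof -
    have "wform V (tr_line \<psi> c) (tr_line \<psi> c) = wform V (\<lambda>s. \<psi> (s, c)) (\<lambda>s. \<psi> (s, c))"
      by (intro wform_cong_AE[OF V] tr_line_tendsto W test_sq_int slices t tr_line_test)
    also have "Re \<dots> = (cmod (f c))\<^sup>2 * (\<integral>s. V s * (cmod (g s))\<^sup>2 \<partial>lborel)"
      unfolding Re_wform integral_mult_right_zero[symmetric]
      by (intro Bochner_Integration.integral_cong) (auto simp: \<psi>_def norm_mult power_mult_distrib)
    finally show ?thesis .
  qed
  ultimately show "Re (E \<psi> \<psi>) = L2norm2 (dderiv [1] g) * L2norm2 f + L2norm2 g * L2norm2 (dderiv [1] f) +
      (cmod (f a))\<^sup>2 * (\<integral>s. (Vp s - \<alpha>) * (cmod (g s))\<^sup>2 \<partial>lborel) + (cmod (f (- a)))\<^sup>2 * (\<integral>s. (Vm s - \<alpha>) * (cmod (g s))\<^sup>2 \<partial>lborel)"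
    unfolding Re_E[OF W] grad_def using weights by simp
qed

text \<open>The exact ground state is not a test function, so the transverse factor is an
  approximating sequence f j. The cutoff index n is fixed first, making the limiting value negative;
  then j is chosen.\<close>

lemma trial_function:
  assumes k: "k > 0" "k * (1 + tanh (k * a)) = \<alpha>"
    and V: "integrable lborel (\<lambda>x. Vm x + Vp x)" "(\<integral>x. (Vm x + Vp x) \<partial>lborel) < 0"
  shows "\<exists>\<psi>. W12 \<psi> \<and> Re (E \<psi> \<psi>) < - k\<^sup>2 * L2norm2 \<psi>"
proof -
  define G where "G = L2norm2 (gs a k)"
  define G' where "G' = L2norm2 (wd (gs a k) 1)"
  have pc: "piecewise_C1_L2 (gs a k) (gs' a k)" by (rule gs_piecewise_C1[OF a k])
  have Wg: "W12 (gs a k)" by (rule piecewise_C1_W12[OF pc])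
  have tr: "tr_pt (gs a k) a = 1" "tr_pt (gs a k) (- a) = 1"
    using tr_pt_piecewise_C1[OF pc] gs_at[OF a k] by auto
  have "eps_form a \<alpha> (gs a k) (gs a k) = L2inner (\<lambda>x. of_real (- k\<^sup>2) * gs a k x) (gs a k)"
    using gs_eigen[OF a k] Wg unfolding op_rel_def by blast
  also have "\<dots> = of_real (- k\<^sup>2) * L2inner (gs a k) (gs a k)" by (simp add: L2inner_def mult.assoc)
  finally have "Re (eps_form a \<alpha> (gs a k) (gs a k)) = - k\<^sup>2 * G" by (simp add: Re_L2inner G_def)
  moreover have "Re (eps_form a \<alpha> (gs a k) (gs a k)) = G' - 2 * \<alpha>"
    unfolding eps_form_def tr G'_def Re_L2inner[symmetric] L2inner_def by simp
  \<comment> \<open>The eigenvalue equation tested with the ground state, whose traces are 1. This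
    is what cancels the two \<alpha> contributions of the lines below.\<close>
  ultimately have energy: "G' + k\<^sup>2 * G = 2 * \<alpha>" by simp
  obtain f where f: "\<And>j. test_fun (f j)" "W12_lim f (gs a k)" using W12_test_dense[OF Wg] by blast
  note fl = W12_real_limD(5,6)[OF Wg f W12_sq_int[OF Wg]]
  have fa: "(\<lambda>j. f j a) \<longlonglongrightarrow> 1" "(\<lambda>j. f j (- a)) \<longlonglongrightarrow> 1"
    using tr_pt_tendsto[OF Wg f, of a] tr_pt_tendsto[OF Wg f, of "- a"] tr by simp_all
  let ?\<theta> = "\<lambda>n. cutoff n :: real \<Rightarrow> complex"
  \<comment> \<open>The form value plus k^2 times the squared norm for the cutoff times the exact
    ground state, after that cancellation. It tends to the integral of Vm + Vp.\<close>
  define lim where "lim n = L2norm2 (dderiv [1] (?\<theta> n)) * G + (\<integral>s. (Vm s + Vp s) * (cmod (?\<theta> n s))\<^sup>2 \<partial>lborel)" for n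
  have "(\<lambda>n. \<integral>s. (Vm s + Vp s) * (cmod (?\<theta> n s))\<^sup>2 \<partial>lborel) \<longlonglongrightarrow> (\<integral>s. (Vm s + Vp s) \<partial>lborel)"
  proof (rule integral_dominated_convergence[where w = "\<lambda>s. \<bar>Vm s + Vp s\<bar>"])
    show m: "(\<lambda>s. Vm s + Vp s) \<in> borel_measurable lborel" using V(1) by (rule borel_measurable_integrable)
    have [measurable]: "(\<lambda>s. Vm s + Vp s) \<in> borel_measurable borel" "?\<theta> n \<in> borel_measurable borel" for n
      using m Cc_measurable[OF test_Cc[OF cutoff_test]] by auto
    show "(\<lambda>s. (Vm s + Vp s) * (cmod (?\<theta> n s))\<^sup>2) \<in> borel_measurable lborel" for n by measurable
    show "integrable lborel (\<lambda>s. \<bar>Vm s + Vp s\<bar>)" using V(1) by simp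
    show "AE s in lborel. (\<lambda>n. (Vm s + Vp s) * (cmod (?\<theta> n s))\<^sup>2) \<longlonglongrightarrow> Vm s + Vp s"
    proof (rule AE_I2)
      fix s
      have "(\<lambda>n. (Vm s + Vp s) * (cmod (?\<theta> n s))\<^sup>2) \<longlonglongrightarrow> (Vm s + Vp s) * (cmod 1)\<^sup>2"
        by (intro tendsto_intros cutoff_tendsto)
      then show "(\<lambda>n. (Vm s + Vp s) * (cmod (?\<theta> n s))\<^sup>2) \<longlonglongrightarrow> Vm s + Vp s" by simp
    qed
    show "AE s in lborel. norm ((Vm s + Vp s) * (cmod (?\<theta> n s))\<^sup>2) \<le> \<bar>Vm s + Vp s\<bar>" for n
    proof (rule AE_I2)
      fix s
      have "(cmod (?\<theta> n s))\<^sup>2 \<le> 1" using cutoff_le[of n s] by (simp add: power_le_one)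
      then have "\<bar>Vm s + Vp s\<bar> * (cmod (?\<theta> n s))\<^sup>2 \<le> \<bar>Vm s + Vp s\<bar> * 1" by (intro mult_left_mono) auto
      then show "norm ((Vm s + Vp s) * (cmod (?\<theta> n s))\<^sup>2) \<le> \<bar>Vm s + Vp s\<bar>" by (simp add: abs_mult)
    qed
  qed
  from tendsto_add[OF tendsto_mult[OF cutoff_deriv_tendsto tendsto_const[of G]] this]
  have "lim \<longlonglongrightarrow> (\<integral>s. (Vm s + Vp s) \<partial>lborel)" unfolding lim_def by simp
  from order_tendstoD(2)[OF this V(2)] obtain n where n: "lim n < 0"
    using eventually_happens trivial_limit_sequentially by blast
  have th: "test_fun (?\<theta> n)" by (rule cutoff_test)
  define \<psi> where "\<psi> j = (\<lambda>p. ?\<theta> n (fst p) * f j (snd p))" for j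
  note T = Re_E_tensor[OF th f(1), folded \<psi>_def]
  define Ip Im where "Ip = (\<integral>s. (Vp s - \<alpha>) * (cmod (?\<theta> n s))\<^sup>2 \<partial>lborel)" and "Im = (\<integral>s. (Vm s - \<alpha>) * (cmod (?\<theta> n s))\<^sup>2 \<partial>lborel)"
  have "Ip + Im = (\<integral>s. (Vp s - \<alpha>) * (cmod (?\<theta> n s))\<^sup>2 + (Vm s - \<alpha>) * (cmod (?\<theta> n s))\<^sup>2 \<partial>lborel)"
    unfolding Ip_def Im_def
    using wform_integrable[OF weights(1) test_sq_int[OF th]] wform_integrable[OF weights(2) test_sq_int[OF th]] by simp
  also have "\<dots> = (\<integral>s. (Vm s + Vp s) * (cmod (?\<theta> n s))\<^sup>2 - 2 * \<alpha> * (cmod (?\<theta> n s))\<^sup>2 \<partial>lborel)"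
    by (intro Bochner_Integration.integral_cong) (auto simp: algebra_simps)
  also have "\<dots> = (\<integral>s. (Vm s + Vp s) * (cmod (?\<theta> n s))\<^sup>2 \<partial>lborel) - 2 * \<alpha> * L2norm2 (?\<theta> n)"
  proof -
    have "integrable lborel (\<lambda>s. Vm s * (cmod (?\<theta> n s))\<^sup>2 + Vp s * (cmod (?\<theta> n s))\<^sup>2)"
      by (intro Bochner_Integration.integrable_add wform_integrable[OF Vm] wform_integrable[OF Vp] test_sq_int th)
    then show ?thesis using sq_int_integrable[OF test_sq_int[OF th]] by (simp add: distrib_right L2norm2_def)
  qed
  finally have I: "Ip + Im = (\<integral>s. (Vm s + Vp s) * (cmod (?\<theta> n s))\<^sup>2 \<partial>lborel) - 2 * \<alpha> * L2norm2 (?\<theta> n)" .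
  have "(\<lambda>j. L2norm2 (dderiv [1] (?\<theta> n)) * L2norm2 (f j) + L2norm2 (?\<theta> n) * L2norm2 (dderiv [1] (f j)) +
      (cmod (f j a))\<^sup>2 * Ip + (cmod (f j (- a)))\<^sup>2 * Im + k\<^sup>2 * (L2norm2 (?\<theta> n) * L2norm2 (f j))) \<longlonglongrightarrow>
      L2norm2 (dderiv [1] (?\<theta> n)) * G + L2norm2 (?\<theta> n) * G' + (cmod 1)\<^sup>2 * Ip + (cmod 1)\<^sup>2 * Im + k\<^sup>2 * (L2norm2 (?\<theta> n) * G)"
    unfolding G_def G'_def by (intro tendsto_intros fl fa)
  moreover have "L2norm2 (dderiv [1] (?\<theta> n)) * G + L2norm2 (?\<theta> n) * G' + (cmod 1)\<^sup>2 * Ip + (cmod 1)\<^sup>2 * Im + k\<^sup>2 * (L2norm2 (?\<theta> n) * G) = lim n"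
  proof -
    have "L2norm2 (?\<theta> n) * G' + k\<^sup>2 * (L2norm2 (?\<theta> n) * G) = L2norm2 (?\<theta> n) * (G' + k\<^sup>2 * G)" by (simp add: algebra_simps)
    then show ?thesis using I unfolding energy lim_def by (simp add: algebra_simps)
  qed
  ultimately have "(\<lambda>j. Re (E (\<psi> j) (\<psi> j)) + k\<^sup>2 * L2norm2 (\<psi> j)) \<longlonglongrightarrow> lim n"
    unfolding T(2,3) Ip_def Im_def by simp
  from order_tendstoD(2)[OF this n] obtain j where "Re (E (\<psi> j) (\<psi> j)) + k\<^sup>2 * L2norm2 (\<psi> j) < 0"
    using eventually_happens trivial_limit_sequentially by blast
  then show ?thesis using T(1)[of j] by (intro exI[of _ "\<psi> j"]) simp
qed

end

section \<open>Compactness of the trace on a segment\<close>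

text \<open>The fundamental theorem and Cauchy-Schwarz on an interval of length at most h. Half-open
  intervals are used because they tile a segment without overlap.\<close>

lemma increment_bound:
  fixes \<phi> :: "real \<Rightarrow> complex"
  assumes \<phi>: "test_fun \<phi>" and xy: "x \<in> {p..<p + h}" "y \<in> {p..<p + h}"
  shows "(cmod (\<phi> x - \<phi> y))\<^sup>2 \<le> h * (\<integral>r. indicator {p..<p + h} r * (cmod (dderiv [1] \<phi> r))\<^sup>2 \<partial>lborel)"
proof -
  let ?d = "dderiv [1] \<phi>" and ?I = "{p..<p + h}"
  have main: "(cmod (\<phi> y - \<phi> x))\<^sup>2 \<le> h * (\<integral>r. indicator ?I r * (cmod (?d r))\<^sup>2 \<partial>lborel)"
    if xy: "x \<in> ?I" "y \<in> ?I" "x \<le> y" for x y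
  proof -
    obtain R1 R2 where R: "\<And>x. norm x > R1 \<Longrightarrow> \<phi> x = 0" "\<And>x. norm x > R2 \<Longrightarrow> ?d x = 0"
      using \<phi> test_dderiv[OF \<phi>] by (metis test_fun_iff)
    have di: "integrable lborel ?d" using Cc_integrable[OF test_Cc[OF test_dderiv[OF \<phi>]]] .
    have ftc: "(\<integral>r. indicator {..c} r *\<^sub>R ?d r \<partial>lborel) = \<phi> c" for c
      by (rule integral_up_to_FTC[where S = "{}" and R = "\<bar>R1\<bar> + \<bar>R2\<bar> + 1"])
         (use R \<phi> di in \<open>auto intro: smooth_continuous test_smooth test_has_vector_derivative\<close>)
    have F: "sq_int (\<lambda>r. indicator ?I r * ?d r)"
    proof (rule sq_intI_bound)
      show "(\<lambda>r. indicator ?I r * ?d r) \<in> borel_measurable borel" using Cc_measurable[OF test_Cc[OF test_dderiv[OF \<phi>, of 1]]] by measurable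
      show "integrable lborel (\<lambda>r. (cmod (?d r))\<^sup>2)" using sq_int_integrable[OF test_sq_int[OF test_dderiv[OF \<phi>]]] .
    qed (auto simp: indicator_def)
    have G: "sq_int (indicator {x<..y} :: real \<Rightarrow> complex)" by (rule sq_int_indicator) (use xy in simp_all)
    have ii: "integrable lborel (\<lambda>r. indicator {..c} r *\<^sub>R ?d r)" for c
      by (rule integrable_mult_indicator[OF _ di]) simp
    have "\<phi> y - \<phi> x = (\<integral>r. indicator {..y} r *\<^sub>R ?d r - indicator {..x} r *\<^sub>R ?d r \<partial>lborel)"
      unfolding Bochner_Integration.integral_diff[OF ii ii] ftc ..
    also have "\<dots> = L2inner (\<lambda>r. indicator ?I r * ?d r) (indicator {x<..y})"
      unfolding L2inner_def using xy by (intro Bochner_Integration.integral_cong) (auto simp: indicator_def)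
    finally have "(cmod (\<phi> y - \<phi> x))\<^sup>2 \<le> L2norm2 (\<lambda>r. indicator ?I r * ?d r) * L2norm2 (indicator {x<..y})"
      using L2inner_le[OF F G] by simp
    also have "L2norm2 (\<lambda>r. indicator ?I r * ?d r) = (\<integral>r. indicator ?I r * (cmod (?d r))\<^sup>2 \<partial>lborel)"
      unfolding L2norm2_def by (intro Bochner_Integration.integral_cong) (auto simp: indicator_def)
    also have "L2norm2 (indicator {x<..y}) = y - x"
      using L2norm2_indicator_diff[of "{x<..y}" "{}"] xy by simp
    also have "(\<integral>r. indicator ?I r * (cmod (?d r))\<^sup>2 \<partial>lborel) * (y - x) \<le> (\<integral>r. indicator ?I r * (cmod (?d r))\<^sup>2 \<partial>lborel) * h"
      using xy by (intro mult_left_mono Bochner_Integration.integral_nonneg) auto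
    finally show ?thesis by (simp add: mult.commute)
  qed
  show ?thesis
    using main[OF xy] main[OF xy(2,1)] norm_minus_commute[of "\<phi> x" "\<phi> y"] by (cases "x \<le> y") auto
qed

text \<open>On a square \<open>Q\<close> of side \<open>h\<close> the trace differs from the mean over \<open>Q\<close> by \<open>O(h)\<close> times the
  Dirichlet energy; the means are finitely many bounded functionals, which yields compactness.\<close>

lemma cell_bound:
  fixes \<phi> :: "real \<times> real \<Rightarrow> complex" and p c h :: real
  assumes \<phi>: "test_fun \<phi>" and h: "h > 0"
  defines "Q \<equiv> {p..<p + h} \<times> {c..<c + h}"
  shows "L2norm2 (\<lambda>s. indicator {p..<p + h} s * \<phi> (s, c)) \<le>
    4 * h * (\<integral>q. indicator Q q * ((cmod (dderiv [(1, 0)] \<phi> q))\<^sup>2 + (cmod (dderiv [(0, 1)] \<phi> q))\<^sup>2) \<partial>lborel) +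
    2 / h ^ 3 * (cmod (L2inner \<phi> (indicator Q)))\<^sup>2"
proof -
  let ?I = "{p..<p + h}" and ?J = "{c..<c + h}"
  let ?d1 = "dderiv [(1, 0)] \<phi>" and ?d2 = "dderiv [(0, 1)] \<phi>"
  have Qm [measurable]: "Q \<in> sets borel" unfolding Q_def by (simp add: borel_Times)
  have Qle: "norm q \<le> \<bar>p\<bar> + \<bar>c\<bar> + 2 * h" if "q \<in> Q" for q
  proof -
    have "norm q \<le> norm (fst q) + norm (snd q)" using norm_Pair_le[of "fst q" "snd q"] by simp
    then show ?thesis using that by (auto simp: Q_def)
  qed
  have Qint: "integrable lborel (\<lambda>q. indicator Q q * g q)" if "g \<in> borel_measurable borel" "\<And>q. \<bar>g q\<bar> \<le> B" for g :: "real \<times> real \<Rightarrow> real" and B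
    by (rule integrable_bounded_support[where B = "\<bar>B\<bar>" and R = "\<bar>p\<bar> + \<bar>c\<bar> + 2 * h"])
       (use that Qle in \<open>auto simp: indicator_def not_le intro: order_trans[OF that(2) abs_ge_self] dest: Qle\<close>)
  have Qarea: "measure lborel Q = h\<^sup>2" "emeasure lborel Q < \<infinity>"
  proof -
    have "emeasure lborel Q = emeasure (lborel \<Otimes>\<^sub>M lborel) (?I \<times> ?J)" unfolding Q_def by (simp add: lborel_prod)
    also have "\<dots> = emeasure lborel ?I * emeasure lborel ?J" by (rule lborel.emeasure_pair_measure_Times) auto
    also have "\<dots> = ennreal (h\<^sup>2)" using h by (simp add: ennreal_mult[symmetric] power2_eq_square)
    finally show "measure lborel Q = h\<^sup>2" "emeasure lborel Q < \<infinity>" by (simp_all add: measure_def)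
  qed
  obtain B1 B2 where B: "\<And>q. cmod (?d1 q) \<le> B1" "\<And>q. cmod (?d2 q) \<le> B2"
    using Cc_bounded[OF test_Cc[OF test_dderiv[OF \<phi>]]] by metis
  have [measurable]: "\<phi> \<in> borel_measurable borel" "?d1 \<in> borel_measurable borel" "?d2 \<in> borel_measurable borel"
    using Cc_measurable[OF test_Cc] \<phi> test_dderiv by blast+
  have sq: "(cmod (?d1 q))\<^sup>2 \<le> B1\<^sup>2" "(cmod (?d2 q))\<^sup>2 \<le> B2\<^sup>2" for q
    by (rule power_mono[OF B(1)] power_mono[OF B(2)]; simp)+
  define g1 g2 where "g1 q = indicator Q q * (cmod (?d1 q))\<^sup>2" and "g2 q = indicator Q q * (cmod (?d2 q))\<^sup>2" for q
  have gi: "integrable lborel g1" "integrable lborel g2"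
    unfolding g1_def g2_def by (rule Qint[where B = "B1\<^sup>2"] Qint[where B = "B2\<^sup>2"]; use sq in simp)+
  define G1 G2 where "G1 = (\<integral>q. g1 q \<partial>lborel)" and "G2 = (\<integral>q. g2 q \<partial>lborel)"
  define D1 where "D1 t = (\<integral>s. g1 (s, t) \<partial>lborel)" for t
  define D2 where "D2 s = (\<integral>t. g2 (s, t) \<partial>lborel)" for s
  have D1: "integrable lborel D1" "(\<integral>t. D1 t \<partial>lborel) = G1" unfolding D1_def G1_def using plane_fubini(3,4)[OF gi(1)] by auto
  have D2: "integrable lborel D2" "(\<integral>s. D2 s \<partial>lborel) = G2" unfolding D2_def G2_def using plane_fubini(1,2)[OF gi(2)] by auto
  have D0: "0 \<le> D1 t" "0 \<le> D2 s" for s t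
    unfolding D1_def D2_def g1_def g2_def by (intro Bochner_Integration.integral_nonneg; simp)+
  have D1eq: "D1 t = indicator ?J t * (\<integral>s. indicator ?I s * (cmod (?d1 (s, t)))\<^sup>2 \<partial>lborel)" for t
    unfolding D1_def g1_def Q_def integral_mult_right_zero[symmetric]
    by (intro Bochner_Integration.integral_cong) (auto simp: indicator_times)
  have D2eq: "D2 s = indicator ?I s * (\<integral>t. indicator ?J t * (cmod (?d2 (s, t)))\<^sup>2 \<partial>lborel)" for s
    unfolding D2_def g2_def Q_def integral_mult_right_zero[symmetric]
    by (intro Bochner_Integration.integral_cong) (auto simp: indicator_times)
  have D1bd: "\<bar>D1 t\<bar> \<le> B1\<^sup>2 * h" for t
  proof -
    have "D1 t \<le> (\<integral>s. B1\<^sup>2 * indicator ?I s \<partial>lborel)"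
      unfolding D1_def g1_def
    proof (rule Bochner_Integration.integral_mono_AE')
      show "integrable lborel (\<lambda>s. B1\<^sup>2 * indicator ?I s :: real)"
        using h by (intro integrable_mult_right integrable_real_indicator) auto
    qed (use sq in \<open>auto simp: Q_def indicator_def\<close>)
    then show ?thesis using D0(1)[of t] h by simp
  qed
  \<comment> \<open>Connect (s, c) to a point of Q by a path with two legs, across the line at s and
    then parallel to it at height t. D2 s and D1 t are the energies along these legs; squaring the
    sum costs the factor 2.\<close>
  have osc: "(cmod (\<phi> (s, c) - \<phi> q))\<^sup>2 \<le> 2 * h * D2 s + 2 * h * D1 (snd q)" if s: "s \<in> ?I" and q: "q \<in> Q" for s q
  proof -
    obtain s' t where q': "q = (s', t)" "s' \<in> ?I" "t \<in> ?J" using q by (auto simp: Q_def)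
    have "(cmod (\<phi> (s, c) - \<phi> (s, t)))\<^sup>2 \<le> h * D2 s"
      using increment_bound[OF slices(3)[OF \<phi>], of c c h t s] q' s h unfolding slices(4)[OF \<phi>] by (simp add: D2eq)
    moreover have "(cmod (\<phi> (s, t) - \<phi> (s', t)))\<^sup>2 \<le> h * D1 t"
      using increment_bound[OF slices(1)[OF \<phi>], of s p h s' t] q' s h unfolding slices(2)[OF \<phi>] by (simp add: D1eq)
    moreover have "(cmod (\<phi> (s, c) - \<phi> (s', t)))\<^sup>2 \<le> 2 * (cmod (\<phi> (s, c) - \<phi> (s, t)))\<^sup>2 + 2 * (cmod (\<phi> (s, t) - \<phi> (s', t)))\<^sup>2"
      using sum_sq_bound[of "\<phi> (s, c) - \<phi> (s, t)" "\<phi> (s, t) - \<phi> (s', t)"] by simp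
    ultimately show ?thesis by (simp add: q')
  qed
  define m where "m = L2inner \<phi> (indicator Q)"
  have iQ: "sq_int (indicator Q :: real \<times> real \<Rightarrow> complex)" by (rule sq_int_indicator) (use Qarea in auto)
  \<comment> \<open>Averaging over Q: pairing \<phi> (s, c) - \<phi> with the indicator of Q gives
    h^2 \<phi> (s, c) - m. Cauchy-Schwarz against area h^2 and division by h^4 produce the stated
    weights.\<close>
  have pt: "(cmod (\<phi> (s, c)))\<^sup>2 \<le> 4 * h * D2 s + (4 * G1 + 2 / h ^ 4 * (cmod m)\<^sup>2)" if s: "s \<in> ?I" for s
  proof -
    define F where "F q = indicator Q q * (\<phi> (s, c) - \<phi> q)" for q
    have Fm [measurable]: "F \<in> borel_measurable borel" unfolding F_def by measurable
    define w where "w q = indicator Q q * (2 * h * D2 s + 2 * h * D1 (snd q))" for q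
    have [measurable]: "(\<lambda>q::real \<times> real. D1 (snd q)) \<in> borel_measurable borel"
      using borel_measurable_integrable[OF D1(1)] by (auto intro: measurable_compose[OF borel_measurable_continuous_onI[OF continuous_on_snd[OF continuous_on_id]]])
    have wD: "integrable lborel (\<lambda>q. indicator Q q * D1 (snd q))" by (rule Qint[where B = "B1\<^sup>2 * h"]) (use D1bd in auto)
    have wi: "integrable lborel w" unfolding w_def
      by (rule Qint[where B = "2 * h * \<bar>D2 s\<bar> + 2 * h * (B1\<^sup>2 * h)"])
         (use D1bd D0 h in \<open>auto simp: abs_mult intro!: order_trans[OF abs_triangle_ineq] add_mono mult_left_mono\<close>)
    have Fw: "(cmod (F q))\<^sup>2 \<le> w q" for q using osc[OF s, of q] by (auto simp: F_def w_def indicator_def)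
    have sF: "sq_int F" by (rule sq_intI_bound[OF Fm wi Fw])
    have "L2norm2 F \<le> (\<integral>q. w q \<partial>lborel)"
      unfolding L2norm2_def by (intro integral_mono sq_int_integrable sF wi Fw)
    also have "\<dots> = 2 * h * D2 s * h\<^sup>2 + 2 * h * (h * G1)"
    proof -
      have "(\<integral>q. indicator Q q * D1 (snd q) \<partial>lborel) = (\<integral>t. \<integral>s. indicator Q (s, t) * D1 t \<partial>lborel \<partial>lborel)"
        using plane_fubini(4)[OF wD] by simp
      also have "\<dots> = (\<integral>t. h * D1 t \<partial>lborel)"
      proof (rule Bochner_Integration.integral_cong[OF refl])
        fix t
        have "(\<integral>s. indicator Q (s, t) * D1 t \<partial>lborel) = (\<integral>s. (indicator ?J t * D1 t) * indicator ?I s \<partial>lborel)"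
          unfolding Q_def by (simp add: indicator_times mult_ac)
        also have "\<dots> = indicator ?J t * D1 t * h" using h by simp
        also have "indicator ?J t * D1 t = D1 t" by (simp add: D1eq indicator_def)
        finally show "(\<integral>s. indicator Q (s, t) * D1 t \<partial>lborel) = h * D1 t" by simp
      qed
      finally have "(\<integral>q. indicator Q q * D1 (snd q) \<partial>lborel) = h * G1" using D1(2) by simp
      moreover have "w = (\<lambda>q. (2 * h * D2 s) * indicator Q q + (2 * h) * (indicator Q q * D1 (snd q)))"
        by (auto simp: w_def fun_eq_iff algebra_simps)
      moreover have "integrable lborel (\<lambda>q. (2 * h * D2 s) * indicator Q q)"
        using Qarea by (intro integrable_mult_right integrable_real_indicator) auto
      ultimately show ?thesis using wD Qarea by simp
    qed
    finally have FL: "L2norm2 F \<le> h\<^sup>2 * (2 * h * D2 s + 2 * G1)" by (simp add: power2_eq_square algebra_simps)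
    have "L2inner F (indicator Q) = (\<integral>q. \<phi> (s, c) * indicator Q q - \<phi> q * cnj (indicator Q q) \<partial>lborel)"
      unfolding L2inner_def F_def by (intro Bochner_Integration.integral_cong) (auto simp: indicator_def)
    also have "\<dots> = of_real (h\<^sup>2) * \<phi> (s, c) - m"
    proof -
      have i: "integrable lborel (\<lambda>q. \<phi> q * cnj (indicator Q q))" by (rule sq_int_mult_integrable(1)[OF test_sq_int[OF \<phi>] iQ])
      have j: "integrable lborel (\<lambda>q. \<phi> (s, c) * indicator Q q)" 
      proof (rule integrable_mult_right)
        have "integrable lborel (\<lambda>q. complex_of_real (indicator Q q))"
          using Qarea by (intro integrable_of_real integrable_real_indicator) auto
        then show "integrable lborel (indicator Q :: real \<times> real \<Rightarrow> complex)" by (simp add: of_real_indicator)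
      qed
      have "(\<integral>q. complex_of_real (indicator Q q) \<partial>lborel) = of_real (h\<^sup>2)"
        unfolding integral_complex_of_real using Qarea by simp
      then have Qi: "(\<integral>q. indicator Q q \<partial>lborel) = complex_of_real (h\<^sup>2)" by (simp add: of_real_indicator)
      show ?thesis
        unfolding Bochner_Integration.integral_diff[OF j i] m_def L2inner_def by (simp add: Qi)
    qed
    finally have mm: "L2inner F (indicator Q) = of_real (h\<^sup>2) * \<phi> (s, c) - m" .
    have "(cmod (of_real (h\<^sup>2) * \<phi> (s, c) - m))\<^sup>2 \<le> L2norm2 F * L2norm2 (indicator Q :: real \<times> real \<Rightarrow> complex)"
      unfolding mm[symmetric] by (rule L2inner_le[OF sF iQ])
    also have "L2norm2 (indicator Q :: real \<times> real \<Rightarrow> complex) = h\<^sup>2" using L2norm2_indicator_diff[of Q "{}"] Qarea by simp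
    finally have "(cmod (of_real (h\<^sup>2) * \<phi> (s, c) - m))\<^sup>2 \<le> L2norm2 F * h\<^sup>2" .
    moreover have "L2norm2 F * h\<^sup>2 \<le> h\<^sup>2 * (2 * h * D2 s + 2 * G1) * h\<^sup>2" using FL by (intro mult_right_mono) auto
    ultimately have e1: "(cmod (of_real (h\<^sup>2) * \<phi> (s, c) - m))\<^sup>2 \<le> h ^ 4 * (2 * h * D2 s + 2 * G1)"
      by (simp add: power4_eq_xxxx power2_eq_square mult_ac)
    have "h ^ 4 * (cmod (\<phi> (s, c)))\<^sup>2 = (cmod (of_real (h\<^sup>2) * \<phi> (s, c)))\<^sup>2"
      using h by (simp add: norm_mult norm_power power_mult_distrib flip: power_mult)
    also have "\<dots> \<le> 2 * (cmod (of_real (h\<^sup>2) * \<phi> (s, c) - m))\<^sup>2 + 2 * (cmod m)\<^sup>2"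
      using sum_sq_bound[of "of_real (h\<^sup>2) * \<phi> (s, c) - m" m] by simp
    also have "\<dots> \<le> h ^ 4 * (4 * h * D2 s + (4 * G1 + 2 / h ^ 4 * (cmod m)\<^sup>2))"
    proof -
      have "h ^ 4 * (4 * h * D2 s + (4 * G1 + 2 / h ^ 4 * (cmod m)\<^sup>2)) = 2 * (h ^ 4 * (2 * h * D2 s + 2 * G1)) + 2 * (cmod m)\<^sup>2"
        using h by (simp add: field_simps)
      then show ?thesis using e1 by linarith
    qed
    finally show ?thesis using h by (simp add: mult_le_cancel_left_pos)
  qed
  \<comment> \<open>Integrating the pointwise bound over an interval of length h turns G1 into h G1
    and 2 / h^4 into 2 / h^3, so both energies end up with the small factor 4 h.\<close>
  have "L2norm2 (\<lambda>s. indicator ?I s * \<phi> (s, c)) \<le> (\<integral>s. 4 * h * D2 s + (4 * G1 + 2 / h ^ 4 * (cmod m)\<^sup>2) * indicator ?I s \<partial>lborel)"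
    unfolding L2norm2_def
  proof (rule Bochner_Integration.integral_mono_AE')
    show "integrable lborel (\<lambda>s. 4 * h * D2 s + (4 * G1 + 2 / h ^ 4 * (cmod m)\<^sup>2) * indicator ?I s)"
      using D2(1) h by (intro Bochner_Integration.integrable_add integrable_mult_right integrable_real_indicator) auto
    show "AE s in lborel. (cmod (indicator ?I s * \<phi> (s, c)))\<^sup>2 \<le> 4 * h * D2 s + (4 * G1 + 2 / h ^ 4 * (cmod m)\<^sup>2) * indicator ?I s"
      using pt D0 h by (intro AE_I2) (auto simp: indicator_def)
    have "0 \<le> G1" unfolding G1_def g1_def by (intro Bochner_Integration.integral_nonneg) simp
    then show "AE s in lborel. 0 \<le> 4 * h * D2 s + (4 * G1 + 2 / h ^ 4 * (cmod m)\<^sup>2) * indicator ?I s"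
      using D0 h by (intro AE_I2) auto
  qed
  also have "\<dots> = 4 * h * G2 + (4 * G1 + 2 / h ^ 4 * (cmod m)\<^sup>2) * h"
  proof -
    have "integrable lborel (\<lambda>s. 4 * h * D2 s)" "integrable lborel (\<lambda>s. (4 * G1 + 2 / h ^ 4 * (cmod m)\<^sup>2) * indicator ?I s)"
      using D2(1) h by (auto intro!: integrable_mult_right integrable_real_indicator)
    then show ?thesis using D2(2) h by (subst Bochner_Integration.integral_add) auto
  qed
  also have "\<dots> = 4 * h * (G1 + G2) + 2 / h ^ 3 * (cmod m)\<^sup>2"
    using h by (simp add: field_simps power4_eq_xxxx power3_eq_cube)
  also have "G1 + G2 = (\<integral>q. indicator Q q * ((cmod (?d1 q))\<^sup>2 + (cmod (?d2 q))\<^sup>2) \<partial>lborel)"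
    using gi unfolding G1_def G2_def g1_def g2_def by (simp add: distrib_left)
  finally show ?thesis unfolding m_def .
qed

definition cell :: "real \<Rightarrow> real \<Rightarrow> real \<Rightarrow> nat \<Rightarrow> (real \<times> real) set" where
  "cell p c h j = {p + real j * h..<p + real j * h + h} \<times> {c..<c + h}"

lemma sum_indicator_partition:
  assumes "h > 0"
  shows "(\<Sum>j<N. indicator {p + real j * h..<p + real j * h + h} s) = (indicator {p..<p + real N * h} s :: real)"
proof (induction N)
  case (Suc N)
  define u where "u = p + real N * h"
  have "p \<le> u" "p + real (Suc N) * h = u + h" using assms by (simp_all add: u_def algebra_simps)
  then have "indicator {p..<p + real (Suc N) * h} s = (indicator {p..<u} s + indicator {u..<u + h} s :: real)"
    using assms by (auto simp: indicator_def)
  then show ?case using Suc by (simp add: u_def)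
qed simp

lemma cell_finite: "emeasure lborel (cell p c h j) < \<infinity>" and cell_sets: "cell p c h j \<in> sets borel"
proof -
  show "cell p c h j \<in> sets borel" unfolding cell_def by (simp add: borel_Times)
  have "bounded {x..<y}" for x y :: real by (rule bounded_subset[of "{x..y}"]) auto
  then have "bounded (cell p c h j)" unfolding cell_def by (intro bounded_Times)
  then show "emeasure lborel (cell p c h j) < \<infinity>" by (rule emeasure_bounded_finite)
qed

lemma cell_sq_int: "sq_int (indicator (cell p c h j) :: real \<times> real \<Rightarrow> complex)"
  by (rule sq_int_indicator) (use cell_finite cell_sets in auto)

text \<open>The cells are disjoint, so their Dirichlet energies add up to at most the total one.
  Hence the factor 4 h does not grow with the number of cells.\<close>

lemma segment_bound_test:
  fixes \<phi> :: "real \<times> real \<Rightarrow> complex"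
  assumes \<phi>: "test_fun \<phi>" and h: "h > 0"
  shows "L2norm2 (\<lambda>s. indicator {p..<p + real N * h} s * \<phi> (s, c)) \<le>
    4 * h * (L2norm2 (dderiv [(1, 0)] \<phi>) + L2norm2 (dderiv [(0, 1)] \<phi>)) +
    2 / h ^ 3 * (\<Sum>j<N. (cmod (L2inner \<phi> (indicator (cell p c h j))))\<^sup>2)"
proof -
  let ?I = "\<lambda>j. {p + real j * h..<p + real j * h + h}"
  define e where "e q = (cmod (dderiv [(1, 0)] \<phi> q))\<^sup>2 + (cmod (dderiv [(0, 1)] \<phi> q))\<^sup>2" for q
  have ei: "integrable lborel e" unfolding e_def
    by (intro Bochner_Integration.integrable_add sq_int_integrable test_sq_int test_dderiv \<phi>)
  have e0: "0 \<le> e q" for q by (simp add: e_def)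
  have ci: "integrable lborel (\<lambda>q. indicator (cell p c h j) q * e q)" for j
    using integrable_mult_indicator[OF _ ei, of "cell p c h j"] cell_sets by simp
  have si: "integrable lborel (\<lambda>s. indicator (?I j) s * (cmod (\<phi> (s, c)))\<^sup>2)" for j
    using integrable_mult_indicator[OF _ sq_int_integrable[OF test_sq_int[OF slices(1)[OF \<phi>, of c]]], of "?I j"] by simp
  have ind2: "(cmod (indicator A s * z))\<^sup>2 = indicator A s * (cmod z)\<^sup>2" for A and s :: real and z
    by (auto simp: indicator_def)
  have "L2norm2 (\<lambda>s. indicator {p..<p + real N * h} s * \<phi> (s, c)) = (\<Sum>j<N. L2norm2 (\<lambda>s. indicator (?I j) s * \<phi> (s, c)))"
    unfolding L2norm2_def ind2 sum_indicator_partition[OF h, symmetric] sum_distrib_right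
    by (rule Bochner_Integration.integral_sum) (rule si)
  also have "\<dots> \<le> (\<Sum>j<N. 4 * h * (\<integral>q. indicator (cell p c h j) q * e q \<partial>lborel) + 2 / h ^ 3 * (cmod (L2inner \<phi> (indicator (cell p c h j))))\<^sup>2)"
    unfolding cell_def e_def by (intro sum_mono cell_bound \<phi> h)
  also have "\<dots> = 4 * h * (\<Sum>j<N. \<integral>q. indicator (cell p c h j) q * e q \<partial>lborel) + 2 / h ^ 3 * (\<Sum>j<N. (cmod (L2inner \<phi> (indicator (cell p c h j))))\<^sup>2)"
    by (simp add: sum.distrib sum_distrib_left)
  also have "(\<Sum>j<N. \<integral>q. indicator (cell p c h j) q * e q \<partial>lborel) \<le> (\<integral>q. e q \<partial>lborel)"
  proof -
    have "(\<Sum>j<N. indicator (cell p c h j) q * e q) \<le> e q" for q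
    proof -
      have "(\<Sum>j<N. indicator (cell p c h j) q) \<le> (\<Sum>j<N. indicator (?I j) (fst q) :: real)"
        by (intro sum_mono) (auto simp: cell_def indicator_def)
      also have "\<dots> \<le> 1" unfolding sum_indicator_partition[OF h] by (simp add: indicator_def)
      finally have "(\<Sum>j<N. indicator (cell p c h j) q) * e q \<le> 1 * e q" using e0 by (intro mult_right_mono)
      then show ?thesis by (simp add: sum_distrib_right)
    qed
    then have "(\<integral>q. (\<Sum>j<N. indicator (cell p c h j) q * e q) \<partial>lborel) \<le> (\<integral>q. e q \<partial>lborel)"
      by (intro integral_mono Bochner_Integration.integrable_sum ci ei)
    moreover have "(\<integral>q. (\<Sum>j<N. indicator (cell p c h j) q * e q) \<partial>lborel) = (\<Sum>j<N. \<integral>q. indicator (cell p c h j) q * e q \<partial>lborel)"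
      by (rule Bochner_Integration.integral_sum) (rule ci)
    ultimately show ?thesis by (simp only:)
  qed
  also have "(\<integral>q. e q \<partial>lborel) = L2norm2 (dderiv [(1, 0)] \<phi>) + L2norm2 (dderiv [(0, 1)] \<phi>)"
    unfolding e_def L2norm2_def
    by (intro Bochner_Integration.integral_add sq_int_integrable test_sq_int test_dderiv \<phi>)
  finally show ?thesis using h by simp
qed

lemma sq_int_indicator_mult:
  assumes "sq_int f" "A \<in> sets borel"
  shows "sq_int (\<lambda>s. indicator A s * f s)" "L2norm2 (\<lambda>s. indicator A s * f s) \<le> L2norm2 f"
proof -
  have le: "(cmod (indicator A s * f s))\<^sup>2 \<le> (cmod (f s))\<^sup>2" for s by (auto simp: indicator_def)
  show s: "sq_int (\<lambda>s. indicator A s * f s)"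
    using assms by (intro sq_intI_bound[OF _ sq_int_integrable[OF assms(1)] le]) (auto simp: sq_int_def)
  show "L2norm2 (\<lambda>s. indicator A s * f s) \<le> L2norm2 f"
    unfolding L2norm2_def by (intro integral_mono sq_int_integrable s assms le)
qed

lemma segment_bound:
  assumes W: "W12 \<psi>" and h: "h > 0"
  shows "L2norm2 (\<lambda>s. indicator {p..<p + real N * h} s * tr_line \<psi> c s) \<le>
    4 * h * (L2norm2 (wd \<psi> (1, 0)) + L2norm2 (wd \<psi> (0, 1))) +
    2 / h ^ 3 * (\<Sum>j<N. (cmod (L2inner \<psi> (indicator (cell p c h j))))\<^sup>2)"
proof -
  let ?A = "{p..<p + real N * h}"
  obtain \<phi>s where t: "\<And>n. test_fun (\<phi>s n)" "W12_lim \<phi>s \<psi>" using W12_test_dense[OF W] by blast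
  have B: "(1, 0) \<in> (Basis :: (real \<times> real) set)" "(0, 1) \<in> (Basis :: (real \<times> real) set)" by (auto simp: Basis_plane)
  have li: "(\<lambda>n. L2inner (\<phi>s n) (indicator (cell p c h j))) \<longlonglongrightarrow> L2inner \<psi> (indicator (cell p c h j))" for j
    by (rule L2inner_tendsto[OF test_sq_int[OF t(1)] W12_sq_int[OF W] W12_lim_D(1)[OF t(2)] cell_sq_int cell_sq_int])
       (simp add: L2norm2_def)
  note sl = test_sq_int[OF slices(1)[OF t(1)]] and tr = tr_line_tendsto[OF W, where c = c]
  show ?thesis
  proof (rule LIMSEQ_le)
    show "(\<lambda>n. L2norm2 (\<lambda>s. indicator ?A s * \<phi>s n (s, c))) \<longlonglongrightarrow> L2norm2 (\<lambda>s. indicator ?A s * tr_line \<psi> c s)"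
    proof (rule L2norm2_tendsto)
      show "(\<lambda>n. L2norm2 (\<lambda>s. indicator ?A s * \<phi>s n (s, c) - indicator ?A s * tr_line \<psi> c s)) \<longlonglongrightarrow> 0"
      proof (rule tendsto_zero_le[OF _ _ tr(2)[OF t]])
        show "L2norm2 (\<lambda>s. indicator ?A s * \<phi>s n (s, c) - indicator ?A s * tr_line \<psi> c s) \<le> L2norm2 (\<lambda>s. \<phi>s n (s, c) - tr_line \<psi> c s)" for n
          using sq_int_indicator_mult(2)[OF sq_int_diff[OF sl[of n c] tr(1)], of ?A] by (simp add: right_diff_distrib)
      qed simp
    qed (intro sq_int_indicator_mult sl tr; simp)+
    show "(\<lambda>n. 4 * h * (L2norm2 (dderiv [(1, 0)] (\<phi>s n)) + L2norm2 (dderiv [(0, 1)] (\<phi>s n))) +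
        2 / h ^ 3 * (\<Sum>j<N. (cmod (L2inner (\<phi>s n) (indicator (cell p c h j))))\<^sup>2)) \<longlonglongrightarrow>
        4 * h * (L2norm2 (wd \<psi> (1, 0)) + L2norm2 (wd \<psi> (0, 1))) + 2 / h ^ 3 * (\<Sum>j<N. (cmod (L2inner \<psi> (indicator (cell p c h j))))\<^sup>2)"
      by (intro tendsto_intros W12_planeD(2)[OF W t] B li)
  qed (use segment_bound_test[OF t(1) h] in blast)
qed

context double_line
begin

definition seg :: "real \<Rightarrow> real \<Rightarrow> (real \<times> real \<Rightarrow> complex) \<Rightarrow> real" where
  "seg L c \<psi> = L2norm2 (\<lambda>s. indicator {- L..<L} s * tr_line \<psi> c s)"

text \<open>The means over all cells, for both lines and all mesh sizes, form a countable family of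
  bounded functionals, so one diagonal subsequence makes all of them converge. A fine mesh then
  handles the energy term and convergence of finitely many means the rest.\<close>

lemma segment_compact:
  assumes W: "\<And>n. W12 (\<Psi> n)" and bd: "\<And>n. grad (\<Psi> n) \<le> B" "\<And>n. L2norm2 (\<Psi> n) \<le> B" and L: "L > 0"
  shows "\<exists>r::nat \<Rightarrow> nat. strict_mono r \<and>
    (\<forall>c\<in>{a, - a}. \<forall>\<epsilon>>0. \<exists>n0. \<forall>i\<ge>n0. \<forall>j\<ge>n0. seg L c (\<lambda>x. \<Psi> (r i) x - \<Psi> (r j) x) < \<epsilon>)"
proof -
  define h where "h N = 2 * L / real (Suc N)" for N
  have h: "h N > 0" "h N \<le> 2 * L" "- L + real (Suc N) * h N = L" for N
    using L by (simp_all add: h_def field_simps)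
  define c where "c b = (if b then a else - a)" for b
  define q where "q x = (case x of (b, N, j) \<Rightarrow> (indicator (cell (- L) (c b) (h N) j) :: real \<times> real \<Rightarrow> complex))" for x
  have qsq: "sq_int (q x)" for x by (cases x) (simp add: q_def cell_sq_int)
  have B0: "0 \<le> B" using bd(2)[of 0] L2norm2_nonneg[of "\<Psi> 0"] by linarith
  have qn: "L2norm2 (q x) \<le> (2 * L)\<^sup>2" for x
  proof (cases x)
    case (fields b N j)
    have "emeasure lborel (cell (- L) (c b) (h N) j) = ennreal (h N) * ennreal (h N)"
      unfolding cell_def lborel_prod[symmetric] by (subst lborel.emeasure_pair_measure_Times) (use h[of N] in auto)
    then have "measure lborel (cell (- L) (c b) (h N) j) = (h N)\<^sup>2"
      using h[of N] by (simp add: measure_def power2_eq_square flip: ennreal_mult)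
    then have "L2norm2 (q x) = (h N)\<^sup>2"
      using L2norm2_indicator_diff[of "cell (- L) (c b) (h N) j" "{}"] cell_sets by (simp add: q_def fields)
    also have "\<dots> \<le> (2 * L)\<^sup>2" using h[of N] by (intro power_mono) auto
    finally show ?thesis .
  qed
  have bound: "norm (L2inner (\<Psi> n) (q x)) \<le> sqrt (B * (2 * L)\<^sup>2)" for n x
  proof (rule real_le_rsqrt)
    have "(cmod (L2inner (\<Psi> n) (q x)))\<^sup>2 \<le> L2norm2 (\<Psi> n) * L2norm2 (q x)" by (rule L2inner_le[OF W12_sq_int[OF W] qsq])
    also have "\<dots> \<le> B * (2 * L)\<^sup>2" using bd(2) qn B0 by (intro mult_mono) auto
    finally show "(cmod (L2inner (\<Psi> n) (q x)))\<^sup>2 \<le> B * (2 * L)\<^sup>2" .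
  qed
  obtain r where r: "strict_mono (r :: nat \<Rightarrow> nat)" and conv: "\<And>x. x \<in> (UNIV :: (bool \<times> nat \<times> nat) set) \<Longrightarrow> \<exists>l. (\<lambda>n. L2inner (\<Psi> (r n)) (q x)) \<longlonglongrightarrow> l"
    using function_convergent_subsequence[of UNIV "\<lambda>n x. L2inner (\<Psi> n) (q x)", OF _ bound] by auto
  have "\<exists>n0. \<forall>i\<ge>n0. \<forall>j\<ge>n0. seg L (c b) (\<lambda>x. \<Psi> (r i) x - \<Psi> (r j) x) < \<epsilon>" if eps: "\<epsilon> > 0" for b \<epsilon>
  proof -
    \<comment> \<open>Differences of two members have gradient energy at most 4 B, and 16 B h N = 32
      B L / (N + 1).\<close>
    obtain N where N: "32 * B * L / \<epsilon> < real N" using reals_Archimedean2 by blast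
    have hN: "4 * h N * (4 * B) < \<epsilon>"
    proof -
      have "32 * B * L < real N * \<epsilon>" using N eps by (simp add: field_simps)
      also have "\<dots> \<le> real (Suc N) * \<epsilon>" using eps by (intro mult_right_mono) auto
      finally show ?thesis by (simp add: h_def field_simps)
    qed
    define f where "f m i = L2inner (\<Psi> (r i)) (q (b, N, m))" for m i
    have "\<forall>m. \<exists>l. f m \<longlonglongrightarrow> l" unfolding f_def using conv by blast
    then have cau: "Cauchy (f m)" for m using LIMSEQ_imp_Cauchy by blast
    define D where "D = (\<epsilon> - 4 * h N * (4 * B)) / 2"
    have D: "D > 0" using hN by (simp add: D_def)
    \<comment> \<open>Chosen so that the N + 1 mean terms, with their weight 2 / h^3, contribute
      exactly D.\<close>
    define \<eta> where "\<eta> = sqrt (D * h N ^ 3 / (2 * real (Suc N)))"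
    have \<eta>: "\<eta> > 0" "\<eta>\<^sup>2 = D * h N ^ 3 / (2 * real (Suc N))" using D h[of N] by (simp_all add: \<eta>_def)
    have "\<forall>m. \<exists>n0. \<forall>i\<ge>n0. \<forall>j\<ge>n0. dist (f m i) (f m j) < \<eta>"
      using cau \<eta>(1) unfolding Cauchy_def by blast
    then obtain n0 where n0: "\<And>m i j. i \<ge> n0 m \<Longrightarrow> j \<ge> n0 m \<Longrightarrow> dist (f m i) (f m j) < \<eta>" by metis
    define M0 where "M0 = Max (n0 ` {..N})"
    have M0: "n0 m \<le> M0" if "m < Suc N" for m using that by (auto simp: M0_def)
    have "seg L (c b) (\<lambda>x. \<Psi> (r i) x - \<Psi> (r j) x) < \<epsilon>" if ij: "i \<ge> M0" "j \<ge> M0" for i j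
    proof -
      define y where "y = (\<lambda>x. \<Psi> (r i) x - \<Psi> (r j) x)"
      have Wy: "W12 y" unfolding y_def by (rule W12_diff(1)[OF W W])
      have B': "(1, 0) \<in> (Basis :: (real \<times> real) set)" "(0, 1) \<in> (Basis :: (real \<times> real) set)" by (auto simp: Basis_plane)
      have gy: "grad y \<le> 4 * B"
        unfolding y_def grad_diff[OF W W]
        using L2norm2_diff_le[OF wd_props(1)[OF W B'(1)] wd_props(1)[OF W B'(1)], of "r i" "r j"]
          L2norm2_diff_le[OF wd_props(1)[OF W B'(2)] wd_props(1)[OF W B'(2)], of "r i" "r j"]
          bd(1)[of "r i"] bd(1)[of "r j"] unfolding grad_def by linarith
      have tm: "(cmod (L2inner y (indicator (cell (- L) (c b) (h N) m))))\<^sup>2 \<le> \<eta>\<^sup>2" if m: "m < Suc N" for m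
      proof -
        have "L2inner y (indicator (cell (- L) (c b) (h N) m)) = f m i - f m j"
          using L2.diff_left[of "\<Psi> (r i)" "\<Psi> (r j)" "indicator (cell (- L) (c b) (h N) m)"] W12_sq_int[OF W] cell_sq_int
          by (simp add: f_def y_def fun_diff_def q_def)
        moreover have "cmod (f m i - f m j) \<le> \<eta>"
          using n0[of m i j] M0[OF m] ij by (simp add: dist_norm)
        ultimately show ?thesis by (simp add: power_mono)
      qed
      have "seg L (c b) y \<le> 4 * h N * grad y + 2 / h N ^ 3 * (\<Sum>m<Suc N. (cmod (L2inner y (indicator (cell (- L) (c b) (h N) m))))\<^sup>2)"
        using segment_bound[OF Wy h(1), where p = "- L" and N = "Suc N" and c = "c b", of N] unfolding h(3) seg_def grad_def .
      also have "\<dots> \<le> 4 * h N * (4 * B) + 2 / h N ^ 3 * (\<Sum>m<Suc N. \<eta>\<^sup>2)"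
        using h(1)[of N] gy by (intro add_mono mult_left_mono sum_mono tm) auto
      also have "\<dots> = 4 * h N * (4 * B) + D" unfolding \<eta>(2) using h(1)[of N] by (simp add: field_simps del: of_nat_Suc)
      also have "\<dots> < \<epsilon>" using field_sum_of_halves[of \<epsilon>] hN unfolding D_def by argo
      finally show ?thesis by (simp add: y_def)
    qed
    then show ?thesis by blast
  qed
  from this[of _ True] this[of _ False] show ?thesis using r by (auto simp: c_def)
qed

section \<open>Decaying potentials: compactness of minimising sequences below the threshold\<close>

lemma wform_lower:
  assumes V: "bdd_weight C V" and tail: "AE s in lborel. s \<notin> {- L..<L} \<longrightarrow> \<bar>V s\<bar> \<le> \<epsilon>" and "\<epsilon> \<ge> 0" and f: "sq_int f"
  shows "- \<epsilon> * L2norm2 f - C * L2norm2 (\<lambda>s. indicator {- L..<L} s * f s) - \<alpha> * L2norm2 f \<le> Re (wform (\<lambda>s. V s - \<alpha>) f f)"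
proof -
  let ?A = "{- L..<L}"
  note i = sq_int_integrable[OF f] sq_int_integrable[OF sq_int_indicator_mult(1)[OF f, of ?A]]
  have Va: "integrable lborel (\<lambda>s. V s * (cmod (f s))\<^sup>2)" by (rule wform_integrable[OF V f])
  have "(\<integral>s. - \<epsilon> * (cmod (f s))\<^sup>2 - C * (cmod (indicator ?A s * f s))\<^sup>2 - \<alpha> * (cmod (f s))\<^sup>2 \<partial>lborel) \<le>
      (\<integral>s. V s * (cmod (f s))\<^sup>2 - \<alpha> * (cmod (f s))\<^sup>2 \<partial>lborel)"
  proof (rule integral_mono_AE)
    show "integrable lborel (\<lambda>s. - \<epsilon> * (cmod (f s))\<^sup>2 - C * (cmod (indicator ?A s * f s))\<^sup>2 - \<alpha> * (cmod (f s))\<^sup>2)"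
      by (intro Bochner_Integration.integrable_diff integrable_mult_right i) simp
    show "integrable lborel (\<lambda>s. V s * (cmod (f s))\<^sup>2 - \<alpha> * (cmod (f s))\<^sup>2)"
      by (intro Bochner_Integration.integrable_diff integrable_mult_right i Va)
    have "AE s in lborel. \<bar>V s\<bar> \<le> C" using V by (simp add: bdd_weight_def)
    then show "AE s in lborel. - \<epsilon> * (cmod (f s))\<^sup>2 - C * (cmod (indicator ?A s * f s))\<^sup>2 - \<alpha> * (cmod (f s))\<^sup>2 \<le>
        V s * (cmod (f s))\<^sup>2 - \<alpha> * (cmod (f s))\<^sup>2"
      using tail
    proof eventually_elim
      fix s assume s: "\<bar>V s\<bar> \<le> C" "s \<notin> ?A \<longrightarrow> \<bar>V s\<bar> \<le> \<epsilon>"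
      have "- \<epsilon> - C * indicator ?A s \<le> V s" using s \<open>\<epsilon> \<ge> 0\<close> C by (cases "s \<in> ?A") auto
      from mult_right_mono[OF this zero_le_power2[of "cmod (f s)"]]
      show "- \<epsilon> * (cmod (f s))\<^sup>2 - C * (cmod (indicator ?A s * f s))\<^sup>2 - \<alpha> * (cmod (f s))\<^sup>2 \<le> V s * (cmod (f s))\<^sup>2 - \<alpha> * (cmod (f s))\<^sup>2"
        by (auto simp: indicator_def left_diff_distrib)
    qed
  qed
  moreover have "(\<integral>s. - \<epsilon> * (cmod (f s))\<^sup>2 - C * (cmod (indicator ?A s * f s))\<^sup>2 - \<alpha> * (cmod (f s))\<^sup>2 \<partial>lborel) =
      - \<epsilon> * L2norm2 f - C * L2norm2 (\<lambda>s. indicator ?A s * f s) - \<alpha> * L2norm2 f"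
    unfolding L2norm2_def using i by simp
  ultimately show ?thesis unfolding Re_wform by (simp add: left_diff_distrib)
qed

text \<open>The potentials are replaced by - \<epsilon> on both lines plus - C on the segment. The
  attraction \<alpha> is paid for by the transverse bound, leaving only an \<epsilon> error and the
  segment traces.\<close>

lemma E_tail_lower:
  assumes W: "W12 \<psi>" and rate: "k * (1 + tanh (k * a)) = \<alpha>" and eps: "\<epsilon> \<ge> 0"
    and tail: "AE s in lborel. s \<notin> {- L..<L} \<longrightarrow> \<bar>Vp s\<bar> \<le> \<epsilon>" "AE s in lborel. s \<notin> {- L..<L} \<longrightarrow> \<bar>Vm s\<bar> \<le> \<epsilon>"
  shows "- k\<^sup>2 * L2norm2 \<psi> \<le> (1 + 4 * \<epsilon>) * Re (E \<psi> \<psi>) + \<epsilon> * (4 * M + 2) * L2norm2 \<psi> + C * (seg L a \<psi> + seg L (- a) \<psi>)"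
proof -
  define T where "T = L2norm2 (tr_line \<psi> a) + L2norm2 (tr_line \<psi> (- a))"
  have "grad \<psi> - \<alpha> * T - \<epsilon> * T - C * (seg L a \<psi> + seg L (- a) \<psi>) \<le> Re (E \<psi> \<psi>)"
    using wform_lower[OF Vp tail(1) eps tr_line_tendsto(1)[OF W, of a]] wform_lower[OF Vm tail(2) eps tr_line_tendsto(1)[OF W, of "- a"]]
    unfolding Re_E[OF W] T_def seg_def by (simp add: algebra_simps)
  moreover have "\<alpha> * T \<le> grad \<psi> + k\<^sup>2 * L2norm2 \<psi>"
    using W12_two_line_bound[OF W a rate] L2norm2_nonneg[of "wd \<psi> (1, 0)"] unfolding T_def grad_def by linarith
  \<comment> \<open>Each trace is at most the gradient energy plus the squared norm, and
    \<open>E_lower\<close> bounds the gradient energy by 2 E + 2 M times the squared norm; two lines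
    double this.\<close>
  moreover have "\<epsilon> * T \<le> \<epsilon> * (4 * Re (E \<psi> \<psi>) + (4 * M + 2) * L2norm2 \<psi>)"
  proof (rule mult_left_mono[OF _ eps])
    have "L2norm2 (tr_line \<psi> c) \<le> grad \<psi> + L2norm2 \<psi>" for c
      using W12_line_bound[OF W, of 1 c] L2norm2_nonneg[of "wd \<psi> (1, 0)"] unfolding grad_def by (simp del: L2norm2_nonneg)
    from this[of a] this[of "- a"] show "T \<le> 4 * Re (E \<psi> \<psi>) + (4 * M + 2) * L2norm2 \<psi>"
      using E_lower[OF W] unfolding T_def by (simp add: distrib_right)
  qed
  ultimately show ?thesis by (simp add: algebra_simps)
qed

text \<open>Since the infimum lies strictly below the threshold, the tail estimate bounds the norm
  by the shifted form and the traces on a segment. Applied to differences of a minimising sequence,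
  both terms become small along a subsequence.\<close>

lemma bottom_compact:
  fixes x0 :: "real \<times> real \<Rightarrow> complex" and k :: real
  assumes rate: "k * (1 + tanh (k * a)) = \<alpha>" and below: "op.bottom < - k\<^sup>2"
    and x0: "W12 x0" "L2norm2 x0 > 0"
    and tail: "\<And>\<epsilon>. \<epsilon> > 0 \<Longrightarrow> \<exists>L>0. (AE s in lborel. s \<notin> {- L..<L} \<longrightarrow> \<bar>Vp s\<bar> \<le> \<epsilon>) \<and> (AE s in lborel. s \<notin> {- L..<L} \<longrightarrow> \<bar>Vm s\<bar> \<le> \<epsilon>)"
    and x: "\<And>n. x n \<in> {\<psi>. W12 \<psi>}" "\<And>n. Re (L2inner (x n) (x n)) = 1"
    and lim: "(\<lambda>n. Re (op.shifted op.bottom (x n) (x n))) \<longlonglongrightarrow> 0"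
  shows "\<exists>r::nat \<Rightarrow> nat. strict_mono r \<and> form_Cauchy op.full (x \<circ> r)"
proof -
  let ?m = op.bottom
  interpret b: semi_ip cscale "{\<psi>. W12 \<psi>}" "op.shifted ?m"
    by (rule op.bottom_semi_ip[of x0]) (use x0 in \<open>simp_all add: Re_L2inner\<close>)
  define bq where "bq \<psi> = Re (op.shifted ?m \<psi> \<psi>)" for \<psi>
  have bq: "bq \<psi> = Re (E \<psi> \<psi>) - ?m * L2norm2 \<psi>" for \<psi> by (simp add: bq_def op.shifted_def Re_L2inner)
  have W: "W12 (x n)" and n1: "L2norm2 (x n) = 1" for n using x by (auto simp: Re_L2inner)
  have "Bseq (\<lambda>n. bq (x n))" unfolding bq_def using lim by (intro convergent_imp_Bseq) (auto simp: convergent_def)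
  then obtain B1 where B1: "\<And>n. \<bar>bq (x n)\<bar> \<le> B1" unfolding Bseq_def by auto
  \<comment> \<open>From \<open>E_lower\<close> with norm 1: the gradient energy is at most 2 (B1 +
    bottom + M). The summand 1 makes B bound the norms too.\<close>
  define B where "B = 1 + \<bar>2 * (B1 + ?m + M)\<bar>"
  have bd: "grad (x n) \<le> B" "L2norm2 (x n) \<le> B" for n
    using E_lower[OF W, of n] B1[of n] n1[of n] bq[of "x n"] by (simp_all add: B_def)
  define \<delta> where "\<delta> = - k\<^sup>2 - ?m"
  have \<delta>: "\<delta> > 0" using below by (simp add: \<delta>_def)
  \<comment> \<open>Dominates the factor that \<epsilon> receives after E is rewritten through the
    shifted form; \<epsilon> A \<le> \<delta> / 2 then sacrifices at most half of the gap. The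
    summand 1 keeps A positive.\<close>
  define A where "A = \<bar>4 * M + 2 + 4 * ?m\<bar> + 1"
  define \<epsilon> where "\<epsilon> = min 1 (\<delta> / (2 * A))"
  have A: "A > 0" by (simp add: A_def)
  have eps: "\<epsilon> > 0" "\<epsilon> \<le> 1" "\<epsilon> * A \<le> \<delta> / 2"
  proof -
    show "\<epsilon> > 0" "\<epsilon> \<le> 1" using \<delta> A by (auto simp: \<epsilon>_def)
    have "\<epsilon> * A \<le> \<delta> / (2 * A) * A" using A by (intro mult_right_mono) (auto simp: \<epsilon>_def)
    then show "\<epsilon> * A \<le> \<delta> / 2" using A by simp
  qed
  obtain L where L: "L > 0" "AE s in lborel. s \<notin> {- L..<L} \<longrightarrow> \<bar>Vp s\<bar> \<le> \<epsilon>" "AE s in lborel. s \<notin> {- L..<L} \<longrightarrow> \<bar>Vm s\<bar> \<le> \<epsilon>"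
    using tail[OF eps(1)] by blast
  \<comment> \<open>Coercivity up to segment traces: substitute E = bq + bottom times the squared
    norm into the tail estimate and move the error to the left. The constant 5 is 1 + 4 \<epsilon>
    for \<epsilon> \<le> 1.\<close>
  have key: "\<delta> / 2 * L2norm2 \<psi> \<le> 5 * bq \<psi> + C * (seg L a \<psi> + seg L (- a) \<psi>)" if W: "W12 \<psi>" for \<psi>
  proof -
    have b0: "0 \<le> bq \<psi>" unfolding bq_def using b.nonneg W by simp
    have "- k\<^sup>2 * L2norm2 \<psi> \<le> (1 + 4 * \<epsilon>) * (bq \<psi> + ?m * L2norm2 \<psi>) + \<epsilon> * (4 * M + 2) * L2norm2 \<psi> + C * (seg L a \<psi> + seg L (- a) \<psi>)"
      using E_tail_lower[OF W rate less_imp_le[OF eps(1)] L(2,3)] by (simp add: bq)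
    then have "\<delta> * L2norm2 \<psi> \<le> (1 + 4 * \<epsilon>) * bq \<psi> + (\<epsilon> * (4 * M + 2 + 4 * ?m)) * L2norm2 \<psi> + C * (seg L a \<psi> + seg L (- a) \<psi>)"
      by (simp add: \<delta>_def algebra_simps)
    moreover have "(1 + 4 * \<epsilon>) * bq \<psi> \<le> 5 * bq \<psi>" using eps b0 by (intro mult_right_mono) auto
    moreover have "(\<epsilon> * (4 * M + 2 + 4 * ?m)) * L2norm2 \<psi> \<le> \<delta> / 2 * L2norm2 \<psi>"
    proof (rule mult_right_mono)
      have "\<epsilon> * (4 * M + 2 + 4 * ?m) \<le> \<epsilon> * A" using eps(1) by (intro mult_left_mono) (auto simp: A_def)
      then show "\<epsilon> * (4 * M + 2 + 4 * ?m) \<le> \<delta> / 2" using eps(3) by linarith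
    qed simp
    ultimately show ?thesis by linarith
  qed
  obtain r where r: "strict_mono (r :: nat \<Rightarrow> nat)"
    and segc: "\<And>c \<eta>. c \<in> {a, - a} \<Longrightarrow> \<eta> > 0 \<Longrightarrow> \<exists>n0. \<forall>i\<ge>n0. \<forall>j\<ge>n0. seg L c (\<lambda>p. x (r i) p - x (r j) p) < \<eta>"
    using segment_compact[of x B L, OF W bd L(1)] by blast
  have full: "Re (op.full \<psi> \<psi>) \<le> bq \<psi> + \<bar>?m + M + 1\<bar> * L2norm2 \<psi>" for \<psi>
  proof -
    have "(?m + M + 1) * L2norm2 \<psi> \<le> \<bar>?m + M + 1\<bar> * L2norm2 \<psi>" by (intro mult_right_mono) auto
    then show ?thesis by (simp add: op.full_def bq Re_L2inner algebra_simps)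
  qed
  have "form_Cauchy op.full (x \<circ> r)"
    unfolding form_Cauchy_def
  proof (intro allI impI)
    fix e :: real assume e: "e > 0"
    \<comment> \<open>If bq and both segment terms of a difference are at most \<eta>, its squared
      norm is at most (2 / \<delta>) (5 + 2 C) \<eta> and its form norm at most Z \<eta>, which is e
      / 2.\<close>
    define Z where "Z = 1 + \<bar>?m + M + 1\<bar> * (2 / \<delta> * (5 + 2 * C))"
    have Z: "Z > 0" using \<delta> C by (auto simp: Z_def intro!: add_pos_nonneg)
    define \<eta> where "\<eta> = e / (2 * Z)"
    have \<eta>: "\<eta> > 0" using e Z by (simp add: \<eta>_def)
    have "(\<lambda>n. bq (x (r n))) \<longlonglongrightarrow> 0"
      using LIMSEQ_subseq_LIMSEQ[OF lim r] by (simp add: o_def bq_def)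
    then obtain n1 where n1: "\<And>n. n \<ge> n1 \<Longrightarrow> \<bar>bq (x (r n))\<bar> < \<eta> / 4" using LIMSEQ_D[of _ 0 "\<eta>/4"] \<eta> by fastforce
    obtain n2 where n2: "\<forall>i\<ge>n2. \<forall>j\<ge>n2. seg L a (\<lambda>p. x (r i) p - x (r j) p) < \<eta>" using segc[of a, OF _ \<eta>] by auto
    obtain n3 where n3: "\<forall>i\<ge>n3. \<forall>j\<ge>n3. seg L (- a) (\<lambda>p. x (r i) p - x (r j) p) < \<eta>" using segc[of "- a", OF _ \<eta>] by auto
    have "Re (op.full ((x \<circ> r) i - (x \<circ> r) j) ((x \<circ> r) i - (x \<circ> r) j)) < e"
      if "i \<ge> max n1 (max n2 n3)" "j \<ge> max n1 (max n2 n3)" for i j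
    proof -
      define y where "y = x (r i) - x (r j)"
      have y': "y = (\<lambda>p. x (r i) p - x (r j) p)" by (simp add: y_def fun_diff_def)
      have Wy: "W12 y" unfolding y' by (rule W12_diff(1)[OF W W])
      have bqy: "bq y \<le> \<eta>"
        using b.diff_diag_le[of "x (r i)" "x (r j)"] W n1[of i] n1[of j] that unfolding bq_def y_def by simp
      have "seg L a y \<le> \<eta>" "seg L (- a) y \<le> \<eta>" using n2 n3 that unfolding y' by (auto intro!: less_imp_le)
      then have "C * (seg L a y + seg L (- a) y) \<le> C * (\<eta> + \<eta>)" by (intro mult_left_mono add_mono C)
      then have "\<delta> / 2 * L2norm2 y \<le> (5 + 2 * C) * \<eta>" using key[OF Wy] bqy by (simp add: algebra_simps)
      then have "L2norm2 y \<le> 2 / \<delta> * (5 + 2 * C) * \<eta>" using \<delta> by (simp add: field_simps)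
      then have "\<bar>?m + M + 1\<bar> * L2norm2 y \<le> \<bar>?m + M + 1\<bar> * (2 / \<delta> * (5 + 2 * C) * \<eta>)" by (intro mult_left_mono) auto
      then have "Re (op.full y y) \<le> Z * \<eta>" using full[of y] bqy by (simp add: Z_def algebra_simps)
      also have "\<dots> < e" using Z e by (simp add: \<eta>_def)
      finally show ?thesis by (simp add: y_def)
    qed
    then show "\<exists>N. \<forall>i\<ge>N. \<forall>j\<ge>N. Re (op.full ((x \<circ> r) i - (x \<circ> r) j) ((x \<circ> r) i - (x \<circ> r) j)) < e" by blast
  qed
  then show ?thesis using r by blast
qed

lemma bottom_isolated_eigenvalue:
  fixes x0 :: "real \<times> real \<Rightarrow> complex" and k :: real
  assumes rate: "k * (1 + tanh (k * a)) = \<alpha>" and below: "op.bottom < - k\<^sup>2"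
    and x0: "W12 x0" "L2norm2 x0 > 0"
    and tail: "\<And>\<epsilon>. \<epsilon> > 0 \<Longrightarrow> \<exists>L>0. (AE s in lborel. s \<notin> {- L..<L} \<longrightarrow> \<bar>Vp s\<bar> \<le> \<epsilon>) \<and> (AE s in lborel. s \<notin> {- L..<L} \<longrightarrow> \<bar>Vm s\<bar> \<le> \<epsilon>)"
  shows "isolated_fin_eigenvalue W12 E (of_real op.bottom)"
proof -
  have x0': "x0 \<in> {\<psi>. W12 \<psi>}" "Re (L2inner x0 x0) > 0" using x0 by (auto simp: Re_L2inner)
  have cpt: "\<exists>r::nat \<Rightarrow> nat. strict_mono r \<and> form_Cauchy op.full (x \<circ> r)"
    if "\<And>n. x n \<in> {\<psi>. W12 \<psi>}" "\<And>n. Re (L2inner (x n) (x n)) = 1" "(\<lambda>n. Re (op.shifted op.bottom (x n) (x n))) \<longlonglongrightarrow> 0" for x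
    by (rule bottom_compact[OF rate below x0 _ that]) (fact tail)
  note iso = op.bottom_isolated[OF x0' cpt]
  show ?thesis
    unfolding isolated_fin_eigenvalue_def
  proof (intro conjI)
    obtain \<psi> where o: "op.opr \<psi> (cscale (of_real op.bottom) \<psi>)" and one: "Re (L2inner \<psi> \<psi>) = 1" using iso(1) by blast
    from o have "op_rel W12 E \<psi> (\<lambda>x. of_real op.bottom * \<psi> x)" unfolding opr_iff cscale_def .
    moreover from this have "\<not> (AE x in lborel. \<psi> x = 0)"
      using L2norm2_eq_0_iff[OF W12_sq_int, of \<psi>] one by (auto simp: op_rel_def Re_L2inner)
    ultimately show "is_eigenvalue W12 E (of_real op.bottom)" unfolding is_eigenvalue_def by blast
    show "\<exists>\<epsilon>>0. \<forall>\<mu>\<in>op_spectrum W12 E. cmod (\<mu> - of_real op.bottom) < \<epsilon> \<longrightarrow> \<mu> = of_real op.bottom"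
      using iso(2) unfolding op_spectrum_def res_iff by blast
    obtain n es where es: "\<And>\<psi>. op.opr \<psi> (cscale (of_real op.bottom) \<psi>) \<Longrightarrow>
        Re (L2inner (\<psi> - op.proj n es \<psi>) (\<psi> - op.proj n es \<psi>)) = 0 \<and> op.proj n es \<psi> \<in> {\<psi>. W12 \<psi>}"
      using iso(3) by blast
    show "\<exists>n::nat. \<exists>\<psi>s. \<forall>\<psi>. op_rel W12 E \<psi> (\<lambda>x. of_real op.bottom * \<psi> x) \<longrightarrow> (\<exists>c. AE x in lborel. \<psi> x = (\<Sum>i<n. c i * \<psi>s i x))"
    proof (intro exI[of _ n] exI[of _ es] allI impI)
      fix \<psi> assume o: "op_rel W12 E \<psi> (\<lambda>x. of_real op.bottom * \<psi> x)"
      then have W: "W12 \<psi>" by (simp add: op_rel_def)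
      from o have "op.opr \<psi> (cscale (of_real op.bottom) \<psi>)" unfolding opr_iff cscale_def .
      from es[OF this] have p: "L2norm2 (\<psi> - op.proj n es \<psi>) = 0" "W12 (op.proj n es \<psi>)" by (auto simp: Re_L2inner)
      have "sq_int (\<psi> - op.proj n es \<psi>)" using sq_int_diff[OF W12_sq_int[OF W] W12_sq_int[OF p(2)]] by (simp add: fun_diff_def)
      then have "AE x in lborel. (\<psi> - op.proj n es \<psi>) x = 0" using L2norm2_eq_0_iff p(1) by blast
      then have "AE x in lborel. \<psi> x = (\<Sum>i<n. L2inner \<psi> (es i) * es i x)"
        by eventually_elim (simp add: op.proj_def sum_fun_apply)
      then show "\<exists>c. AE x in lborel. \<psi> x = (\<Sum>i<n. c i * es i x)" by (rule exI[of _ "\<lambda>i. L2inner \<psi> (es i)"])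
    qed
  qed
qed

end

section \<open>From decaying essential suprema to the spectral conclusions\<close>

lemma esssup_tail:
  fixes V :: "real \<Rightarrow> real"
  assumes "((\<lambda>L. esssup (restrict_space lborel (- {- L..L})) (\<lambda>x. ereal \<bar>V x\<bar>)) \<longlongrightarrow> 0) at_top" and "\<epsilon> > 0"
  shows "\<forall>\<^sub>F L in at_top. AE s in lborel. s \<notin> {- L..L} \<longrightarrow> \<bar>V s\<bar> \<le> (\<epsilon> :: real)"
proof -
  have "\<forall>\<^sub>F L in at_top. esssup (restrict_space lborel (- {- L..L})) (\<lambda>x. ereal \<bar>V x\<bar>) < ereal \<epsilon>"
    using order_tendstoD(2)[OF assms(1), of "ereal \<epsilon>"] assms(2) by simp
  then show ?thesis
  proof eventually_elim
    fix L assume l: "esssup (restrict_space lborel (- {- L..L})) (\<lambda>x. ereal \<bar>V x\<bar>) < ereal \<epsilon>"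
    have "AE s in restrict_space lborel (- {- L..L}). ereal \<bar>V s\<bar> \<le> ereal \<epsilon>"
      using esssup_AE[where M = "restrict_space lborel (- {- L..L})" and f = "\<lambda>x. ereal \<bar>V x\<bar>"]
      by eventually_elim (rule order_trans[OF _ less_imp_le[OF l]])
    moreover have "- {- L..L} \<in> sets borel" by (intro borel_comp) simp
    ultimately show "AE s in lborel. s \<notin> {- L..L} \<longrightarrow> \<bar>V s\<bar> \<le> \<epsilon>"
      by (subst (asm) AE_restrict_space_iff) (auto elim: eventually_mono)
  qed
qed

theorem theorem4p1:
  fixes a \<alpha> :: real and Vp Vm :: "real \<Rightarrow> real"
  assumes "a > 0" and "\<alpha> > 0"
    and "Vp \<in> borel_measurable lborel" and "\<exists>C. AE x in lborel. \<bar>Vp x\<bar> \<le> C"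
    and "Vm \<in> borel_measurable lborel" and "\<exists>C. AE x in lborel. \<bar>Vm x\<bar> \<le> C"
    and "integrable lborel (\<lambda>x. Vm x + Vp x)"
    and "(\<integral>x. (Vm x + Vp x) \<partial>lborel) < 0"
  shows "Inf {lam::real. of_real lam \<in> op_spectrum W12 (E_form a \<alpha> Vp Vm)} < xi0 a \<alpha>
    \<and> ((((\<lambda>L. esssup (restrict_space lborel (- {-L..L})) (\<lambda>x. ereal \<bar>Vp x\<bar>)) \<longlongrightarrow> 0) at_top
         \<and> ((\<lambda>L. esssup (restrict_space lborel (- {-L..L})) (\<lambda>x. ereal \<bar>Vm x\<bar>)) \<longlongrightarrow> 0) at_top)
       \<longrightarrow> (\<exists>lam::real. lam < xi0 a \<alpha> \<and> isolated_fin_eigenvalue W12 (E_form a \<alpha> Vp Vm) (of_real lam)))"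
proof -
  obtain C1 C2 where C12: "AE x in lborel. \<bar>Vp x\<bar> \<le> C1" "AE x in lborel. \<bar>Vm x\<bar> \<le> C2" using assms(4,6) by blast
  define C where "C = max 0 (max C1 C2)"
  have "AE x in lborel. \<bar>Vp x\<bar> \<le> C" using C12(1) by eventually_elim (simp add: C_def)
  moreover have "AE x in lborel. \<bar>Vm x\<bar> \<le> C" using C12(2) by eventually_elim (simp add: C_def)
  ultimately interpret double_line a \<alpha> C Vp Vm
    using assms(1-3,5) by unfold_locales (auto simp: bdd_weight_def C_def)
  obtain k where k: "k > 0" "k * (1 + tanh (k * a)) = \<alpha>" using exists_decay_rate[OF assms(1,2)] .
  have xi: "xi0 a \<alpha> = - k\<^sup>2" by (rule xi0_eq[OF assms(1) k])
  obtain x0 where x0: "W12 x0" "Re (E x0 x0) < - k\<^sup>2 * L2norm2 x0" using trial_function[OF k assms(7,8)] by blast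
  \<comment> \<open>For a function of norm 0 the lower bound would make the form value nonnegative,
    while it is strictly negative by choice of x0.\<close>
  have "L2norm2 x0 \<noteq> 0" using x0(2) E_lower[OF x0(1)] grad_nonneg[of x0] by auto
  then have pos: "L2norm2 x0 > 0" using L2norm2_nonneg[of x0] by linarith
  have x0': "x0 \<in> {\<psi>. W12 \<psi>}" "Re (L2inner x0 x0) > 0" using x0 pos by (auto simp: Re_L2inner)
  have below: "op.bottom < - k\<^sup>2" by (rule op.bottom_less[OF x0']) (use x0 in \<open>simp add: Re_L2inner\<close>)
  let ?S = "{lam::real. of_real lam \<in> op_spectrum W12 E}"
  have "op.bottom \<in> ?S" using op.bottom_spectrum[OF x0'] by (simp add: op_spectrum_def res_iff)
  \<comment> \<open>Needed because \<open>Inf\<close> on the reals is informative only for sets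
    bounded below.\<close>
  moreover have "bdd_below ?S"
    by (rule bdd_belowI[of _ "- M"]) (use op.res_below in \<open>force simp: op_spectrum_def res_iff not_le[symmetric]\<close>)
  ultimately have "Inf ?S \<le> op.bottom" by (rule cInf_lower)
  moreover have "isolated_fin_eigenvalue W12 E (of_real op.bottom)"
    if t: "((\<lambda>L. esssup (restrict_space lborel (- {-L..L})) (\<lambda>x. ereal \<bar>Vp x\<bar>)) \<longlongrightarrow> 0) at_top"
      "((\<lambda>L. esssup (restrict_space lborel (- {-L..L})) (\<lambda>x. ereal \<bar>Vm x\<bar>)) \<longlongrightarrow> 0) at_top"
  proof (rule bottom_isolated_eigenvalue[OF k(2) below x0(1) pos])
    fix \<epsilon> :: real assume "\<epsilon> > 0"
    from eventually_conj[OF eventually_gt_at_top[of 0] eventually_conj[OF esssup_tail[OF t(1) this] esssup_tail[OF t(2) this]]]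
    obtain L where L: "L > 0" "AE s in lborel. s \<notin> {- L..L} \<longrightarrow> \<bar>Vp s\<bar> \<le> \<epsilon>" "AE s in lborel. s \<notin> {- L..L} \<longrightarrow> \<bar>Vm s\<bar> \<le> \<epsilon>"
      using eventually_happens[of _ "at_top :: real filter"] by auto
    \<comment> \<open>The compactness argument tiles half-open segments; enlarging by 1 makes such a
      segment contain the closed interval, right end included.\<close>
    have "AE s in lborel. s \<notin> {- (L + 1)..<L + 1} \<longrightarrow> \<bar>Vp s\<bar> \<le> \<epsilon>" using L(2) by eventually_elim auto
    moreover have "AE s in lborel. s \<notin> {- (L + 1)..<L + 1} \<longrightarrow> \<bar>Vm s\<bar> \<le> \<epsilon>" using L(3) by eventually_elim auto
    ultimately show "\<exists>L>0. (AE s in lborel. s \<notin> {- L..<L} \<longrightarrow> \<bar>Vp s\<bar> \<le> \<epsilon>) \<and> (AE s in lborel. s \<notin> {- L..<L} \<longrightarrow> \<bar>Vm s\<bar> \<le> \<epsilon>)"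
      using L(1) by (intro exI[of _ "L + 1"]) auto
  qed
  ultimately show ?thesis using below unfolding xi by auto
qed

end
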